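(* Let $\mathfrak g$ be a finite-dimensional semi-simple complex Lie algebra, $V$ a finite-dimensional orthogonal $\mathfrak g$-representation, and $\hat V=\bigoplus_{k\in\mathbb Z}t^kV$ its affinization, a representation of the untwisted affine Lie algebra $\hat{\mathfrak g}$. Then $\mathrm{Spin}_0(\hat V)$, when restricted from $\hat{\mathfrak g}$ to $\mathfrak g\oplus\mathbb C\hat d$, factors into an infinite tensor product: $$\mathrm{Spin}_0(\hat V){\downarrow}^{\hat{\mathfrak g}}_{\mathfrak g\oplus\mathbb C\hat d}\;\cong\;\mathrm{Spin}_0(V)\otimes\wedge^\bullet(tV)\otimes\wedge^\bullet(t^{2}V)\otimes\cdots.$$
   Context: $\hat{\mathfrak g}=\mathfrak g\otimes\mathbb C[t,t^{-1}]\oplus\mathbb CK\oplus\mathbb Cd$ is the untwisted affine Lie algebra associated to $\mathfrak g$, $K$ the central element, $d$ the canonical derivation; $\mathfrak h$ is the Cartan subalgebra of $\mathfrak g$ and $\theta$ its highest root. A representation $V$ is orthogonal if it has a non-degenerate symmetric bilinear form $Q$ invariant under the Lie algebra, $Q(Xu,v)+Q(u,Xv)=0$. On the affinization $\hat V=\bigoplus_{k\in\mathbb Z}t^kV$: $(t^lX)\cdot t^kv=t^{k+l}(X\cdot v)$ for $X\in\mathfrak g$, $v\in V$; $K$ acts by $0$; $d$ acts by $t\frac d{dt}$; it inherits from $V$ the non-degenerate symmetric invariant form $\hat Q(t^ku,t^lv)=\delta_{k,-l}Q(u,v)$. Choose a strictly dominant coweight $d_1\in\mathfrak h$ with $\beta(d_1)\in\mathbb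 Z\setminus\{0\}$ for all nonzero weights $\beta$ of $V$, a sufficiently large integer $N$ with $-N<\beta(d_1),\theta(d_1)<N$ for all weights $\beta$ of $V$, and put $\hat d=Nd+d_1$. With distinguished element $\hat d$ for both algebras, $\hat{\mathfrak g}$ and $\mathfrak g\oplus\mathbb C\hat d$ are augmented Kac-Moody algebras (the simple roots take positive integer values on $\hat d$), and $\mathfrak g\oplus\mathbb C\hat d\subset\hat{\mathfrak g}$ respects Cartan subalgebras and positive roots. $V$ is regarded as the $\mathfrak g\oplus\mathbb C\hat d$-submodule $t^0V$ of $\hat V$. Spin construction. Let $\mathfrak a$ be $\hat{\mathfrak g}$ or $\mathfrak g\oplus\mathbb C\hat d$, with Cartan subalgebra $\mathfrak h_{\mathfrak a}$ and simple coroots $\alpha_i^\vee$, and let $U$ be $\hat V$ or $V$ respectively, with its invariant form, again denoted $Q$. Take a basis $\{e_i\}_{i\in I}$ of $U$ of weight vectors with $Q(e_i,e_j)=\delta_{i,-j}$, $I$ being $\mathbb Z$, $\mathbb Z\setminus\{0\}$, $\{m,\dots,1,0,-1,\dots,-m\}$ or $\{m,\dots,1,-1,\dots,-m\}$; without loss of generality the weight $\beta_i$ of $e_i$ satisfies $\beta_i(\hat d)\ge0$ for $i>0$. Let $I^+=\{i\in I: i>0\}$, $U^+=\mathrm{span}\{e_i:i\in I^+\}$, $\mathrm{Spin}(U)=\wedge^\bullet U^+$ (finite linear combinations of finite wedges) with basis $e_J=e_{j_1}\wedge\cdots\wedge e_{j_k}$, $J=\{j_1>\cdots>j_k\}\subset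 I^+$. For $i\in I^+$, $e_i$ acts by $e_J\mapsto e_i\wedge e_J$; $e_{-i}$ by $e_J\mapsto2(-1)^{|\{j\in J:j>i\}|}e_{J\setminus\{i\}}$ if $i\in J$, else $0$; $e_0$ (if $0\in I$) by $e_J\mapsto(-1)^{|J|}e_J$. Let $\mathfrak{so}(U)$ be the Lie algebra of matrices $(a_{i,j})_{i,j\in I}$ with $a_{i,j}=-a_{-j,-i}$, finitely many nonzero entries in each column, and with the blocks $(a_{i,-j})_{i,j>0}$, $(a_{-i,j})_{i,j>0}$ having finitely many nonzero entries. With $Z_{i,j}=E_{i,j}-E_{-j,-i}$ ($i>-j$, $E_{i,j}$ the coordinate matrices) put $\phi(Z_{i,j})=-\frac12e_je_{-i}$, extended linearly, also to infinite sums. Then $\widetilde{\mathfrak{so}}(U)=\phi(\mathfrak{so}(U))\oplus\mathbb C1$ is a Lie algebra acting on $\mathrm{Spin}(U)$, a central extension of $\mathfrak{so}(U)$ via $\pi:\phi(A)\mapsto A$, $1\mapsto0$. The action on $U$ gives $\sigma:\mathfrak a\to\mathfrak{so}(U)$. Fix a complement $\mathfrak h''$ of $\bigoplus_i\mathbb C\alpha_i^\vee$ in $\mathfrak h_{\mathfrak a}$, let $\mathfrak a_R$ be the span of all root vectors, and fix a linear functional $\psi$ on $\mathfrak h''\oplus\mathfrak a_R$ with $\psi(\mathfrak a_R)=0$; $\mathrm{Spin}(U)$ is an $\mathfrak a$-representation through the unique Lie algebra map $\tilde\sigma:\mathfrak a\to\widetilde{\mathfrak{so}}(U)$ with $\pi\tilde\sigma=\sigma$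 and $\tilde\sigma=\phi\sigma+\psi$ on $\mathfrak h''\oplus\mathfrak a_R$. If $m_0$ is the dimension of the zero weight space of $U$, $\mathrm{Spin}(U)$ is a direct sum of $2^{\lfloor m_0/2\rfloor}$ copies of a representation called $\mathrm{Spin}_0(U)$. $\wedge^\bullet(t^{k}V)$ is the exterior algebra of the $\mathfrak g\oplus\mathbb C\hat d$-submodule $t^{k}V\subset\hat V$. Put $U_0=\mathrm{Spin}_0(V)$ and $U_k=\wedge^\bullet(t^{k}V)$ for $k\ge1$, which contains the canonical one-dimensional representation $\mathbb C1=\wedge^0(t^{k}V)$. The infinite tensor product is the direct limit of the maps $U_0\otimes\cdots\otimes U_k\to U_0\otimes\cdots\otimes U_k\otimes U_{k+1}$, $u_0\otimes\cdots\otimes u_k\mapsto u_0\otimes\cdots\otimes u_k\otimes1$.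
   Formalization: As stated with φ(Z_ij) = -½e_j e_{-i} the formula fails (d̂ gets the opposite sign); proved for φ(Z_ij) = ½e_i e_{-j}, and for the given φ with factors ∧(t^{-k}V); h'' and ψ for g⊕Cd̂ are restrictions of those for ĝ, since otherwise d̂ could differ by a scalar. *)

theory Defs
  imports Complex_Main "HOL-Library.Poly_Mapping" "HOL-Library.Product_Plus"
begin

section \<open>Complex Lie algebras and their modules\<close>

text \<open>
  Addition is that of the ambient type, carriers are subspaces of it. Thus a subalgebra or a
  submodule is obtained by updating the carrier, and a module is restricted to a subalgebra by
  simply mentioning the subalgebra in place of the algebra.
\<close>

record 'l lie_alg =
  lcar :: "'l set"
  lscl :: "complex \<Rightarrow> 'l \<Rightarrow> 'l"
  lbr :: "'l \<Rightarrow> 'l \<Rightarrow> 'l"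

record ('l, 'm) lie_mod =
  mcar :: "'m set"
  mscl :: "complex \<Rightarrow> 'm \<Rightarrow> 'm"
  act :: "'l \<Rightarrow> 'm \<Rightarrow> 'm"

definition linear_on ::
  "(complex \<Rightarrow> 'a \<Rightarrow> 'a) \<Rightarrow> (complex \<Rightarrow> 'b \<Rightarrow> 'b) \<Rightarrow> 'a::plus set \<Rightarrow> ('a \<Rightarrow> 'b::plus) \<Rightarrow> bool" where
  "linear_on s t A f \<longleftrightarrow>
     (\<forall>x\<in>A. \<forall>y\<in>A. f (x + y) = f x + f y) \<and> (\<forall>c. \<forall>x\<in>A. f (s c x) = t c (f x))"

definition lie_algebra :: "'l::ab_group_add lie_alg \<Rightarrow> bool" where
  "lie_algebra L \<longleftrightarrow>
     vector_space (lscl L) \<and> module.subspace (lscl L) (lcar L) \<and>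
     (\<forall>x\<in>lcar L. \<forall>y\<in>lcar L. lbr L x y \<in> lcar L) \<and>
     (\<forall>x\<in>lcar L. linear_on (lscl L) (lscl L) (lcar L) (lbr L x)) \<and>
     (\<forall>y\<in>lcar L. linear_on (lscl L) (lscl L) (lcar L) (\<lambda>x. lbr L x y)) \<and>
     (\<forall>x\<in>lcar L. lbr L x x = 0) \<and>
     (\<forall>x\<in>lcar L. \<forall>y\<in>lcar L. \<forall>z\<in>lcar L.
        lbr L x (lbr L y z) + lbr L y (lbr L z x) + lbr L z (lbr L x y) = 0)"

definition lie_module :: "'l::ab_group_add lie_alg \<Rightarrow> ('l, 'm::ab_group_add) lie_mod \<Rightarrow> bool" where
  "lie_module L M \<longleftrightarrow>
     vector_space (mscl M) \<and> module.subspace (mscl M) (mcar M) \<and>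
     (\<forall>x\<in>lcar L. \<forall>u\<in>mcar M. act M x u \<in> mcar M) \<and>
     (\<forall>x\<in>lcar L. linear_on (mscl M) (mscl M) (mcar M) (act M x)) \<and>
     (\<forall>u\<in>mcar M. linear_on (lscl L) (mscl M) (lcar L) (\<lambda>x. act M x u)) \<and>
     (\<forall>x\<in>lcar L. \<forall>y\<in>lcar L. \<forall>u\<in>mcar M.
        act M (lbr L x y) u = act M x (act M y u) - act M y (act M x u))"

definition module_iso ::
  "'l lie_alg \<Rightarrow> ('l, 'm::ab_group_add) lie_mod \<Rightarrow> ('l, 'n::ab_group_add) lie_mod \<Rightarrow> bool" where
  "module_iso L M N \<longleftrightarrow>
     (\<exists>f. bij_betw f (mcar M) (mcar N) \<and> linear_on (mscl M) (mscl N) (mcar M) f \<and>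
          (\<forall>x\<in>lcar L. \<forall>u\<in>mcar M. f (act M x u) = act N x (f u)))"

definition adjoint :: "'l lie_alg \<Rightarrow> ('l, 'l) lie_mod" where
  "adjoint L = \<lparr>mcar = lcar L, mscl = lscl L, act = lbr L\<rparr>"

definition orthogonal_form ::
  "'l lie_alg \<Rightarrow> ('l, 'm::ab_group_add) lie_mod \<Rightarrow> ('m \<Rightarrow> 'm \<Rightarrow> complex) \<Rightarrow> bool" where
  "orthogonal_form L M Q \<longleftrightarrow>
     (\<forall>u\<in>mcar M. linear_on (mscl M) (*) (mcar M) (Q u)) \<and>
     (\<forall>u\<in>mcar M. \<forall>v\<in>mcar M. Q u v = Q v u) \<and>
     (\<forall>u\<in>mcar M. (\<forall>v\<in>mcar M. Q u v = 0) \<longrightarrow> u = 0) \<and>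
     (\<forall>x\<in>lcar L. \<forall>u\<in>mcar M. \<forall>v\<in>mcar M. Q (act M x u) v + Q u (act M x v) = 0)"

definition lie_ideal :: "'l::ab_group_add lie_alg \<Rightarrow> 'l set \<Rightarrow> bool" where
  "lie_ideal L S \<longleftrightarrow>
     module.subspace (lscl L) S \<and> S \<subseteq> lcar L \<and> (\<forall>x\<in>lcar L. \<forall>y\<in>S. lbr L x y \<in> S)"

definition simple_lie_algebra :: "'l::ab_group_add lie_alg \<Rightarrow> bool" where
  "simple_lie_algebra L \<longleftrightarrow>
     lie_algebra L \<and> (\<exists>x\<in>lcar L. \<exists>y\<in>lcar L. lbr L x y \<noteq> 0) \<and>
     (\<forall>S. lie_ideal L S \<longrightarrow> S = {0} \<or> S = lcar L)"

definition semisimple_lie_algebra :: "'l::ab_group_add lie_alg \<Rightarrow> bool" where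
  "semisimple_lie_algebra L \<longleftrightarrow>
     lie_algebra L \<and>
     (\<exists>F. finite F \<and> (\<forall>S\<in>F. lie_ideal L S \<and> simple_lie_algebra (L\<lparr>lcar := S\<rparr>)) \<and>
          module.span (lscl L) (\<Union>F) = lcar L \<and>
          (\<forall>f. (\<forall>S\<in>F. f S \<in> S) \<and> (\<Sum>S\<in>F. f S) = 0 \<longrightarrow> (\<forall>S\<in>F. f S = 0)))"

primrec lower_central :: "'l::ab_group_add lie_alg \<Rightarrow> nat \<Rightarrow> 'l set" where
  "lower_central L 0 = lcar L"
| "lower_central L (Suc n) =
     module.span (lscl L) {lbr L x y | x y. x \<in> lcar L \<and> y \<in> lower_central L n}"

definition cartan_subalgebra :: "'l::ab_group_add lie_alg \<Rightarrow> 'l set \<Rightarrow> bool" where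
  "cartan_subalgebra L H \<longleftrightarrow>
     module.subspace (lscl L) H \<and> H \<subseteq> lcar L \<and> (\<forall>x\<in>H. \<forall>y\<in>H. lbr L x y \<in> H) \<and>
     (\<exists>n. lower_central (L\<lparr>lcar := H\<rparr>) n = {0}) \<and>
     (\<forall>x\<in>lcar L. (\<forall>h\<in>H. lbr L x h \<in> H) \<longrightarrow> x \<in> H)"

definition complement_in ::
  "(complex \<Rightarrow> 'l \<Rightarrow> 'l) \<Rightarrow> 'l::ab_group_add set \<Rightarrow> 'l set \<Rightarrow> 'l set \<Rightarrow> bool" where
  "complement_in s W C D \<longleftrightarrow>
     module.subspace s D \<and> D \<subseteq> W \<and> D \<inter> C = {0} \<and> (\<forall>w\<in>W. \<exists>x\<in>D. \<exists>y\<in>C. w = x + y)"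


section \<open>Weights, roots and simple coroots\<close>

text \<open>
  A functional on \<open>H\<close> is a function on the ambient type of which only the values on \<open>H\<close> matter.
\<close>

definition weight_space :: "('l, 'm) lie_mod \<Rightarrow> 'l set \<Rightarrow> ('l \<Rightarrow> complex) \<Rightarrow> 'm set" where
  "weight_space M H \<beta> = {u \<in> mcar M. \<forall>h\<in>H. act M h u = mscl M (\<beta> h) u}"

definition is_weight ::
  "'l::ab_group_add lie_alg \<Rightarrow> ('l, 'm::ab_group_add) lie_mod \<Rightarrow> 'l set \<Rightarrow> ('l \<Rightarrow> complex) \<Rightarrow> bool" where
  "is_weight L M H \<beta> \<longleftrightarrow> linear_on (lscl L) (*) H \<beta> \<and> weight_space M H \<beta> \<noteq> {0}"

definition is_root :: "'l::ab_group_add lie_alg \<Rightarrow> 'l set \<Rightarrow> ('l \<Rightarrow> complex) \<Rightarrow> bool" where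
  "is_root L H \<alpha> \<longleftrightarrow> is_weight L (adjoint L) H \<alpha> \<and> (\<exists>h\<in>H. \<alpha> h \<noteq> 0)"

definition root_span :: "'l::ab_group_add lie_alg \<Rightarrow> 'l set \<Rightarrow> 'l set" where
  "root_span L H = module.span (lscl L) (\<Union>\<alpha>\<in>Collect (is_root L H). weight_space (adjoint L) H \<alpha>)"

definition root_base :: "'l::ab_group_add lie_alg \<Rightarrow> 'l set \<Rightarrow> ('l \<Rightarrow> complex) set \<Rightarrow> bool" where
  "root_base L H \<Delta> \<longleftrightarrow>
     finite \<Delta> \<and> (\<forall>\<alpha>\<in>\<Delta>. is_root L H \<alpha>) \<and>
     (\<forall>c. (\<forall>h\<in>H. (\<Sum>\<alpha>\<in>\<Delta>. c \<alpha> * \<alpha> h) = 0) \<longrightarrow> (\<forall>\<alpha>\<in>\<Delta>. c \<alpha> = 0)) \<and>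
     (\<forall>\<beta>. is_root L H \<beta> \<longrightarrow>
        (\<exists>n :: ('l \<Rightarrow> complex) \<Rightarrow> nat.
           (\<forall>h\<in>H. \<beta> h = (\<Sum>\<alpha>\<in>\<Delta>. of_nat (n \<alpha>) * \<alpha> h)) \<or>
           (\<forall>h\<in>H. \<beta> h = - (\<Sum>\<alpha>\<in>\<Delta>. of_nat (n \<alpha>) * \<alpha> h))))"

text \<open>
  In \<open>highest_root\<close> the sum must be neither a root nor zero, as otherwise negatives of simple roots
  would qualify. A semisimple algebra has one highest root for each simple ideal.
\<close>

definition highest_root ::
  "'l::ab_group_add lie_alg \<Rightarrow> 'l set \<Rightarrow> ('l \<Rightarrow> complex) set \<Rightarrow> ('l \<Rightarrow> complex) \<Rightarrow> bool" where
  "highest_root L H \<Delta> \<theta> \<longleftrightarrow>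
     is_root L H \<theta> \<and> (\<forall>\<alpha>\<in>\<Delta>. \<not> is_weight L (adjoint L) H (\<lambda>h. \<theta> h + \<alpha> h))"

definition strictly_dominant_coweight ::
  "'l set \<Rightarrow> ('l \<Rightarrow> complex) set \<Rightarrow> 'l \<Rightarrow> bool" where
  "strictly_dominant_coweight H \<Delta> d \<longleftrightarrow> d \<in> H \<and> (\<forall>\<alpha>\<in>\<Delta>. \<exists>n::nat. n > 0 \<and> \<alpha> d = of_nat n)"

text \<open>Positive roots with respect to a distinguished element \<open>d\<close> of the Cartan subalgebra.\<close>

definition positive_root ::
  "'l::ab_group_add lie_alg \<Rightarrow> 'l set \<Rightarrow> 'l \<Rightarrow> ('l \<Rightarrow> complex) \<Rightarrow> bool" where
  "positive_root L H d \<alpha> \<longleftrightarrow> is_root L H \<alpha> \<and> (\<exists>n::nat. n > 0 \<and> \<alpha> d = of_nat n)"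

definition simple_root ::
  "'l::ab_group_add lie_alg \<Rightarrow> 'l set \<Rightarrow> 'l \<Rightarrow> ('l \<Rightarrow> complex) \<Rightarrow> bool" where
  "simple_root L H d \<alpha> \<longleftrightarrow>
     positive_root L H d \<alpha> \<and>
     \<not> (\<exists>\<beta> \<gamma>. positive_root L H d \<beta> \<and> positive_root L H d \<gamma> \<and> (\<forall>h\<in>H. \<alpha> h = \<beta> h + \<gamma> h))"

definition simple_coroots :: "'l::ab_group_add lie_alg \<Rightarrow> 'l set \<Rightarrow> 'l \<Rightarrow> 'l set" where
  "simple_coroots L H d =
     {k \<in> H. \<exists>\<alpha>. simple_root L H d \<alpha> \<and> \<alpha> k = 2 \<and>
        k \<in> module.span (lscl L)
               {lbr L x y | x y. x \<in> weight_space (adjoint L) H \<alpha> \<and>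
                                 y \<in> weight_space (adjoint L) H (\<lambda>h. - \<alpha> h)}}"


section \<open>The affine Lie algebra and affinizations\<close>

text \<open>
  Laurent polynomials with coefficients in \<open>'a\<close> are elements of \<open>int \<Rightarrow>\<^sub>0 'a\<close>. The triple
  \<open>(x, a, b)\<close> stands for \<open>x + a K + b d\<close>.
\<close>

type_synonym 'g affine = "(int \<Rightarrow>\<^sub>0 'g) \<times> complex \<times> complex"

definition loop_product ::
  "('a::zero \<Rightarrow> 'b::zero \<Rightarrow> 'c::comm_monoid_add) \<Rightarrow> (int \<Rightarrow>\<^sub>0 'a) \<Rightarrow> (int \<Rightarrow>\<^sub>0 'b) \<Rightarrow> (int \<Rightarrow>\<^sub>0 'c)" where
  "loop_product f x y =
     (\<Sum>m\<in>Poly_Mapping.keys x. \<Sum>n\<in>Poly_Mapping.keys y. Poly_Mapping.single (m + n)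
        (f (Poly_Mapping.lookup x m) (Poly_Mapping.lookup y n)))"

definition euler_derivation ::
  "(complex \<Rightarrow> 'a \<Rightarrow> 'a) \<Rightarrow> (int \<Rightarrow>\<^sub>0 'a) \<Rightarrow> (int \<Rightarrow>\<^sub>0 'a::comm_monoid_add)" where
  "euler_derivation s x =
     (\<Sum>k\<in>Poly_Mapping.keys x. Poly_Mapping.single k (s (of_int k) (Poly_Mapping.lookup x k)))"

definition affine_algebra ::
  "'g::ab_group_add lie_alg \<Rightarrow> ('g \<Rightarrow> 'g \<Rightarrow> complex) \<Rightarrow> 'g affine lie_alg" where
  "affine_algebra G B =
     \<lparr>lcar = UNIV,
      lscl = (\<lambda>c (x, a, b). (Poly_Mapping.map (lscl G c) x, c * a, c * b)),
      lbr = (\<lambda>(x, a, b) (y, a', b').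
        (loop_product (lbr G) x y
           + Poly_Mapping.map (lscl G b) (euler_derivation (lscl G) y)
           - Poly_Mapping.map (lscl G b') (euler_derivation (lscl G) x),
         \<Sum>m\<in>Poly_Mapping.keys x.
           of_int m * B (Poly_Mapping.lookup x m) (Poly_Mapping.lookup y (- m)),
         0))\<rparr>"

definition affine_cartan :: "'g::ab_group_add set \<Rightarrow> 'g affine set" where
  "affine_cartan h = {(Poly_Mapping.single 0 x, a, b) | x a b. x \<in> h}"

definition hat_d :: "int \<Rightarrow> 'g::ab_group_add \<Rightarrow> 'g affine" where
  "hat_d N d1 = (Poly_Mapping.single 0 d1, 0, of_int N)"

text \<open>
  For \<open>W\<close> a subspace of the underlying finite-dimensional algebra, this is \<open>W \<oplus> \<complex> hat_d\<close> inside the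
  affine algebra.
\<close>

definition with_hat_d ::
  "'g::ab_group_add lie_alg \<Rightarrow> ('g \<Rightarrow> 'g \<Rightarrow> complex) \<Rightarrow> int \<Rightarrow> 'g \<Rightarrow> 'g set \<Rightarrow> 'g affine set" where
  "with_hat_d G B N d1 W =
     {(Poly_Mapping.single 0 x, 0, 0) + lscl (affine_algebra G B) c (hat_d N d1) | x c. x \<in> W}"

definition augmented_algebra ::
  "'g::ab_group_add lie_alg \<Rightarrow> ('g \<Rightarrow> 'g \<Rightarrow> complex) \<Rightarrow> int \<Rightarrow> 'g \<Rightarrow> 'g affine lie_alg" where
  "augmented_algebra G B N d1 = (affine_algebra G B)\<lparr>lcar := with_hat_d G B N d1 (lcar G)\<rparr>"

definition affinization ::
  "('g::ab_group_add, 'v::ab_group_add) lie_mod \<Rightarrow> ('g affine, int \<Rightarrow>\<^sub>0 'v) lie_mod" where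
  "affinization V =
     \<lparr>mcar = UNIV,
      mscl = (\<lambda>c. Poly_Mapping.map (mscl V c)),
      act = (\<lambda>(x, a, b) u. loop_product (act V) x u
                + Poly_Mapping.map (mscl V b) (euler_derivation (mscl V) u))\<rparr>"

definition affine_form ::
  "('v \<Rightarrow> 'v \<Rightarrow> complex) \<Rightarrow> (int \<Rightarrow>\<^sub>0 'v::zero) \<Rightarrow> (int \<Rightarrow>\<^sub>0 'v) \<Rightarrow> complex" where
  "affine_form Q u v =
     (\<Sum>k\<in>Poly_Mapping.keys u. Q (Poly_Mapping.lookup u k) (Poly_Mapping.lookup v (- k)))"

text \<open>The subspace \<open>t\<^sup>kV\<close> of the affinization.\<close>

definition t_power ::
  "('g::ab_group_add, 'v::ab_group_add) lie_mod \<Rightarrow> int \<Rightarrow> ('g affine, int \<Rightarrow>\<^sub>0 'v) lie_mod" where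
  "t_power V k = (affinization V)\<lparr>mcar := {u. Poly_Mapping.keys u \<subseteq> {k}}\<rparr>"


section \<open>Exterior algebras\<close>

text \<open>
  The exterior algebra on basis vectors \<open>e\<^sub>i\<close> indexed by a linear order consists of the finite linear
  combinations of the vectors \<open>single J 1\<close>, standing for \<open>e\<^sub>J\<close>, with \<open>J\<close> a finite set of indices.
  The factors of \<open>e\<^sub>J\<close> are in descending order, so that moving \<open>e\<^sub>i\<close> to its place in
  \<open>e\<^sub>i \<and> e\<^sub>J\<close> costs one sign for each element of \<open>J\<close> above \<open>i\<close>.
\<close>

definition cscale :: "complex \<Rightarrow> ('j \<Rightarrow>\<^sub>0 complex) \<Rightarrow> ('j \<Rightarrow>\<^sub>0 complex)" where
  "cscale c = Poly_Mapping.map ((*) c)"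

definition linear_extension ::
  "('j \<Rightarrow> ('k \<Rightarrow>\<^sub>0 complex)) \<Rightarrow> ('j \<Rightarrow>\<^sub>0 complex) \<Rightarrow> ('k \<Rightarrow>\<^sub>0 complex)" where
  "linear_extension f u = (\<Sum>J\<in>Poly_Mapping.keys u. cscale (Poly_Mapping.lookup u J) (f J))"

definition wedge_index :: "'i::linorder \<Rightarrow> 'i set \<Rightarrow> ('i set \<Rightarrow>\<^sub>0 complex)" where
  "wedge_index i J =
     (if i \<in> J then 0 else Poly_Mapping.single (insert i J) ((- 1) ^ card {j \<in> J. j > i}))"

definition basis_of ::
  "(complex \<Rightarrow> 'm \<Rightarrow> 'm) \<Rightarrow> 'm::ab_group_add set \<Rightarrow> 'i set \<Rightarrow> ('i \<Rightarrow> 'm) \<Rightarrow> bool" where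
  "basis_of s W I b \<longleftrightarrow>
     inj_on b I \<and> \<not> module.dependent s (b ` I) \<and> module.span s (b ` I) = W"

text \<open>The exterior algebra of a module \<open>M\<close> with basis \<open>b 0, \<dots>, b (n - 1)\<close>.\<close>

definition wedge ::
  "('l, 'm::ab_group_add) lie_mod \<Rightarrow> nat \<Rightarrow> (nat \<Rightarrow> 'm) \<Rightarrow> 'm \<Rightarrow>
     (nat set \<Rightarrow>\<^sub>0 complex) \<Rightarrow> (nat set \<Rightarrow>\<^sub>0 complex)" where
  "wedge M n b w u =
     (\<Sum>i<n. cscale (module.representation (mscl M) (b ` {..<n}) w (b i))
        (linear_extension (wedge_index i) u))"

text \<open>
  The action is \<open>x \<cdot> (w\<^sub>1 \<and> \<dots> \<and> w\<^sub>r) = \<Sum>\<^sub>p w\<^sub>1 \<and> \<dots> \<and> x \<cdot> w\<^sub>p \<and> \<dots> \<and> w\<^sub>r\<close>.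
\<close>

definition exterior_algebra ::
  "('l, 'm::ab_group_add) lie_mod \<Rightarrow> nat \<Rightarrow> (nat \<Rightarrow> 'm) \<Rightarrow> ('l, nat set \<Rightarrow>\<^sub>0 complex) lie_mod" where
  "exterior_algebra M n b =
     \<lparr>mcar = {u. \<forall>J\<in>Poly_Mapping.keys u. J \<subseteq> {..<n}},
      mscl = cscale,
      act = (\<lambda>x. linear_extension (\<lambda>J.
        let js = rev (sorted_list_of_set J)
        in \<Sum>p<length js.
             foldr (wedge M n b) ((map b js)[p := act M x (b (js ! p))])
               (Poly_Mapping.single {} 1)))\<rparr>"


section \<open>The infinite tensor product\<close>

text \<open>
  Let \<open>S\<close> be any module and let \<open>E k\<close>, for \<open>k \<ge> 1\<close>, be modules with basis vectors \<open>e\<^sub>J\<close> and a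
  canonical vector \<open>1 = e\<^sub>\<emptyset>\<close>. Then \<open>S \<otimes> E 1 \<otimes> \<dots> \<otimes> E n\<close> is the space of finite sums of
  \<open>s \<otimes> e\<^bsub>J 1\<^esub> \<otimes> \<dots> \<otimes> e\<^bsub>J n\<^esub>\<close>, written \<open>single J s\<close> with \<open>J k = \<emptyset>\<close> for \<open>k\<close> outside \<open>{1..n}\<close>.
  With this convention \<open>u \<mapsto> u \<otimes> 1\<close> is the inclusion of stage \<open>n\<close> into stage \<open>n + 1\<close>, and
  the direct limit is the union of the stages.
\<close>

definition tensor_stage ::
  "('l, 's::zero) lie_mod \<Rightarrow> (nat \<Rightarrow> ('l, 'i set \<Rightarrow>\<^sub>0 complex) lie_mod) \<Rightarrow> nat \<Rightarrow>
     ((nat \<Rightarrow> 'i set) \<Rightarrow>\<^sub>0 's) set" where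
  "tensor_stage S E n =
     {T. \<forall>J\<in>Poly_Mapping.keys T. Poly_Mapping.lookup T J \<in> mcar S \<and>
           (\<forall>k\<in>{1..n}. Poly_Mapping.single (J k) 1 \<in> mcar (E k)) \<and>
           (\<forall>k. k \<notin> {1..n} \<longrightarrow> J k = {})}"

text \<open>
  The action is given by the Leibniz rule; the factors \<open>e\<^sub>\<emptyset> = 1\<close> are annihilated by the algebra
  and contribute nothing.
\<close>

definition infinite_tensor ::
  "('l, 's::ab_group_add) lie_mod \<Rightarrow> (nat \<Rightarrow> ('l, 'i set \<Rightarrow>\<^sub>0 complex) lie_mod) \<Rightarrow>
     ('l, (nat \<Rightarrow> 'i set) \<Rightarrow>\<^sub>0 's) lie_mod" where
  "infinite_tensor S E =
     \<lparr>mcar = (\<Union>n. tensor_stage S E n),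
      mscl = (\<lambda>c. Poly_Mapping.map (mscl S c)),
      act = (\<lambda>x T. \<Sum>J\<in>Poly_Mapping.keys T.
        Poly_Mapping.single J (act S x (Poly_Mapping.lookup T J)) +
        (\<Sum>k\<in>{k. J k \<noteq> {}}.
           let v = act (E k) x (Poly_Mapping.single (J k) 1)
           in \<Sum>K\<in>Poly_Mapping.keys v. Poly_Mapping.single (J(k := K))
                (mscl S (Poly_Mapping.lookup v K) (Poly_Mapping.lookup T J))))\<rparr>"


section \<open>The spin construction\<close>

definition spin_index_set :: "int set \<Rightarrow> bool" where
  "spin_index_set I \<longleftrightarrow>
     I = UNIV \<or> I = UNIV - {0} \<or>
     (\<exists>m::nat. I = {- int m..int m} \<or> I = {- int m..int m} - {0})"

text \<open>Here \<open>\<beta> i\<close> is the weight of \<open>e i\<close>, and \<open>d\<close> is the distinguished element.\<close>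

definition spin_basis ::
  "'l::ab_group_add lie_alg \<Rightarrow> 'l set \<Rightarrow> 'l \<Rightarrow> ('l, 'm::ab_group_add) lie_mod \<Rightarrow>
     ('m \<Rightarrow> 'm \<Rightarrow> complex) \<Rightarrow> int set \<Rightarrow> (int \<Rightarrow> 'm) \<Rightarrow> bool" where
  "spin_basis L H d U Q I e \<longleftrightarrow>
     spin_index_set I \<and> basis_of (mscl U) (mcar U) I e \<and>
     (\<forall>i\<in>I. \<forall>j\<in>I. Q (e i) (e j) = (if i = - j then 1 else 0)) \<and>
     (\<exists>\<beta>. (\<forall>i\<in>I. linear_on (lscl L) (*) H (\<beta> i) \<and> e i \<in> weight_space U H (\<beta> i)) \<and>
          (\<forall>i\<in>I. i > 0 \<longrightarrow> \<beta> i d \<in> \<real> \<and> Re (\<beta> i d) \<ge> 0))"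

definition spin_space :: "int set \<Rightarrow> (int set \<Rightarrow>\<^sub>0 complex) set" where
  "spin_space I = {u. \<forall>J\<in>Poly_Mapping.keys u. finite J \<and> J \<subseteq> {i \<in> I. i > 0}}"

text \<open>The action of the basis vector \<open>e i\<close>.\<close>

definition clifford :: "int \<Rightarrow> (int set \<Rightarrow>\<^sub>0 complex) \<Rightarrow> (int set \<Rightarrow>\<^sub>0 complex)" where
  "clifford i = linear_extension (\<lambda>J.
     if i > 0 then wedge_index i J
     else if i < 0 then
       (if - i \<in> J then Poly_Mapping.single (J - {- i}) (2 * (- 1) ^ card {j \<in> J. j > - i}) else 0)
     else Poly_Mapping.single J ((- 1) ^ card J))"

definition so_matrices :: "int set \<Rightarrow> (int \<Rightarrow> int \<Rightarrow> complex) set" where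
  "so_matrices I =
     {a. (\<forall>i j. a i j \<noteq> 0 \<longrightarrow> i \<in> I \<and> j \<in> I) \<and> (\<forall>i j. a i j = - a (- j) (- i)) \<and>
         (\<forall>j. finite {i. a i j \<noteq> 0}) \<and>
         finite {(i, j). i > 0 \<and> j > 0 \<and> a i (- j) \<noteq> 0} \<and>
         finite {(i, j). i > 0 \<and> j > 0 \<and> a (- i) j \<noteq> 0}}"

text \<open>
  The quadratic Clifford element assigned to \<open>Z\<^sub>i\<^sub>,\<^sub>j = E\<^sub>i\<^sub>,\<^sub>j - E\<^bsub>-j,-i\<^esub>\<close>. There are two usual
  normalizations, interchanged by the automorphism \<open>A \<mapsto> - A\<^sup>T\<close> of the Lie algebra of matrices, and
  the sign \<open>\<epsilon>\<close> selects one of them. For \<open>\<epsilon> = -1\<close> it is \<open>-(1/2) e\<^sub>j e\<^bsub>-i\<^esub>\<close>: the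
  vector \<open>e\<^sub>\<emptyset>\<close> is killed by positive root vectors, and wedging with \<open>e\<^sub>j\<close> changes the weight by
  \<open>-\<beta>\<^sub>j\<close>. For \<open>\<epsilon> = 1\<close> it is \<open>(1/2) e\<^sub>i e\<^bsub>-j\<^esub>\<close>, whose commutator with the Clifford generators
  is the action of \<open>Z\<^sub>i\<^sub>,\<^sub>j\<close> on \<open>U\<close>: wedging with \<open>e\<^sub>j\<close> changes the weight by \<open>\<beta>\<^sub>j\<close>. On
  \<open>t\<^sup>kV\<close> with \<open>k > 0\<close> the two differ by duality, \<open>(t\<^sup>kV)\<^sup>* = t\<^bsup>-k\<^esup>V\<close>.
\<close>

definition phi_Z :: "int \<Rightarrow> int \<Rightarrow> int \<Rightarrow> (int set \<Rightarrow>\<^sub>0 complex) \<Rightarrow> (int set \<Rightarrow>\<^sub>0 complex)" where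
  "phi_Z \<epsilon> i j u =
     (if \<epsilon> = - 1 then cscale (- 1 / 2) (clifford j (clifford (- i) u))
      else cscale (1 / 2) (clifford i (clifford (- j) u)))"

text \<open>
  A matrix in \<^const>\<open>so_matrices\<close> is \<open>\<Sum>\<^bsub>i > -j\<^esub> a\<^sub>i\<^sub>,\<^sub>j Z\<^sub>i\<^sub>,\<^sub>j\<close>; on a given vector of the spin
  space only finitely many terms are nonzero.
\<close>

definition phi :: "int \<Rightarrow> (int \<Rightarrow> int \<Rightarrow> complex) \<Rightarrow> (int set \<Rightarrow>\<^sub>0 complex) \<Rightarrow> (int set \<Rightarrow>\<^sub>0 complex)" where
  "phi \<epsilon> a u = Sum_any (\<lambda>(i, j). if i > - j then cscale (a i j) (phi_Z \<epsilon> i j u) else 0)"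

definition action_matrix ::
  "('l, 'm::ab_group_add) lie_mod \<Rightarrow> int set \<Rightarrow> (int \<Rightarrow> 'm) \<Rightarrow> 'l \<Rightarrow> int \<Rightarrow> int \<Rightarrow> complex" where
  "action_matrix U I e x i j =
     (if i \<in> I \<and> j \<in> I
      then module.representation (mscl U) (e ` I) (act U x (e j)) (e i) else 0)"

text \<open>
  \<open>so_ext_projects \<epsilon> I T a\<close>: as an operator on the spin space, \<open>T\<close> belongs to the central
  extension \<open>\<phi>(so(U)) \<oplus> \<complex>1\<close>, and its projection to \<open>so(U)\<close> is \<open>a\<close>.
\<close>

definition so_ext_projects ::
  "int \<Rightarrow> int set \<Rightarrow> ((int set \<Rightarrow>\<^sub>0 complex) \<Rightarrow> (int set \<Rightarrow>\<^sub>0 complex)) \<Rightarrow>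
     (int \<Rightarrow> int \<Rightarrow> complex) \<Rightarrow> bool" where
  "so_ext_projects \<epsilon> I T a \<longleftrightarrow>
     a \<in> so_matrices I \<and> (\<exists>c. \<forall>u\<in>spin_space I. T u = phi \<epsilon> a u + cscale c u)"

definition spin_functional ::
  "'l::ab_group_add lie_alg \<Rightarrow> 'l set \<Rightarrow> 'l set \<Rightarrow> ('l \<Rightarrow> complex) \<Rightarrow> bool" where
  "spin_functional L H H2 \<psi> \<longleftrightarrow>
     linear_on (lscl L) (*) {x + y | x y. x \<in> H2 \<and> y \<in> root_span L H} \<psi> \<and>
     (\<forall>y\<in>root_span L H. \<psi> y = 0)"

definition spin_module ::
  "int set \<Rightarrow> ('l \<Rightarrow> (int set \<Rightarrow>\<^sub>0 complex) \<Rightarrow> (int set \<Rightarrow>\<^sub>0 complex)) \<Rightarrow>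
     ('l, int set \<Rightarrow>\<^sub>0 complex) lie_mod" where
  "spin_module I st = \<lparr>mcar = spin_space I, mscl = cscale, act = st\<rparr>"

definition spin_lift ::
  "int \<Rightarrow> 'l::ab_group_add lie_alg \<Rightarrow> 'l set \<Rightarrow> ('l, 'm::ab_group_add) lie_mod \<Rightarrow> int set \<Rightarrow>
     (int \<Rightarrow> 'm) \<Rightarrow> 'l set \<Rightarrow> ('l \<Rightarrow> complex) \<Rightarrow>
     ('l \<Rightarrow> (int set \<Rightarrow>\<^sub>0 complex) \<Rightarrow> (int set \<Rightarrow>\<^sub>0 complex)) \<Rightarrow> bool" where
  "spin_lift \<epsilon> L H U I e H2 \<psi> st \<longleftrightarrow>
     lie_module L (spin_module I st) \<and>
     (\<forall>x\<in>lcar L. so_ext_projects \<epsilon> I (st x) (action_matrix U I e x)) \<and>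
     (\<forall>x\<in>H2. \<forall>y\<in>root_span L H. \<forall>u\<in>spin_space I.
        st (x + y) u = phi \<epsilon> (action_matrix U I e (x + y)) u + cscale (\<psi> (x + y)) u)"

definition copies :: "nat \<Rightarrow> ('l, 'm::ab_group_add) lie_mod \<Rightarrow> ('l, nat \<Rightarrow>\<^sub>0 'm) lie_mod" where
  "copies n M =
     \<lparr>mcar = {f. Poly_Mapping.keys f \<subseteq> {..<n} \<and> (\<forall>i. Poly_Mapping.lookup f i \<in> mcar M)},
      mscl = (\<lambda>c. Poly_Mapping.map (mscl M c)),
      act = (\<lambda>x. Poly_Mapping.map (act M x))\<rparr>"

definition zero_weight_dim :: "('l, 'm::ab_group_add) lie_mod \<Rightarrow> 'l set \<Rightarrow> nat" where
  "zero_weight_dim M H = vector_space.dim (mscl M) (weight_space M H (\<lambda>h. 0))"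

text \<open>
  \<open>S\<close> is a model of \<open>Spin\<^sub>0(U)\<close>, where \<open>U\<close> has index set \<open>I\<close> and lift \<open>st\<close>.
\<close>

definition is_spin0 ::
  "'l::ab_group_add lie_alg \<Rightarrow> 'l set \<Rightarrow> ('l, 'm::ab_group_add) lie_mod \<Rightarrow> int set \<Rightarrow>
     ('l \<Rightarrow> (int set \<Rightarrow>\<^sub>0 complex) \<Rightarrow> (int set \<Rightarrow>\<^sub>0 complex)) \<Rightarrow>
     ('l, 's::ab_group_add) lie_mod \<Rightarrow> bool" where
  "is_spin0 L H U I st S \<longleftrightarrow>
     lie_module L S \<and>
     module_iso L (spin_module I st) (copies (2 ^ (zero_weight_dim U H div 2)) S)"

end

theory Submission
  imports Defs "HOL-Library.Product_Lexorder"
begin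

text \<open>
  The Fock space \<open>Spin(V) \<otimes> \<Lambda>(tV) \<otimes> \<Lambda>(t\<^sup>2V) \<otimes> \<dots>\<close> is a module for the Clifford algebra of the
  affinization: vectors of positive degree act by wedging, those of negative degree by contraction
  and those of degree zero as on \<open>Spin(V)\<close> (for \<open>\<epsilon> = -1\<close> positive and negative change places). It
  is generated by a vacuum for the chosen polarization of the affinization, so as a Clifford module
  it is the spin space of the affinization. The two actions of the subalgebra have the same
  commutators with the Clifford generators; by Schur's lemma they differ by a scalar functional. It
  vanishes on brackets, hence on the perfect algebra \<open>G\<close>, and on \<open>H2\<close>, where the weights of the two
  vacua agree; together with \<open>G\<close> this determines it on the whole subalgebra.

  Hence \<open>Spin\<^sub>0\<close> of the affinization and \<open>Spin\<^sub>0(V) \<otimes> \<Lambda>(tV) \<otimes> \<dots>\<close> become isomorphic after taking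
  \<open>m\<close> copies of each, with the same \<open>m\<close> since the zero weight spaces agree. The derivation \<open>d\<close>
  commutes with the subalgebra and has finite-dimensional eigenspaces on both modules, and
  multiplicities of finite-dimensional modules can be cancelled by the Krull-Schmidt argument: by
  Fitting's lemma the endomorphism ring of an indecomposable module is local.
\<close>

text \<open>\<open>Spin\<^sub>0\<close> is not constructed: \<open>is_spin0\<close> only says that a
  power of 2 many copies of a model make up the spin module. An isomorphism of full spin modules is
  therefore not yet the claim. These modules may be infinite-dimensional, so the copies are
  cancelled one eigenspace of \<open>d\<close> at a time. The bases \<open>e\<close> and
  \<open>e'\<close> are unrelated, so no relabelling of basis vectors gives an isomorphism; it has
  to be determined by the image of a vacuum and the Clifford relations. Vectors of degree zero act
  on the coefficients in \<open>Spin(V)\<close> and must be combined with the parity of the wedge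
  part, as in a tensor product of superalgebras; otherwise they would commute, not anticommute, with
  the rest. The factor 2 of the annihilators in \<open>clifford\<close> makes all anticommutators
  equal to \<open>2 * Qh\<close>, and the annihilation coefficients on the Fock space are scaled
  accordingly. The bound \<open>N\<close> on the weights ensures that no index that is positive for
  \<open>e'\<close> has negative degree. Compatibility with brackets is given for \<open>st\<close>
  and \<open>st'\<close> only; whatever the Fock module needs of it is transported from
  there.\<close>

abbreviation "lookup \<equiv> Poly_Mapping.lookup"
abbreviation "single \<equiv> Poly_Mapping.single"
abbreviation "keys \<equiv> Poly_Mapping.keys"
abbreviation "pmap \<equiv> Poly_Mapping.map"

subsection \<open>Modules over a set of operators\<close>

text \<open>The bracket plays no role in the theory of submodules and homomorphisms, and the Fock module
  below is not known in advance to respect it.\<close>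

definition op_module :: "'l lie_alg \<Rightarrow> ('l, 'm::ab_group_add) lie_mod \<Rightarrow> bool" where
  "op_module L M \<longleftrightarrow>
     vector_space (mscl M) \<and> module.subspace (mscl M) (mcar M) \<and>
     (\<forall>x\<in>lcar L. \<forall>u\<in>mcar M. act M x u \<in> mcar M) \<and>
     (\<forall>x\<in>lcar L. linear_on (mscl M) (mscl M) (mcar M) (act M x))"

definition submodule :: "'l lie_alg \<Rightarrow> ('l, 'm::ab_group_add) lie_mod \<Rightarrow> 'm set \<Rightarrow> bool" where
  "submodule L M A \<longleftrightarrow>
     A \<subseteq> mcar M \<and> module.subspace (mscl M) A \<and> (\<forall>x\<in>lcar L. \<forall>u\<in>A. act M x u \<in> A)"

definition mod_hom ::
  "'l lie_alg \<Rightarrow> ('l, 'm::ab_group_add) lie_mod \<Rightarrow> ('l, 'n::ab_group_add) lie_mod \<Rightarrow> ('m \<Rightarrow> 'n) \<Rightarrow> bool"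
  where
  "mod_hom L M N f \<longleftrightarrow>
     (\<forall>u\<in>mcar M. f u \<in> mcar N) \<and> linear_on (mscl M) (mscl N) (mcar M) f \<and>
     (\<forall>x\<in>lcar L. \<forall>u\<in>mcar M. f (act M x u) = act N x (f u))"

text \<open>Internal direct sums: with both summands inside one carrier, the same submodule can be
  given several complements, which is what the exchange arguments below compare.\<close>

definition dsum :: "'l lie_alg \<Rightarrow> ('l, 'm::ab_group_add) lie_mod \<Rightarrow> 'm set \<Rightarrow> 'm set \<Rightarrow> bool" where
  "dsum L M A B \<longleftrightarrow>
     submodule L M A \<and> submodule L M B \<and> A \<inter> B = {0} \<and> (\<forall>p\<in>mcar M. \<exists>a\<in>A. \<exists>b\<in>B. p = a + b)"

abbreviation sub :: "('l, 'm) lie_mod \<Rightarrow> 'm set \<Rightarrow> ('l, 'm) lie_mod" where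
  "sub M A \<equiv> M\<lparr>mcar := A\<rparr>"

lemma vector_space_module: "vector_space s \<Longrightarrow> module s"
  by (simp add: module_iff_vector_space)

lemma
  assumes "vector_space s" "module.subspace s A"
  shows subspace_0: "0 \<in> A"
    and subspace_add: "x \<in> A \<Longrightarrow> y \<in> A \<Longrightarrow> x + y \<in> A"
    and subspace_scale: "x \<in> A \<Longrightarrow> s c x \<in> A"
    and subspace_neg: "x \<in> A \<Longrightarrow> - x \<in> A"
    and subspace_diff: "x \<in> A \<Longrightarrow> y \<in> A \<Longrightarrow> x - y \<in> A"
    and subspace_sum: "(\<And>i. i \<in> F \<Longrightarrow> g i \<in> A) \<Longrightarrow> sum g F \<in> A"
proof -
  interpret vector_space s by fact
  note a = assms(2)
  show "0 \<in> A" by (rule subspace_0[OF a])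
  show "x \<in> A \<Longrightarrow> y \<in> A \<Longrightarrow> x + y \<in> A" by (rule subspace_add[OF a])
  show "x \<in> A \<Longrightarrow> s c x \<in> A" by (rule subspace_scale[OF a])
  show "x \<in> A \<Longrightarrow> - x \<in> A" by (rule subspace_neg[OF a])
  show "x \<in> A \<Longrightarrow> y \<in> A \<Longrightarrow> x - y \<in> A" by (rule subspace_diff[OF a])
  show "(\<And>i. i \<in> F \<Longrightarrow> g i \<in> A) \<Longrightarrow> sum g F \<in> A" by (rule subspace_sum[OF a])
qed

lemma subspaceI:
  assumes "vector_space s" "0 \<in> A" "\<And>x y. x \<in> A \<Longrightarrow> y \<in> A \<Longrightarrow> x + y \<in> A"
    "\<And>c x. x \<in> A \<Longrightarrow> s c x \<in> A"
  shows "module.subspace s A"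
  using assms by (simp add: module.subspace_def vector_space_module)

lemma
  assumes "vector_space s"
  shows vs_add: "s c (x + y) = s c x + s c y" and vs_add_left: "s (c + d) x = s c x + s d x"
    and vs_mult: "s c (s d x) = s (c * d) x" and vs_one: "s 1 x = x"
    and vs_zero: "s 0 x = 0" and vs_zero_right: "s c 0 = 0" and vs_neg: "s (- c) x = - s c x"
    and vs_neg_right: "s c (- x) = - s c x" and vs_diff: "s c (x - y) = s c x - s c y"
    and vs_sum: "s c (sum g F) = (\<Sum>i\<in>F. s c (g i))"
proof -
  interpret vector_space s by fact
  show "s c (x + y) = s c x + s c y" "s (c + d) x = s c x + s d x" "s c (s d x) = s (c * d) x" "s 1 x = x"
    "s 0 x = 0" "s c 0 = 0" "s (- c) x = - s c x" "s c (- x) = - s c x" "s c (x - y) = s c x - s c y"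
    "s c (sum g F) = (\<Sum>i\<in>F. s c (g i))"
    by (simp_all add: scale_right_distrib scale_left_distrib scale_right_diff_distrib scale_sum_right)
qed

lemma linear_on_add: "linear_on s t A f \<Longrightarrow> x \<in> A \<Longrightarrow> y \<in> A \<Longrightarrow> f (x + y) = f x + f y"
  and linear_on_scale: "linear_on s t A f \<Longrightarrow> x \<in> A \<Longrightarrow> f (s c x) = t c (f x)"
  by (auto simp: linear_on_def)

lemma linear_on_0:
  assumes "linear_on s t A f" "vector_space s" "vector_space t" "module.subspace s A"
  shows "f 0 = 0"
  using linear_on_scale[OF assms(1) subspace_0[OF assms(2,4)], of 0] assms by (simp add: vs_zero)

lemma linear_on_neg:
  assumes "linear_on s t A f" "vector_space s" "vector_space t" "x \<in> A"
  shows "f (- x) = - f x"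
  using linear_on_scale[OF assms(1,4), of "- 1"] assms by (simp add: vs_neg vs_one)

lemma linear_on_diff:
  assumes "linear_on s t A f" "vector_space s" "vector_space t" "module.subspace s A" "x \<in> A" "y \<in> A"
  shows "f (x - y) = f x - f y"
  using linear_on_add[OF assms(1,5) subspace_neg[OF assms(2,4,6)]] linear_on_neg[OF assms(1-3,6)]
  by simp

lemma linear_on_sum:
  assumes "linear_on s t A f" "vector_space s" "vector_space t" "module.subspace s A"
    "finite F" "\<And>i. i \<in> F \<Longrightarrow> g i \<in> A"
  shows "f (sum g F) = (\<Sum>i\<in>F. f (g i))"
  using assms(5,6)
proof (induction F rule: finite_induct)
  case empty
  then show ?case using linear_on_0[OF assms(1-4)] by simp
next
  case (insert x F)
  have "sum g F \<in> A" by (rule subspace_sum[OF assms(2,4)]) (use insert in auto)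
  then show ?case using insert linear_on_add[OF assms(1), of "g x" "sum g F"] by auto
qed

lemma op_moduleD:
  assumes "op_module L M"
  shows "vector_space (mscl M)" "module.subspace (mscl M) (mcar M)"
    "x \<in> lcar L \<Longrightarrow> u \<in> mcar M \<Longrightarrow> act M x u \<in> mcar M"
    "x \<in> lcar L \<Longrightarrow> linear_on (mscl M) (mscl M) (mcar M) (act M x)"
  using assms by (auto simp: op_module_def)

lemma lie_module_op_module: "lie_module L M \<Longrightarrow> op_module L M"
  by (auto simp: lie_module_def op_module_def)

lemma submoduleD:
  assumes "submodule L M A"
  shows "A \<subseteq> mcar M" "module.subspace (mscl M) A" "x \<in> lcar L \<Longrightarrow> u \<in> A \<Longrightarrow> act M x u \<in> A"
  using assms by (auto simp: submodule_def)

lemma linear_on_subset: "linear_on s t A f \<Longrightarrow> B \<subseteq> A \<Longrightarrow> linear_on s t B f"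
  unfolding linear_on_def by blast

lemma op_module_sub: "op_module L M \<Longrightarrow> submodule L M A \<Longrightarrow> op_module L (sub M A)"
  by (auto simp: op_module_def submodule_def intro: linear_on_subset)

lemma submodule_self: "op_module L M \<Longrightarrow> submodule L M (mcar M)"
  by (auto simp: op_module_def submodule_def)

lemma submodule_sub_iff: "submodule L (sub M A) C \<Longrightarrow> submodule L M A \<Longrightarrow> submodule L M C"
  by (auto simp: submodule_def)

lemma submodule_subI: "submodule L M C \<Longrightarrow> C \<subseteq> A \<Longrightarrow> submodule L (sub M A) C"
  by (auto simp: submodule_def)

lemma mod_homD:
  assumes "mod_hom L M N f"
  shows "u \<in> mcar M \<Longrightarrow> f u \<in> mcar N" "linear_on (mscl M) (mscl N) (mcar M) f"
    "x \<in> lcar L \<Longrightarrow> u \<in> mcar M \<Longrightarrow> f (act M x u) = act N x (f u)"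
  using assms by (auto simp: mod_hom_def)

lemma mod_hom_add: "mod_hom L M N f \<Longrightarrow> x \<in> mcar M \<Longrightarrow> y \<in> mcar M \<Longrightarrow> f (x + y) = f x + f y"
  and mod_hom_scale: "mod_hom L M N f \<Longrightarrow> x \<in> mcar M \<Longrightarrow> f (mscl M c x) = mscl N c (f x)"
  by (auto simp: mod_hom_def linear_on_def)

lemma
  assumes "mod_hom L M N f" "op_module L M" "op_module L N"
  shows mod_hom_0: "f 0 = 0"
    and mod_hom_neg: "x \<in> mcar M \<Longrightarrow> f (- x) = - f x"
    and mod_hom_diff: "x \<in> mcar M \<Longrightarrow> y \<in> mcar M \<Longrightarrow> f (x - y) = f x - f y"
    and mod_hom_sum: "finite F \<Longrightarrow> (\<And>i. i \<in> F \<Longrightarrow> g i \<in> mcar M) \<Longrightarrow> f (sum g F) = (\<Sum>i\<in>F. f (g i))"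
proof -
  note l = mod_homD(2)[OF assms(1)] op_moduleD(1)[OF assms(2)] op_moduleD(1)[OF assms(3)]
  note l4 = l op_moduleD(2)[OF assms(2)]
  show "f 0 = 0" by (rule linear_on_0[OF l4])
  show "x \<in> mcar M \<Longrightarrow> f (- x) = - f x" by (rule linear_on_neg[OF l])
  show "x \<in> mcar M \<Longrightarrow> y \<in> mcar M \<Longrightarrow> f (x - y) = f x - f y" by (rule linear_on_diff[OF l4])
  show "finite F \<Longrightarrow> (\<And>i. i \<in> F \<Longrightarrow> g i \<in> mcar M) \<Longrightarrow> f (sum g F) = (\<Sum>i\<in>F. f (g i))"
    by (rule linear_on_sum[OF l4])
qed

lemma
  assumes "op_module L M"
  shows om_zero: "0 \<in> mcar M" and om_add: "x \<in> mcar M \<Longrightarrow> y \<in> mcar M \<Longrightarrow> x + y \<in> mcar M"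
    and om_scale: "x \<in> mcar M \<Longrightarrow> mscl M c x \<in> mcar M"
    and om_neg: "x \<in> mcar M \<Longrightarrow> - x \<in> mcar M"
    and om_diff: "x \<in> mcar M \<Longrightarrow> y \<in> mcar M \<Longrightarrow> x - y \<in> mcar M"
    and om_sum: "(\<And>i. i \<in> F \<Longrightarrow> g i \<in> mcar M) \<Longrightarrow> sum g F \<in> mcar M"
proof -
  note a = op_moduleD(1,2)[OF assms]
  show "0 \<in> mcar M" by (rule subspace_0[OF a])
  show "x \<in> mcar M \<Longrightarrow> y \<in> mcar M \<Longrightarrow> x + y \<in> mcar M" by (rule subspace_add[OF a])
  show "x \<in> mcar M \<Longrightarrow> mscl M c x \<in> mcar M" by (rule subspace_scale[OF a])
  show "x \<in> mcar M \<Longrightarrow> - x \<in> mcar M" by (rule subspace_neg[OF a])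
  show "x \<in> mcar M \<Longrightarrow> y \<in> mcar M \<Longrightarrow> x - y \<in> mcar M" by (rule subspace_diff[OF a])
  show "(\<And>i. i \<in> F \<Longrightarrow> g i \<in> mcar M) \<Longrightarrow> sum g F \<in> mcar M" by (rule subspace_sum[OF a])
qed

lemma
  assumes "op_module L M" "x \<in> lcar L"
  shows om_act_0: "act M x 0 = 0"
    and om_act_add: "u \<in> mcar M \<Longrightarrow> v \<in> mcar M \<Longrightarrow> act M x (u + v) = act M x u + act M x v"
    and om_act_scale: "u \<in> mcar M \<Longrightarrow> act M x (mscl M c u) = mscl M c (act M x u)"
    and om_act_neg: "u \<in> mcar M \<Longrightarrow> act M x (- u) = - act M x u"
    and om_act_diff: "u \<in> mcar M \<Longrightarrow> v \<in> mcar M \<Longrightarrow> act M x (u - v) = act M x u - act M x v"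
proof -
  note l = op_moduleD(4)[OF assms] op_moduleD(1)[OF assms(1)] op_moduleD(1)[OF assms(1)]
  note l4 = l op_moduleD(2)[OF assms(1)]
  show "act M x 0 = 0" by (rule linear_on_0[OF l4])
  show "u \<in> mcar M \<Longrightarrow> v \<in> mcar M \<Longrightarrow> act M x (u + v) = act M x u + act M x v"
    by (rule linear_on_add[OF l(1)])
  show "u \<in> mcar M \<Longrightarrow> act M x (mscl M c u) = mscl M c (act M x u)"
    by (rule linear_on_scale[OF l(1)])
  show "u \<in> mcar M \<Longrightarrow> act M x (- u) = - act M x u" by (rule linear_on_neg[OF l])
  show "u \<in> mcar M \<Longrightarrow> v \<in> mcar M \<Longrightarrow> act M x (u - v) = act M x u - act M x v"
    by (rule linear_on_diff[OF l4])
qed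

lemma mod_hom_comp: "mod_hom L M N f \<Longrightarrow> mod_hom L N P g \<Longrightarrow> mod_hom L M P (\<lambda>x. g (f x))"
  by (auto simp: mod_hom_def linear_on_def)

lemma mod_hom_id: "mod_hom L M M (\<lambda>x. x)"
  by (auto simp: mod_hom_def linear_on_def)

lemma mod_hom_restrict:
  "mod_hom L M N f \<Longrightarrow> A \<subseteq> mcar M \<Longrightarrow> (\<And>u. u \<in> A \<Longrightarrow> f u \<in> B) \<Longrightarrow> mod_hom L (sub M A) (sub N B) f"
  by (auto simp: mod_hom_def linear_on_def subset_iff)

lemma mod_hom_sub_target:
  "mod_hom L M N f \<Longrightarrow> (\<And>u. u \<in> mcar M \<Longrightarrow> f u \<in> B) \<Longrightarrow> mod_hom L M (sub N B) f"
  by (simp add: mod_hom_def)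

lemma mod_hom_sub_target_mono: "mod_hom L M (sub N B) f \<Longrightarrow> B \<subseteq> mcar N \<Longrightarrow> mod_hom L M N f"
  unfolding mod_hom_def by auto

lemma mod_hom_plus:
  assumes "mod_hom L M N f" "mod_hom L M N g" "op_module L N"
  shows "mod_hom L M N (\<lambda>x. f x + g x)"
  using mod_homD[OF assms(1)] mod_homD[OF assms(2)] assms
  by (auto simp: mod_hom_def linear_on_def om_add om_act_add vs_add[OF op_moduleD(1)[OF assms(3)]]
      algebra_simps)

lemma mod_hom_minus:
  assumes "mod_hom L M N f" "mod_hom L M N g" "op_module L N"
  shows "mod_hom L M N (\<lambda>x. f x - g x)"
  using mod_homD[OF assms(1)] mod_homD[OF assms(2)] assms
  by (auto simp: mod_hom_def linear_on_def om_diff om_act_diff vs_diff[OF op_moduleD(1)[OF assms(3)]]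
      algebra_simps)

lemma module_iso_iff: "module_iso L M N \<longleftrightarrow> (\<exists>f. mod_hom L M N f \<and> bij_betw f (mcar M) (mcar N))"
  unfolding module_iso_def mod_hom_def by (auto simp: bij_betw_def)

lemma mod_hom_inv:
  assumes "mod_hom L M N f" "bij_betw f (mcar M) (mcar N)" "op_module L M"
  shows "mod_hom L N M (inv_into (mcar M) f)"
proof -
  let ?g = "inv_into (mcar M) f"
  have g: "?g v \<in> mcar M" "f (?g v) = v" if "v \<in> mcar N" for v
    using that assms(2) by (auto simp: bij_betw_def f_inv_into_f inv_into_into)
  have fg: "?g (f u) = u" if "u \<in> mcar M" for u
    using that assms(2) by (simp add: bij_betw_inv_into_left)
  have "?g (x + y) = ?g x + ?g y" if "x \<in> mcar N" "y \<in> mcar N" for x y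
    using fg[of "?g x + ?g y"] mod_hom_add[OF assms(1), of "?g x" "?g y"] g that om_add[OF assms(3)]
    by metis
  moreover have "?g (mscl N c x) = mscl M c (?g x)" if "x \<in> mcar N" for c x
    using fg[of "mscl M c (?g x)"] mod_hom_scale[OF assms(1), of "?g x"] g that om_scale[OF assms(3)]
    by metis
  moreover have "?g (act N x u) = act M x (?g u)" if "x \<in> lcar L" "u \<in> mcar N" for x u
    using fg[of "act M x (?g u)"] mod_homD(3)[OF assms(1), of x "?g u"] g that op_moduleD(3)[OF assms(3)]
    by metis
  ultimately show ?thesis using g by (auto simp: mod_hom_def linear_on_def)
qed

lemma module_iso_sym: "module_iso L M N \<Longrightarrow> op_module L M \<Longrightarrow> module_iso L N M"
  unfolding module_iso_iff using mod_hom_inv bij_betw_inv_into by blast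

lemma module_iso_trans: "module_iso L M N \<Longrightarrow> module_iso L N P \<Longrightarrow> module_iso L M P"
  unfolding module_iso_iff using mod_hom_comp bij_betw_trans[unfolded comp_def] by blast

lemma module_iso_refl: "module_iso L M M"
  unfolding module_iso_iff using mod_hom_id bij_betw_id[unfolded id_def] by blast

subsection \<open>Direct sums\<close>

lemma dsum_sym: "dsum L M A B \<Longrightarrow> dsum L M B A"
  unfolding dsum_def by (metis Int_commute add.commute)

text \<open>Two candidates for the \<open>A\<close>-component of a vector differ by an element of
  \<open>A \<inter> B\<close>, so the choice made by \<open>SOME\<close> is forced
  (\<open>uniq\<close>). Linearity and equivariance then follow by exhibiting an admissible
  component.\<close>

lemma dsum_proj:
  assumes "op_module L M" "dsum L M A B"
  obtains f where "mod_hom L M (sub M A) f" "\<And>a. a \<in> A \<Longrightarrow> f a = a" "\<And>b. b \<in> B \<Longrightarrow> f b = 0"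
    "\<And>p. p \<in> mcar M \<Longrightarrow> p - f p \<in> B"
proof -
  have A: "submodule L M A" and B: "submodule L M B" and AB: "A \<inter> B = {0}"
    and ex: "\<And>p. p \<in> mcar M \<Longrightarrow> \<exists>a\<in>A. p - a \<in> B"
    using assms(2) by (auto simp: dsum_def) (metis add_diff_cancel_left')
  note vs = op_moduleD(1)[OF assms(1)]
  note sA = submoduleD(2)[OF A] and sB = submoduleD(2)[OF B]
  define f where "f p = (SOME a. a \<in> A \<and> p - a \<in> B)" for p
  have f: "f p \<in> A" "p - f p \<in> B" if "p \<in> mcar M" for p
    using someI_ex[of "\<lambda>a. a \<in> A \<and> p - a \<in> B"] ex[OF that] unfolding f_def by blast+
  have uniq: "f p = a" if "p \<in> mcar M" "a \<in> A" "p - a \<in> B" for p a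
  proof -
    have "f p - a \<in> A" using f that subspace_diff[OF vs sA] by blast
    moreover have "(p - a) - (p - f p) \<in> B" using f that subspace_diff[OF vs sB] by blast
    ultimately have "f p - a \<in> A \<inter> B" by simp
    then show ?thesis using AB by simp
  qed
  show thesis
  proof (rule that)
    show "mod_hom L M (sub M A) f"
    proof -
      have "f (x + y) = f x + f y" if "x \<in> mcar M" "y \<in> mcar M" for x y
      proof (rule uniq)
        have "(x - f x) + (y - f y) \<in> B" using f that subspace_add[OF vs sB] by blast
        then show "x + y - (f x + f y) \<in> B" by (simp add: algebra_simps)
      qed (use f that subspace_add[OF vs sA] om_add[OF assms(1)] in auto)
      moreover have "f (mscl M c x) = mscl M c (f x)" if "x \<in> mcar M" for c x
        by (rule uniq) (use f that vs_diff[OF vs, symmetric] subspace_scale[OF vs sB]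
            subspace_scale[OF vs sA] om_scale[OF assms(1)] in auto)
      moreover have "f (act M x u) = act M x (f u)" if "x \<in> lcar L" "u \<in> mcar M" for x u
      proof (rule uniq)
        have "act M x (u - f u) = act M x u - act M x (f u)"
          using om_act_diff[OF assms(1)] that f submoduleD(1)[OF A] by blast
        then show "act M x u - act M x (f u) \<in> B"
          using submoduleD(3)[OF B that(1) f(2)[OF that(2)]] by simp
      qed (use f that submoduleD(3)[OF A] op_moduleD(3)[OF assms(1)] in auto)
      ultimately show ?thesis using f by (simp add: mod_hom_def linear_on_def)
    qed
    show "f a = a" if "a \<in> A" for a
      by (rule uniq) (use that submoduleD(1)[OF A] subspace_0[OF vs sB] in auto)
    show "f b = 0" if "b \<in> B" for b
      by (rule uniq) (use that submoduleD(1)[OF B] subspace_0[OF vs sA] in auto)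
    show "p - f p \<in> B" if "p \<in> mcar M" for p using f that by blast
  qed
qed

lemma submodule_image:
  assumes "mod_hom L M N f" "op_module L M" "op_module L N" "submodule L M A"
  shows "submodule L N (f ` A)"
proof -
  have A: "A \<subseteq> mcar M" by (rule submoduleD(1)[OF assms(4)])
  note vs = op_moduleD(1)[OF assms(2)] and sA = submoduleD(2)[OF assms(4)]
  have 0: "0 \<in> f ` A"
    using mod_hom_0[OF assms(1-3)] subspace_0[OF vs sA] by (metis imageI)
  have "f a + f b \<in> f ` A" if "a \<in> A" "b \<in> A" for a b
    using mod_hom_add[OF assms(1), of a b] that A subspace_add[OF vs sA] by (metis imageI subsetD)
  moreover have "mscl N c (f a) \<in> f ` A" if "a \<in> A" for a c
    using mod_hom_scale[OF assms(1), of a] that A subspace_scale[OF vs sA] by (metis imageI subsetD)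
  moreover have "act N x (f a) \<in> f ` A" if "a \<in> A" "x \<in> lcar L" for a x
    using mod_homD(3)[OF assms(1), of x a] that A submoduleD(3)[OF assms(4)] by (metis imageI subsetD)
  ultimately show ?thesis
    unfolding submodule_def using 0 A mod_homD(1)[OF assms(1)]
    by (auto intro!: subspaceI[OF op_moduleD(1)[OF assms(3)]])
qed

lemma submodule_kernel:
  assumes "mod_hom L M N f" "op_module L M" "op_module L N"
  shows "submodule L M {u \<in> mcar M. f u = 0}"
  unfolding submodule_def
  using assms mod_homD[OF assms(1)] op_moduleD[OF assms(2)]
  by (auto intro!: subspaceI
      simp: om_zero mod_hom_0[OF assms] om_add om_scale mod_hom_add mod_hom_scale
        vs_zero_right[OF op_moduleD(1)[OF assms(3)]] om_act_0[OF assms(3)])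

lemma submodule_Int:
  assumes "op_module L M" "submodule L M A" "submodule L M B"
  shows "submodule L M (A \<inter> B)"
  using assms module.subspace_inter[OF vector_space_module[OF op_moduleD(1)[OF assms(1)]]]
  by (auto simp: submodule_def)

definition set_sum :: "'m::plus set \<Rightarrow> 'm set \<Rightarrow> 'm set" where
  "set_sum A B = {a + b | a b. a \<in> A \<and> b \<in> B}"

lemma submodule_set_sum:
  assumes "op_module L M" "submodule L M A" "submodule L M B"
  shows "submodule L M (set_sum A B)"
proof -
  note vs = op_moduleD(1)[OF assms(1)]
  note sA = submoduleD(2)[OF assms(2)] and sB = submoduleD(2)[OF assms(3)]
  have "module.subspace (mscl M) (set_sum A B)"
  proof (rule subspaceI[OF vs])
    show "0 \<in> set_sum A B"
      using subspace_0[OF vs sA] subspace_0[OF vs sB] unfolding set_sum_def by force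
    show "x + y \<in> set_sum A B" if xy: "x \<in> set_sum A B" "y \<in> set_sum A B" for x y
    proof -
      obtain a b where "x = a + b" "a \<in> A" "b \<in> B" using xy(1) by (auto simp: set_sum_def)
      moreover obtain c d where "y = c + d" "c \<in> A" "d \<in> B" using xy(2) by (auto simp: set_sum_def)
      ultimately have "x + y = (a + c) + (b + d)" "a + c \<in> A" "b + d \<in> B"
        using subspace_add[OF vs sA] subspace_add[OF vs sB] by (simp_all add: algebra_simps)
      then show ?thesis unfolding set_sum_def by blast
    qed
    show "mscl M c x \<in> set_sum A B" if "x \<in> set_sum A B" for c x
      using that vs_add[OF vs] subspace_scale[OF vs sA] subspace_scale[OF vs sB]
      unfolding set_sum_def by blast
  qed
  moreover have "act M x (a + b) \<in> set_sum A B" if "a \<in> A" "b \<in> B" "x \<in> lcar L" for a b x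
    using om_act_add[OF assms(1) that(3), of a b] that submoduleD[OF assms(2)] submoduleD[OF assms(3)]
    unfolding set_sum_def by blast
  ultimately show ?thesis
    using submoduleD(1)[OF assms(2)] submoduleD(1)[OF assms(3)] om_add[OF assms(1)]
    unfolding submodule_def set_sum_def by blast
qed

lemma subset_set_sum:
  fixes A :: "'m::monoid_add set"
  shows "0 \<in> B \<Longrightarrow> A \<subseteq> set_sum A B" "0 \<in> A \<Longrightarrow> B \<subseteq> set_sum A B"
  unfolding set_sum_def by force+

lemma dsum_set_sum:
  assumes "op_module L M" "submodule L M A" "submodule L M B" "A \<inter> B = {0}"
  shows "dsum L (sub M (set_sum A B)) A B"
proof -
  have "0 \<in> A" "0 \<in> B" using assms(4) by auto
  then show ?thesis
    using assms subset_set_sum[of B A] subset_set_sum[of A B]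
    unfolding dsum_def by (auto intro!: submodule_subI simp: set_sum_def)
qed

text \<open>A summand of a summand is a summand. This serves for minimal summands and for the
  exchange step in \<open>cancel_internal\<close>.\<close>

lemma dsum_assoc:
  assumes M: "op_module L M" and AB: "dsum L M A B" and A12: "dsum L (sub M A) A1 A2"
  shows "dsum L M A1 (set_sum A2 B)"
proof -
  note vs = op_moduleD(1)[OF M]
  have A: "submodule L M A" and B: "submodule L M B" using AB by (auto simp: dsum_def)
  have A1: "submodule L M A1" and A2: "submodule L M A2"
    using A12 submodule_sub_iff[OF _ A] by (auto simp: dsum_def)
  have sub: "A1 \<subseteq> A" "A2 \<subseteq> A" using A12 by (auto simp: dsum_def submodule_def)
  have "x = 0" if "x \<in> A1" "x \<in> set_sum A2 B" for x
  proof -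
    obtain a b where ab: "x = a + b" "a \<in> A2" "b \<in> B" using \<open>x \<in> set_sum A2 B\<close> by (auto simp: set_sum_def)
    then have "x - a = b" by simp
    moreover have "x - a \<in> A" using \<open>x \<in> A1\<close> ab sub subspace_diff[OF vs submoduleD(2)[OF A]] by blast
    ultimately have "b \<in> A \<inter> B" using ab by simp
    then have "b = 0" using AB by (auto simp: dsum_def)
    then have "x \<in> A1 \<inter> A2" using ab that by simp
    then show ?thesis using A12 by (auto simp: dsum_def)
  qed
  moreover have "0 \<in> A1 \<inter> set_sum A2 B"
    using subspace_0[OF vs submoduleD(2)[OF A1]]
      subspace_0[OF vs submoduleD(2)[OF submodule_set_sum[OF M A2 B]]] by simp
  moreover have "\<exists>a\<in>A1. \<exists>b\<in>set_sum A2 B. p = a + b" if p: "p \<in> mcar M" for p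
  proof -
    obtain a b where ab: "p = a + b" "a \<in> A" "b \<in> B" using AB p by (auto simp: dsum_def)
    then obtain c d where "a = c + d" "c \<in> A1" "d \<in> A2" using A12 by (auto simp: dsum_def)
    then show ?thesis using ab unfolding set_sum_def
      by (intro bexI[of _ c] bexI[of _ "d + b"]) (auto simp: add.assoc)
  qed
  ultimately show ?thesis
    unfolding dsum_def using A1 submodule_set_sum[OF M A2 B] by auto
qed

text \<open>Both complements represent the quotient by \<open>Z\<close>: the projection to
  \<open>B\<close> along \<open>Z\<close>, restricted to \<open>A\<close>, is inverted by the
  projection to \<open>A\<close> along \<open>Z\<close>.\<close>

lemma dsum_complement_iso:
  assumes M: "op_module L M" and "dsum L M Z A" "dsum L M Z B"
  shows "module_iso L (sub M A) (sub M B)"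
proof -
  have A: "submodule L M A" and B: "submodule L M B" and Z: "submodule L M Z"
    using assms by (auto simp: dsum_def)
  note vs = op_moduleD(1)[OF M] and sZ = submoduleD(2)[OF Z]
  obtain f where f: "mod_hom L M (sub M A) f" "\<And>a. a \<in> A \<Longrightarrow> f a = a" "\<And>b. b \<in> Z \<Longrightarrow> f b = 0"
    "\<And>p. p \<in> mcar M \<Longrightarrow> p - f p \<in> Z"
    using dsum_proj[OF M dsum_sym[OF assms(2)]] by blast
  obtain g where g: "mod_hom L M (sub M B) g" "\<And>a. a \<in> B \<Longrightarrow> g a = a" "\<And>b. b \<in> Z \<Longrightarrow> g b = 0"
    "\<And>p. p \<in> mcar M \<Longrightarrow> p - g p \<in> Z"
    using dsum_proj[OF M dsum_sym[OF assms(3)]] by blast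
  have gf: "f (g a) = a" if "a \<in> A" for a
  proof -
    have am: "a \<in> mcar M" "g a \<in> mcar M" using that submoduleD(1)[OF A] submoduleD(1)[OF B] mod_homD(1)[OF g(1)] by auto
    have "f (a - g a) = f a - f (g a)"
      using mod_hom_diff[OF f(1) M op_module_sub[OF M A]] am by blast
    then show ?thesis using f(2,3) g(4)[OF am(1)] that by simp
  qed
  have fg: "g (f a) = a" if "a \<in> B" for a
  proof -
    have am: "a \<in> mcar M" "f a \<in> mcar M" using that submoduleD(1)[OF A] submoduleD(1)[OF B] mod_homD(1)[OF f(1)] by auto
    have "g (a - f a) = g a - g (f a)"
      using mod_hom_diff[OF g(1) M op_module_sub[OF M B]] am by blast
    then show ?thesis using g(2,3) f(4)[OF am(1)] that by simp
  qed
  have fA: "f b \<in> A" if "b \<in> B" for b using that submoduleD(1)[OF B] mod_homD(1)[OF f(1)] by auto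
  have gB: "g a \<in> B" if "a \<in> A" for a using that submoduleD(1)[OF A] mod_homD(1)[OF g(1)] by auto
  have "bij_betw g A B"
    by (rule bij_betw_byWitness[where f' = f]) (use gf fg fA gB in auto)
  moreover have "mod_hom L (sub M A) (sub M B) g"
    using mod_hom_restrict[OF g(1) submoduleD(1)[OF A], of B] gB by simp
  ultimately show ?thesis unfolding module_iso_iff by auto
qed

lemma dsum_iso:
  assumes P: "op_module L P" and Q: "op_module L Q" and dP: "dsum L P A1 A2" and dQ: "dsum L Q B1 B2"
    and i1: "module_iso L (sub P A1) (sub Q B1)" and i2: "module_iso L (sub P A2) (sub Q B2)"
  shows "module_iso L P Q"
proof -
  note vs = op_moduleD(1)[OF Q]
  have sA: "submodule L P A1" "submodule L P A2" and sB: "submodule L Q B1" "submodule L Q B2"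
    using dP dQ by (auto simp: dsum_def)
  obtain p1 where p1: "mod_hom L P (sub P A1) p1" "\<And>a. a \<in> A1 \<Longrightarrow> p1 a = a" "\<And>b. b \<in> A2 \<Longrightarrow> p1 b = 0"
    "\<And>p. p \<in> mcar P \<Longrightarrow> p - p1 p \<in> A2"
    using dsum_proj[OF P dP] by blast
  obtain f1 where f1: "mod_hom L (sub P A1) (sub Q B1) f1" "bij_betw f1 A1 B1"
    using i1 by (auto simp: module_iso_iff)
  obtain f2 where f2: "mod_hom L (sub P A2) (sub Q B2) f2" "bij_betw f2 A2 B2"
    using i2 by (auto simp: module_iso_iff)
  \<comment> \<open>\<open>u - p1 u\<close> is the \<open>A2\<close>-component of \<open>u\<close>,
    so the two given isomorphisms are applied componentwise.\<close>
  define F where "F u = f1 (p1 u) + f2 (u - p1 u)" for u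
  have p1': "mod_hom L P P p1" by (rule mod_hom_sub_target_mono[OF p1(1) submoduleD(1)[OF sA(1)]])
  have h1: "mod_hom L P Q (\<lambda>u. f1 (p1 u))"
    by (rule mod_hom_sub_target_mono[OF mod_hom_comp[OF p1(1) f1(1)] submoduleD(1)[OF sB(1)]])
  have "mod_hom L P (sub P A2) (\<lambda>u. u - p1 u)"
    by (rule mod_hom_sub_target[OF mod_hom_minus[OF mod_hom_id p1' P] p1(4)])
  then have h2: "mod_hom L P Q (\<lambda>u. f2 (u - p1 u))"
    by (rule mod_hom_sub_target_mono[OF mod_hom_comp[OF _ f2(1)] submoduleD(1)[OF sB(2)]])
  have F: "mod_hom L P Q F" unfolding F_def by (rule mod_hom_plus[OF h1 h2 Q])
  have val: "F (a + b) = f1 a + f2 b" if "a \<in> A1" "b \<in> A2" for a b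
  proof -
    have "p1 (a + b) = p1 a + p1 b" using mod_hom_add[OF p1(1)] that submoduleD(1)[OF sA(1)] submoduleD(1)[OF sA(2)] by blast
    then show ?thesis using p1(2,3) that by (simp add: F_def)
  qed
  have "inj_on F (mcar P)"
  proof (rule inj_onI)
    fix u v assume uv: "u \<in> mcar P" "v \<in> mcar P" "F u = F v"
    obtain a b where u: "u = a + b" "a \<in> A1" "b \<in> A2" using dP uv by (auto simp: dsum_def)
    obtain c d where v: "v = c + d" "c \<in> A1" "d \<in> A2" using dP uv by (auto simp: dsum_def)
    have eq: "f1 a - f1 c = f2 d - f2 b" using uv(3) val u v by (simp add: algebra_simps)
    have in1: "f1 a \<in> B1" "f1 c \<in> B1" "f2 d \<in> B2" "f2 b \<in> B2" using f1(2) f2(2) u v by (auto simp: bij_betw_def)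
    have "f1 a - f1 c \<in> B1 \<inter> B2"
      using eq subspace_diff[OF vs submoduleD(2)[OF sB(1)], of "f1 a" "f1 c"]
        subspace_diff[OF vs submoduleD(2)[OF sB(2)], of "f2 d" "f2 b"] in1 by auto
    moreover have "B1 \<inter> B2 = {0}" using dQ by (simp add: dsum_def)
    ultimately have "f1 a - f1 c = 0" "f2 d - f2 b = 0" using eq by auto
    then have "a = c" "b = d" using f1(2) f2(2) u v by (auto simp: bij_betw_def inj_on_def)
    then show "u = v" using u v by simp
  qed
  moreover have "F ` mcar P = mcar Q"
  proof (intro equalityI subsetI)
    fix q assume "q \<in> mcar Q"
    then obtain x y where q: "q = x + y" "x \<in> B1" "y \<in> B2" using dQ by (auto simp: dsum_def)
    obtain a b where "a \<in> A1" "b \<in> A2" "f1 a = x" "f2 b = y" using q f1(2) f2(2) by (auto simp: bij_betw_def)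
    then have "F (a + b) = q" using val q by simp
    moreover have "a + b \<in> mcar P"
      using \<open>a \<in> A1\<close> \<open>b \<in> A2\<close> om_add[OF P] submoduleD(1)[OF sA(1)] submoduleD(1)[OF sA(2)] by blast
    ultimately have "F (a + b) = q" "a + b \<in> mcar P" by auto
    then show "q \<in> F ` mcar P" by blast
  qed (use mod_homD(1)[OF F] in auto)
  ultimately show ?thesis using F by (auto simp: module_iso_iff bij_betw_def)
qed

section \<open>Finite-dimensional subspaces\<close>

definition fin_dim :: "(complex \<Rightarrow> 'm::ab_group_add \<Rightarrow> 'm) \<Rightarrow> 'm set \<Rightarrow> bool" where
  "fin_dim s A \<longleftrightarrow> (\<exists>F. finite F \<and> A \<subseteq> module.span s F)"

lemma fin_dim_mono: "fin_dim s B \<Longrightarrow> A \<subseteq> B \<Longrightarrow> fin_dim s A"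
  by (auto simp: fin_dim_def)

lemma fin_dim_dim_mono:
  assumes "vector_space s" "fin_dim s B" "A \<subseteq> B"
  shows "vector_space.dim s A \<le> vector_space.dim s B"
proof -
  interpret vector_space s by fact
  obtain F where F: "finite F" "B \<subseteq> span F" using assms(2) by (auto simp: fin_dim_def)
  obtain b where b: "b \<subseteq> B" "independent b" "B \<subseteq> span b" "card b = dim B" using basis_exists[of B] by metis
  have "finite b" using independent_span_bound[OF F(1) b(2)] b(1) F(2) by blast
  then show ?thesis using dim_le_card[of A b] b assms(3) by auto
qed

text \<open>A vector of \<open>B\<close> outside \<open>A\<close> enlarges a basis of
  \<open>A\<close>, and the enlarged set extends to a basis of \<open>B\<close>.\<close>

lemma fin_dim_dim_strict:
  assumes "vector_space s" "fin_dim s B" "A \<subset> B" "module.subspace s A"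
  shows "vector_space.dim s A < vector_space.dim s B"
proof -
  interpret vector_space s by fact
  obtain F where F: "finite F" "B \<subseteq> span F" using assms(2) by (auto simp: fin_dim_def)
  obtain a where a: "a \<subseteq> A" "independent a" "A \<subseteq> span a" "card a = dim A" using basis_exists[of A] by metis
  obtain v where v: "v \<in> B" "v \<notin> A" using assms(3) by blast
  have "span a \<subseteq> A" using a(1) assms(4) span_minimal by blast
  then have i: "independent (insert v a)" using a(2) v(2) independent_insertI by blast
  have "insert v a \<subseteq> B" using v a(1) assms(3) by blast
  then obtain b where b: "insert v a \<subseteq> b" "b \<subseteq> B" "independent b" "B \<subseteq> span b"
    using maximal_independent_subset_extend[OF _ i] by metis
  have "finite b" using independent_span_bound[OF F(1) b(3)] b(2) F(2) by blast
  then have "card (insert v a) \<le> card b" using b(1) card_mono by blast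
  moreover have "card b = dim B" using basis_card_eq_dim[OF b(2,4,3)] .
  moreover have "v \<notin> a" using a(1) v(2) by blast
  moreover have "finite a" by (rule finite_subset[OF _ \<open>finite b\<close>]) (use b(1) in blast)
  ultimately show ?thesis using a(4) by simp
qed

lemma fin_dim_subspace_eq:
  assumes "vector_space s" "fin_dim s B" "A \<subseteq> B" "module.subspace s A"
    "vector_space.dim s B \<le> vector_space.dim s A"
  shows "A = B"
  using fin_dim_dim_strict[OF assms(1,2) _ assms(4)] assms(3,5) by fastforce

lemma fin_dim_image:
  assumes "vector_space s" "vector_space t" "module.subspace s A" "linear_on s t A f" "fin_dim s A"
  shows "fin_dim t (f ` A)"
proof -
  interpret S: vector_space s by fact
  interpret T: vector_space t by fact
  obtain F where F: "finite F" "A \<subseteq> S.span F" using assms(5) by (auto simp: fin_dim_def)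
  obtain b where b: "b \<subseteq> A" "S.independent b" "A \<subseteq> S.span b" using S.basis_exists[of A] by metis
  have fb: "finite b" using S.independent_span_bound[OF F(1) b(2)] b(1) F(2) by blast
  have "f a \<in> T.span (f ` b)" if aA: "a \<in> A" for a
  proof -
    obtain c where c: "a = (\<Sum>v\<in>b. s (c v) v)"
      using aA b(3) S.span_finite[OF fb] by auto
    have "f a = (\<Sum>v\<in>b. t (c v) (f v))"
      unfolding c using b(1) linear_on_scale[OF assms(4)]
      by (subst linear_on_sum[OF assms(4,1,2,3) fb])
        (auto intro!: S.subspace_scale[OF assms(3)] sum.cong)
    also have "\<dots> \<in> T.span (f ` b)"
      by (intro T.span_sum T.span_scale) (rule T.span_base, simp)
    finally show ?thesis .
  qed
  then show ?thesis unfolding fin_dim_def using fb by (intro exI[of _ "f ` b"]) auto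
qed

text \<open>The inverse of \<open>f\<close> is linear on the image, so \<open>fin_dim_image\<close>
  applies to it.\<close>

lemma fin_dim_inj:
  assumes "vector_space s" "vector_space t" "module.subspace s A" "linear_on s t A f" "inj_on f A"
    "fin_dim t (f ` A)"
  shows "fin_dim s A"
proof -
  interpret S: vector_space s by fact
  interpret T: vector_space t by fact
  have sub: "T.subspace (f ` A)"
  proof (rule subspaceI[OF assms(2)])
    show "0 \<in> f ` A" using linear_on_0[OF assms(4,1,2,3)] S.subspace_0[OF assms(3)] by (metis imageI)
    show "x + y \<in> f ` A" if "x \<in> f ` A" "y \<in> f ` A" for x y
      using that linear_on_add[OF assms(4)] S.subspace_add[OF assms(3)] by auto (metis imageI)
    show "t c x \<in> f ` A" if "x \<in> f ` A" for c x
      using that linear_on_scale[OF assms(4)] S.subspace_scale[OF assms(3)] by auto (metis imageI)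
  qed
  let ?g = "inv_into A f"
  have fg: "f (?g y) = y" "?g y \<in> A" if "y \<in> f ` A" for y using that by (auto simp: f_inv_into_f inv_into_into)
  have gf: "?g (f x) = x" if "x \<in> A" for x using that assms(5) by simp
  have "linear_on t s (f ` A) ?g"
    unfolding linear_on_def
  proof (intro conjI ballI allI)
    fix x y assume "x \<in> f ` A" "y \<in> f ` A"
    then obtain a b where "x = f a" "y = f b" "a \<in> A" "b \<in> A" by auto
    then show "?g (x + y) = ?g x + ?g y"
      using linear_on_add[OF assms(4), of a b] gf S.subspace_add[OF assms(3), of a b] by metis
  next
    fix c x assume "x \<in> f ` A"
    then obtain a where "x = f a" "a \<in> A" by auto
    then show "?g (t c x) = s c (?g x)"
      using linear_on_scale[OF assms(4), of a c] gf S.subspace_scale[OF assms(3), of a c] by metis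
  qed
  then have "fin_dim s (?g ` f ` A)" by (rule fin_dim_image[OF assms(2,1) sub _ assms(6)])
  moreover have "?g ` f ` A = A" using gf by (force simp: image_image)
  ultimately show ?thesis by simp
qed

subsection \<open>Fitting's lemma\<close>

text \<open>The zero module is excluded, as the zero ring is from local rings: on it the empty sum
  in \<open>local_sum\<close> would be bijective.\<close>

definition indecomposable :: "'l lie_alg \<Rightarrow> ('l, 'm::ab_group_add) lie_mod \<Rightarrow> bool" where
  "indecomposable L X \<longleftrightarrow> mcar X \<noteq> {0} \<and> (\<forall>A B. dsum L X A B \<longrightarrow> A = {0} \<or> A = mcar X)"

lemma mod_hom_funpow: "mod_hom L X X f \<Longrightarrow> mod_hom L X X (f ^^ k)"
proof (induction k)
  case 0 then show ?case using mod_hom_id by (simp add: id_def)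
next
  case (Suc k)
  then show ?case using mod_hom_comp[of L X X "f ^^ k" X f] by (simp add: comp_def)
qed

text \<open>Images of the powers of \<open>f\<close> decrease and their kernels increase, so in
  finite dimension both become stationary. From then on image and kernel are complementary, and
  \<open>f\<close> is bijective on the image.\<close>

lemma fitting:
  assumes X: "op_module L X" and fin: "fin_dim (mscl X) (mcar X)" and f: "mod_hom L X X f"
  obtains k where "dsum L X ((f ^^ k) ` mcar X) {u \<in> mcar X. (f ^^ k) u = 0}"
    "inj_on f ((f ^^ k) ` mcar X)" "f ` (f ^^ k) ` mcar X = (f ^^ k) ` mcar X"
proof -
  note vs = op_moduleD(1)[OF X]
  let ?im = "\<lambda>k. (f ^^ k) ` mcar X" and ?ker = "\<lambda>k. {u \<in> mcar X. (f ^^ k) u = 0}"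
  let ?dim = "vector_space.dim (mscl X)"
  note hk = mod_hom_funpow[OF f]
  have fc: "(f ^^ k) u \<in> mcar X" if "u \<in> mcar X" for k u using mod_homD(1)[OF hk] that by auto
  have f0: "(f ^^ k) 0 = 0" for k by (rule mod_hom_0[OF hk X X])
  have sim: "submodule L X (?im k)" for k by (rule submodule_image[OF hk X X submodule_self[OF X]])
  have sker: "submodule L X (?ker k)" for k by (rule submodule_kernel[OF hk X X])
  have im_anti: "?im (k + j) \<subseteq> ?im k" for k j
    using fc[of _ j] by (auto simp: funpow_add)
  have ker_mono: "?ker k \<subseteq> ?ker (k + j)" for k j
    using f0 by (auto simp: funpow_add add.commute[of k])
  obtain k1 where k1: "\<And>k. ?dim (?im k1) \<le> ?dim (?im k)"
    using ex_has_least_nat[of "\<lambda>_. True" 0 "\<lambda>k. ?dim (?im k)"] by auto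
  have "\<forall>k. ?dim (?ker k) \<le> ?dim (mcar X)"
    using fin_dim_dim_mono[OF vs fin] submoduleD(1)[OF sker] by blast
  then obtain k2 where k2: "\<And>k. ?dim (?ker k) \<le> ?dim (?ker k2)"
    using ex_has_greatest_nat[of "\<lambda>_. True" 0 "\<lambda>k. ?dim (?ker k)" "Suc (?dim (mcar X))"]
    by (auto simp: less_Suc_eq_le)
  \<comment> \<open>\<open>k1\<close> has an image of least dimension and \<open>k2\<close> a kernel
    of greatest dimension; from their sum on, both chains are constant.\<close>
  define K where "K = k1 + k2"
  have im_eq: "?im (k1 + j) = ?im k1" for j
    by (rule fin_dim_subspace_eq[OF vs _ im_anti submoduleD(2)[OF sim] k1])
       (rule fin_dim_mono[OF fin submoduleD(1)[OF sim]])
  have ker_eq: "?ker k2 = ?ker (k2 + j)" for j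
    by (rule fin_dim_subspace_eq[OF vs _ ker_mono submoduleD(2)[OF sker] k2])
       (rule fin_dim_mono[OF fin submoduleD(1)[OF sker]])
  have imK: "?im (K + j) = ?im K" for j
    using im_eq[of k2] im_eq[of "k2 + j"] by (simp add: K_def add.assoc)
  have kerK: "?ker (K + j) = ?ker K" for j
    using ker_eq[of k1] ker_eq[of "k1 + j"] by (simp add: K_def ac_simps)
  \<comment> \<open>If \<open>u\<close>, the image of \<open>v\<close> under the \<open>K\<close>-th
    power, is killed by a power of \<open>f\<close>, then \<open>v\<close> lies in the kernel of the
    power \<open>K + K\<close>, which equals the kernel of the \<open>K\<close>-th power.\<close>
  have int: "u = 0" if u: "u \<in> ?im K" "u \<in> ?ker (K + j)" for u j
  proof -
    obtain v where v: "v \<in> mcar X" "u = (f ^^ K) v" using u by auto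
    have "u \<in> ?ker K" using that kerK by blast
    then have "v \<in> ?ker (K + K)" using v by (simp add: funpow_add)
    then show ?thesis using kerK v by auto
  qed
  have d: "dsum L X (?im K) (?ker K)"
    unfolding dsum_def
  proof (intro conjI ballI)
    show "submodule L X (?im K)" by (rule sim)
    show "submodule L X (?ker K)" by (rule sker)
    have "0 \<in> ?im K" using f0 om_zero[OF X] by (metis imageI)
    then show "?im K \<inter> ?ker K = {0}" using int[of _ 0] f0 om_zero[OF X] by auto
    fix p assume p: "p \<in> mcar X"
    then have "(f ^^ K) p \<in> ?im (K + K)" using imK by blast
    then obtain y where y: "y \<in> mcar X" "(f ^^ K) p = (f ^^ K) ((f ^^ K) y)" by (auto simp: funpow_add)
    have "(f ^^ K) (p - (f ^^ K) y) = 0" using mod_hom_diff[OF hk X X p fc[OF y(1)]] y(2) by simp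
    then have "p - (f ^^ K) y \<in> ?ker K" using om_diff[OF X p fc[OF y(1)]] by simp
    moreover have "p = (f ^^ K) y + (p - (f ^^ K) y)" by simp
    ultimately show "\<exists>a\<in>?im K. \<exists>b\<in>?ker K. p = a + b" using y(1) by blast
  qed
  have inj: "inj_on f (?im K)"
  proof (rule inj_onI)
    fix u v assume uv: "u \<in> ?im K" "v \<in> ?im K" "f u = f v"
    have m: "u \<in> mcar X" "v \<in> mcar X" using uv submoduleD(1)[OF sim] by auto
    have "f (u - v) = 0" using mod_hom_diff[OF f X X m] uv by simp
    moreover have "u - v \<in> ?im K" using uv subspace_diff[OF vs submoduleD(2)[OF sim]] by blast
    moreover have "(f ^^ (K + 1)) (u - v) = (f ^^ K) (f (u - v))" by (simp add: funpow_swap1)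
    ultimately have "u - v = 0" using int[of "u - v" 1] f0 om_diff[OF X m] by simp
    then show "u = v" by simp
  qed
  have "f ` ?im K = ?im K" using imK[of 1] by (simp add: image_comp)
  then show ?thesis using d inj that by blast
qed

text \<open>One of the two Fitting summands is zero. A map that is not bijective cannot have the
  whole module as stable image, so some power of it vanishes.\<close>

lemma indecomposable_endo:
  assumes X: "op_module L X" and fin: "fin_dim (mscl X) (mcar X)" and ind: "indecomposable L X"
    and f: "mod_hom L X X f" and nb: "\<not> bij_betw f (mcar X) (mcar X)"
  obtains k where "\<And>u. u \<in> mcar X \<Longrightarrow> (f ^^ k) u = 0"
proof -
  obtain k where k: "dsum L X ((f ^^ k) ` mcar X) {u \<in> mcar X. (f ^^ k) u = 0}"
    "inj_on f ((f ^^ k) ` mcar X)" "f ` (f ^^ k) ` mcar X = (f ^^ k) ` mcar X"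
    using fitting[OF X fin f] by blast
  have "(f ^^ k) ` mcar X = {0} \<or> (f ^^ k) ` mcar X = mcar X"
    using ind k(1) unfolding indecomposable_def by blast
  moreover have "(f ^^ k) ` mcar X \<noteq> mcar X" using k(2,3) nb unfolding bij_betw_def by metis
  ultimately have "(f ^^ k) ` mcar X = {0}" by blast
  then show ?thesis using that by blast
qed

text \<open>A nilpotent endomorphism with trivial kernel lives only on the zero module.\<close>

lemma indecomposable_bij_if_inj:
  assumes X: "op_module L X" "fin_dim (mscl X) (mcar X)" "indecomposable L X"
    and f: "mod_hom L X X f" and inj: "\<And>u. u \<in> mcar X \<Longrightarrow> f u = 0 \<Longrightarrow> u = 0"
  shows "bij_betw f (mcar X) (mcar X)"
proof (rule ccontr)
  assume "\<not> ?thesis"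
  then obtain k where k: "\<And>u. u \<in> mcar X \<Longrightarrow> (f ^^ k) u = 0"
    using indecomposable_endo[OF X f] by blast
  have "u = 0" if "u \<in> mcar X" "(f ^^ j) u = 0" for u j
    using that
  proof (induction j arbitrary: u)
    case (Suc j)
    then show ?case using inj mod_homD(1)[OF f] by (simp add: funpow_swap1)
  qed simp
  then have "mcar X = {0}" using k om_zero[OF X(1)] by blast
  then show False using X(3) by (simp add: indecomposable_def)
qed

text \<open>Locality of the endomorphism ring. Composition with the inverse \<open>?i\<close> of the
  sum turns the sum into the identity. If neither summand is bijective, \<open>?i f\<close> is
  nilpotent; yet it fixes every vector of the kernel of \<open>?i g\<close>, so that kernel is zero
  and \<open>?i g\<close> is bijective after all.\<close>

lemma local_sum2:
  assumes X: "op_module L X" "fin_dim (mscl X) (mcar X)" "indecomposable L X"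
    and f: "mod_hom L X X f" and g: "mod_hom L X X g"
    and fg: "bij_betw (\<lambda>x. f x + g x) (mcar X) (mcar X)"
  shows "bij_betw f (mcar X) (mcar X) \<or> bij_betw g (mcar X) (mcar X)"
proof (rule ccontr)
  let ?h = "\<lambda>x. f x + g x" and ?i = "inv_into (mcar X) (\<lambda>x. f x + g x)"
  assume neg: "\<not> ?thesis"
  have h: "mod_hom L X X ?h" by (rule mod_hom_plus[OF f g X(1)])
  have i: "mod_hom L X X ?i" by (rule mod_hom_inv[OF h fg X(1)])
  have bi: "bij_betw ?i (mcar X) (mcar X)" by (rule bij_betw_inv_into[OF fg])
  have hif: "mod_hom L X X (\<lambda>x. ?i (f x))" and ig: "mod_hom L X X (\<lambda>x. ?i (g x))"
    by (rule mod_hom_comp[OF f i], rule mod_hom_comp[OF g i])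
  have one: "?i (f x) + ?i (g x) = x" if "x \<in> mcar X" for x
  proof -
    have "?i (f x) + ?i (g x) = ?i (?h x)"
      using mod_hom_add[OF i] mod_homD(1)[OF f that] mod_homD(1)[OF g that] by metis
    then show ?thesis using bij_betw_inv_into_left[OF fg that] by simp
  qed
  have refl_bij: "bij_betw e (mcar X) (mcar X)" if e: "mod_hom L X X e" and b: "bij_betw (\<lambda>x. ?i (e x)) (mcar X) (mcar X)" for e
  proof (rule indecomposable_bij_if_inj[OF X e])
    fix u assume u: "u \<in> mcar X" "e u = 0"
    then have "?i (e u) = ?i (e 0)" using mod_hom_0[OF e X(1) X(1)] by simp
    then show "u = 0" using inj_onD[OF bij_betw_imp_inj_on[OF b]] u om_zero[OF X(1)] by blast
  qed
  have nf: "\<not> bij_betw (\<lambda>x. ?i (f x)) (mcar X) (mcar X)" and ng: "\<not> bij_betw (\<lambda>x. ?i (g x)) (mcar X) (mcar X)"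
    using neg refl_bij[OF f] refl_bij[OF g] by blast+
  obtain k where k: "\<And>u. u \<in> mcar X \<Longrightarrow> ((\<lambda>x. ?i (f x)) ^^ k) u = 0"
    using indecomposable_endo[OF X hif nf] by blast
  have "bij_betw (\<lambda>x. ?i (g x)) (mcar X) (mcar X)"
  proof (rule indecomposable_bij_if_inj[OF X ig])
    fix u assume u: "u \<in> mcar X" "?i (g u) = 0"
    have "?i (f u) = u" using one[OF u(1)] u(2) by simp
    then have "((\<lambda>x. ?i (f x)) ^^ j) u = u" for j by (induction j) auto
    then show "u = 0" using k u(1) by metis
  qed
  then show False using ng by blast
qed

text \<open>Induction from the case of two terms; the empty sum is not bijective because the module
  is nonzero.\<close>

lemma local_sum:
  assumes X: "op_module L X" "fin_dim (mscl X) (mcar X)" "indecomposable L X"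
    and f: "\<And>i. i \<in> F \<Longrightarrow> mod_hom L X X (f i)" and F: "finite F"
    and b: "bij_betw (\<lambda>x. \<Sum>i\<in>F. f i x) (mcar X) (mcar X)"
  shows "\<exists>i\<in>F. bij_betw (f i) (mcar X) (mcar X)"
proof -
  have z: "mod_hom L X X (\<lambda>x. 0)"
    using om_zero[OF X(1)] om_act_0[OF X(1)] vs_zero_right[OF op_moduleD(1)[OF X(1)]]
    by (simp add: mod_hom_def linear_on_def)
  have s: "mod_hom L X X (\<lambda>x. \<Sum>i\<in>F. f i x)" if "finite F" "\<And>i. i \<in> F \<Longrightarrow> mod_hom L X X (f i)" for F
    using that by (induction F rule: finite_induct) (auto intro: z mod_hom_plus[OF _ _ X(1)])
  show ?thesis using F f b
  proof (induction F rule: finite_induct)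
    case empty
    then have "(\<lambda>x. 0) ` mcar X = mcar X" by (simp add: bij_betw_def)
    then have "mcar X = {0}" using om_zero[OF X(1)] by (metis image_constant)
    then show ?case using X(3) by (simp add: indecomposable_def)
  next
    case (insert i F)
    have "bij_betw (\<lambda>x. f i x + (\<Sum>i\<in>F. f i x)) (mcar X) (mcar X)" using insert by simp
    moreover have hi: "mod_hom L X X (f i)" and hF: "mod_hom L X X (\<lambda>x. \<Sum>i\<in>F. f i x)"
      using insert(4) s[OF insert(1)] by simp_all
    ultimately consider "bij_betw (f i) (mcar X) (mcar X)" | "bij_betw (\<lambda>x. \<Sum>i\<in>F. f i x) (mcar X) (mcar X)"
      using local_sum2[OF X hi hF] by blast
    then show ?case
    proof cases
      case 2
      have "\<exists>i\<in>F. bij_betw (f i) (mcar X) (mcar X)" by (rule insert(3)[OF _ 2]) (simp add: insert(4))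
      then show ?thesis by blast
    qed blast
  qed
qed

lemma module_iso_op_module_sub_image:
  assumes F: "mod_hom L P Q F" "bij_betw F (mcar P) (mcar Q)" and A: "submodule L P A"
  shows "module_iso L (sub P A) (sub Q (F ` A))"
proof -
  have "mod_hom L (sub P A) (sub Q (F ` A)) F"
    by (rule mod_hom_restrict[OF F(1) submoduleD(1)[OF A]]) simp
  moreover have "bij_betw F A (F ` A)"
    using bij_betw_subset[OF F(2) submoduleD(1)[OF A]] by simp
  ultimately show ?thesis unfolding module_iso_iff by auto
qed

lemma dsum_image:
  assumes P: "op_module L P" and Q: "op_module L Q"
    and F: "mod_hom L P Q F" "bij_betw F (mcar P) (mcar Q)" and d: "dsum L P A B"
  shows "dsum L Q (F ` A) (F ` B)"
proof -
  have A: "submodule L P A" and B: "submodule L P B" and AB: "A \<inter> B = {0}" using d by (auto simp: dsum_def)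
  have "F ` A \<inter> F ` B = F ` (A \<inter> B)"
    using inj_on_image_Int[OF bij_betw_imp_inj_on[OF F(2)] submoduleD(1)[OF A] submoduleD(1)[OF B]] by simp
  then have "F ` A \<inter> F ` B = {0}" using AB mod_hom_0[OF F(1) P Q] by simp
  moreover have "\<exists>a\<in>F ` A. \<exists>b\<in>F ` B. q = a + b" if q: "q \<in> mcar Q" for q
  proof -
    obtain p where p: "p \<in> mcar P" "q = F p" using q F(2) by (auto simp: bij_betw_def)
    then obtain a b where "p = a + b" "a \<in> A" "b \<in> B" using d by (auto simp: dsum_def)
    moreover have "F (a + b) = F a + F b"
      using \<open>a \<in> A\<close> \<open>b \<in> B\<close> mod_hom_add[OF F(1)] submoduleD(1)[OF A] submoduleD(1)[OF B] by blast
    ultimately show ?thesis using p by blast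
  qed
  ultimately show ?thesis
    unfolding dsum_def using submodule_image[OF F(1) P Q A] submodule_image[OF F(1) P Q B] by blast
qed

lemma indecomposable_iso:
  assumes X: "op_module L X" and Y: "op_module L Y" and "module_iso L X Y" and ind: "indecomposable L X"
  shows "indecomposable L Y"
proof -
  obtain F where F: "mod_hom L X Y F" "bij_betw F (mcar X) (mcar Y)" using assms(3) by (auto simp: module_iso_iff)
  let ?G = "inv_into (mcar X) F"
  have G: "mod_hom L Y X ?G" "bij_betw ?G (mcar Y) (mcar X)"
    by (rule mod_hom_inv[OF F X], rule bij_betw_inv_into[OF F(2)])
  have im: "F ` ?G ` A = A" if "A \<subseteq> mcar Y" for A
    using that F(2) by (force simp: image_image bij_betw_def f_inv_into_f)
  have F0: "F 0 = 0" by (rule mod_hom_0[OF F(1) X Y])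
  have "mcar Y \<noteq> {0}"
  proof
    assume Y0: "mcar Y = {0}"
    have "x = 0" if "x \<in> mcar X" for x
      using inj_onD[OF bij_betw_imp_inj_on[OF F(2)] _ that om_zero[OF X]] mod_homD(1)[OF F(1) that] Y0 F0 by auto
    then show False using ind om_zero[OF X] by (auto simp: indecomposable_def)
  qed
  moreover have "A = {0} \<or> A = mcar Y" if d: "dsum L Y A B" for A B
  proof -
    have A: "A \<subseteq> mcar Y" using d by (auto simp: dsum_def submodule_def)
    have "?G ` A = {0} \<or> ?G ` A = mcar X"
      using dsum_image[OF Y X G d] ind by (auto simp: indecomposable_def)
    then show ?thesis using im[OF A] F0 bij_betw_imp_surj_on[OF F(2)] by force
  qed
  ultimately show ?thesis by (auto simp: indecomposable_def)
qed

subsection \<open>Cancellation of a common summand\<close>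

text \<open>The exchange argument. With the projections \<open>p\<close> to \<open>X\<close> along
  \<open>P'\<close> and \<open>q\<close> to \<open>Y\<close> along \<open>Q1\<close>, the identity
  of \<open>X\<close> is \<open>p q + p (1 - q)\<close>, and by locality one of the two terms is
  bijective on \<open>X\<close>. Either \<open>X\<close> itself is complementary to
  \<open>Q1\<close>, or \<open>Q1\<close> contains a copy of \<open>X\<close> that is complementary
  to \<open>P'\<close>.\<close>

lemma cancel_internal:
  assumes Q: "op_module L Q" and dX: "dsum L Q X P'" and dY: "dsum L Q Y Q1"
    and XY: "module_iso L (sub Q X) (sub Q Y)" and fin: "fin_dim (mscl Q) X"
    and ind: "indecomposable L (sub Q X)"
  shows "module_iso L (sub Q P') (sub Q Q1)"
proof -
  note vs = op_moduleD(1)[OF Q]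
  have sX: "submodule L Q X" and sP: "submodule L Q P'" and sY: "submodule L Q Y" and sQ: "submodule L Q Q1"
    using dX dY by (auto simp: dsum_def)
  note cX = submoduleD(1)[OF sX] and cY = submoduleD(1)[OF sY] and cP = submoduleD(1)[OF sP]
    and cQ = submoduleD(1)[OF sQ]
  note oX = op_module_sub[OF Q sX] and oY = op_module_sub[OF Q sY]
  note locX = oX _ ind
  have finX: "fin_dim (mscl (sub Q X)) (mcar (sub Q X))" using fin by simp
  obtain p where p: "mod_hom L Q (sub Q X) p" "\<And>a. a \<in> X \<Longrightarrow> p a = a" "\<And>b. b \<in> P' \<Longrightarrow> p b = 0"
    "\<And>u. u \<in> mcar Q \<Longrightarrow> u - p u \<in> P'"
    using dsum_proj[OF Q dX] by blast
  obtain q where q: "mod_hom L Q (sub Q Y) q" "\<And>a. a \<in> Y \<Longrightarrow> q a = a" "\<And>b. b \<in> Q1 \<Longrightarrow> q b = 0"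
    "\<And>u. u \<in> mcar Q \<Longrightarrow> u - q u \<in> Q1"
    using dsum_proj[OF Q dY] by blast
  have q': "mod_hom L Q Q q" by (rule mod_hom_sub_target_mono[OF q(1) cY])
  have pX: "p u \<in> X" if "u \<in> mcar Q" for u using mod_homD(1)[OF p(1) that] by simp
  have qY: "q u \<in> Y" if "u \<in> mcar Q" for u using mod_homD(1)[OF q(1) that] by simp
  have r: "mod_hom L Q Q (\<lambda>u. u - q u)" by (rule mod_hom_minus[OF mod_hom_id q' Q])
  have res: "mod_hom L (sub Q X) N f" if "mod_hom L Q N f" for N f
    using mod_hom_restrict[OF that cX, of "mcar N"] mod_homD(1)[OF that] cX by auto
  have f: "mod_hom L (sub Q X) (sub Q X) (\<lambda>u. p (q u))" by (rule res[OF mod_hom_comp[OF q' p(1)]])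
  have g: "mod_hom L (sub Q X) (sub Q X) (\<lambda>u. p (u - q u))" by (rule res[OF mod_hom_comp[OF r p(1)]])
  have p_add: "p (u + v) = p u + p v" if "u \<in> mcar Q" "v \<in> mcar Q" for u v by (rule mod_hom_add[OF p(1) that])
  have p0: "p 0 = 0" by (rule mod_hom_0[OF p(1) Q oX])
  have q0: "q 0 = 0" by (rule mod_hom_0[OF q(1) Q oY])
  have one: "p (q u) + p (u - q u) = u" if "u \<in> X" for u
  proof -
    have u: "u \<in> mcar Q" using that cX by blast
    have "p (q u) + p (u - q u) = p (q u + (u - q u))"
      using p_add[of "q u" "u - q u"] mod_homD(1)[OF q' u] om_diff[OF Q u] by simp
    then show ?thesis using p(2) that by simp
  qed
  have "bij_betw (\<lambda>u. p (q u) + p (u - q u)) X X"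
    using one bij_betw_cong[of X "\<lambda>u. p (q u) + p (u - q u)" "\<lambda>u. u" X] bij_betw_id[of X] by (simp add: id_def)
  then have "bij_betw (\<lambda>u. p (q u)) X X \<or> bij_betw (\<lambda>u. p (u - q u)) X X"
    using local_sum2[OF oX finX ind f g] by simp
  then show ?thesis
  proof
    assume b: "bij_betw (\<lambda>u. p (q u)) X X"
    have inj: "u = 0" if "u \<in> X" "q u = 0" for u
    proof (rule inj_onD[OF bij_betw_imp_inj_on[OF b]])
      show "p (q u) = p (q 0)" using that q0 by simp
    qed (use that subspace_0[OF vs submoduleD(2)[OF sX]] in auto)
    \<comment> \<open>Bijectivity of \<open>p q\<close> only shows that \<open>q\<close> is
      injective on \<open>X\<close>. Returning from \<open>Y\<close> to \<open>X\<close> by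
      \<open>h\<close> gives an injective endomorphism of \<open>X\<close>, which is bijective;
      therefore \<open>q\<close> maps \<open>X\<close> onto \<open>Y\<close>.\<close>
    obtain h where h: "mod_hom L (sub Q Y) (sub Q X) h" "bij_betw h Y X"
      using module_iso_sym[OF XY oX] by (auto simp: module_iso_iff)
    have h0: "h 0 = 0" by (rule mod_hom_0[OF h(1) oY oX])
    have "bij_betw (\<lambda>u. h (q u)) (mcar (sub Q X)) (mcar (sub Q X))"
    proof (rule indecomposable_bij_if_inj[OF oX finX ind])
      show "mod_hom L (sub Q X) (sub Q X) (\<lambda>u. h (q u))" by (rule mod_hom_comp[OF res[OF q(1)] h(1)])
      fix u assume u: "u \<in> mcar (sub Q X)" "h (q u) = 0"
      then have uQ: "u \<in> mcar Q" using cX by auto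
      have "q u = 0"
        using inj_onD[OF bij_betw_imp_inj_on[OF h(2)], of "q u" 0] u h0 qY[OF uQ]
          subspace_0[OF vs submoduleD(2)[OF sY]] by simp
      then show "u = 0" using inj u by simp
    qed
    then have hq: "h ` q ` X = X" by (simp add: bij_betw_def image_image)
    have surj: "\<exists>x\<in>X. q x = y" if y: "y \<in> Y" for y
    proof -
      have "h y \<in> h ` q ` X" using hq h(2) y by (auto simp: bij_betw_def)
      then obtain x where "x \<in> X" "h y = h (q x)" by auto
      then have "y = q x" using inj_onD[OF bij_betw_imp_inj_on[OF h(2)], of y "q x"] y qY cX by auto
      then show ?thesis using \<open>x \<in> X\<close> by blast
    qed
    \<comment> \<open>\<open>Q1\<close> is the kernel of \<open>q\<close> and \<open>q\<close> maps
      \<open>X\<close> bijectively to \<open>Y\<close>, so \<open>X\<close> can take the place of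
      \<open>Y\<close>.\<close>
    have "dsum L Q X Q1"
      unfolding dsum_def
    proof (intro conjI ballI)
      show "X \<inter> Q1 = {0}"
        using inj q(3) subspace_0[OF vs submoduleD(2)[OF sX]] subspace_0[OF vs submoduleD(2)[OF sQ]] by auto
      fix u assume u: "u \<in> mcar Q"
      obtain x where x: "x \<in> X" "q x = q u" using surj qY[OF u] by blast
      have xQ: "x \<in> mcar Q" using x cX by blast
      have "(u - q u) - (x - q x) \<in> Q1" using subspace_diff[OF vs submoduleD(2)[OF sQ] q(4)[OF u] q(4)[OF xQ]] .
      then have "u - x \<in> Q1" using x by simp
      then show "\<exists>a\<in>X. \<exists>b\<in>Q1. u = a + b" using x by (intro bexI[of _ x] bexI[of _ "u - x"]) auto
    qed (rule sX, rule sQ)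
    then show ?thesis by (rule dsum_complement_iso[OF Q dX])
  next
    assume b: "bij_betw (\<lambda>u. p (u - q u)) X X"
    \<comment> \<open>The copy of \<open>X\<close> inside \<open>Q1\<close>: its image under the
      projection to \<open>Q1\<close> along \<open>Y\<close>.\<close>
    define Z where "Z = (\<lambda>u. u - q u) ` X"
    have sZ: "submodule L Q Z"
      unfolding Z_def by (rule submodule_image[OF r Q Q sX])
    have ZQ: "Z \<subseteq> Q1" unfolding Z_def using q(4) cX by auto
    have inj: "u = v" if "u \<in> X" "v \<in> X" "p (u - q u) = p (v - q v)" for u v
      using inj_onD[OF bij_betw_imp_inj_on[OF b] that(3,1,2)] .
    have X0: "0 \<in> X" by (rule subspace_0[OF vs submoduleD(2)[OF sX]])
    have dZ: "dsum L Q Z P'"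
      unfolding dsum_def
    proof (intro conjI ballI)
      have "z = 0" if "z \<in> Z" "z \<in> P'" for z
      proof -
        obtain x where x: "x \<in> X" "z = x - q x" using \<open>z \<in> Z\<close> by (auto simp: Z_def)
        have "x = 0" using inj[OF x(1) X0] p(3)[OF that(2)] x q0 p0 by simp
        then show ?thesis using x q0 by simp
      qed
      then show "Z \<inter> P' = {0}"
        using subspace_0[OF vs submoduleD(2)[OF sZ]] subspace_0[OF vs submoduleD(2)[OF sP]] by auto
      fix u assume u: "u \<in> mcar Q"
      obtain x where x: "x \<in> X" "p u = p (x - q x)" using b pX[OF u] by (auto simp: bij_betw_def)
      have z: "x - q x \<in> Z" "x - q x \<in> mcar Q" using x sZ by (auto simp: Z_def submodule_def)
      have "p (u - (x - q x)) = 0" using mod_hom_diff[OF p(1) Q oX u z(2)] x by simp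
      then have "u - (x - q x) \<in> P'" using p(4)[OF om_diff[OF Q u z(2)]] by simp
      then show "\<exists>a\<in>Z. \<exists>b\<in>P'. u = a + b"
        using z by (intro bexI[of _ "x - q x"] bexI[of _ "u - (x - q x)"]) auto
    qed (rule sZ, rule sP)
    \<comment> \<open>As \<open>Z\<close> lies in \<open>Q1\<close>, its complement
      \<open>P'\<close> cuts out a complement \<open>C\<close> of \<open>Z\<close> in
      \<open>Q1\<close>. Then \<open>P'\<close> and \<open>C + Y\<close> are both complements of
      \<open>Z\<close>, and replacing \<open>Y\<close> by the isomorphic \<open>Z\<close> turns
      \<open>C + Y\<close> into \<open>Q1\<close>.\<close>
    define C where "C = Q1 \<inter> P'"
    have sC: "submodule L Q C" unfolding C_def by (rule submodule_Int[OF Q sQ sP])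
    have dC: "dsum L (sub Q Q1) Z C"
      unfolding dsum_def
    proof (intro conjI ballI)
      show "submodule L (sub Q Q1) Z" by (rule submodule_subI[OF sZ ZQ])
      show "submodule L (sub Q Q1) C" by (rule submodule_subI[OF sC]) (simp add: C_def)
      have "0 \<in> C" by (rule subspace_0[OF vs submoduleD(2)[OF sC]])
      then show "Z \<inter> C = {0}" using dZ by (auto simp: dsum_def C_def)
      fix u assume "u \<in> mcar (sub Q Q1)"
      then have u: "u \<in> Q1" "u \<in> mcar Q" using cQ by auto
      then obtain z c where zc: "u = z + c" "z \<in> Z" "c \<in> P'" using dZ by (auto simp: dsum_def)
      have "u - z \<in> Q1" using subspace_diff[OF vs submoduleD(2)[OF sQ] u(1)] zc ZQ by blast
      then have "c \<in> C" using zc by (simp add: C_def)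
      then show "\<exists>a\<in>Z. \<exists>b\<in>C. u = a + b" using zc by blast
    qed
    have XZ: "module_iso L (sub Q X) (sub Q Z)"
      unfolding module_iso_iff
    proof (intro exI[of _ "\<lambda>u. u - q u"] conjI)
      show "mod_hom L (sub Q X) (sub Q Z) (\<lambda>u. u - q u)"
        by (rule mod_hom_restrict[OF r cX]) (simp add: Z_def)
      show "bij_betw (\<lambda>u. u - q u) (mcar (sub Q X)) (mcar (sub Q Z))"
        unfolding bij_betw_def Z_def by (simp, rule inj_onI, rule inj) (simp_all only:)
    qed
    have YZ: "module_iso L (sub Q Y) (sub Q Z)"
      by (rule module_iso_trans[OF module_iso_sym[OF XY oX] XZ])
    have d1: "dsum L Q Z (set_sum C Y)" by (rule dsum_assoc[OF Q dsum_sym[OF dY] dC])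
    have sCY: "submodule L Q (set_sum C Y)" by (rule submodule_set_sum[OF Q sC sY])
    have i1: "module_iso L (sub Q P') (sub Q (set_sum C Y))" by (rule dsum_complement_iso[OF Q dZ d1])
    have "0 \<in> C" by (rule subspace_0[OF vs submoduleD(2)[OF sC]])
    then have "C \<inter> Y = {0}" using dY by (auto simp: dsum_def C_def)
    then have d2: "dsum L (sub Q (set_sum C Y)) C Y" by (rule dsum_set_sum[OF Q sC sY])
    have "module_iso L (sub Q (set_sum C Y)) (sub Q Q1)"
      by (rule dsum_iso[OF op_module_sub[OF Q sCY] op_module_sub[OF Q sQ] d2 dsum_sym[OF dC]])
         (simp_all add: module_iso_refl YZ)
    then show ?thesis by (rule module_iso_trans[OF i1])
  qed
qed

text \<open>The decomposition of \<open>P\<close> is carried into \<open>Q\<close> by the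
  isomorphism, so that two decompositions of one module are compared.\<close>

lemma cancel:
  assumes P: "op_module L P" and Q: "op_module L Q" and PQ: "module_iso L P Q"
    and dX: "dsum L P X P1" and dY: "dsum L Q Y Q1"
    and XY: "module_iso L (sub P X) (sub Q Y)" and fin: "fin_dim (mscl P) X"
    and ind: "indecomposable L (sub P X)"
  shows "module_iso L (sub P P1) (sub Q Q1)"
proof -
  obtain F where F: "mod_hom L P Q F" "bij_betw F (mcar P) (mcar Q)" using PQ by (auto simp: module_iso_iff)
  have sX: "submodule L P X" and sP: "submodule L P P1" using dX by (auto simp: dsum_def)
  have dF: "dsum L Q (F ` X) (F ` P1)" by (rule dsum_image[OF P Q F dX])
  have sFX: "submodule L Q (F ` X)" using dF by (auto simp: dsum_def)
  note iX = module_iso_op_module_sub_image[OF F sX]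
  have iX': "module_iso L (sub Q (F ` X)) (sub P X)" by (rule module_iso_sym[OF iX op_module_sub[OF P sX]])
  have "module_iso L (sub Q (F ` P1)) (sub Q Q1)"
  proof (rule cancel_internal[OF Q dF dY])
    show "module_iso L (sub Q (F ` X)) (sub Q Y)" by (rule module_iso_trans[OF iX' XY])
    show "fin_dim (mscl Q) (F ` X)"
      by (rule fin_dim_image[OF op_moduleD(1)[OF P] op_moduleD(1)[OF Q] submoduleD(2)[OF sX] _ fin])
         (rule linear_on_subset[OF mod_homD(2)[OF F(1)] submoduleD(1)[OF sX]])
    show "indecomposable L (sub Q (F ` X))"
      by (rule indecomposable_iso[OF op_module_sub[OF P sX] op_module_sub[OF Q sFX] iX ind])
  qed
  then show ?thesis by (rule module_iso_trans[OF module_iso_op_module_sub_image[OF F sP]])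
qed

text \<open>A nonzero summand of least dimension will do: by \<open>dsum_assoc\<close> any summand
  of it is again a summand of the whole module.\<close>

lemma exists_indecomposable_summand:
  assumes M: "op_module L M" and fin: "fin_dim (mscl M) (mcar M)" and nz: "mcar M \<noteq> {0}"
  obtains X B where "dsum L M X B" "indecomposable L (sub M X)"
proof -
  note vs = op_moduleD(1)[OF M]
  have "submodule L M {0}"
    using om_zero[OF M] om_act_0[OF M] vs_zero_right[OF vs]
    by (auto simp: submodule_def intro!: subspaceI[OF vs])
  then have "dsum L M (mcar M) {0}" using submodule_self[OF M] om_zero[OF M] by (auto simp: dsum_def)
  then obtain X where X: "X \<noteq> {0}" "\<exists>B. dsum L M X B"
    and least: "\<And>Y. Y \<noteq> {0} \<Longrightarrow> \<exists>B. dsum L M Y B \<Longrightarrow> vector_space.dim (mscl M) X \<le> vector_space.dim (mscl M) Y"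
    using ex_has_least_nat[of "\<lambda>X. X \<noteq> {0} \<and> (\<exists>B. dsum L M X B)" "mcar M" "vector_space.dim (mscl M)"] nz
    by metis
  obtain B where B: "dsum L M X B" using X by blast
  have sX: "submodule L M X" using B by (auto simp: dsum_def)
  have "A1 = {0} \<or> A1 = X" if d: "dsum L (sub M X) A1 A2" for A1 A2
  proof (cases "A1 = {0}")
    case False
    have s1: "submodule L (sub M X) A1" using d by (auto simp: dsum_def)
    have "vector_space.dim (mscl M) X \<le> vector_space.dim (mscl M) A1"
      by (rule least[OF False]) (use dsum_assoc[OF M B d] in blast)
    then have "A1 = X"
      using fin_dim_subspace_eq[OF vs fin_dim_mono[OF fin submoduleD(1)[OF sX]], of A1] s1
      by (simp add: submodule_def)
    then show ?thesis by simp
  qed simp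
  then have "indecomposable L (sub M X)" using X by (auto simp: indecomposable_def)
  then show ?thesis using that B by blast
qed

subsection \<open>Cancellation of multiplicities\<close>

lemma lookup_pmap: "f 0 = 0 \<Longrightarrow> lookup (pmap f u) k = f (lookup u k)"
  by (simp add: Poly_Mapping.map.rep_eq when_def)

lemma keys_pmap_subset: "keys (pmap f u) \<subseteq> keys u"
  by (auto simp: in_keys_iff Poly_Mapping.map.rep_eq when_def)

lemma vector_space_pmap:
  assumes "vector_space s"
  shows "vector_space (\<lambda>c. pmap (s c) :: ('k \<Rightarrow>\<^sub>0 'm::ab_group_add) \<Rightarrow> _)"
  by standard (auto intro!: poly_mapping_eqI simp: lookup_pmap vs_zero_right[OF assms] lookup_add
      vs_add[OF assms] vs_add_left[OF assms] vs_mult[OF assms] vs_one[OF assms])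

lemma copies_simps:
  "mcar (copies m M) = {f. keys f \<subseteq> {..<m} \<and> (\<forall>i. lookup f i \<in> mcar M)}"
  "mscl (copies m M) = (\<lambda>c. pmap (mscl M c))"
  "act (copies m M) x = pmap (act M x)"
  by (simp_all add: copies_def)

lemma keys_add_subset: "keys f \<subseteq> A \<Longrightarrow> keys g \<subseteq> A \<Longrightarrow> keys (f + g) \<subseteq> A"
  using keys_add[of f g] by blast

lemma op_module_copies:
  assumes M: "op_module L M"
  shows "op_module L (copies m M)"
proof -
  note vs = op_moduleD(1)[OF M]
  have map: "pmap f u \<in> mcar (copies m M)"
    if "u \<in> mcar (copies m M)" "\<And>v. v \<in> mcar M \<Longrightarrow> f v \<in> mcar M" "f 0 = 0" for f u
    using that keys_pmap_subset[of f u] by (auto simp: copies_simps lookup_pmap)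
  show ?thesis
    unfolding op_module_def
  proof (intro conjI ballI)
    show "vector_space (mscl (copies m M))" by (simp add: copies_simps vector_space_pmap[OF vs])
    then show "module.subspace (mscl (copies m M)) (mcar (copies m M))"
    proof (rule subspaceI)
      show "x + y \<in> mcar (copies m M)" if "x \<in> mcar (copies m M)" "y \<in> mcar (copies m M)" for x y
        using that keys_add_subset[of x _ y] by (auto simp: copies_simps lookup_add om_add[OF M])
      show "mscl (copies m M) c x \<in> mcar (copies m M)" if "x \<in> mcar (copies m M)" for c x
        using map[OF that, of "mscl M c"] by (simp add: copies_simps om_scale[OF M] vs_zero_right[OF vs])
    qed (simp add: copies_simps om_zero[OF M])
    fix x assume x: "x \<in> lcar L"
    show "act (copies m M) x u \<in> mcar (copies m M)" if "u \<in> mcar (copies m M)" for u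
      using map[OF that, of "act M x"] x by (simp add: copies_simps om_act_0[OF M] op_moduleD(3)[OF M])
    show "linear_on (mscl (copies m M)) (mscl (copies m M)) (mcar (copies m M)) (act (copies m M) x)"
      unfolding linear_on_def
      by (auto intro!: poly_mapping_eqI simp: copies_simps lookup_pmap om_act_0[OF M x] lookup_add om_act_add[OF M x]
          vs_zero_right[OF vs] om_act_scale[OF M x])
  qed
qed

lemma mod_hom_copies_single:
  assumes M: "op_module L M" and "j < m"
  shows "mod_hom L M (copies m M) (single j)"
  unfolding mod_hom_def linear_on_def
  using assms om_zero[OF M] om_act_0[OF M] vs_zero_right[OF op_moduleD(1)[OF M]]
  by (auto intro!: poly_mapping_eqI simp: copies_simps lookup_single lookup_pmap when_def lookup_add)

lemma mod_hom_copies_lookup: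
  assumes M: "op_module L M"
  shows "mod_hom L (copies m M) M (\<lambda>u. lookup u j)"
  unfolding mod_hom_def linear_on_def
  using om_act_0[OF M] vs_zero_right[OF op_moduleD(1)[OF M]]
  by (auto simp: copies_simps lookup_pmap lookup_add)

lemma copies_sum:
  assumes "u \<in> mcar (copies m M)"
  shows "u = (\<Sum>j<m. single j (lookup u j))"
proof (rule poly_mapping_eqI)
  fix k
  have "lookup u k = 0" if "\<not> k < m" using assms that by (auto simp: copies_simps in_keys_iff)
  then show "lookup u k = lookup (\<Sum>j<m. single j (lookup u j)) k"
    by (auto simp: lookup_sum lookup_single when_def)
qed

text \<open>\<open>P j\<close> has its coordinates below \<open>j\<close> in \<open>M1\<close> and
  the others free. Passing from \<open>P j\<close> to \<open>P (Suc j)\<close> splits off one copy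
  of \<open>X\<close>, in coordinate \<open>j\<close>; after \<open>m\<close> steps only the copies
  of \<open>M1\<close> are left.\<close>

lemma dsum_copies_step:
  assumes M: "op_module L M" and d: "dsum L M X M1" and j: "j < m"
  defines "P \<equiv> \<lambda>j. {f \<in> mcar (copies m M). \<forall>i<j. lookup f i \<in> M1}"
  shows "submodule L (copies m M) (P j)"
    and "dsum L (sub (copies m M) (P j)) (single j ` X) (P (Suc j))"
    and "module_iso L (sub M X) (sub (copies m M) (single j ` X))"
proof -
  note C = op_module_copies[OF M, of m] and vs = op_moduleD(1)[OF M]
  have sX: "submodule L M X" and s1: "submodule L M M1" using d by (auto simp: dsum_def)
  have X0: "0 \<in> X" "0 \<in> M1" using subspace_0[OF vs submoduleD(2)[OF sX]] subspace_0[OF vs submoduleD(2)[OF s1]] by auto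
  show sP: "submodule L (copies m M) (P j)" for j
    unfolding submodule_def
  proof (intro conjI ballI)
    show "P j \<subseteq> mcar (copies m M)" by (auto simp: P_def)
    show "module.subspace (mscl (copies m M)) (P j)"
      by (rule subspaceI[OF op_moduleD(1)[OF C]])
         (auto simp: P_def om_zero[OF C] om_add[OF C] om_scale[OF C] X0 lookup_add copies_simps(2)
            lookup_pmap vs_zero_right[OF vs] subspace_add[OF vs submoduleD(2)[OF s1]]
            subspace_scale[OF vs submoduleD(2)[OF s1]] om_scale[OF C, unfolded copies_simps(2)])
    show "act (copies m M) x u \<in> P j" if "x \<in> lcar L" "u \<in> P j" for x u
      using that op_moduleD(3)[OF C that(1), of u] submoduleD(3)[OF s1 that(1)] 
      by (auto simp: P_def copies_simps(3) lookup_pmap om_act_0[OF M])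
  qed
  note hs = mod_hom_copies_single[OF M j]
  have sS: "submodule L (copies m M) (single j ` X)" by (rule submodule_image[OF hs M C sX])
  have cS: "single j ` X \<subseteq> P j"
    using submoduleD(1)[OF sS] X0 by (auto simp: P_def lookup_single when_def)
  show "dsum L (sub (copies m M) (P j)) (single j ` X) (P (Suc j))"
    unfolding dsum_def
  proof (intro conjI ballI)
    show "submodule L (sub (copies m M) (P j)) (single j ` X)" by (rule submodule_subI[OF sS cS])
    show "submodule L (sub (copies m M) (P j)) (P (Suc j))"
      by (rule submodule_subI[OF sP]) (auto simp: P_def)
    have "single j x = 0" if "x \<in> X" "single j x \<in> P (Suc j)" for x
    proof -
      have "x \<in> X \<inter> M1" using that by (auto simp: P_def dest!: spec[of _ j])
      moreover have "X \<inter> M1 = {0}" using d by (simp add: dsum_def)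
      ultimately show ?thesis by auto
    qed
    moreover have "0 \<in> P (Suc j)" by (rule subspace_0[OF op_moduleD(1)[OF C] submoduleD(2)[OF sP]])
    moreover have "0 \<in> single j ` X" by (rule subspace_0[OF op_moduleD(1)[OF C] submoduleD(2)[OF sS]])
    ultimately show "single j ` X \<inter> P (Suc j) = {0}" by auto
    fix f assume f: "f \<in> mcar (sub (copies m M) (P j))"
    then have fm: "f \<in> mcar (copies m M)" by (simp add: P_def)
    then have "lookup f j \<in> mcar M" by (simp add: copies_simps)
    then obtain a b where ab: "lookup f j = a + b" "a \<in> X" "b \<in> M1" using d by (auto simp: dsum_def)
    have "f - single j a \<in> mcar (copies m M)"
      using om_diff[OF C fm] ab(2) submoduleD(1)[OF sS] by blast
    then have "f - single j a \<in> P (Suc j)"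
      using f ab by (auto simp: P_def lookup_minus lookup_single when_def less_Suc_eq)
    then show "\<exists>a\<in>single j ` X. \<exists>b\<in>P (Suc j). f = a + b"
      using ab(2) by (intro bexI[of _ "single j a"] bexI[of _ "f - single j a"]) auto
  qed
  show "module_iso L (sub M X) (sub (copies m M) (single j ` X))"
    unfolding module_iso_iff
  proof (intro exI conjI)
    show "mod_hom L (sub M X) (sub (copies m M) (single j ` X)) (single j)"
      by (rule mod_hom_restrict[OF hs submoduleD(1)[OF sX]]) simp
    show "bij_betw (single j) (mcar (sub M X)) (mcar (sub (copies m M) (single j ` X)))"
      by (auto simp: bij_betw_def intro!: inj_onI dest: arg_cong[of _ _ "\<lambda>f. lookup f j"])
  qed
qed

text \<open>The inclusion of \<open>X\<close> into the copies of \<open>M\<close> passes through the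
  copies of \<open>N\<close>, so the identity of \<open>X\<close> is a sum of endomorphisms
  factoring through \<open>N\<close>. By locality one of them is bijective; its first factor embeds
  \<open>X\<close> in \<open>N\<close>, with the kernel of the second factor as complement.\<close>

lemma power_summand:
  assumes M: "op_module L M" and N: "op_module L N" and iso: "module_iso L (copies m M) (copies m N)"
    and m: "m > 0" and d: "dsum L M X M1" and ind: "indecomposable L (sub M X)"
    and fin: "fin_dim (mscl M) X"
  obtains Y N1 where "dsum L N Y N1" "module_iso L (sub M X) (sub N Y)"
proof -
  note CM = op_module_copies[OF M, of m] and CN = op_module_copies[OF N, of m]
  have sX: "submodule L M X" using d by (auto simp: dsum_def)
  note oX = op_module_sub[OF M sX] and cX = submoduleD(1)[OF sX]
  obtain F where F: "mod_hom L (copies m M) (copies m N) F" "bij_betw F (mcar (copies m M)) (mcar (copies m N))"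
    using iso by (auto simp: module_iso_iff)
  let ?G = "inv_into (mcar (copies m M)) F"
  have G: "mod_hom L (copies m N) (copies m M) ?G" by (rule mod_hom_inv[OF F CM])
  obtain p where p: "mod_hom L M (sub M X) p" "\<And>a. a \<in> X \<Longrightarrow> p a = a" "\<And>b. b \<in> M1 \<Longrightarrow> p b = 0"
    "\<And>u. u \<in> mcar M \<Longrightarrow> u - p u \<in> M1"
    using dsum_proj[OF M d] by blast
  \<comment> \<open>Coordinate \<open>j\<close> of the isomorphism on the zeroth copy;
    \<open>\<beta> j\<close> is the matching part of the inverse, followed by the projection to
    \<open>X\<close>.\<close>
  define \<alpha> where "\<alpha> j x = lookup (F (single 0 x)) j" for j x
  define \<beta> where "\<beta> j y = p (lookup (?G (single j y)) 0)" for j y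
  have \<alpha>: "mod_hom L M N (\<alpha> j)" for j
    unfolding \<alpha>_def
    by (rule mod_hom_comp[OF mod_hom_comp[OF mod_hom_copies_single[OF M m] F(1)] mod_hom_copies_lookup[OF N]])
  have \<alpha>X: "mod_hom L (sub M X) N (\<alpha> j)" for j
    using mod_hom_restrict[OF \<alpha> cX, where B = "mcar N"] mod_homD(1)[OF \<alpha>] cX by auto
  have \<beta>: "mod_hom L N (sub M X) (\<beta> j)" if "j < m" for j
    unfolding \<beta>_def
    by (rule mod_hom_comp[OF mod_hom_comp[OF mod_hom_comp[OF mod_hom_copies_single[OF N that] G]
            mod_hom_copies_lookup[OF M]] p(1)])
  have e: "mod_hom L (sub M X) (sub M X) (\<lambda>x. \<beta> j (\<alpha> j x))" if "j < m" for j
    by (rule mod_hom_comp[OF \<alpha>X \<beta>[OF that]])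
  have one: "(\<Sum>j<m. \<beta> j (\<alpha> j x)) = x" if x: "x \<in> X" for x
  proof -
    have xM: "x \<in> mcar M" using x cX by blast
    have s: "single 0 x \<in> mcar (copies m M)" by (rule mod_homD(1)[OF mod_hom_copies_single[OF M m] xM])
    have Fs: "F (single 0 x) \<in> mcar (copies m N)" by (rule mod_homD(1)[OF F(1) s])
    have \<alpha>N: "\<alpha> j x \<in> mcar N" for j by (rule mod_homD(1)[OF \<alpha> xM])
    have sN: "single j (\<alpha> j x) \<in> mcar (copies m N)" if "j < m" for j
      by (rule mod_homD(1)[OF mod_hom_copies_single[OF N that] \<alpha>N])
    have GM: "?G (single j (\<alpha> j x)) \<in> mcar (copies m M)" if "j < m" for j
      by (rule mod_homD(1)[OF G sN[OF that]])
    have "(\<Sum>j<m. \<beta> j (\<alpha> j x)) = p (\<Sum>j<m. lookup (?G (single j (\<alpha> j x))) 0)"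
      unfolding \<beta>_def using mod_homD(1)[OF mod_hom_copies_lookup[OF M, of m 0] GM]
      by (subst mod_hom_sum[OF p(1) M oX]) auto
    also have "(\<Sum>j<m. lookup (?G (single j (\<alpha> j x))) 0) =
        lookup (?G (\<Sum>j<m. single j (\<alpha> j x))) 0"
      by (subst mod_hom_sum[OF G CN CM]) (use sN in \<open>auto simp: lookup_sum\<close>)
    also have "(\<Sum>j<m. single j (\<alpha> j x)) = F (single 0 x)"
      unfolding \<alpha>_def using copies_sum[OF Fs] by simp
    also have "?G (F (single 0 x)) = single 0 x"
      by (rule bij_betw_inv_into_left[OF F(2) s])
    finally show ?thesis using p(2) x by simp
  qed
  have "bij_betw (\<lambda>x. \<Sum>j<m. \<beta> j (\<alpha> j x)) X X"
    using bij_betw_cong[of X "\<lambda>x. \<Sum>j<m. \<beta> j (\<alpha> j x)" "\<lambda>x. x" X] one bij_betw_id[of X] by (simp add: id_def)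
  then have "\<exists>j\<in>{..<m}. bij_betw (\<lambda>x. \<beta> j (\<alpha> j x)) (mcar (sub M X)) (mcar (sub M X))"
    by (intro local_sum[OF oX _ ind]) (use fin e in auto)
  then obtain j where j: "j < m" "bij_betw (\<lambda>x. \<beta> j (\<alpha> j x)) X X" by auto
  note b = \<beta>[OF j(1)]
  have b0: "\<beta> j 0 = 0" and a0: "\<alpha> j 0 = 0" by (rule mod_hom_0[OF b N oX], rule mod_hom_0[OF \<alpha> M N])
  have inj: "u = v" if "\<beta> j (\<alpha> j u) = \<beta> j (\<alpha> j v)" "u \<in> X" "v \<in> X" for u v
    using inj_onD[OF bij_betw_imp_inj_on[OF j(2)] that] .
  have X0: "0 \<in> X" by (rule subspace_0[OF op_moduleD(1)[OF M] submoduleD(2)[OF sX]])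
  have sY: "submodule L N (\<alpha> j ` X)" by (rule submodule_image[OF \<alpha> M N sX])
  have sK: "submodule L N {y \<in> mcar N. \<beta> j y = 0}" by (rule submodule_kernel[OF b N oX])
  have dN: "dsum L N (\<alpha> j ` X) {y \<in> mcar N. \<beta> j y = 0}"
    unfolding dsum_def
  proof (intro conjI ballI)
    have "\<alpha> j x = 0" if "x \<in> X" "\<beta> j (\<alpha> j x) = 0" for x
      using inj[of x 0] that X0 a0 b0 by simp
    then show "\<alpha> j ` X \<inter> {y \<in> mcar N. \<beta> j y = 0} = {0}"
      using a0 b0 X0 om_zero[OF N] by (auto intro!: image_eqI[of _ _ 0])
    fix u assume u: "u \<in> mcar N"
    then have "\<beta> j u \<in> X" using mod_homD(1)[OF b] by simp
    then obtain x where x: "x \<in> X" "\<beta> j u = \<beta> j (\<alpha> j x)" using j(2) by (auto simp: bij_betw_def)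
    have ax: "\<alpha> j x \<in> mcar N" using mod_homD(1)[OF \<alpha>] x cX by blast
    have "\<beta> j (u - \<alpha> j x) = 0" using mod_hom_diff[OF b N oX u ax] x by simp
    then show "\<exists>a\<in>\<alpha> j ` X. \<exists>b\<in>{y \<in> mcar N. \<beta> j y = 0}. u = a + b"
      using om_diff[OF N u ax] x by (intro bexI[of _ "\<alpha> j x"] bexI[of _ "u - \<alpha> j x"]) auto
  qed (rule sY, rule sK)
  have "module_iso L (sub M X) (sub N (\<alpha> j ` X))"
    unfolding module_iso_iff
  proof (intro exI conjI)
    show "mod_hom L (sub M X) (sub N (\<alpha> j ` X)) (\<alpha> j)" by (rule mod_hom_restrict[OF \<alpha> cX]) simp
    have "inj_on (\<alpha> j) X"
    proof (rule inj_onI)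
      fix u v assume uv: "u \<in> X" "v \<in> X" "\<alpha> j u = \<alpha> j v"
      show "u = v" by (rule inj[OF _ uv(1,2)]) (simp add: uv(3))
    qed
    then show "bij_betw (\<alpha> j) (mcar (sub M X)) (mcar (sub N (\<alpha> j ` X)))" by (simp add: bij_betw_def)
  qed
  then show ?thesis using that dN by blast
qed

text \<open>Induction on the dimension. An indecomposable summand of \<open>M\<close> recurs in
  \<open>N\<close>; it is removed from the \<open>m\<close> copies one coordinate at a time, each
  time by \<open>cancel\<close>, until \<open>m\<close> copies of the two complements
  remain.\<close>

lemma power_cancel:
  assumes "m > 0" and "op_module L M" "op_module L N" "fin_dim (mscl M) (mcar M)"
    "module_iso L (copies m M) (copies m N)"
  shows "module_iso L M N"
  using assms(2-)
proof (induction "vector_space.dim (mscl M) (mcar M)" arbitrary: M N rule: less_induct)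
  case less
  note M = less.prems(1) and N = less.prems(2) and fin = less.prems(3) and iso = less.prems(4)
  note CM = op_module_copies[OF M, of m] and CN = op_module_copies[OF N, of m]
  show ?case
  proof (cases "mcar M = {0}")
    case True
    have "f = 0" if "f \<in> mcar (copies m M)" for f
    proof (rule poly_mapping_eqI)
      show "lookup f k = lookup 0 k" for k using that True by (simp add: copies_simps)
    qed
    then have MC: "mcar (copies m M) = {0}" using om_zero[OF CM] by blast
    obtain F where F: "mod_hom L (copies m M) (copies m N) F" "bij_betw F (mcar (copies m M)) (mcar (copies m N))"
      using iso by (auto simp: module_iso_iff)
    have "mcar (copies m N) = {0}" using F(2) MC mod_hom_0[OF F(1) CM CN] by (auto simp: bij_betw_def)
    \<comment> \<open>Here \<open>m > 0\<close> matters: \<open>N\<close> embeds in its copies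
      through coordinate 0, so it vanishes together with them.\<close>
    moreover have "single 0 y \<in> mcar (copies m N)" if "y \<in> mcar N" for y
      by (rule mod_homD(1)[OF mod_hom_copies_single[OF N assms(1)] that])
    ultimately have "single 0 y = (0 :: nat \<Rightarrow>\<^sub>0 _)" if "y \<in> mcar N" for y using that by blast
    then have "y = 0" if "y \<in> mcar N" for y using that single_zero by (metis lookup_single_eq)
    then have NC: "mcar N = {0}" using om_zero[OF N] by blast
    have "mod_hom L M N (\<lambda>x. 0)"
      using om_zero[OF N] om_act_0[OF N] vs_zero_right[OF op_moduleD(1)[OF N]]
      by (simp add: mod_hom_def linear_on_def)
    moreover have "bij_betw (\<lambda>x. 0) (mcar M) (mcar N)" using True NC by (simp add: bij_betw_def)
    ultimately show ?thesis unfolding module_iso_iff by blast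
  next
    case False
    obtain X M1 where d: "dsum L M X M1" and ind: "indecomposable L (sub M X)"
      using exists_indecomposable_summand[OF M fin False] by blast
    have sX: "submodule L M X" and sM1: "submodule L M M1" using d by (auto simp: dsum_def)
    note finX = fin_dim_mono[OF fin submoduleD(1)[OF sX]]
    obtain Y N1 where dN: "dsum L N Y N1" and XY: "module_iso L (sub M X) (sub N Y)"
      using power_summand[OF M N iso assms(1) d ind finX] by blast
    have sN1: "submodule L N N1" using dN by (auto simp: dsum_def)
    define PM where "PM j = {f \<in> mcar (copies m M). \<forall>i<j. lookup f i \<in> M1}" for j
    define PN where "PN j = {f \<in> mcar (copies m N). \<forall>i<j. lookup f i \<in> N1}" for j
    have "module_iso L (sub (copies m M) (PM j)) (sub (copies m N) (PN j))" if "j \<le> m" for j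
      using that
    proof (induction j)
      case 0
      show ?case using iso by (simp add: PM_def PN_def)
    next
      case (Suc j)
      then have j: "j < m" by simp
      note sM = dsum_copies_step[OF M d j, folded PM_def]
      note sN = dsum_copies_step[OF N dN j, folded PN_def]
      let ?XM = "single j ` X" and ?YN = "single j ` Y"
      have oX: "op_module L (sub M X)" by (rule op_module_sub[OF M sX])
      have sXM: "submodule L (copies m M) ?XM" using sM(1,2) submodule_sub_iff by (auto simp: dsum_def)
      have "module_iso L (sub (sub (copies m M) (PM j)) (PM (Suc j))) (sub (sub (copies m N) (PN j)) (PN (Suc j)))"
      proof (rule cancel[OF op_module_sub[OF CM sM(1)] op_module_sub[OF CN sN(1)] _ sM(2) sN(2)])
        show "module_iso L (sub (copies m M) (PM j)) (sub (copies m N) (PN j))" using Suc by simp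
        have "module_iso L (sub (copies m M) ?XM) (sub (copies m N) ?YN)"
          using module_iso_sym[OF sM(3) oX] XY sN(3) module_iso_trans by metis
        then show "module_iso L (sub (sub (copies m M) (PM j)) ?XM) (sub (sub (copies m N) (PN j)) ?YN)" by simp
        have lin: "linear_on (mscl M) (mscl (copies m M)) X (single j)"
          by (rule linear_on_subset[OF mod_homD(2)[OF mod_hom_copies_single[OF M j]] submoduleD(1)[OF sX]])
        show "fin_dim (mscl (sub (copies m M) (PM j))) ?XM"
          using fin_dim_image[OF op_moduleD(1)[OF M] op_moduleD(1)[OF CM] submoduleD(2)[OF sX] lin finX] by simp
        have "indecomposable L (sub (copies m M) ?XM)"
          by (rule indecomposable_iso[OF oX op_module_sub[OF CM sXM] sM(3) ind])
        then show "indecomposable L (sub (sub (copies m M) (PM j)) ?XM)" by simp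
      qed
      then show ?case by simp
    qed
    then have "module_iso L (sub (copies m M) (PM m)) (sub (copies m N) (PN m))" by simp
    moreover have "sub (copies m M) (PM m) = copies m (sub M M1)"
    proof -
      have "PM m = {f. keys f \<subseteq> {..<m} \<and> (\<forall>i. lookup f i \<in> M1)}"
        using submoduleD(1)[OF sM1] subspace_0[OF op_moduleD(1)[OF M] submoduleD(2)[OF sM1]]
        unfolding PM_def copies_simps by (auto simp: in_keys_iff subset_iff) metis
      then show ?thesis by (simp add: copies_def)
    qed
    moreover have "sub (copies m N) (PN m) = copies m (sub N N1)"
    proof -
      have "PN m = {f. keys f \<subseteq> {..<m} \<and> (\<forall>i. lookup f i \<in> N1)}"
        using submoduleD(1)[OF sN1] subspace_0[OF op_moduleD(1)[OF N] submoduleD(2)[OF sN1]]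
        unfolding PN_def copies_simps by (auto simp: in_keys_iff subset_iff) metis
      then show ?thesis by (simp add: copies_def)
    qed
    ultimately have iso1: "module_iso L (copies m (sub M M1)) (copies m (sub N N1))" by simp
    have "M1 \<noteq> mcar M"
    proof
      assume "M1 = mcar M"
      then have "X = {0}" using d submoduleD(1)[OF sX] by (auto simp: dsum_def)
      then show False using ind by (simp add: indecomposable_def)
    qed
    then have "M1 \<subset> mcar M" using submoduleD(1)[OF sM1] by blast
    then have "vector_space.dim (mscl M) M1 < vector_space.dim (mscl M) (mcar M)"
      by (rule fin_dim_dim_strict[OF op_moduleD(1)[OF M] fin _ submoduleD(2)[OF sM1]])
    then have "module_iso L (sub M M1) (sub N N1)"
      using fin_dim_mono[OF fin submoduleD(1)[OF sM1]]
      by (intro less.hyps[OF _ op_module_sub[OF M sM1] op_module_sub[OF N sN1] _ iso1]) simp_all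
    then show ?thesis by (rule dsum_iso[OF M N d dN XY])
  qed
qed

subsection \<open>Modules graded by an operator with finite-dimensional eigenspaces\<close>

definition eigenspace :: "'l \<Rightarrow> ('l, 'm::ab_group_add) lie_mod \<Rightarrow> complex \<Rightarrow> 'm set" where
  "eigenspace D M c = {u \<in> mcar M. act M D u = mscl M c u}"

text \<open>The grading is by eigenspaces of an element of the algebra, since a model of
  \<open>Spin\<^sub>0\<close> carries no structure beyond its module action; every homomorphism then
  respects it automatically. The commutation condition makes the eigenspaces submodules.\<close>

definition graded_by :: "'l lie_alg \<Rightarrow> 'l \<Rightarrow> ('l, 'm::ab_group_add) lie_mod \<Rightarrow> bool" where
  "graded_by L D M \<longleftrightarrow> D \<in> lcar L \<and>
     (\<forall>x\<in>lcar L. \<forall>u\<in>mcar M. act M x (act M D u) = act M D (act M x u)) \<and>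
     (\<forall>u\<in>mcar M. \<exists>S g. finite S \<and> (\<forall>c\<in>S. g c \<in> eigenspace D M c) \<and> u = (\<Sum>c\<in>S. g c)) \<and>
     (\<forall>c. fin_dim (mscl M) (eigenspace D M c))"

lemma submodule_eigenspace:
  assumes M: "op_module L M" and g: "graded_by L D M"
  shows "submodule L M (eigenspace D M c)"
  unfolding submodule_def
proof (intro conjI ballI)
  note vs = op_moduleD(1)[OF M]
  have D: "D \<in> lcar L" using g by (simp add: graded_by_def)
  show "eigenspace D M c \<subseteq> mcar M" by (auto simp: eigenspace_def)
  show "module.subspace (mscl M) (eigenspace D M c)"
    by (rule subspaceI[OF vs])
       (auto simp: eigenspace_def om_zero[OF M] om_act_0[OF M D] vs_zero_right[OF vs] om_add[OF M]
          om_act_add[OF M D] vs_add[OF vs] om_scale[OF M] om_act_scale[OF M D] vs_mult[OF vs] mult.commute)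
  show "act M x u \<in> eigenspace D M c" if x: "x \<in> lcar L" and u: "u \<in> eigenspace D M c" for x u
  proof -
    have uM: "u \<in> mcar M" "act M D u = mscl M c u" using u by (auto simp: eigenspace_def)
    have "act M D (act M x u) = act M x (act M D u)" using g x uM(1) by (simp add: graded_by_def)
    then show ?thesis using uM op_moduleD(3)[OF M x] om_act_scale[OF M x] by (simp add: eigenspace_def)
  qed
qed

text \<open>The modules to be compared are known through the copies that make up a larger graded
  module. Decompositions are pushed back by \<open>r\<close>, and finite dimension is inherited
  along \<open>i\<close>, which is injective.\<close>

lemma graded_retract:
  assumes M: "op_module L M" and W: "op_module L W" and g: "graded_by L D W"
    and i: "mod_hom L M W i" and r: "mod_hom L W M r" and ri: "\<And>u. u \<in> mcar M \<Longrightarrow> r (i u) = u"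
  shows "graded_by L D M"
proof -
  have D: "D \<in> lcar L" using g by (simp add: graded_by_def)
  have inj: "u = v" if "u \<in> mcar M" "v \<in> mcar M" "i u = i v" for u v using ri that by metis
  have eig: "i u \<in> eigenspace D W c" if "u \<in> eigenspace D M c" for u c
    using that mod_homD(1)[OF i] mod_homD(3)[OF i D] mod_hom_scale[OF i]
    by (fastforce simp: eigenspace_def)
  have reig: "r u \<in> eigenspace D M c" if "u \<in> eigenspace D W c" for u c
    using that mod_homD(1)[OF r] mod_homD(3)[OF r D] mod_hom_scale[OF r]
    by (fastforce simp: eigenspace_def)
  show ?thesis
    unfolding graded_by_def
  proof (intro conjI ballI allI D)
    fix x u assume x: "x \<in> lcar L" and u: "u \<in> mcar M"
    have "i (act M x (act M D u)) = act W x (act W D (i u))" "i (act M D (act M x u)) = act W D (act W x (i u))"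
      using mod_homD(3)[OF i] x u D op_moduleD(3)[OF M] by auto
    moreover have "act W x (act W D (i u)) = act W D (act W x (i u))"
      using g x mod_homD(1)[OF i u] by (auto simp: graded_by_def)
    ultimately show "act M x (act M D u) = act M D (act M x u)"
      by (intro inj) (use x u D op_moduleD(3)[OF M] in auto)
  next
    fix u assume u: "u \<in> mcar M"
    obtain S h where S: "finite S" "\<And>c. c \<in> S \<Longrightarrow> h c \<in> eigenspace D W c" "i u = (\<Sum>c\<in>S. h c)"
      using g mod_homD(1)[OF i u] unfolding graded_by_def by metis
    have "u = r (\<Sum>c\<in>S. h c)" using ri[OF u] S(3) by simp
    also have "\<dots> = (\<Sum>c\<in>S. r (h c))"
      by (rule mod_hom_sum[OF r W M S(1)]) (use S(2) in \<open>auto simp: eigenspace_def\<close>)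
    finally show "\<exists>S g. finite S \<and> (\<forall>c\<in>S. g c \<in> eigenspace D M c) \<and> u = (\<Sum>c\<in>S. g c)"
      using S reig by (intro exI[of _ S] exI[of _ "\<lambda>c. r (h c)"]) auto
  next
    fix c
    show "fin_dim (mscl M) (eigenspace D M c)"
    proof (rule fin_dim_inj[OF op_moduleD(1)[OF M] op_moduleD(1)[OF W]])
      show "linear_on (mscl M) (mscl W) (eigenspace D M c) i"
        by (rule linear_on_subset[OF mod_homD(2)[OF i]]) (auto simp: eigenspace_def)
      show "inj_on i (eigenspace D M c)" using inj by (auto simp: eigenspace_def intro!: inj_onI)
      have "fin_dim (mscl W) (eigenspace D W c)" using g by (simp add: graded_by_def)
      then show "fin_dim (mscl W) (i ` eigenspace D M c)" by (rule fin_dim_mono) (use eig in auto)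
      note vs = op_moduleD(1)[OF M]
      show "module.subspace (mscl M) (eigenspace D M c)"
        by (rule subspaceI[OF vs])
          (auto simp: eigenspace_def om_zero[OF M] om_act_0[OF M D] vs_zero_right[OF vs] om_add[OF M]
          om_act_add[OF M D] vs_add[OF vs] om_scale[OF M] om_act_scale[OF M D] vs_mult[OF vs] mult.commute)
    qed
  qed
qed

lemma graded_copies_summand:
  assumes M: "op_module L M" and W: "op_module L W" and g: "graded_by L D W"
    and iso: "module_iso L W (copies m M)" and m: "m > 0"
  shows "graded_by L D M"
proof -
  obtain F where F: "mod_hom L W (copies m M) F" "bij_betw F (mcar W) (mcar (copies m M))"
    using iso by (auto simp: module_iso_iff)
  let ?G = "inv_into (mcar W) F"
  note G = mod_hom_inv[OF F W]
  note s = mod_hom_copies_single[OF M m]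
  show ?thesis
  proof (rule graded_retract[OF M W g mod_hom_comp[OF s G] mod_hom_comp[OF F(1) mod_hom_copies_lookup[OF M, of m 0]]])
    fix u assume "u \<in> mcar M"
    then show "lookup (F (?G (single 0 u))) 0 = u"
      using bij_betw_inv_into_right[OF F(2)] mod_homD(1)[OF s] by simp
  qed
qed

text \<open>Applying \<open>D\<close> and subtracting \<open>a\<close> times the relation gives a
  relation with coefficients \<open>c - a\<close>, in which the eigenvalue \<open>a\<close> no
  longer occurs.\<close>

lemma eigen_independent:
  assumes M: "op_module L M" and D: "D \<in> lcar L"
  shows "finite S \<Longrightarrow> (\<And>c. c \<in> S \<Longrightarrow> g c \<in> eigenspace D M c) \<Longrightarrow> (\<Sum>c\<in>S. g c) = 0 \<Longrightarrow> \<forall>c\<in>S. g c = 0"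
proof (induction S arbitrary: g rule: finite_induct)
  case (insert a S)
  note vs = op_moduleD(1)[OF M]
  have e: "g c \<in> mcar M" "act M D (g c) = mscl M c (g c)" if "c \<in> insert a S" for c
    using insert.prems(1)[OF that] by (auto simp: eigenspace_def)
  have z: "(\<Sum>c\<in>insert a S. g c) = 0" by (rule insert.prems(2))
  have "(\<Sum>c\<in>insert a S. mscl M c (g c)) = act M D (\<Sum>c\<in>insert a S. g c)"
    using e by (subst linear_on_sum[OF op_moduleD(4)[OF M D] vs vs op_moduleD(2)[OF M]]) (use insert.hyps in auto)
  then have "(\<Sum>c\<in>insert a S. mscl M c (g c)) = 0" using z om_act_0[OF M D] by simp
  moreover have "(\<Sum>c\<in>insert a S. mscl M a (g c)) = 0" using z vs_sum[OF vs, symmetric, of a g] vs_zero_right[OF vs] by simp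
  ultimately have "(\<Sum>c\<in>insert a S. mscl M (c - a) (g c)) = 0"
    using vs_add_left[OF vs] vs_neg[OF vs] by (simp add: sum.distrib sum_negf diff_conv_add_uminus del: add_uminus_conv_diff)
  then have "(\<Sum>c\<in>S. mscl M (c - a) (g c)) = 0" using insert.hyps vs_zero[OF vs] by simp
  moreover have "mscl M (c - a) (g c) \<in> eigenspace D M c" if "c \<in> S" for c
    using e[of c] that om_scale[OF M] om_act_scale[OF M D] by (auto simp: eigenspace_def vs_mult[OF vs] mult.commute)
  ultimately have S: "\<forall>c\<in>S. mscl M (c - a) (g c) = 0" by (rule insert.IH[rotated])
  have "g c = 0" if "c \<in> S" for c
  proof -
    have "c \<noteq> a" using that insert.hyps by blast
    then have "g c = mscl M (inverse (c - a)) (mscl M (c - a) (g c))" by (simp add: vs_mult[OF vs] vs_one[OF vs])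
    then show ?thesis using S that vs_zero_right[OF vs] by simp
  qed
  then show ?case using z insert.hyps by simp
qed simp

lemma graded_hom:
  assumes M: "op_module L M" and N: "op_module L N" and g: "graded_by L D M"
    and f: "\<And>c. mod_hom L (sub M (eigenspace D M c)) N (f c)"
  obtains F where "mod_hom L M N F" "\<And>c u. u \<in> eigenspace D M c \<Longrightarrow> F u = f c u"
proof -
  note vs = op_moduleD(1)[OF M]
  have D: "D \<in> lcar L" using g by (simp add: graded_by_def)
  note sE = submodule_eigenspace[OF M g]
  note oE = op_module_sub[OF M sE]
  note E0 = subspace_0[OF vs submoduleD(2)[OF sE]]
  note f0 = mod_hom_0[OF f oE N]
  have eM: "v \<in> mcar M" if "v \<in> eigenspace D M c" for v c using that by (simp add: eigenspace_def)
  \<comment> \<open>Since \<open>h\<close> vanishes off \<open>S\<close>, the whole function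
    \<open>h\<close>, and not only its restriction to \<open>S\<close>, is determined by
    \<open>u\<close>; two decompositions are compared over the union of their supports.\<close>
  define R where "R S h u \<longleftrightarrow> finite S \<and> (\<forall>c. h c \<in> eigenspace D M c) \<and> (\<forall>c. c \<notin> S \<longrightarrow> h c = 0) \<and> u = (\<Sum>c\<in>S. h c)"
    for S h u
  have ex: "\<exists>S h. R S h u" if "u \<in> mcar M" for u
  proof -
    obtain S h where "finite S" "\<forall>c\<in>S. h c \<in> eigenspace D M c" "u = (\<Sum>c\<in>S. h c)"
      using g \<open>u \<in> mcar M\<close> unfolding graded_by_def by metis
    then have "R S (\<lambda>c. if c \<in> S then h c else 0) u" using E0 by (auto simp: R_def)
    then show ?thesis by blast
  qed
  have mono: "R T h u" if "R S h u" "S \<subseteq> T" "finite T" for S T h u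
    using that sum.mono_neutral_left[of T S h] by (auto simp: R_def)
  have uniq: "h = h'" if "R S h u" "R S' h' u" for S h S' h' u
  proof -
    have "finite (S \<union> S')" using that by (simp add: R_def)
    note fin = this
    then have 1: "R (S \<union> S') h u" "R (S \<union> S') h' u" using mono[OF that(1)] mono[OF that(2)] by blast+
    then have "(\<Sum>c\<in>S \<union> S'. h c - h' c) = 0" by (simp add: R_def sum_subtractf)
    moreover have "h c - h' c \<in> eigenspace D M c" for c
      using 1 subspace_diff[OF vs submoduleD(2)[OF sE]] by (auto simp: R_def)
    ultimately have "\<forall>c\<in>S \<union> S'. h c - h' c = 0" by (intro eigen_independent[OF M D fin])
    then have "h c = h' c" for c using 1 by (cases "c \<in> S \<union> S'") (simp_all add: R_def)
    then show ?thesis by blast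
  qed
  define H where "H u = (SOME h. \<exists>S. R S h u)" for u
  have H: "\<exists>S. R S (H u) u" if "u \<in> mcar M" for u
    using someI_ex[of "\<lambda>h. \<exists>S. R S h u"] ex[OF that] unfolding H_def by blast
  define F where "F u = (\<Sum>c | H u c \<noteq> 0. f c (H u c))" for u
  have F: "F u = (\<Sum>c\<in>S. f c (h c))" if "R S h u" "u \<in> mcar M" for S h u
  proof -
    have "H u = h" using H uniq that by blast
    then have "F u = (\<Sum>c | h c \<noteq> 0. f c (h c))" by (simp add: F_def)
    also have "\<dots> = (\<Sum>c\<in>S. f c (h c))"
      by (rule sum.mono_neutral_left) (use that f0 in \<open>auto simp: R_def\<close>)
    finally show ?thesis .
  qed
  have fN: "f c v \<in> mcar N" if "v \<in> eigenspace D M c" for c v using mod_homD(1)[OF f] that by simp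
  have "mod_hom L M N F"
    unfolding mod_hom_def linear_on_def
  proof (intro conjI ballI allI)
    fix u assume u: "u \<in> mcar M"
    obtain S h where R: "R S h u" using ex[OF u] by blast
    show "F u \<in> mcar N" unfolding F[OF R u] by (rule om_sum[OF N], rule fN) (use R in \<open>auto simp: R_def\<close>)
    fix c
    have "R S (\<lambda>l. mscl M c (h l)) (mscl M c u)"
      using R subspace_scale[OF vs submoduleD(2)[OF sE]] vs_zero_right[OF vs] by (auto simp: R_def vs_sum[OF vs])
    then have "F (mscl M c u) = (\<Sum>l\<in>S. f l (mscl M c (h l)))" using F om_scale[OF M u] by blast
    also have "\<dots> = (\<Sum>l\<in>S. mscl N c (f l (h l)))"
      using mod_hom_scale[OF f] R by (intro sum.cong) (auto simp: R_def)
    finally show "F (mscl M c u) = mscl N c (F u)" using F[OF R u] by (simp add: vs_sum[OF op_moduleD(1)[OF N]])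
  next
    fix u v assume u: "u \<in> mcar M" and v: "v \<in> mcar M"
    obtain S h T k where R: "R S h u" "R T k v" using ex[OF u] ex[OF v] by blast
    have "finite (S \<union> T)" using R by (simp add: R_def)
    then have R': "R (S \<union> T) h u" "R (S \<union> T) k v" using mono[OF R(1)] mono[OF R(2)] by blast+
    have "R (S \<union> T) (\<lambda>l. h l + k l) (u + v)"
      using R' subspace_add[OF vs submoduleD(2)[OF sE]] by (auto simp: R_def sum.distrib)
    then have "F (u + v) = (\<Sum>l\<in>S \<union> T. f l (h l + k l))" using F om_add[OF M u v] by blast
    also have "\<dots> = (\<Sum>l\<in>S \<union> T. f l (h l) + f l (k l))"
      using mod_hom_add[OF f] R by (intro sum.cong) (auto simp: R_def)
    finally show "F (u + v) = F u + F v" using F[OF R'(1) u] F[OF R'(2) v] by (simp add: sum.distrib)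
  next
    fix x u assume x: "x \<in> lcar L" and u: "u \<in> mcar M"
    obtain S h where R: "R S h u" using ex[OF u] by blast
    have "act M x u = (\<Sum>l\<in>S. act M x (h l))"
      using R eM by (subst linear_on_sum[OF op_moduleD(4)[OF M x] vs vs op_moduleD(2)[OF M], symmetric]) (auto simp: R_def)
    then have "R S (\<lambda>l. act M x (h l)) (act M x u)"
      using R submoduleD(3)[OF sE x] om_act_0[OF M x] by (auto simp: R_def)
    then have "F (act M x u) = (\<Sum>l\<in>S. f l (act M x (h l)))" using F op_moduleD(3)[OF M x u] by blast
    also have "\<dots> = (\<Sum>l\<in>S. act N x (f l (h l)))"
      using mod_homD(3)[OF f x] R by (intro sum.cong) (auto simp: R_def)
    also have "\<dots> = act N x (\<Sum>l\<in>S. f l (h l))"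
      using R fN
      by (subst linear_on_sum[OF op_moduleD(4)[OF N x] op_moduleD(1)[OF N] op_moduleD(1)[OF N] op_moduleD(2)[OF N]])
         (auto simp: R_def)
    finally show "F (act M x u) = act N x (F u)" using F[OF R u] by simp
  qed
  moreover have "F u = f c u" if u: "u \<in> eigenspace D M c" for c u
  proof -
    have "R {c} (\<lambda>l. if l = c then u else 0) u" using u E0 by (auto simp: R_def)
    then show ?thesis using F[of "{c}" _ u] eM[OF u] by simp
  qed
  ultimately show ?thesis using that by blast
qed

text \<open>Homomorphisms commute with \<open>D\<close>, so the isomorphism of copies matches
  eigenspaces, and these are copies of the eigenspaces of \<open>M\<close> and \<open>N\<close>.
  There \<open>power_cancel\<close> applies; the resulting isomorphisms and their inverses are glued
  by \<open>graded_hom\<close>.\<close>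

lemma graded_power_cancel:
  assumes M: "op_module L M" and N: "op_module L N" and gM: "graded_by L D M" and gN: "graded_by L D N"
    and m: "m > 0" and iso: "module_iso L (copies m M) (copies m N)"
  shows "module_iso L M N"
proof -
  have D: "D \<in> lcar L" using gM by (simp add: graded_by_def)
  note CM = op_module_copies[OF M, of m] and CN = op_module_copies[OF N, of m]
  obtain F where F: "mod_hom L (copies m M) (copies m N) F" "bij_betw F (mcar (copies m M)) (mcar (copies m N))"
    using iso by (auto simp: module_iso_iff)
  have cE: "copies m (sub P (eigenspace D P c)) = sub (copies m P) (eigenspace D (copies m P) c)"
    if P: "op_module L P" for P :: "('a, 'x::ab_group_add) lie_mod" and c
  proof -
    have "(pmap (act P D) f = pmap (mscl P c) f) \<longleftrightarrow>
      (\<forall>i. act P D (lookup f i) = mscl P c (lookup f i))" for f :: "nat \<Rightarrow>\<^sub>0 'x"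
      by (simp add: poly_mapping_eq_iff fun_eq_iff lookup_pmap om_act_0[OF P D] vs_zero_right[OF op_moduleD(1)[OF P]])
    then have "eigenspace D (copies m P) c =
        {f. keys f \<subseteq> {..<m} \<and> (\<forall>i. lookup f i \<in> eigenspace D P c)}"
      by (auto simp: eigenspace_def copies_simps)
    then show ?thesis by (simp add: copies_def)
  qed
  have pieces: "module_iso L (sub M (eigenspace D M c)) (sub N (eigenspace D N c))" for c
  proof (rule power_cancel[OF m op_module_sub[OF M submodule_eigenspace[OF M gM]] op_module_sub[OF N submodule_eigenspace[OF N gN]]])
    show "fin_dim (mscl (sub M (eigenspace D M c))) (mcar (sub M (eigenspace D M c)))"
      using gM by (simp add: graded_by_def)
    have img: "F ` eigenspace D (copies m M) c = eigenspace D (copies m N) c"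
    proof (intro equalityI subsetI)
      fix v assume "v \<in> F ` eigenspace D (copies m M) c"
      then show "v \<in> eigenspace D (copies m N) c"
        using mod_homD(1)[OF F(1)] mod_homD(3)[OF F(1) D, symmetric] mod_hom_scale[OF F(1)] by (auto simp: eigenspace_def)
    next
      fix v assume v: "v \<in> eigenspace D (copies m N) c"
      then have "v \<in> F ` mcar (copies m M)" using F(2) by (simp add: bij_betw_def eigenspace_def)
      then obtain u where u: "u \<in> mcar (copies m M)" "v = F u" by blast
      have "F (act (copies m M) D u) = F (mscl (copies m M) c u)"
        using v u mod_homD(3)[OF F(1) D u(1)] mod_hom_scale[OF F(1) u(1)] by (simp add: eigenspace_def)
      then have "act (copies m M) D u = mscl (copies m M) c u"
        by (rule inj_onD[OF bij_betw_imp_inj_on[OF F(2)]]) (use op_moduleD(3)[OF CM D u(1)] om_scale[OF CM u(1)] in auto)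
      then show "v \<in> F ` eigenspace D (copies m M) c" using u by (auto simp: eigenspace_def)
    qed
    have sub: "eigenspace D (copies m M) c \<subseteq> mcar (copies m M)" by (auto simp: eigenspace_def)
    show "module_iso L (copies m (sub M (eigenspace D M c))) (copies m (sub N (eigenspace D N c)))"
      unfolding cE[OF M] cE[OF N] module_iso_iff
      using mod_hom_restrict[OF F(1) sub, of "eigenspace D (copies m N) c"] bij_betw_subset[OF F(2) sub img] img
      by auto
  qed
  have "\<forall>c. \<exists>f. mod_hom L (sub M (eigenspace D M c)) (sub N (eigenspace D N c)) f \<and>
      bij_betw f (eigenspace D M c) (eigenspace D N c)"
    using pieces by (auto simp: module_iso_iff)
  then obtain f where f: "\<And>c. mod_hom L (sub M (eigenspace D M c)) (sub N (eigenspace D N c)) (f c)"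
    "\<And>c. bij_betw (f c) (eigenspace D M c) (eigenspace D N c)"
    by metis
  define k where "k c = inv_into (eigenspace D M c) (f c)" for c
  have k: "mod_hom L (sub N (eigenspace D N c)) (sub M (eigenspace D M c)) (k c)" for c
    unfolding k_def using mod_hom_inv[OF f(1) _ op_module_sub[OF M submodule_eigenspace[OF M gM]], of c] f(2)[of c] by simp
  note tM = submoduleD(1)[OF submodule_eigenspace[OF M gM]] and tN = submoduleD(1)[OF submodule_eigenspace[OF N gN]]
  obtain A where A: "mod_hom L M N A" "\<And>c u. u \<in> eigenspace D M c \<Longrightarrow> A u = f c u"
    by (rule graded_hom[OF M N gM mod_hom_sub_target_mono[OF f(1) tN]]) blast
  obtain B where B: "mod_hom L N M B" "\<And>c u. u \<in> eigenspace D N c \<Longrightarrow> B u = k c u"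
    by (rule graded_hom[OF N M gN mod_hom_sub_target_mono[OF k tM]]) blast
  have id_if: "C u = u" if P: "op_module L P" and gP: "graded_by L D P" and C: "mod_hom L P P C"
    and e: "\<And>c u. u \<in> eigenspace D P c \<Longrightarrow> C u = u" and u: "u \<in> mcar P"
    for P :: "('a, 'x::ab_group_add) lie_mod" and C u
  proof -
    obtain S h where S: "finite S" "\<forall>c\<in>S. h c \<in> eigenspace D P c" "u = (\<Sum>c\<in>S. h c)"
      using gP u unfolding graded_by_def by metis
    have "C u = (\<Sum>c\<in>S. C (h c))"
      unfolding S(3) by (rule mod_hom_sum[OF C P P S(1)]) (use S(2) in \<open>auto simp: eigenspace_def\<close>)
    also have "\<dots> = (\<Sum>c\<in>S. h c)" by (rule sum.cong) (use S(2) e in auto)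
    finally show ?thesis using S(3) by simp
  qed
  have fE: "f c u \<in> eigenspace D N c" if "u \<in> eigenspace D M c" for c u using f(2)[of c] that by (auto simp: bij_betw_def)
  have kE: "k c u \<in> eigenspace D M c" if "u \<in> eigenspace D N c" for c u using mod_homD(1)[OF k, of u c] that by simp
  have BA: "B (A u) = u" if "u \<in> mcar M" for u
  proof (rule id_if[OF M gM mod_hom_comp[OF A(1) B(1)] _ that])
    show "B (A u) = u" if "u \<in> eigenspace D M c" for c u
      using A(2)[OF that] B(2)[OF fE[OF that]] bij_betw_inv_into_left[OF f(2) that] by (simp add: k_def)
  qed
  have AB: "A (B u) = u" if "u \<in> mcar N" for u
  proof (rule id_if[OF N gN mod_hom_comp[OF B(1) A(1)] _ that])
    show "A (B u) = u" if "u \<in> eigenspace D N c" for c u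
      using B(2)[OF that] A(2)[OF kE[OF that]] bij_betw_inv_into_right[OF f(2) that] by (simp add: k_def)
  qed
  have "bij_betw A (mcar M) (mcar N)"
    by (rule bij_betw_byWitness[where f' = B]) (use BA AB mod_homD(1)[OF A(1)] mod_homD(1)[OF B(1)] in auto)
  then show ?thesis using A(1) by (auto simp: module_iso_iff)
qed

subsection \<open>Creation and annihilation operators\<close>

text \<open>The sign is expressed by negation and not by a scalar, because the coefficients may lie
  in any abelian group.\<close>

definition sg :: "nat \<Rightarrow> 's::ab_group_add \<Rightarrow> 's" where
  "sg n s = (if even n then s else - s)"

definition above :: "'i::linorder \<Rightarrow> 'i set \<Rightarrow> nat" where
  "above i K = card {j \<in> K. i < j}"

lemma sg_0 [simp]: "sg n 0 = 0"
  and sg_eq_0_iff [simp]: "sg n s = 0 \<longleftrightarrow> s = 0"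
  and sg_add: "sg n (s + t) = sg n s + sg n t"
  and sg_minus: "sg n (- s) = - sg n s"
  and sg_Suc: "sg (Suc n) s = - sg n s"
  by (auto simp: sg_def)

text \<open>Exchanging the order of an insertion and a removal alters exactly one of the two
  exponents, by one. This is the sign in \<open>ann_cre_diff\<close>.\<close>

lemma sg_swap:
  fixes i j :: "'i::linorder"
  assumes "i \<noteq> j" "b' = (if j < i then Suc b else b)" "a = (if i < j then Suc a' else a')"
  shows "sg a (sg b' s) = - sg b (sg a' s)"
  using assms by (cases "i < j") (auto simp: sg_def)

lemma sg_twice [simp]: "sg n (sg n s) = s"
  by (simp add: sg_def)

text \<open>Wedging with e_i, described by its coefficient at each \<open>K\<close>. The
  coefficients are arbitrary, so that the same operator serves the spin space and the Fock space,
  whose coefficients lie in a spin space.\<close>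

lift_definition cre :: "'i::linorder \<Rightarrow> ('i set \<Rightarrow>\<^sub>0 's::ab_group_add) \<Rightarrow> ('i set \<Rightarrow>\<^sub>0 's)" is
  "\<lambda>i u K. if i \<in> K then sg (above i K) (u (K - {i})) else 0"
proof -
  fix i :: 'i and u :: "'i set \<Rightarrow> 's"
  assume fin: "finite {K. u K \<noteq> 0}"
  have "{K. (if i \<in> K then sg (above i K) (u (K - {i})) else 0) \<noteq> 0} \<subseteq> insert i ` {K. u K \<noteq> 0}"
  proof
    fix K assume "K \<in> {K. (if i \<in> K then sg (above i K) (u (K - {i})) else 0) \<noteq> 0}"
    then have "i \<in> K" "u (K - {i}) \<noteq> 0" by (auto split: if_splits)
    then show "K \<in> insert i ` {K. u K \<noteq> 0}" by (intro image_eqI[of _ _ "K - {i}"]) auto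
  qed
  then show "finite {K. (if i \<in> K then sg (above i K) (u (K - {i})) else 0) \<noteq> 0}"
    by (rule finite_subset) (simp add: fin)
qed

text \<open>Contraction with the dual of e_i; the factor 2 of the Clifford operators is supplied
  separately.\<close>

lift_definition ann :: "'i::linorder \<Rightarrow> ('i set \<Rightarrow>\<^sub>0 's::ab_group_add) \<Rightarrow> ('i set \<Rightarrow>\<^sub>0 's)" is
  "\<lambda>i u K. if i \<in> K then 0 else sg (above i K) (u (insert i K))"
proof -
  fix i :: 'i and u :: "'i set \<Rightarrow> 's"
  assume fin: "finite {K. u K \<noteq> 0}"
  have "{K. (if i \<in> K then 0 else sg (above i K) (u (insert i K))) \<noteq> 0} \<subseteq> (\<lambda>K. K - {i}) ` {K. u K \<noteq> 0}"
  proof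
    fix K assume "K \<in> {K. (if i \<in> K then 0 else sg (above i K) (u (insert i K))) \<noteq> 0}"
    then have "i \<notin> K" "u (insert i K) \<noteq> 0" by (auto split: if_splits)
    then show "K \<in> (\<lambda>K. K - {i}) ` {K. u K \<noteq> 0}" by (intro image_eqI[of _ _ "insert i K"]) auto
  qed
  then show "finite {K. (if i \<in> K then 0 else sg (above i K) (u (insert i K))) \<noteq> 0}"
    by (rule finite_subset) (simp add: fin)
qed

text \<open>The parity operator. It represents e_0 on the spin space, and on the Fock space it
  supplies the sign by which operators on the coefficients anticommute with wedging.\<close>

lift_definition par :: "('i set \<Rightarrow>\<^sub>0 's::ab_group_add) \<Rightarrow> ('i set \<Rightarrow>\<^sub>0 's)" is
  "\<lambda>u K. sg (card K) (u K)"
  by simp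

text \<open>\<open>card\<close> is 0 on infinite sets, so the signs obey the exchange rules on
  finite keys only.\<close>

definition finkeys :: "('i set \<Rightarrow>\<^sub>0 's::zero) \<Rightarrow> bool" where
  "finkeys u \<longleftrightarrow> (\<forall>K\<in>keys u. finite K)"

lemma lookup_infinite: "finkeys u \<Longrightarrow> infinite K \<Longrightarrow> lookup u K = 0"
  by (auto simp: finkeys_def in_keys_iff)

lemma finkeysI: "(\<And>K. infinite K \<Longrightarrow> lookup u K = 0) \<Longrightarrow> finkeys u"
  by (auto simp: finkeys_def in_keys_iff)

lemma finkeys_0 [simp]: "finkeys 0"
  by (simp add: finkeys_def)

lemma finkeys_add: "finkeys u \<Longrightarrow> finkeys v \<Longrightarrow> finkeys (u + v)"
  by (rule finkeysI) (simp add: lookup_add lookup_infinite)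

lemma finkeys_cre: "finkeys u \<Longrightarrow> finkeys (cre i u)"
  by (rule finkeysI) (auto simp: cre.rep_eq lookup_infinite)

lemma finkeys_ann: "finkeys u \<Longrightarrow> finkeys (ann i u)"
  by (rule finkeysI) (auto simp: ann.rep_eq lookup_infinite)

lemma finkeys_par: "finkeys u \<Longrightarrow> finkeys (par u)"
  by (rule finkeysI) (auto simp: par.rep_eq lookup_infinite)

lemma finkeys_pmap: "finkeys u \<Longrightarrow> finkeys (pmap f u)"
  using keys_pmap_subset[of f u] by (auto simp: finkeys_def)

lemma above_insert:
  "finite K \<Longrightarrow> i \<notin> K \<Longrightarrow> above j (insert i K) = (if j < i then Suc (above j K) else above j K)"
proof -
  assume K: "finite K" "i \<notin> K"
  have "{x \<in> insert i K. j < x} = (if j < i then insert i {x \<in> K. j < x} else {x \<in> K. j < x})" by auto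
  then show ?thesis using K by (simp add: above_def)
qed

lemma above_remove: "finite K \<Longrightarrow> i \<in> K \<Longrightarrow> above j K = (if j < i then Suc (above j (K - {i})) else above j (K - {i}))"
  using above_insert[of "K - {i}" i j] by (simp add: insert_absorb)

lemma above_self: "above i (insert i K) = above i K" "above i (K - {i}) = above i K"
  unfolding above_def by (auto intro!: arg_cong[of _ _ card])

lemma cre_add: "cre i (u + v) = cre i u + cre i v"
  and ann_add: "ann i (u + v) = ann i u + ann i v"
  and par_add: "par (u + v) = par u + par v"
  by (auto intro!: poly_mapping_eqI simp: cre.rep_eq ann.rep_eq par.rep_eq lookup_add sg_add)

lemma cre_0 [simp]: "cre i 0 = 0"
  and ann_0 [simp]: "ann i 0 = 0"
  and par_0 [simp]: "par 0 = 0"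
  by (auto intro!: poly_mapping_eqI simp: cre.rep_eq ann.rep_eq par.rep_eq)

lemma cre_neg: "cre i (- u) = - cre i u"
  and ann_neg: "ann i (- u) = - ann i u"
  and par_neg: "par (- u) = - par u"
  by (auto intro!: poly_mapping_eqI simp: cre.rep_eq ann.rep_eq par.rep_eq sg_minus)

lemma cre_diff: "cre i (u - v) = cre i u - cre i v"
  using cre_add[of i u "- v"] by (simp add: cre_neg)

lemma cre_sum: "cre i (sum f A) = (\<Sum>x\<in>A. cre i (f x))"
  and ann_sum: "ann i (sum f A) = (\<Sum>x\<in>A. ann i (f x))"
  and par_sum: "par (sum f A) = (\<Sum>x\<in>A. par (f x))"
  by (induction A rule: infinite_finite_induct) (auto simp: cre_add ann_add par_add)

lemma cre_single: "cre i (single J s) =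
    (if i \<in> J then 0 else single (insert i J) (sg (above i J) s))"
proof (rule poly_mapping_eqI)
  fix K
  have "J = K - {i} \<longleftrightarrow> K = insert i J" if "i \<in> K" "i \<notin> J" using that by auto
  then show "lookup (cre i (single J s)) K = lookup
     (if i \<in> J then 0 else single (insert i J) (sg (above i J) s)) K"
    by (auto simp: cre.rep_eq lookup_single when_def above_self)
qed

lemma ann_single: "ann i (single J s) =
    (if i \<in> J then single (J - {i}) (sg (above i J) s) else 0)"
proof (rule poly_mapping_eqI)
  fix K
  have "J = insert i K \<longleftrightarrow> J - {i} = K" if "i \<notin> K" "i \<in> J" using that by auto
  then show "lookup (ann i (single J s)) K = lookup
     (if i \<in> J then single (J - {i}) (sg (above i J) s) else 0) K"
    by (auto simp: ann.rep_eq lookup_single when_def above_self)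
qed

lemma par_single: "par (single J s) = single J (sg (card J) s)"
  by (rule poly_mapping_eqI) (simp add: par.rep_eq lookup_single when_def)

lemma ann_cre_same:
  assumes "finkeys u"
  shows "ann i (cre i u) + cre i (ann i u) = u"
  by (rule poly_mapping_eqI)
     (simp add: cre.rep_eq ann.rep_eq lookup_add above_self insert_absorb)

lemma ann_cre_diff:
  assumes "finkeys u" "i \<noteq> j"
  shows "ann i (cre j u) + cre j (ann i u) = 0"
proof (rule poly_mapping_eqI)
  fix K
  show "lookup (ann i (cre j u) + cre j (ann i u)) K = lookup 0 K"
  proof (cases "finite K \<and> i \<notin> K \<and> j \<in> K")
    case True
    have e: "insert i K - {j} = insert i (K - {j})" using assms(2) by auto
    have l: "lookup (ann i (cre j u) + cre j (ann i u)) K =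
        sg (above i K) (sg (above j (insert i K)) (lookup u (insert i (K - {j})))) +
        sg (above j K) (sg (above i (K - {j})) (lookup u (insert i (K - {j}))))"
      using True assms(2) by (simp add: lookup_add cre.rep_eq ann.rep_eq e)
    have 1: "above j (insert i K) = (if j < i then Suc (above j K) else above j K)"
      by (rule above_insert) (use True in auto)
    have 2: "above i K = (if i < j then Suc (above i (K - {j})) else above i (K - {j}))"
      by (rule above_remove) (use True in auto)
    show ?thesis unfolding l sg_swap[OF assms(2) 1 2] by simp
  next
    case False
    then consider "infinite K" | "finite K" "i \<in> K \<or> j \<notin> K" by blast
    then show ?thesis
      using assms by cases (auto simp: lookup_add cre.rep_eq ann.rep_eq lookup_infinite)
  qed
qed

lemma ann_cre: "finkeys u \<Longrightarrow> ann i (cre j u) = (if i = j then u else 0) - cre j (ann i u)"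
  using ann_cre_same[of u i] ann_cre_diff[of u i j] by (auto simp: eq_diff_eq)

lemma cre_cre:
  assumes "finkeys u"
  shows "cre i (cre j u) = - cre j (cre i u)"
proof (rule poly_mapping_eqI)
  fix K
  show "lookup (cre i (cre j u)) K = lookup (- cre j (cre i u)) K"
  proof (cases "finite K \<and> i \<in> K \<and> j \<in> K \<and> i \<noteq> j")
    case True
    have ne: "j \<noteq> i" using True by blast
    have e: "K - {j} - {i} = K - {i} - {j}" by auto
    have l: "lookup (cre i (cre j u)) K =
        sg (above i K) (sg (above j (K - {i})) (lookup u (K - {i} - {j})))"
      "lookup (- cre j (cre i u)) K =
        - sg (above j K) (sg (above i (K - {j})) (lookup u (K - {i} - {j})))"
      using True ne by (simp_all add: cre.rep_eq e)
    have 1: "above i K = (if i < j then Suc (above i (K - {j})) else above i (K - {j}))"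
      by (rule above_remove) (use True in auto)
    have 2: "above j K = (if j < i then Suc (above j (K - {i})) else above j (K - {i}))"
      by (rule above_remove) (use True in auto)
    show ?thesis
      unfolding l 1 2 using ne by (cases "i < j") (auto simp: sg_def)
  next
    case False
    then consider "infinite K" | "i = j" | "finite K" "i \<notin> K \<or> j \<notin> K" by blast
    then show ?thesis
      using assms by cases (auto simp: cre.rep_eq lookup_infinite)
  qed
qed

lemma ann_ann:
  assumes "finkeys u"
  shows "ann i (ann j u) = - ann j (ann i u)"
proof (rule poly_mapping_eqI)
  fix K
  show "lookup (ann i (ann j u)) K = lookup (- ann j (ann i u)) K"
  proof (cases "finite K \<and> i \<notin> K \<and> j \<notin> K \<and> i \<noteq> j")
    case True
    have ne: "i \<noteq> j" using True by blast
    have e: "insert j (insert i K) = insert i (insert j K)" by auto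
    have l: "lookup (ann i (ann j u)) K =
        sg (above i K) (sg (above j (insert i K)) (lookup u (insert i (insert j K))))"
      "lookup (- ann j (ann i u)) K =
        - sg (above j K) (sg (above i (insert j K)) (lookup u (insert i (insert j K))))"
      using True ne by (simp_all add: ann.rep_eq e)
    have 1: "above j (insert i K) = (if j < i then Suc (above j K) else above j K)"
      by (rule above_insert) (use True in auto)
    have 2: "above i (insert j K) = (if i < j then Suc (above i K) else above i K)"
      by (rule above_insert) (use True in auto)
    show ?thesis
      unfolding l 1 2 using ne by (cases "i < j") (auto simp: sg_def)
  next
    case False
    then consider "infinite K" | "i = j" | "finite K" "i \<in> K \<or> j \<in> K" by blast
    then show ?thesis
      using assms by cases (auto simp: ann.rep_eq lookup_infinite)
  qed
qed

lemma cre_par: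
  assumes "finkeys u"
  shows "cre i (par u) = - par (cre i u)"
proof (rule poly_mapping_eqI)
  fix K
  show "lookup (cre i (par u)) K = lookup (- par (cre i u)) K"
  proof (cases "finite K \<and> i \<in> K")
    case True
    then have "card K = Suc (card (K - {i}))" using card_Suc_Diff1[of K i] by simp
    then show ?thesis using True by (auto simp: cre.rep_eq par.rep_eq sg_def)
  next
    case False
    then show ?thesis using lookup_infinite[OF assms] by (auto simp: cre.rep_eq par.rep_eq)
  qed
qed

lemma ann_par:
  assumes "finkeys u"
  shows "ann i (par u) = - par (ann i u)"
proof (rule poly_mapping_eqI)
  fix K
  show "lookup (ann i (par u)) K = lookup (- par (ann i u)) K"
  proof (cases "finite K \<and> i \<notin> K")
    case True
    then have "card (insert i K) = Suc (card K)" by simp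
    then show ?thesis using True by (auto simp: ann.rep_eq par.rep_eq sg_def)
  next
    case False
    then show ?thesis using lookup_infinite[OF assms] by (auto simp: ann.rep_eq par.rep_eq)
  qed
qed

lemma par_par [simp]: "par (par u) = u"
  by (rule poly_mapping_eqI) (simp add: par.rep_eq)

text \<open>Maps of the coefficients need only be odd on the coefficients that occur.\<close>

lemma
  assumes "f 0 = 0" "\<And>K. f (- lookup u K) = - f (lookup u K)"
  shows pmap_cre: "pmap f (cre i u) = cre i (pmap f u)"
    and pmap_ann: "pmap f (ann i u) = ann i (pmap f u)"
    and pmap_par: "pmap f (par u) = par (pmap f u)"
  using assms by (auto intro!: poly_mapping_eqI simp: cre.rep_eq ann.rep_eq par.rep_eq lookup_pmap sg_def)

lemma poly_mapping_sum_single: "(\<Sum>J\<in>keys u. single J (lookup u J)) = u"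
proof (rule poly_mapping_eqI)
  fix K
  show "lookup (\<Sum>J\<in>keys u. single J (lookup u J)) K = lookup u K"
    by (auto simp: lookup_sum lookup_single when_def in_keys_iff)
qed

section \<open>Complex scalars and the Clifford generators\<close>

lemma cscale_vs: "vector_space cscale"
proof -
  have "vector_space ((*) :: complex \<Rightarrow> complex \<Rightarrow> complex)"
    by standard (auto simp: algebra_simps)
  then show ?thesis unfolding cscale_def[abs_def] by (rule vector_space_pmap)
qed

lemma lookup_cscale [simp]: "lookup (cscale c u) K = c * lookup u K"
  by (simp add: cscale_def lookup_pmap)

lemma cscale_single: "cscale c (single J a) = single J (c * a)"
  by (rule poly_mapping_eqI) (simp add: lookup_single when_def)

lemma cscale_add: "cscale c (u + v) = cscale c u + cscale c v"
  and cscale_add_left: "cscale (c + d) u = cscale c u + cscale d u"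
  and cscale_cscale: "cscale c (cscale d u) = cscale (c * d) u"
  and cscale_1 [simp]: "cscale 1 u = u" and cscale_0_left [simp]: "cscale 0 u = 0"
  and cscale_minus: "cscale c (- u) = - cscale c u" and cscale_minus_left: "cscale (- c) u = - cscale c u"
  and cscale_diff: "cscale c (u - v) = cscale c u - cscale c v"
  and cscale_sum: "cscale c (sum f A) = (\<Sum>x\<in>A. cscale c (f x))"
proof -
  note vs = cscale_vs
  show "cscale c (u + v) = cscale c u + cscale c v" by (rule vs_add[OF vs])
  show "cscale (c + d) u = cscale c u + cscale d u" by (rule vs_add_left[OF vs])
  show "cscale c (cscale d u) = cscale (c * d) u" by (rule vs_mult[OF vs])
  show "cscale 1 u = u" by (rule vs_one[OF vs])
  show "cscale 0 u = 0" by (rule vs_zero[OF vs])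
  show "cscale c (- u) = - cscale c u" by (rule vs_neg_right[OF vs])
  show "cscale (- c) u = - cscale c u" by (rule vs_neg[OF vs])
  show "cscale c (u - v) = cscale c u - cscale c v" by (rule vs_diff[OF vs])
  show "cscale c (sum f A) = (\<Sum>x\<in>A. cscale c (f x))" by (rule vs_sum[OF vs])
qed

lemma cscale_0 [simp]: "cscale c 0 = 0"
  by (rule vs_zero_right[OF cscale_vs])

lemma cscale_eq_0_iff: "cscale c u = 0 \<longleftrightarrow> c = 0 \<or> u = 0"
proof
  assume "cscale c u = 0"
  then have "c * lookup u K = 0" for K by (metis lookup_cscale lookup_zero)
  then show "c = 0 \<or> u = 0" by (auto intro!: poly_mapping_eqI)
qed auto

text \<open>Used to identify operators given on basis vectors with the coefficientwise ones: only
  the values on \<open>single J c\<close> have to be compared.\<close>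

lemma linear_extension_unique:
  fixes T :: "('j \<Rightarrow>\<^sub>0 complex) \<Rightarrow> ('k \<Rightarrow>\<^sub>0 complex)"
  assumes "\<And>u v. T (u + v) = T u + T v" "\<And>J c. T (single J c) = cscale c (f J)"
  shows "linear_extension f u = T u"
proof -
  have "T 0 = 0" using assms(1)[of 0 0] by simp
  then have s: "T (sum g A) = (\<Sum>x\<in>A. T (g x))" for g :: "'j \<Rightarrow> _" and A
    by (induction A rule: infinite_finite_induct) (auto simp: assms(1))
  have "T u = T (\<Sum>J\<in>keys u. single J (lookup u J))"
    by (simp add: poly_mapping_sum_single)
  then show ?thesis by (simp add: s assms(2) linear_extension_def)
qed

lemma linear_extension_wedge: "linear_extension (wedge_index i) u = cre i u"
proof (rule linear_extension_unique)
  show "cre i (single J c) = cscale c (wedge_index i J)" for J c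
    by (simp add: cre_single wedge_index_def cscale_single sg_def above_def)
qed (rule cre_add)

lemma cre_cscale: "cre i (cscale c u) = cscale c (cre i u)"
  and ann_cscale: "ann i (cscale c u) = cscale c (ann i u)"
  and par_cscale: "par (cscale c u) = cscale c (par u)"
  unfolding cscale_def by (simp_all add: pmap_cre pmap_ann pmap_par)

lemma clifford_pos: "i > 0 \<Longrightarrow> clifford i u = cre i u"
  using linear_extension_wedge[of i u] by (simp add: clifford_def wedge_index_def[abs_def])

lemma clifford_neg: "i < 0 \<Longrightarrow> clifford i u = cscale 2 (ann (- i) u)"
  unfolding clifford_def
  by (rule linear_extension_unique)
     (auto simp: ann_add cscale_add ann_single cscale_single sg_def above_def mult.commute)

lemma clifford_zero: "clifford 0 u = par u"
  unfolding clifford_def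
  by (rule linear_extension_unique) (auto simp: par_add par_single cscale_single sg_def)

lemmas clifford_simps = clifford_pos clifford_neg clifford_zero

lemma clifford_add: "clifford i (u + v) = clifford i u + clifford i v"
  by (cases i "0::int" rule: linorder_cases) (auto simp: clifford_simps cre_add ann_add par_add cscale_add)

lemma clifford_cscale: "clifford i (cscale c u) = cscale c (clifford i u)"
  by (cases i "0::int" rule: linorder_cases)
     (auto simp: clifford_simps cre_cscale ann_cscale par_cscale cscale_cscale mult.commute)

lemma clifford_0 [simp]: "clifford i 0 = 0"
  using clifford_cscale[of i 0 0] by simp

lemma clifford_minus: "clifford i (- u) = - clifford i u"
  using clifford_cscale[of i "- 1" u] by (simp add: cscale_minus_left)

lemma clifford_diff: "clifford i (u - v) = clifford i u - clifford i v"
  using clifford_add[of i u "- v"] by (simp add: clifford_minus)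

lemma clifford_sum: "clifford i (sum f A) = (\<Sum>x\<in>A. clifford i (f x))"
  by (induction A rule: infinite_finite_induct) (auto simp: clifford_add)

lemma finkeys_cscale: "finkeys u \<Longrightarrow> finkeys (cscale c u)"
  unfolding cscale_def by (rule finkeys_pmap)

lemma finkeys_clifford: "finkeys u \<Longrightarrow> finkeys (clifford i u)"
  by (cases i "0::int" rule: linorder_cases)
     (auto simp: clifford_simps finkeys_cre finkeys_ann finkeys_par finkeys_cscale)

text \<open>The value 2 has two sources: the factor 2 in the annihilators for opposite nonzero
  indices, and the doubled square of the parity for \<open>i = j = 0\<close>.\<close>

lemma clifford_anticomm:
  assumes u: "finkeys u"
  shows "clifford i (clifford j u) + clifford j (clifford i u) = (if i = - j then cscale 2 u else 0)"
proof -
  have two: "cscale 2 v = v + v" for v :: "int set \<Rightarrow>\<^sub>0 complex"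
    by (rule poly_mapping_eqI) (simp add: lookup_add)
  note simps = clifford_simps cre_cre[OF u, of i j] ann_ann[OF u, of "- i" "- j"] ann_cre[OF u]
    cre_par[OF u] ann_par[OF u] cre_cscale ann_cscale par_cscale cscale_cscale cscale_minus cscale_diff two[symmetric]
  show ?thesis
    by (cases i "0::int" rule: linorder_cases; cases j "0::int" rule: linorder_cases) (auto simp: simps)
qed

lemma vector_space_complex: "vector_space ((*) :: complex \<Rightarrow> complex \<Rightarrow> complex)"
  by standard (auto simp: algebra_simps)

subsection \<open>The quadratic elements\<close>

lemma so_matricesD:
  assumes "a \<in> so_matrices I"
  shows "a i j \<noteq> 0 \<Longrightarrow> i \<in> I \<and> j \<in> I" "a i j = - a (- j) (- i)" "finite {i. a i j \<noteq> 0}"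
    "finite {(i, j). i > 0 \<and> j > 0 \<and> a i (- j) \<noteq> 0}" "finite {(i, j). i > 0 \<and> j > 0 \<and> a (- i) j \<noteq> 0}"
  using assms unfolding so_matrices_def by blast+

text \<open>On \<open>so_matrices\<close> the antisymmetry makes this the negative transpose of
  \<open>a\<close>.\<close>

definition rev_matrix :: "(int \<Rightarrow> int \<Rightarrow> complex) \<Rightarrow> int \<Rightarrow> int \<Rightarrow> complex" where
  "rev_matrix a i j = a (- i) (- j)"

lemma rev_matrix_so:
  assumes "a \<in> so_matrices I" "uminus ` I = I"
  shows "rev_matrix a \<in> so_matrices I"
proof -
  have I: "- i \<in> I \<longleftrightarrow> i \<in> I" for i using assms(2) by (metis image_eqI image_iff minus_minus)
  have col: "finite {i. a (- i) (- j) \<noteq> 0}" for j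
  proof -
    have "finite {i. a i (- j) \<noteq> 0}" by (rule so_matricesD(3)[OF assms(1)])
    then have "finite (uminus -` {i. a i (- j) \<noteq> 0})" by (rule finite_vimageI) simp
    then show ?thesis by (simp add: vimage_def)
  qed
  have nz: "a (- i) (- j) \<noteq> 0 \<Longrightarrow> i \<in> I \<and> j \<in> I" for i j
    using so_matricesD(1)[OF assms(1)] I by blast
  have anti: "a (- i) (- j) = - a (- (- j)) (- (- i))" for i j by (rule so_matricesD(2)[OF assms(1)])
  show ?thesis
    unfolding so_matrices_def rev_matrix_def mem_Collect_eq
  proof (intro conjI allI impI)
    show "finite {(i, j). i > 0 \<and> j > 0 \<and> a (- i) (- (- j)) \<noteq> 0}"
      using so_matricesD(5)[OF assms(1)] by simp
    show "finite {(i, j). i > 0 \<and> j > 0 \<and> a (- (- i)) (- j) \<noteq> 0}"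
      using so_matricesD(4)[OF assms(1)] by simp
  qed (use nz anti col in blast)+
qed

text \<open>Exchanging the two indices turns the normalization for \<open>\<epsilon> = -1\<close> into that for \<open>\<epsilon> = 1\<close>.\<close>

lemma phi_minus:
  assumes "a \<in> so_matrices I"
  shows "phi (- 1) a u = phi 1 (rev_matrix a) u"
proof -
  let ?s = "\<lambda>(i, j). (j, i) :: int \<times> int"
  let ?g = "\<lambda>(i, j). if i > - j then cscale (rev_matrix a i j) (phi_Z 1 i j u) else 0"
  have e: "cscale (a i j) (phi_Z (- 1) i j u) = cscale (rev_matrix a j i) (phi_Z 1 j i u)" for i j
    using so_matricesD(2)[OF assms, of i j] by (simp add: phi_Z_def rev_matrix_def cscale_cscale)
  have "(\<lambda>(i, j). if i > - j then cscale (a i j) (phi_Z (- 1) i j u) else 0) = ?g \<circ> ?s"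
    by (auto simp: fun_eq_iff e)
  moreover have "Sum_any (?g \<circ> ?s) = Sum_any ?g"
    by (rule Sum_any.reindex_cong[of ?s, symmetric]) (auto intro!: bijI injI surjI[of _ ?s])
  ultimately show ?thesis unfolding phi_def by simp
qed

definition phi_term :: "(int \<Rightarrow> int \<Rightarrow> complex) \<Rightarrow> (int set \<Rightarrow>\<^sub>0 complex) \<Rightarrow> int \<times> int \<Rightarrow> (int set \<Rightarrow>\<^sub>0 complex)" where
  "phi_term a u = (\<lambda>(i, j). if i > - j then cscale (a i j / 2) (clifford i (clifford (- j) u)) else 0)"

lemma phi_eq: "phi 1 a u = Sum_any (phi_term a u)"
  unfolding phi_def phi_term_def
  by (rule arg_cong[of _ _ Sum_any]) (auto simp: fun_eq_iff phi_Z_def cscale_cscale)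

lemma ann_eq_0: "p \<notin> \<Union> (keys u) \<Longrightarrow> ann p u = 0"
  by (rule poly_mapping_eqI) (auto simp: ann.rep_eq in_keys_iff)

text \<open>A nonzero term with \<open>j < 0\<close> has \<open>i > - j > 0\<close>, so its
  coefficient lies in one of the blocks with finitely many entries. For \<open>j \<ge> 0\<close> the
  annihilator leaves only \<open>j = 0\<close> and the indices occurring in \<open>u\<close>, each
  with a finite column.\<close>

lemma phi_support:
  assumes a: "a \<in> so_matrices I" and u: "finkeys u"
  shows "finite {p. phi_term a u p \<noteq> 0}"
proof (rule finite_subset)
  let ?X = "\<Union> (keys u)"
  let ?A = "(\<lambda>(i, j). (i, - j)) ` {(i, j). i > 0 \<and> j > 0 \<and> a i (- j) \<noteq> 0}"
  let ?B = "\<Union>j\<in>insert 0 ?X. (\<lambda>i. (i, j)) ` {i. a i j \<noteq> 0}"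
  have "finite ?X" using u by (auto simp: finkeys_def)
  then have "finite ?B" by (intro finite_UN_I) (simp_all add: so_matricesD(3)[OF a])
  then show "finite (?A \<union> ?B)" using so_matricesD(4)[OF a] by simp
  show "{p. phi_term a u p \<noteq> 0} \<subseteq> ?A \<union> ?B"
  proof
    fix p assume "p \<in> {p. phi_term a u p \<noteq> 0}"
    moreover obtain i j where p: "p = (i, j)" by (cases p)
    ultimately have nz: "i > - j" "a i j \<noteq> 0" "clifford (- j) u \<noteq> 0"
      by (auto simp: phi_term_def split: if_splits)
    show "p \<in> ?A \<union> ?B"
    proof (cases "j < 0")
      case True
      then have "p \<in> ?A" using nz p by (auto intro!: image_eqI[of _ _ "(i, - j)"])
      then show ?thesis by blast
    next
      case False
      have "j \<in> insert 0 ?X"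
      proof (rule ccontr)
        assume "j \<notin> insert 0 ?X"
        then have "clifford (- j) u = 0" using False by (auto simp: clifford_neg ann_eq_0)
        then show False using nz by simp
      qed
      then have "p \<in> ?B" using nz p by blast
      then show ?thesis by blast
    qed
  qed
qed

lemma phi_sum:
  assumes "finite T" "{p. phi_term a u p \<noteq> 0} \<subseteq> T"
  shows "phi 1 a u = (\<Sum>p\<in>T. phi_term a u p)"
  unfolding phi_eq by (rule Sum_any.expand_superset[OF assms])

text \<open>By the Clifford relations the commutator of (1/2) e_i e_(-j) with e_l contributes e_i if
  \<open>j = l\<close> and minus e_(-j) if \<open>i = - l\<close>. The sum defining
  \<open>phi\<close> runs over half of the index pairs; antisymmetry of \<open>a\<close> turns the
  second kind of term into the missing part of column \<open>l\<close>.\<close>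

lemma phi_comm_1:
  assumes a: "a \<in> so_matrices I" and u: "finkeys u"
  shows "phi 1 a (clifford l u) = clifford l (phi 1 a u) + (\<Sum>i | a i l \<noteq> 0. cscale (a i l) (clifford i u))"
proof -
  note anti = so_matricesD(2)[OF a]
  have fl: "finite {i. a i l \<noteq> 0}" by (rule so_matricesD(3)[OF a])
  let ?R = "(\<lambda>i. (i, l)) ` {i. a i l \<noteq> 0}" and ?S = "(\<lambda>j. (- l, - j)) ` {j. a j l \<noteq> 0}"
  \<comment> \<open>One finite index set for the terms of both applications of \<open>phi\<close>,
    for column \<open>l\<close>, and for the mirror image of that column.\<close>
  define T where "T = {p. phi_term a u p \<noteq> 0} \<union> {p. phi_term a (clifford l u) p \<noteq> 0} \<union> ?R \<union> ?S"
  have T: "finite T" unfolding T_def using phi_support[OF a u] phi_support[OF a finkeys_clifford[OF u]] fl by simp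
  have s1: "{p. phi_term a u p \<noteq> 0} \<subseteq> T" and s2: "{p. phi_term a (clifford l u) p \<noteq> 0} \<subseteq> T"
    unfolding T_def by blast+
  define f where "f = (\<lambda>(i, j). if i > - j \<and> j = l then cscale (a i j) (clifford i u) else 0)"
  define g where "g = (\<lambda>(i, j). if i > - j \<and> i = - l then cscale (a i j) (clifford (- j) u) else 0)"
  have t: "phi_term a (clifford l u) p - clifford l (phi_term a u p) = f p - g p" for p
  proof -
    obtain i j where p: "p = (i, j)" by (cases p)
    have 1: "clifford (- j) (clifford l u) = (if j = l then cscale 2 u else 0) - clifford l (clifford (- j) u)"
      using clifford_anticomm[OF u, of "- j" l] by (simp add: eq_diff_eq)
    have 2: "clifford i (clifford l v) = (if i = - l then cscale 2 v else 0) - clifford l (clifford i v)" if "finkeys v" for v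
      using clifford_anticomm[OF that, of i l] by (simp add: eq_diff_eq)
    have "clifford i (clifford (- j) (clifford l u)) - clifford l (clifford i (clifford (- j) u)) =
       (if j = l then cscale 2 (clifford i u) else 0) - (if i = - l then cscale 2 (clifford (- j) u) else 0)"
      unfolding 1 clifford_diff 2[OF finkeys_clifford[OF u]]
      by (simp add: clifford_cscale)
    then have "cscale (a i j / 2) (clifford i (clifford (- j) (clifford l u))) - clifford l (cscale (a i j / 2) (clifford i (clifford (- j) u)))
       = (if j = l then cscale (a i j) (clifford i u) else 0) - (if i = - l then cscale (a i j) (clifford (- j) u) else 0)"
      unfolding clifford_cscale cscale_diff[symmetric] by (simp add: cscale_diff cscale_cscale)
    then show ?thesis unfolding p phi_term_def f_def g_def by auto
  qed
  have "phi 1 a (clifford l u) - clifford l (phi 1 a u) = (\<Sum>p\<in>T. f p) - (\<Sum>p\<in>T. g p)"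
    unfolding sum_subtractf[symmetric] t[symmetric]
    unfolding phi_sum[OF T s1] phi_sum[OF T s2] by (simp add: sum_subtractf clifford_sum)
  also have "(\<Sum>p\<in>T. f p) = (\<Sum>p\<in>?R. f p)"
    by (rule sum.mono_neutral_right[OF T]) (auto simp: T_def f_def split: if_splits)
  also have "\<dots> = (\<Sum>i | a i l \<noteq> 0. if i > - l then cscale (a i l) (clifford i u) else 0)"
    by (subst sum.reindex) (auto simp: inj_on_def f_def intro!: sum.cong)
  also have "(\<Sum>p\<in>T. g p) = (\<Sum>p\<in>?S. g p)"
  proof (rule sum.mono_neutral_right[OF T])
    show "\<forall>p\<in>T - ?S. g p = 0"
    proof
      fix p assume p: "p \<in> T - ?S"
      obtain i j where ij: "p = (i, j)" by (cases p)
      have "a i j = 0" if "i = - l"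
      proof (rule ccontr)
        assume "a i j \<noteq> 0"
        then have "a (- j) l \<noteq> 0" using anti[of i j] that by simp
        then have "p \<in> ?S" using ij that by (intro image_eqI[of _ _ "- j"]) auto
        then show False using p by blast
      qed
      then show "g p = 0" unfolding ij g_def by auto
    qed
  qed (auto simp: T_def)
  also have "\<dots> = (\<Sum>i | a i l \<noteq> 0. if i < - l then - cscale (a i l) (clifford i u) else 0)"
  proof (subst sum.reindex)
    show "inj_on (\<lambda>j. (- l, - j)) {j. a j l \<noteq> 0}" by (auto simp: inj_on_def)
    show "sum (g \<circ> (\<lambda>j. (- l, - j))) {j. a j l \<noteq> 0} =
        (\<Sum>i | a i l \<noteq> 0. if i < - l then - cscale (a i l) (clifford i u) else 0)"
    proof (rule sum.cong)
      fix i
      have "a (- l) (- i) = - a i l" using anti[of "- l" "- i"] by simp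
      then show "(g \<circ> (\<lambda>j. (- l, - j))) i = (if i < - l then - cscale (a i l) (clifford i u) else 0)"
        by (simp add: g_def cscale_minus_left)
    qed simp
  qed
  finally have "phi 1 a (clifford l u) - clifford l (phi 1 a u) =
    (\<Sum>i | a i l \<noteq> 0. (if i > - l then cscale (a i l) (clifford i u) else 0) -
       (if i < - l then - cscale (a i l) (clifford i u) else 0))"
    by (simp add: sum_subtractf)
  \<comment> \<open>The two cases leave out \<open>i = - l\<close>, where antisymmetry forces
    \<open>a (- l) l = 0\<close>.\<close>
  also have "\<dots> = (\<Sum>i | a i l \<noteq> 0. cscale (a i l) (clifford i u))"
    using anti[of "- l" l] by (intro sum.cong) auto
  finally show ?thesis by (simp add: algebra_simps)
qed

text \<open>For \<open>\<epsilon> = - 1\<close> the entries come from \<open>rev_matrix\<close>,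
  whose indices are negated; hence the factors \<open>\<epsilon>\<close> in the
  coefficients.\<close>

lemma phi_comm:
  assumes a: "a \<in> so_matrices I" and I: "uminus ` I = I" and \<epsilon>: "\<epsilon> \<in> {1, - 1}" and u: "finkeys u"
  shows "phi \<epsilon> a (clifford l u) = clifford l (phi \<epsilon> a u) +
    (\<Sum>i | a (\<epsilon> * i) (\<epsilon> * l) \<noteq> 0. cscale (a (\<epsilon> * i) (\<epsilon> * l)) (clifford i u))"
proof (cases "\<epsilon> = 1")
  case False
  then have "\<epsilon> = - 1" using \<epsilon> by simp
  then show ?thesis
    using phi_comm_1[OF rev_matrix_so[OF a I] u, of l] by (simp add: phi_minus[OF a]) (simp add: rev_matrix_def)
qed (use phi_comm_1[OF a u] in simp)

text \<open>For a diagonal matrix, reversed if \<open>\<epsilon> = - 1\<close>, only the terms with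
  \<open>i = j > 0\<close> enter, and there an annihilator stands on the right: \<open>phi\<close>
  is normally ordered with respect to the vacuum.\<close>

lemma phi_vacuum:
  assumes a: "a \<in> so_matrices I" and \<epsilon>: "\<epsilon> \<in> {1, - 1}" and diag: "\<And>i j. a i j \<noteq> 0 \<Longrightarrow> i = j"
  shows "phi \<epsilon> a (single {} 1) = 0"
proof -
  have "phi 1 a (single {} 1) = 0" if diag: "\<And>i j. a i j \<noteq> 0 \<Longrightarrow> i = j" for a
  proof -
    have "phi_term a (single {} 1) p = 0" for p
      using diag[of "fst p" "snd p"]
      by (cases p; cases "a (fst p) (snd p) = 0") (auto simp: phi_term_def clifford_neg ann_single cscale_eq_0_iff)
    then show ?thesis unfolding phi_eq by simp
  qed
  moreover have "i = j" if "rev_matrix a i j \<noteq> 0" for i j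
    using diag[of "- i" "- j"] that by (simp add: rev_matrix_def)
  ultimately show ?thesis using \<epsilon> diag phi_minus[OF a] by auto
qed

subsection \<open>Irreducibility of the spin space\<close>

lemma spin_space_iff: "u \<in> spin_space I \<longleftrightarrow> (\<forall>K. lookup u K \<noteq> 0 \<longrightarrow> finite K \<and> K \<subseteq> {i \<in> I. i > 0})"
  by (auto simp: spin_space_def in_keys_iff)

lemma spin_space_finkeys: "u \<in> spin_space I \<Longrightarrow> finkeys u"
  by (auto simp: spin_space_def finkeys_def)

lemma spin_space_subspace: "module.subspace cscale (spin_space I)"
proof (rule subspaceI[OF cscale_vs])
  show "u + v \<in> spin_space I" if u: "u \<in> spin_space I" and v: "v \<in> spin_space I" for u v
    unfolding spin_space_iff
  proof (intro allI impI)
    fix K assume "lookup (u + v) K \<noteq> 0"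
    then have "lookup u K \<noteq> 0 \<or> lookup v K \<noteq> 0" by (auto simp: lookup_add)
    then show "finite K \<and> K \<subseteq> {i \<in> I. 0 < i}" using u v unfolding spin_space_iff by blast
  qed
qed (auto simp: spin_space_iff)

lemma spin_space_vacuum: "single {} c \<in> spin_space I"
  by (auto simp: spin_space_iff lookup_single when_def)

lemma clifford_spin_space:
  assumes "u \<in> spin_space I" "i \<in> I"
  shows "clifford i u \<in> spin_space I"
proof (cases i "0::int" rule: linorder_cases)
  case equal
  then show ?thesis using assms by (auto simp: clifford_zero spin_space_iff par.rep_eq)
next
  case greater
  show ?thesis unfolding clifford_pos[OF greater] spin_space_iff
  proof (intro allI impI)
    fix K assume "lookup (cre i u) K \<noteq> 0"
    then have "i \<in> K" "lookup u (K - {i}) \<noteq> 0" by (auto simp: cre.rep_eq split: if_splits)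
    then have "finite (K - {i})" "K - {i} \<subseteq> {i \<in> I. i > 0}" using assms by (auto simp: spin_space_iff)
    then show "finite K \<and> K \<subseteq> {i \<in> I. 0 < i}" using greater assms by auto
  qed
next
  case less
  show ?thesis unfolding clifford_neg[OF less] spin_space_iff
  proof (intro allI impI)
    fix K assume "lookup (cscale 2 (ann (- i) u)) K \<noteq> 0"
    then have "lookup u (insert (- i) K) \<noteq> 0" by (auto simp: ann.rep_eq split: if_splits)
    then show "finite K \<and> K \<subseteq> {i \<in> I. 0 < i}" using assms by (auto simp: spin_space_iff)
  qed
qed

text \<open>Each e_J is a product of wedges applied to the vacuum, up to a sign that the scalars
  absorb.\<close>

lemma spin_space_from_vacuum:
  assumes W: "module.subspace cscale W" and cl: "\<And>i u. i \<in> I \<Longrightarrow> i > 0 \<Longrightarrow> u \<in> W \<Longrightarrow> clifford i u \<in> W"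
    and vac: "single {} 1 \<in> W"
  shows "spin_space I \<subseteq> W"
proof
  fix u assume u: "u \<in> spin_space I"
  have e: "single J 1 \<in> W" if "finite J" "J \<subseteq> {i \<in> I. i > 0}" for J
    using that
  proof (induction J rule: finite_induct)
    case (insert i J)
    have "clifford i (single J 1) \<in> W" using cl insert by auto
    then have "cre i (single J 1) \<in> W" using insert by (simp add: clifford_pos)
    then have "single (insert i J) (sg (above i J) 1) \<in> W" using insert by (simp add: cre_single)
    then have "cscale (sg (above i J) 1) (single (insert i J) (sg (above i J) 1)) \<in> W"
      by (rule subspace_scale[OF cscale_vs W])
    then show ?case by (simp add: cscale_single sg_def split: if_splits)
  qed (rule vac)
  have "(\<Sum>J\<in>keys u. cscale (lookup u J) (single J 1)) \<in> W"
    by (rule subspace_sum[OF cscale_vs W], rule subspace_scale[OF cscale_vs W], rule e)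
       (use u in \<open>auto simp: spin_space_def\<close>)
  then show "u \<in> W" by (simp add: cscale_single poly_mapping_sum_single)
qed

text \<open>Annihilating the indices of a largest \<open>J\<close> with \<open>e\<^sub>J\<close> occurring in a vector leaves a
  multiple of the vacuum.\<close>

lemma spin_space_reach_vacuum:
  assumes W: "module.subspace cscale W" and cl: "\<And>i u. i \<in> I \<Longrightarrow> i < 0 \<Longrightarrow> u \<in> W \<Longrightarrow> clifford i u \<in> W"
    and I: "uminus ` I = I" and u: "u \<in> W" "u \<in> spin_space I" "u \<noteq> 0"
  shows "single {} 1 \<in> W"
proof -
  have "\<exists>J\<in>keys u. \<forall>K\<in>keys u. card K \<le> card J" if "u \<noteq> 0" for u :: "int set \<Rightarrow>\<^sub>0 complex"
  proof -
    have "finite (card ` keys u)" "card ` keys u \<noteq> {}" using that by auto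
    then show ?thesis using Max_in[of "card ` keys u"] Max_ge[of "card ` keys u"] by fastforce
  qed
  then have "\<exists>m. \<exists>J\<in>keys u. card J = m \<and> (\<forall>K\<in>keys u. card K \<le> m)"
    using u(3) by blast
  then obtain m where m: "\<exists>J\<in>keys u. card J = m" "\<forall>K\<in>keys u. card K \<le> m" by blast
  from u(1,2) m show ?thesis
  proof (induction m arbitrary: u)
    case 0
    have "K = {}" if "K \<in> keys u" for K
      using 0 that by (auto simp: spin_space_def)
    then have "keys u = {{}}" using 0(3) by auto
    then have e: "u = single {} (lookup u {})" "lookup u {} \<noteq> 0"
      using poly_mapping_sum_single[of u] by (auto simp: in_keys_iff)
    have "cscale (inverse (lookup u {})) u \<in> W" by (rule subspace_scale[OF cscale_vs W 0(1)])
    then show ?case using e by (metis cscale_single left_inverse)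
  next
    case (Suc m)
    obtain J where J: "J \<in> keys u" "card J = Suc m" using Suc.prems by blast
    then obtain i where i: "i \<in> J" by fastforce
    have fJ: "finite J" "J \<subseteq> {i \<in> I. i > 0}" using J Suc.prems(2) by (auto simp: spin_space_def)
    then have iI: "i > 0" "i \<in> I" using i by auto
    then have mI: "- i \<in> I" using I by blast
    let ?v = "clifford (- i) u"
    have v: "?v \<in> W" "?v \<in> spin_space I"
      using cl[OF mI _ Suc.prems(1)] iI clifford_spin_space[OF Suc.prems(2) mI] by auto
    have lv: "lookup ?v K = 2 * (if i \<in> K then 0 else sg (above i K) (lookup u (insert i K)))" for K
      using iI by (simp add: clifford_neg ann.rep_eq)
    have "J - {i} \<in> keys ?v" using J(1) i by (simp add: in_keys_iff lv insert_absorb)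
    moreover have "card (J - {i}) = m" using J(2) fJ(1) i by simp
    moreover have "card K \<le> m" if "K \<in> keys ?v" for K
    proof -
      have "i \<notin> K" "insert i K \<in> keys u" "finite K"
        using that v(2) by (auto simp: in_keys_iff lv spin_space_iff split: if_splits)
      then show ?thesis using Suc.prems(4) by fastforce
    qed
    ultimately show ?case by (intro Suc.IH[OF v]) blast+
  qed
qed

section \<open>The derivation of an exterior algebra induced by a matrix\<close>

definition dgam :: "(complex \<Rightarrow> 's \<Rightarrow> 's) \<Rightarrow> 'i::linorder set \<Rightarrow> ('i \<Rightarrow> 'i \<Rightarrow> complex) \<Rightarrow>
    ('i set \<Rightarrow>\<^sub>0 's::ab_group_add) \<Rightarrow> ('i set \<Rightarrow>\<^sub>0 's)" where
  "dgam s F A u = (\<Sum>i\<in>F. \<Sum>j\<in>F. pmap (s (A j i)) (cre j (ann i u)))"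

lemma pmap_0 [simp]: "pmap f 0 = 0"
  by (rule poly_mapping_eqI) (simp add: Poly_Mapping.map.rep_eq)

lemma
  assumes "vector_space s"
  shows scale_cre: "pmap (s c) (cre i u) = cre i (pmap (s c) u)"
    and scale_ann: "pmap (s c) (ann i u) = ann i (pmap (s c) u)"
    and scale_par: "pmap (s c) (par u) = par (pmap (s c) u)"
  by (simp_all add: pmap_cre pmap_ann pmap_par vs_zero_right[OF assms] vs_neg_right[OF assms])

lemma pmap_single: "f 0 = 0 \<Longrightarrow> pmap f (single K t) = single K (f t)"
  by (rule poly_mapping_eqI) (simp add: lookup_pmap lookup_single when_def)

lemma dgam_add:
  assumes "vector_space s"
  shows "dgam s F A (u + v) = dgam s F A u + dgam s F A v"
  unfolding dgam_def
  by (simp add: ann_add cre_add vs_add[OF vector_space_pmap[OF assms]] sum.distrib)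

lemma dgam_scale:
  assumes "vector_space s"
  shows "dgam s F A (pmap (s c) u) = pmap (s c) (dgam s F A u)"
  unfolding dgam_def
  by (simp add: vs_sum[OF vector_space_pmap[OF assms]] scale_cre[OF assms, symmetric]
      scale_ann[OF assms, symmetric] vs_mult[OF vector_space_pmap[OF assms]] mult.commute)

text \<open>\<open>dgam\<close> is the derivation that extends the endomorphism with matrix
  \<open>A\<close>, where \<open>A j i\<close> is the coefficient of e_j in the image of e_i: its
  commutator with wedging by e_l is wedging by column \<open>l\<close>.\<close>

lemma dgam_cre:
  assumes s: "vector_space s" and F: "finite F" and u: "finkeys u"
  shows "dgam s F A (cre l u) = cre l (dgam s F A u) +
     (if l \<in> F then \<Sum>j\<in>F. pmap (s (A j l)) (cre j u) else 0)"
proof -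
  note vp = vector_space_pmap[OF s]
  have "cre j (ann i (cre l u)) = (if i = l then cre j u else 0) + cre l (cre j (ann i u))" for i j
    using cre_cre[OF finkeys_ann[OF u], of j l i] by (simp add: ann_cre[OF u] cre_diff)
  then have "pmap (s (A j i)) (cre j (ann i (cre l u))) =
      (if i = l then pmap (s (A j l)) (cre j u) else 0) +
      cre l (pmap (s (A j i)) (cre j (ann i u)))" for i j
    by (simp add: vs_add[OF vp] scale_cre[OF s])
  then have "dgam s F A (cre l u) =
      (\<Sum>i\<in>F. \<Sum>j\<in>F. (if i = l then pmap (s (A j l)) (cre j u) else 0)) + cre l (dgam s F A u)"
    by (simp add: dgam_def sum.distrib cre_sum)
  also have "(\<Sum>i\<in>F. \<Sum>j\<in>F. (if i = l then pmap (s (A j l)) (cre j u) else 0)) =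
      (\<Sum>i\<in>F. if i = l then \<Sum>j\<in>F. pmap (s (A j l)) (cre j u) else 0)"
    by (rule sum.cong) auto
  finally show ?thesis using F by (simp add: sum.delta add.commute)
qed

text \<open>Contractions transform by the dual endomorphism, hence the row \<open>l\<close> and the
  minus sign.\<close>

lemma dgam_ann:
  assumes s: "vector_space s" and F: "finite F" and u: "finkeys u"
  shows "dgam s F A (ann l u) = ann l (dgam s F A u) -
     (if l \<in> F then \<Sum>i\<in>F. pmap (s (A l i)) (ann i u) else 0)"
proof -
  note vp = vector_space_pmap[OF s]
  have "cre j (ann i (ann l u)) = ann l (cre j (ann i u)) - (if j = l then ann i u else 0)" for i j
    using ann_cre[OF finkeys_ann[OF u], of l j i] ann_ann[OF u, of i l] by (auto simp: cre_neg algebra_simps)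
  then have "pmap (s (A j i)) (cre j (ann i (ann l u))) =
      ann l (pmap (s (A j i)) (cre j (ann i u))) -
      (if j = l then pmap (s (A l i)) (ann i u) else 0)" for i j
    by (simp add: vs_diff[OF vp] scale_ann[OF s])
  then have "dgam s F A (ann l u) = ann l (dgam s F A u) -
      (\<Sum>i\<in>F. \<Sum>j\<in>F. (if j = l then pmap (s (A l i)) (ann i u) else 0))"
    by (simp add: dgam_def sum_subtractf ann_sum)
  then show ?thesis using F by (simp add: sum.delta)
qed

lemma dgam_0_if: "(\<And>K i. K \<in> keys u \<Longrightarrow> i \<in> F \<Longrightarrow> i \<notin> K) \<Longrightarrow> dgam s F A u = 0"
proof -
  assume *: "\<And>K i. K \<in> keys u \<Longrightarrow> i \<in> F \<Longrightarrow> i \<notin> K"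
  have "ann i u = 0" if "i \<in> F" for i
    by (rule poly_mapping_eqI) (use *[OF _ that] in \<open>auto simp: ann.rep_eq in_keys_iff\<close>)
  then show ?thesis by (simp add: dgam_def)
qed

lemma finkeys_sum: "(\<And>i. i \<in> A \<Longrightarrow> finkeys (f i)) \<Longrightarrow> finkeys (sum f A)"
  by (induction A rule: infinite_finite_induct) (auto simp: finkeys_add)

subsection \<open>Exterior algebras as Fock spaces\<close>

text \<open>The list is descending, so each new index exceeds those already present and no sign
  arises.\<close>

lemma foldr_cre_sorted: "finite J \<Longrightarrow> foldr cre (rev (sorted_list_of_set J)) (single {} c) = single J c"
proof (induction J rule: finite_linorder_max_induct)
  case (insert b A)
  have bA: "b \<notin> A" using insert.hyps by auto
  have "insort b (sorted_list_of_set A) = sorted_list_of_set A @ [b]"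
    by (rule sorted_insort_is_snoc) (use insert.hyps in \<open>simp_all add: less_imp_le\<close>)
  then have "sorted_list_of_set (insert b A) = sorted_list_of_set A @ [b]"
    using insert.hyps(1) bA by (simp add: sorted_list_of_set.sorted_key_list_of_set_insert)
  moreover have "above b A = 0"
  proof -
    have "{j \<in> A. b < j} = {}" using insert.hyps(2) by fastforce
    then show ?thesis unfolding above_def by (metis card.empty)
  qed
  moreover note bA
  ultimately show ?case using insert.IH by (simp add: cre_single sg_def)
qed simp

text \<open>The Leibniz rule in abstract form, in the shape of the action in
  \<open>exterior_algebra\<close>: the sum over \<open>p\<close> replaces one factor at a
  time.\<close>

lemma foldr_derivation:
  assumes D: "\<And>w u. w \<in> set ws \<Longrightarrow> finkeys u \<Longrightarrow> D (g w u) = g w (D u) + g (X w) u"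
    and g: "\<And>w u v. g w (u + v) = g w u + g w v" "\<And>w. g w 0 = 0"
    and fin: "\<And>w u. finkeys u \<Longrightarrow> finkeys (g w u)" and v: "finkeys v"
  shows "D (foldr g ws v) = foldr g ws (D v) + (\<Sum>p<length ws. foldr g (ws[p := X (ws ! p)]) v)"
  using D
proof (induction ws)
  case (Cons w ws)
  have f: "finkeys (foldr g ws v)" by (induction ws) (auto simp: v fin)
  have gs: "g w (sum f A) = (\<Sum>x\<in>A. g w (f x))" for f :: "nat \<Rightarrow> _" and A
    by (induction A rule: infinite_finite_induct) (auto simp: g)
  have "D (foldr g (w # ws) v) = g w (D (foldr g ws v)) + g (X w) (foldr g ws v)"
    using Cons.prems f by simp
  also have "D (foldr g ws v) = foldr g ws (D v) + (\<Sum>p<length ws. foldr g (ws[p := X (ws ! p)]) v)"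
    using Cons by simp
  finally show ?case
    by (simp add: g gs sum.lessThan_Suc_shift ac_simps del: sum.lessThan_Suc)
qed simp

lemma wedge_eq: "wedge M n b w u = (\<Sum>i<n. cscale (module.representation (mscl M) (b ` {..<n}) w (b i)) (cre i u))"
  by (simp add: wedge_def linear_extension_wedge)

lemma linear_extension_single: "linear_extension f (single J c) = cscale c (f J)"
  by (cases "c = 0") (simp_all add: linear_extension_def)

text \<open>\<open>dgam\<close> is a derivation that kills \<open>single {} 1\<close>, and
  \<open>single J 1\<close> is the descending product of its basis vectors, so the Leibniz rule
  reproduces the defining formula of the action.\<close>

lemma exterior_act_single:
  assumes vs: "vector_space (mscl M)" and b: "basis_of (mscl M) W {..<n} (b :: nat \<Rightarrow> 'm::ab_group_add)"
    and J: "J \<subseteq> {..<n}"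
  shows "act (exterior_algebra M n b) x (single J 1) =
    dgam (*) {..<n} (\<lambda>j i. module.representation (mscl M) (b ` {..<n}) (act M x (b i)) (b j)) (single J 1)"
proof -
  interpret vector_space "mscl M" by fact
  let ?A = "\<lambda>j i. representation (b ` {..<n}) (act M x (b i)) (b j)"
  let ?D = "dgam (*) {..<n} ?A"
  have ind: "independent (b ` {..<n})" and inj: "inj_on b {..<n}" using b by (auto simp: basis_of_def)
  have fJ: "finite J" using J finite_subset by blast
  define js where "js = rev (sorted_list_of_set J)"
  have js: "set js \<subseteq> {..<n}" using J fJ by (simp add: js_def)
  have wb: "wedge M n b (b i) u = cre i u" if "i < n" for i u
  proof -
    have "representation (b ` {..<n}) (b i) (b j) = (if j = i then 1 else 0)" if "j < n" for j
      using representation_basis[OF ind, of "b i"] \<open>i < n\<close> that inj by (auto simp: inj_on_def)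
    then have "wedge M n b (b i) u = (\<Sum>j<n. cscale (if j = i then 1 else 0) (cre j u))"
      by (simp add: wedge_eq)
    also have "\<dots> = (\<Sum>j<n. if j = i then cre j u else 0)" by (rule sum.cong) auto
    finally show ?thesis using that by simp
  qed
  have fold: "foldr (wedge M n b) (map b js) v = foldr cre js v" for v
    using js by (induction js) (auto simp: wb)
  have "?D (foldr (wedge M n b) (map b js) (single {} 1)) =
      foldr (wedge M n b) (map b js) (?D (single {} 1)) +
      (\<Sum>p<length (map b js). foldr (wedge M n b) ((map b js)[p := act M x (map b js ! p)]) (single {} 1))"
  proof (rule foldr_derivation)
    fix w and u :: "nat set \<Rightarrow>\<^sub>0 complex" assume w: "w \<in> set (map b js)" and u: "finkeys u"
    then obtain i where i: "i < n" "w = b i" using js by auto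
    show "?D (wedge M n b w u) = wedge M n b w (?D u) + wedge M n b (act M x w) u"
      using i dgam_cre[OF vector_space_complex _ u, of "{..<n}" ?A i]
      by (simp add: wb) (simp add: wedge_eq cscale_def)
  qed (auto simp: wedge_eq cre_add cscale_add sum.distrib finkeys_sum finkeys_cscale finkeys_cre finkeys_def[of "single _ _"])
  moreover have "?D (single {} 1) = 0" by (rule dgam_0_if) auto
  moreover have "foldr (wedge M n b) (map b js) 0 = 0" unfolding fold by (induction js) auto
  moreover have "foldr cre js (single {} 1) = single J (1::complex)"
    unfolding js_def by (rule foldr_cre_sorted[OF fJ])
  then have "foldr (wedge M n b) (map b js) (single {} 1) = single J 1"
    unfolding fold .
  ultimately show ?thesis
    unfolding exterior_algebra_def Let_def js_def[symmetric]
    by (simp add: linear_extension_single flip: js_def) (simp add: js_def)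
qed

subsection \<open>The tensor product as a Fock space\<close>

text \<open>The pair \<open>(k, i)\<close> stands for the \<open>i\<close>-th basis vector of slot
  \<open>k\<close>. All slots together form a single exterior algebra, with the pairs in
  lexicographic order.\<close>

definition slot_op :: "(complex \<Rightarrow> 's \<Rightarrow> 's) \<Rightarrow> nat \<Rightarrow> (nat \<Rightarrow> nat \<Rightarrow> complex) \<Rightarrow> nat \<Rightarrow>
    ((nat \<times> nat) set \<Rightarrow>\<^sub>0 's::ab_group_add) \<Rightarrow> ((nat \<times> nat) set \<Rightarrow>\<^sub>0 's)" where
  "slot_op s n a k = dgam s ({k} \<times> {..<n}) (\<lambda>p q. a (snd p) (snd q))"

text \<open>All slot operators outside this set kill \<open>u\<close>, so on a vector with finite
  keys the sum over all slots is finite.\<close>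

definition slots :: "((nat \<times> nat) set \<Rightarrow>\<^sub>0 's::zero) \<Rightarrow> nat set" where
  "slots u = fst ` \<Union> (keys u)"

text \<open>The tensor product of \<open>S\<close> with one exterior algebra on \<open>n\<close> basis vectors for each slot
  \<open>k \<ge> 1\<close>, where \<open>a x k\<close> is the matrix of \<open>x\<close> on the \<open>k\<close>-th space.\<close>

definition fock_module :: "('l, 's::ab_group_add) lie_mod \<Rightarrow> nat \<Rightarrow> ('l \<Rightarrow> nat \<Rightarrow> nat \<Rightarrow> nat \<Rightarrow> complex) \<Rightarrow>
    ('l, (nat \<times> nat) set \<Rightarrow>\<^sub>0 's) lie_mod" where
  "fock_module S n a =
     \<lparr>mcar = {u. \<forall>K. lookup u K \<in> mcar S \<and>
        (lookup u K \<noteq> 0 \<longrightarrow> finite K \<and> K \<subseteq> {1..} \<times> {..<n})},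
      mscl = (\<lambda>c. pmap (mscl S c)),
      act = (\<lambda>x u. pmap (act S x) u + Sum_any (\<lambda>k. slot_op (mscl S) n (a x k) k u))\<rparr>"

lemma fock_module_simps:
  "u \<in> mcar (fock_module S n a) \<longleftrightarrow> (\<forall>K. lookup u K \<in> mcar S \<and>
        (lookup u K \<noteq> 0 \<longrightarrow> finite K \<and> K \<subseteq> {1..} \<times> {..<n}))"
  "mscl (fock_module S n a) = (\<lambda>c. pmap (mscl S c))"
  "act (fock_module S n a) x u = pmap (act S x) u + Sum_any (\<lambda>k. slot_op (mscl S) n (a x k) k u)"
  by (simp_all add: fock_module_def)

lemma fock_key:
  assumes "u \<in> mcar (fock_module S n a)" "lookup u K \<noteq> 0"
  shows "finite K" "K \<subseteq> {1..} \<times> {..<n}"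
  using assms by (simp_all add: fock_module_simps)

lemma slot_op_0: "k \<notin> slots u \<Longrightarrow> slot_op s n A k u = 0"
  unfolding slot_op_def by (rule dgam_0_if) (force simp: slots_def)

lemma finite_slots: "finkeys u \<Longrightarrow> finite (slots u)"
  by (auto simp: slots_def finkeys_def)

lemma Sum_slot_op:
  assumes "finite F" "slots u \<subseteq> F"
  shows "Sum_any (\<lambda>k. slot_op s n (A k) k u) = (\<Sum>k\<in>F. slot_op s n (A k) k u)"
  by (rule Sum_any.expand_superset[OF assms(1)]) (use slot_op_0[of _ u] assms(2) in blast)

lemma slots_add: "slots (u + v) \<subseteq> slots u \<union> slots v"
  using keys_add[of u v] unfolding slots_def by blast

lemma slots_pmap: "slots (pmap f u) \<subseteq> slots u"
  using keys_pmap_subset[of f u] by (auto simp: slots_def)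

lemma fock_finkeys: "u \<in> mcar (fock_module S n a) \<Longrightarrow> finkeys u"
  by (auto simp: fock_module_simps finkeys_def in_keys_iff)

lemma fock_module_subspace:
  assumes "op_module L S"
  shows "module.subspace (\<lambda>c. pmap (mscl S c)) (mcar (fock_module S n a))"
proof (rule subspaceI[OF vector_space_pmap[OF op_moduleD(1)[OF assms]]])
  note vs = op_moduleD(1)[OF assms]
  let ?W = "mcar (fock_module S n a)"
  show "0 \<in> ?W" by (simp add: fock_module_simps om_zero[OF assms])
  show "u + v \<in> ?W" if u: "u \<in> ?W" and v: "v \<in> ?W" for u v
    unfolding fock_module_simps
  proof (intro allI conjI impI)
    fix K
    show "lookup (u + v) K \<in> mcar S"
      using u v by (simp add: fock_module_simps lookup_add om_add[OF assms])
    assume "lookup (u + v) K \<noteq> 0"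
    then have "lookup u K \<noteq> 0 \<or> lookup v K \<noteq> 0" by (auto simp: lookup_add)
    then show "finite K" "K \<subseteq> {1..} \<times> {..<n}" using fock_key[OF u] fock_key[OF v] by metis+
  qed
  show "pmap (mscl S c) u \<in> ?W" if u: "u \<in> ?W" for u c
  proof -
    have "mscl S c t \<noteq> 0 \<Longrightarrow> t \<noteq> 0" for t using vs_zero_right[OF vs] by auto
    then show ?thesis
      using u by (simp add: fock_module_simps lookup_pmap vs_zero_right[OF vs] om_scale[OF assms])
  qed
qed

lemma sg_mem: "op_module L S \<Longrightarrow> t \<in> mcar S \<Longrightarrow> sg m t \<in> mcar S"
  by (auto simp: sg_def om_neg)

lemma fock_cre:
  assumes S: "op_module L S" and u: "u \<in> mcar (fock_module S n a)" and "k \<ge> 1" "j < n"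
  shows "cre (k, j) u \<in> mcar (fock_module S n a)"
  unfolding fock_module_simps
proof (intro allI conjI impI)
  fix K
  show "lookup (cre (k, j) u) K \<in> mcar S"
    using u om_zero[OF S] sg_mem[OF S] by (simp add: cre.rep_eq fock_module_simps)
  assume "lookup (cre (k, j) u) K \<noteq> 0"
  then have K: "(k, j) \<in> K" "lookup u (K - {(k, j)}) \<noteq> 0" by (auto simp: cre.rep_eq split: if_splits)
  then have "finite (K - {(k, j)})" "K - {(k, j)} \<subseteq> {1..} \<times> {..<n}" using fock_key[OF u K(2)] by simp_all
  then show "finite K" "K \<subseteq> {1..} \<times> {..<n}" using assms(3,4) by auto
qed

lemma fock_ann:
  assumes S: "op_module L S" and u: "u \<in> mcar (fock_module S n a)"
  shows "ann p u \<in> mcar (fock_module S n a)"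
  unfolding fock_module_simps
proof (intro allI conjI impI)
  fix K
  show "lookup (ann p u) K \<in> mcar S"
    using u om_zero[OF S] sg_mem[OF S] by (simp add: ann.rep_eq fock_module_simps)
  assume "lookup (ann p u) K \<noteq> 0"
  then have K: "lookup u (insert p K) \<noteq> 0" by (auto simp: ann.rep_eq split: if_splits)
  then have "finite (insert p K)" "insert p K \<subseteq> {1..} \<times> {..<n}" using fock_key[OF u K] by simp_all
  then show "finite K" "K \<subseteq> {1..} \<times> {..<n}" by auto
qed

lemma fock_pmap:
  assumes u: "u \<in> mcar (fock_module S n a)" and "f 0 = 0" "\<And>t. t \<in> mcar S \<Longrightarrow> f t \<in> mcar S'"
  shows "pmap f u \<in> mcar (fock_module S' n a')"
proof -
  have "f t \<noteq> 0 \<Longrightarrow> t \<noteq> 0" for t using assms(2) by auto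
  then show ?thesis using u assms(2,3) by (simp add: fock_module_simps lookup_pmap)
qed

lemma fock_slot_op:
  assumes S: "op_module L S" and u: "u \<in> mcar (fock_module S n a)"
  shows "slot_op (mscl S) n A k u \<in> mcar (fock_module S n a)"
proof (cases "k \<ge> 1")
  case True
  note sub = vector_space_pmap[OF op_moduleD(1)[OF S]] fock_module_subspace[OF S, of n a]
  show ?thesis
    unfolding slot_op_def dgam_def
    by (intro subspace_sum[OF sub] subspace_scale[OF sub]) (auto intro!: fock_cre[OF S] fock_ann[OF S] u True)
next
  case False
  have "k \<notin> slots u"
    using u False by (force simp: slots_def in_keys_iff fock_module_simps)
  then show ?thesis using slot_op_0 subspace_0[OF vector_space_pmap[OF op_moduleD(1)[OF S]] fock_module_subspace[OF S]] by metis
qed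

lemma slot_op_add: "vector_space s \<Longrightarrow> slot_op s n A k (u + v) = slot_op s n A k u + slot_op s n A k v"
  and slot_op_scale: "vector_space s \<Longrightarrow> slot_op s n A k (pmap (s c) u) = pmap (s c) (slot_op s n A k u)"
  by (simp_all add: slot_op_def dgam_add dgam_scale)

lemma op_module_fock:
  assumes S: "op_module L S"
  shows "op_module L (fock_module S n a)"
  unfolding op_module_def
proof (intro conjI ballI)
  note vs = op_moduleD(1)[OF S]
  note vp = vector_space_pmap[OF vs]
  let ?W = "mcar (fock_module S n a)"
  show "vector_space (mscl (fock_module S n a))" by (simp add: fock_module_simps vp)
  show sub: "module.subspace (mscl (fock_module S n a)) ?W"
    unfolding fock_module_simps by (rule fock_module_subspace[OF S])
  fix x assume x: "x \<in> lcar L"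
  have x0: "act S x 0 = 0" by (rule om_act_0[OF S x])
  show "act (fock_module S n a) x u \<in> ?W" if u: "u \<in> ?W" for u
  proof -
    have "(\<Sum>k\<in>slots u. slot_op (mscl S) n (a x k) k u) \<in> ?W"
      by (rule subspace_sum[OF vp fock_module_subspace[OF S]]) (rule fock_slot_op[OF S u])
    moreover have "pmap (act S x) u \<in> ?W"
      by (rule fock_pmap[where f = "act S x", OF u x0]) (rule op_moduleD(3)[OF S x])
    ultimately show ?thesis
      unfolding fock_module_simps(3) Sum_slot_op[OF finite_slots[OF fock_finkeys[OF u]] order_refl]
      by (intro subspace_add[OF vp fock_module_subspace[OF S]])
  qed
  show "linear_on (mscl (fock_module S n a)) (mscl (fock_module S n a)) ?W (act (fock_module S n a) x)"
    unfolding linear_on_def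
  proof (intro conjI ballI allI)
    fix u v assume u: "u \<in> ?W" and v: "v \<in> ?W"
    let ?F = "slots u \<union> slots v"
    have F: "finite ?F" using finite_slots fock_finkeys u v by blast
    have "pmap (act S x) (u + v) = pmap (act S x) u + pmap (act S x) v"
      by (rule poly_mapping_eqI) (use u v in \<open>simp add: lookup_pmap x0 lookup_add om_act_add[OF S x] fock_module_simps\<close>)
    then show "act (fock_module S n a) x (u + v) = act (fock_module S n a) x u + act (fock_module S n a) x v"
      unfolding fock_module_simps Sum_slot_op[OF F slots_add] Sum_slot_op[OF F Un_upper1] Sum_slot_op[OF F Un_upper2]
      by (simp add: slot_op_add[OF vs] sum.distrib)
  next
    fix c u assume u: "u \<in> ?W"
    have F: "finite (slots u)" using finite_slots fock_finkeys u by blast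
    have "pmap (act S x) (pmap (mscl S c) u) = pmap (mscl S c) (pmap (act S x) u)"
      by (rule poly_mapping_eqI) (use u in \<open>simp add: lookup_pmap x0 vs_zero_right[OF vs] om_act_scale[OF S x] fock_module_simps\<close>)
    then show "act (fock_module S n a) x (mscl (fock_module S n a) c u) = mscl (fock_module S n a) c (act (fock_module S n a) x u)"
      unfolding fock_module_simps Sum_slot_op[OF F slots_pmap] Sum_slot_op[OF F order_refl]
      by (simp add: slot_op_scale[OF vs] vs_add[OF vp] vs_sum[OF vp])
  qed
qed

text \<open>Functoriality of the Fock construction in the coefficient module; it carries the
  splitting of the spin module into copies over to the Fock space.\<close>

lemma mod_hom_fock:
  assumes S: "op_module L S" and S': "op_module L S'" and g: "mod_hom L S S' g"
  shows "mod_hom L (fock_module S n a) (fock_module S' n a) (pmap g)"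
proof -
  let ?W = "mcar (fock_module S n a)"
  note vs = op_moduleD(1)[OF S] and vs' = op_moduleD(1)[OF S']
  have g0: "g 0 = 0" by (rule mod_hom_0[OF g S S'])
  have add: "pmap g (u + v) = pmap g u + pmap g v" if "u \<in> ?W" "v \<in> ?W" for u v
    by (rule poly_mapping_eqI) (use that in \<open>simp add: lookup_pmap g0 lookup_add mod_hom_add[OF g] fock_module_simps\<close>)
  have scale: "pmap g (pmap (mscl S c) u) = pmap (mscl S' c) (pmap g u)" if "u \<in> ?W" for c u
    by (rule poly_mapping_eqI)
       (use that in \<open>simp add: lookup_pmap g0 vs_zero_right[OF vs] vs_zero_right[OF vs'] mod_hom_scale[OF g] fock_module_simps\<close>)
  note sub = vector_space_pmap[OF vs] fock_module_subspace[OF S]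
  have sum: "pmap g (sum f F) = (\<Sum>i\<in>F. pmap g (f i))" if "finite F" "\<And>i. i \<in> F \<Longrightarrow> f i \<in> ?W" for F f
    using that
  proof (induction F rule: finite_induct)
    case empty
    show ?case by (rule poly_mapping_eqI) (simp add: lookup_pmap g0)
  next
    case (insert i F)
    then have "sum f F \<in> ?W" using subspace_sum[OF sub] by blast
    then show ?case using insert add by simp
  qed
  have slot: "pmap g (slot_op (mscl S) n A k u) = slot_op (mscl S') n A k (pmap g u)" if u: "u \<in> ?W" for A k u
  proof (cases "k \<ge> 1")
    case True
    have c: "cre (k, j) (ann q u) \<in> ?W" if "j < n" for j q by (rule fock_cre[OF S fock_ann[OF S u] True that])
    have cs: "pmap (mscl S c) (cre (k, j) (ann q u)) \<in> ?W" if "j < n" for j q c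
      by (rule subspace_scale[OF sub]) (rule c[OF that])
    \<comment> \<open>\<open>g\<close> is additive on the carrier only, but compatibility with signs
      on the occurring coefficients is all that \<open>cre\<close> and \<open>ann\<close>
      require.\<close>
    have neg: "g (- lookup v K) = - g (lookup v K)" if "v \<in> ?W" for v K
      using mod_hom_neg[OF g S S'] that by (simp add: fock_module_simps)
    have e: "pmap g (cre (k, j) (ann q u)) = cre (k, j) (ann q (pmap g u))" for j q
      using pmap_cre[of g, OF g0 neg[OF fock_ann[OF S u]]] pmap_ann[of g, OF g0 neg[OF u]] by metis
    have "pmap g (slot_op (mscl S) n A k u) =
      (\<Sum>p\<in>{k} \<times> {..<n}. \<Sum>q\<in>{k} \<times> {..<n}. pmap g (pmap (mscl S (A (snd q) (snd p))) (cre q (ann p u))))"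
      unfolding slot_op_def dgam_def
      by (subst sum) (auto intro!: subspace_sum[OF sub] cs sum sum.cong)
    also have "\<dots> = slot_op (mscl S') n A k (pmap g u)"
      unfolding slot_op_def dgam_def by (intro sum.cong refl) (auto simp: scale c e)
    finally show ?thesis .
  next
    case False
    have "k \<notin> slots u" using u False by (force simp: slots_def in_keys_iff fock_module_simps)
    then have "k \<notin> slots u" "k \<notin> slots (pmap g u)" using slots_pmap[of g u] by auto
    then show ?thesis by (simp add: slot_op_0)
  qed
  show ?thesis
    unfolding mod_hom_def linear_on_def
  proof (intro conjI ballI allI)
    show "pmap g u \<in> mcar (fock_module S' n a)" if "u \<in> ?W" for u
      by (rule fock_pmap[where f = g, OF that g0]) (rule mod_homD(1)[OF g])
    show "pmap g (act (fock_module S n a) x u) = act (fock_module S' n a) x (pmap g u)"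
      if x: "x \<in> lcar L" and u: "u \<in> ?W" for x u
    proof -
      have F: "finite (slots u)" using finite_slots fock_finkeys u by blast
      have m: "pmap (act S x) u \<in> ?W" by (rule fock_pmap[where f = "act S x", OF u om_act_0[OF S x]]) (rule op_moduleD(3)[OF S x])
      have s: "(\<Sum>k\<in>slots u. slot_op (mscl S) n (a x k) k u) \<in> ?W"
        by (rule subspace_sum[OF sub]) (rule fock_slot_op[OF S u])
      have e: "pmap g (pmap (act S x) u) = pmap (act S' x) (pmap g u)"
        by (rule poly_mapping_eqI)
           (use u in \<open>simp add: lookup_pmap g0 om_act_0[OF S x] om_act_0[OF S' x] mod_homD(3)[OF g x] fock_module_simps\<close>)
      show ?thesis
        unfolding fock_module_simps Sum_slot_op[OF F order_refl] Sum_slot_op[OF F slots_pmap]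
        by (simp add: add[OF m s] e sum[OF F fock_slot_op[OF S u]] slot[OF u])
    qed
  qed (simp_all add: add scale fock_module_simps(2))
qed

text \<open>The coordinate projections \<open>p i\<close> and inclusions \<open>j i\<close> of the
  copies are applied to the coefficients; the relations between them persist
  coefficientwise.\<close>

lemma fock_copies:
  assumes S: "op_module L S" and W: "op_module L W" and iso: "module_iso L W (copies m S)"
  shows "module_iso L (fock_module W n a) (copies m (fock_module S n a))"
proof -
  note CS = op_module_copies[OF S, of m]
  note FS = op_module_fock[OF S, of n a] and FW = op_module_fock[OF W, of n a]
  note CF = op_module_copies[OF FS, of m]
  obtain F where F: "mod_hom L W (copies m S) F" "bij_betw F (mcar W) (mcar (copies m S))"
    using iso by (auto simp: module_iso_iff)
  let ?G = "inv_into (mcar W) F"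
  have G: "mod_hom L (copies m S) W ?G" by (rule mod_hom_inv[OF F W])
  define p where "p i w = lookup (F w) i" for i w
  define j where "j i t = ?G (single i t)" for i t
  have p: "mod_hom L W S (p i)" for i unfolding p_def by (rule mod_hom_comp[OF F(1) mod_hom_copies_lookup[OF S]])
  have j: "mod_hom L S W (j i)" if "i < m" for i unfolding j_def by (rule mod_hom_comp[OF mod_hom_copies_single[OF S that] G])
  have p0: "p i 0 = 0" for i by (rule mod_hom_0[OF p W S])
  have j0: "j i 0 = 0" if "i < m" for i by (rule mod_hom_0[OF j[OF that] S W])
  have pj: "p i (\<Sum>l<m. j l (t l)) = t i" if tS: "\<And>l. l < m \<Longrightarrow> t l \<in> mcar S" and im: "i < m" for i t
  proof -
    have sC: "single l (t l) \<in> mcar (copies m S)" if "l < m" for l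
      by (rule mod_homD(1)[OF mod_hom_copies_single[OF S that] tS[OF that]])
    have "(\<Sum>l<m. j l (t l)) = ?G (\<Sum>l<m. single l (t l))"
      unfolding j_def by (rule mod_hom_sum[OF G CS W, symmetric]) (use sC in auto)
    moreover have "(\<Sum>l<m. single l (t l)) \<in> mcar (copies m S)"
      by (rule om_sum[OF CS]) (use sC in auto)
    ultimately have "p i (\<Sum>l<m. j l (t l)) = lookup (\<Sum>l<m. single l (t l)) i"
      unfolding p_def using bij_betw_inv_into_right[OF F(2)] by simp
    then show ?thesis using im by (simp add: lookup_sum lookup_single when_def)
  qed
  have jp: "(\<Sum>l<m. j l (p l w)) = w" if w: "w \<in> mcar W" for w
  proof -
    have Fw: "F w \<in> mcar (copies m S)" by (rule mod_homD(1)[OF F(1) w])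
    have "single l (p l w) \<in> mcar (copies m S)" if "l < m" for l
      by (rule mod_homD(1)[OF mod_hom_copies_single[OF S that]]) (rule mod_homD(1)[OF p w])
    then have "(\<Sum>l<m. j l (p l w)) = ?G (\<Sum>l<m. single l (p l w))"
      unfolding j_def by (intro mod_hom_sum[OF G CS W, symmetric]) auto
    then show ?thesis unfolding p_def using copies_sum[OF Fw] bij_betw_inv_into_left[OF F(2) w] by simp
  qed
  define A where "A u = (\<Sum>i<m. single i (pmap (p i) u))" for u :: "(nat \<times> nat) set \<Rightarrow>\<^sub>0 'c"
  define B where "B v = (\<Sum>i<m. pmap (j i) (lookup v i))"
    for v :: "nat \<Rightarrow>\<^sub>0 (nat \<times> nat) set \<Rightarrow>\<^sub>0 'b"
  have lA: "lookup (A u) i = (if i < m then pmap (p i) u else 0)" for u i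
    by (auto simp: A_def lookup_sum lookup_single when_def)
  have homsum: "mod_hom L M N (\<lambda>u. \<Sum>i\<in>X. f i u)" if "op_module L N" "finite X" "\<And>i. i \<in> X \<Longrightarrow> mod_hom L M N (f i)"
    for M :: "('a, 'x::ab_group_add) lie_mod" and N :: "('a, 'y::ab_group_add) lie_mod" and X :: "nat set" and f
    using that(2,3)
  proof (induction X rule: finite_induct)
    case empty
    show ?case
      using om_zero[OF that(1)] om_act_0[OF that(1)] vs_zero_right[OF op_moduleD(1)[OF that(1)]]
      by (simp add: mod_hom_def linear_on_def)
  next
    case (insert i X)
    then show ?case using mod_hom_plus[OF _ _ that(1), of M "f i" "\<lambda>u. \<Sum>i\<in>X. f i u"] by simp
  qed
  have A: "mod_hom L (fock_module W n a) (copies m (fock_module S n a)) A"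
    unfolding A_def
    by (rule homsum[OF CF], simp, rule mod_hom_comp[OF mod_hom_fock[OF W S p]], rule mod_hom_copies_single[OF FS]) simp
  have B: "mod_hom L (copies m (fock_module S n a)) (fock_module W n a) B"
    unfolding B_def
    by (rule homsum[OF FW], simp, rule mod_hom_comp[OF mod_hom_copies_lookup[OF FS]], rule mod_hom_fock[OF S W j]) simp
  have BA: "B (A u) = u" if u: "u \<in> mcar (fock_module W n a)" for u
  proof (rule poly_mapping_eqI)
    fix K
    have "lookup (B (A u)) K = (\<Sum>i<m. j i (p i (lookup u K)))"
      unfolding B_def by (simp add: lookup_sum lA lookup_pmap p0 j0)
    then show "lookup (B (A u)) K = lookup u K"
      using jp u by (simp add: fock_module_simps)
  qed
  have AB: "A (B v) = v" if v: "v \<in> mcar (copies m (fock_module S n a))" for v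
  proof (rule poly_mapping_eqI)
    fix i
    show "lookup (A (B v)) i = lookup v i"
    proof (cases "i < m")
      case True
      have "pmap (p i) (B v) = lookup v i"
      proof (rule poly_mapping_eqI)
        fix K
        have vS: "lookup (lookup v l) K \<in> mcar S" for l
          using v by (simp add: copies_simps fock_module_simps)
        have "lookup (pmap (p i) (B v)) K =
            p i (\<Sum>l<m. j l (lookup (lookup v l) K))"
          by (simp add: lookup_pmap p0 B_def lookup_sum j0)
        also have "\<dots> = lookup (lookup v i) K" by (rule pj[OF vS True])
        finally show "lookup (pmap (p i) (B v)) K = lookup (lookup v i) K" .
      qed
      then show ?thesis using True lA by simp
    next
      case False
      then show ?thesis using v lA by (auto simp: copies_simps in_keys_iff)
    qed
  qed
  have "bij_betw A (mcar (fock_module W n a)) (mcar (copies m (fock_module S n a)))"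
    by (rule bij_betw_byWitness[where f' = B]) (use BA AB mod_homD(1)[OF A] mod_homD(1)[OF B] in auto)
  then show ?thesis using A by (auto simp: module_iso_iff)
qed

section \<open>From families of index sets to sets of index pairs\<close>

definition flat :: "(nat \<Rightarrow> nat set) \<Rightarrow> (nat \<times> nat) set" where
  "flat J = {(k, i). i \<in> J k}"

definition unflat :: "(nat \<times> nat) set \<Rightarrow> nat \<Rightarrow> nat set" where
  "unflat K k = {i. (k, i) \<in> K}"

lemma flat_unflat [simp]: "flat (unflat K) = K" and unflat_flat [simp]: "unflat (flat J) = J"
  by (auto simp: flat_def unflat_def)

lemma inj_flat: "inj flat" and inj_unflat: "inj unflat"
  by (metis injI unflat_flat) (metis injI flat_unflat)

lemma lookup_map_key: "inj f \<Longrightarrow> lookup (Poly_Mapping.map_key f u) k = lookup u (f k)"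
  by (simp add: Poly_Mapping.map_key.rep_eq)

lemma map_key_unflat_single: "Poly_Mapping.map_key unflat (single J t) = single (flat J) t"
  using map_key_single[OF inj_unflat, of "flat J" t] by simp

lemma map_key_unflat_add: "Poly_Mapping.map_key unflat (u + v) = Poly_Mapping.map_key unflat u + Poly_Mapping.map_key unflat v"
  by (rule poly_mapping_eqI) (simp add: lookup_map_key[OF inj_unflat] lookup_add)

lemma map_key_unflat_0: "Poly_Mapping.map_key unflat 0 = 0"
  by (rule poly_mapping_eqI) (simp add: lookup_map_key[OF inj_unflat])

lemma map_key_unflat_sum: "Poly_Mapping.map_key unflat (sum f A) = (\<Sum>x\<in>A. Poly_Mapping.map_key unflat (f x))"
  by (induction A rule: infinite_finite_induct) (auto simp: map_key_unflat_0 map_key_unflat_add)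

lemma flat_finite: "finite (flat J) \<Longrightarrow> finite (J k)"
proof -
  assume "finite (flat J)"
  then have "finite (snd ` flat J)" by simp
  then show ?thesis by (rule rev_finite_subset) (force simp: flat_def)
qed

text \<open>Lexicographically, the pairs above \<open>(k, i)\<close> are those above
  \<open>i\<close> in slot \<open>k\<close> together with all pairs of later slots.\<close>

lemma above_flat:
  assumes "finite (flat J)"
  shows "above (k, i) (flat J) = above i (J k) + card {p \<in> flat J. fst p > k}"
proof -
  have "{p \<in> flat J. (k, i) < p} = Pair k ` {m \<in> J k. i < m} \<union> {p \<in> flat J. fst p > k}"
    by (auto simp: flat_def less_prod_def')
  moreover have "card (Pair k ` {m \<in> J k. i < m} \<union> {p \<in> flat J. fst p > k}) =
      card (Pair k ` {m \<in> J k. i < m}) + card {p \<in> flat J. fst p > k}"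
    using assms flat_finite[OF assms, of k] by (intro card_Un_disjoint) auto
  ultimately show ?thesis unfolding above_def by (simp add: card_image inj_on_def)
qed

text \<open>The signs from the slots beyond \<open>k\<close> occur twice and cancel.\<close>

lemma slot_op_single:
  assumes s: "vector_space s" and J: "finite (flat J)"
  shows "slot_op s n A k (single (flat J) t) =
    (let v = dgam (*) {..<n} A (single (J k) 1)
     in \<Sum>K\<in>keys v. single (flat (J(k := K))) (s (lookup v K) t))"
proof -
  \<comment> \<open>\<open>\<iota>\<close> inserts a vector of the exterior algebra of slot
    \<open>k\<close> into the tensor whose other slots are those of \<open>J\<close>.\<close>
  define \<iota> where "\<iota> w = (\<Sum>K\<in>keys w. single (flat (J(k := K))) (s (lookup w K) t))"
    for w :: "nat set \<Rightarrow>\<^sub>0 complex"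
  have \<iota>: "\<iota> w = (\<Sum>K\<in>X. single (flat (J(k := K))) (s (lookup w K) t))"
    if "finite X" "keys w \<subseteq> X" for w X
    unfolding \<iota>_def by (rule sum.mono_neutral_left[OF that]) (auto simp: in_keys_iff vs_zero[OF s])
  have add: "\<iota> (u + v) = \<iota> u + \<iota> v" for u v
  proof -
    let ?X = "keys u \<union> keys v"
    show ?thesis
      using \<iota>[of ?X "u + v"] \<iota>[of ?X u] \<iota>[of ?X v] keys_add[of u v]
      by (simp add: lookup_add vs_add_left[OF s] single_add sum.distrib)
  qed
  have z: "\<iota> 0 = 0" by (simp add: \<iota>_def)
  have sum: "\<iota> (sum f X) = (\<Sum>x\<in>X. \<iota> (f x))" for f :: "nat \<Rightarrow> _" and X
    by (induction X rule: infinite_finite_induct) (auto simp: z add)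
  have single: "\<iota> (single K c) = single (flat (J(k := K))) (s c t)" for K c
    using \<iota>[of "{K}" "single K c"] by simp
  have trm: "\<iota> (cscale a (cre j (ann i (single (J k) 1)))) =
      pmap (s a) (cre (k, j) (ann (k, i) (single (flat J) t)))" for a i j
  proof (cases "i \<in> J k \<and> j \<notin> J k - {i}")
    case True
    let ?J = "J(k := J k - {i})" and ?R = "card {p \<in> flat J. fst p > k}"
    have e: "flat J - {(k, i)} = flat ?J" "insert (k, j) (flat ?J) = flat (J(k := insert j (J k - {i})))"
      by (auto simp: flat_def split: if_splits)
    have fin: "finite (flat ?J)" using J by (simp flip: e(1))
    have R: "card {p \<in> flat ?J. fst p > k} = ?R"
      by (rule arg_cong[of _ _ card]) (auto simp: flat_def split: if_splits)
    have 1: "(k, i) \<in> flat J" "(k, j) \<notin> flat ?J" using True by (auto simp: flat_def)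
    have "pmap (s a) (cre (k, j) (ann (k, i) (single (flat J) t))) =
        single (flat (J(k := insert j (J k - {i}))))
          (s a (sg (above (k, j) (flat ?J)) (sg (above (k, i) (flat J)) t)))"
      using 1 by (simp add: ann_single cre_single e pmap_single[where f = "s a", OF vs_zero_right[OF s]])
    also have "sg (above (k, j) (flat ?J)) (sg (above (k, i) (flat J)) t) =
        sg (above j (J k - {i})) (sg (above i (J k)) t)"
      unfolding above_flat[OF J] above_flat[OF fin] R by (auto simp: sg_def)
    also have "s a (sg (above j (J k - {i})) (sg (above i (J k)) t)) =
        s (a * sg (above j (J k - {i})) (sg (above i (J k)) 1)) t"
      by (auto simp: sg_def vs_neg[OF s] vs_neg_right[OF s])
    finally have r: "pmap (s a) (cre (k, j) (ann (k, i) (single (flat J) t))) =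
        single (flat (J(k := insert j (J k - {i}))))
          (s (a * sg (above j (J k - {i})) (sg (above i (J k)) 1)) t)" .
    have "cre j (ann i (single (J k) (1::complex))) =
        single (insert j (J k - {i})) (sg (above j (J k - {i})) (sg (above i (J k)) 1))"
      using True by (auto simp: ann_single cre_single)
    then show ?thesis unfolding r by (simp only: cscale_single single)
  next
    case False
    have "cre j (ann i (single (J k) (1::complex))) = 0"
      using False by (auto simp: ann_single cre_single)
    moreover have "cre (k, j) (ann (k, i) (single (flat J) t)) = 0"
      using False by (auto simp: ann_single cre_single flat_def)
    ultimately show ?thesis by (simp add: z)
  qed
  have "slot_op s n A k (single (flat J) t) =
      (\<Sum>i<n. \<Sum>j<n. pmap (s (A j i)) (cre (k, j) (ann (k, i) (single (flat J) t))))"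
  proof -
    have "{k} \<times> {..<n} = Pair k ` {..<n}" by auto
    then show ?thesis unfolding slot_op_def dgam_def by (simp add: sum.reindex inj_on_def)
  qed
  also have "\<dots> = \<iota> (dgam (*) {..<n} A (single (J k) 1))"
    unfolding dgam_def sum trm[symmetric] by (simp add: cscale_def)
  finally show ?thesis by (simp add: \<iota>_def Let_def)
qed

text \<open>Relabelling the keys by \<open>flat\<close> identifies the carriers; the actions agree
  because \<open>dgam\<close> on slot \<open>k\<close> is the action on the \<open>k\<close>-th
  exterior algebra.\<close>

lemma infinite_tensor_iso:
  fixes M :: "nat \<Rightarrow> ('l, 'm::ab_group_add) lie_mod" and b :: "nat \<Rightarrow> nat \<Rightarrow> 'm"
    and S :: "('l, 'b::ab_group_add) lie_mod"
  assumes S: "op_module L S"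
    and vsM: "\<And>k. vector_space (mscl (M k))"
    and b: "\<And>k. k \<ge> 1 \<Longrightarrow> basis_of (mscl (M k)) (W k) {..<n} (b k)"
  defines "E \<equiv> \<lambda>k. exterior_algebra (M k) n (b k)"
    and "a \<equiv> \<lambda>x k j i. module.representation (mscl (M k)) (b k ` {..<n}) (act (M k) x (b k i)) (b k j)"
  shows "module_iso L (fock_module S n a) (infinite_tensor S E)"
proof -
  let ?F = "fock_module S n a" and ?T = "infinite_tensor S E"
  let ?g = "Poly_Mapping.map_key flat :: ((nat \<times> nat) set \<Rightarrow>\<^sub>0 'b) \<Rightarrow> _"
  let ?f = "Poly_Mapping.map_key unflat :: ((nat \<Rightarrow> nat set) \<Rightarrow>\<^sub>0 'b) \<Rightarrow> _"
  note vs = op_moduleD(1)[OF S]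
  note lg = lookup_map_key[OF inj_flat] and lf = lookup_map_key[OF inj_unflat]
  have fg: "?f (?g u) = u" and gf: "?g (?f T) = T" for u T
    by (auto intro!: poly_mapping_eqI simp: lg lf)
  have carE: "single K 1 \<in> mcar (E k) \<longleftrightarrow> K \<subseteq> {..<n}" for K k
    by (simp add: E_def exterior_algebra_def)
  have T_iff: "T \<in> mcar ?T \<longleftrightarrow> (\<exists>m. \<forall>J\<in>keys T. lookup T J \<in> mcar S \<and>
      (\<forall>k\<in>{1..m}. J k \<subseteq> {..<n}) \<and> (\<forall>k. k \<notin> {1..m} \<longrightarrow> J k = {}))" for T
    unfolding infinite_tensor_def tensor_stage_def by (auto simp: carE)
  have gT: "?g u \<in> mcar ?T" if u: "u \<in> mcar ?F" for u
  proof -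
    \<comment> \<open>A stage of the direct limit that contains \<open>u\<close>: the largest slot
      occurring in it, or 0 if there is none.\<close>
    define m where "m = Max (insert 0 (slots u))"
    have fin: "finite (slots u)" by (rule finite_slots[OF fock_finkeys[OF u]])
    have "lookup (?g u) J \<in> mcar S \<and> (\<forall>k\<in>{1..m}. J k \<subseteq> {..<n}) \<and> (\<forall>k. k \<notin> {1..m} \<longrightarrow> J k = {})"
      if J: "J \<in> keys (?g u)" for J
    proof -
      have nz: "lookup u (flat J) \<noteq> 0" using J by (simp add: in_keys_iff lg)
      have c: "flat J \<subseteq> {1..} \<times> {..<n}" by (rule fock_key(2)[OF u nz])
      have "k \<in> {1..m}" if "i \<in> J k" for k i
      proof -
        have "(k, i) \<in> flat J" using that by (simp add: flat_def)
        then have "k \<in> slots u" "k \<ge> 1" using nz c by (force simp: slots_def in_keys_iff, auto)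
        then show ?thesis unfolding m_def using fin by simp
      qed
      moreover have "J k \<subseteq> {..<n}" for k using c by (auto simp: flat_def)
      ultimately show ?thesis using u by (auto simp: lg fock_module_simps)
    qed
    then show ?thesis unfolding T_iff by blast
  qed
  have fF: "?f T \<in> mcar ?F" if T: "T \<in> mcar ?T" for T
  proof -
    obtain m where m: "\<And>J. J \<in> keys T \<Longrightarrow> lookup T J \<in> mcar S \<and>
      (\<forall>k\<in>{1..m}. J k \<subseteq> {..<n}) \<and> (\<forall>k. k \<notin> {1..m} \<longrightarrow> J k = {})"
      using T unfolding T_iff by blast
    show ?thesis
      unfolding fock_module_simps lf
    proof (intro allI conjI impI)
      fix K
      show "lookup T (unflat K) \<in> mcar S"
        using m[of "unflat K"] om_zero[OF S] by (cases "unflat K \<in> keys T") (auto simp: in_keys_iff)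
      assume "lookup T (unflat K) \<noteq> 0"
      then have "\<forall>k\<in>{1..m}. unflat K k \<subseteq> {..<n}" "\<forall>k. k \<notin> {1..m} \<longrightarrow> unflat K k = {}"
        using m[of "unflat K"] by (auto simp: in_keys_iff)
      note 1 = this
      have "K \<subseteq> {1..m} \<times> {..<n}"
      proof
        fix p assume p: "p \<in> K"
        then have i: "snd p \<in> unflat K (fst p)" by (simp add: unflat_def)
        then have "fst p \<in> {1..m}" using 1(2) by blast
        then show "p \<in> {1..m} \<times> {..<n}" using 1(1) i by (auto simp: mem_Times_iff)
      qed
      then show "finite K" "K \<subseteq> {1..} \<times> {..<n}" using finite_subset by fastforce+
    qed
  qed
  have eq: "?f (act ?T x T) = act ?F x (?f T)" if x: "x \<in> lcar L" and T: "T \<in> mcar ?T" for x T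
  proof -
    let ?X = "keys T"
    have key: "finite (flat J)" "flat J \<subseteq> {1..} \<times> {..<n}" if "J \<in> ?X" for J
      using fock_key[OF fF[OF T], of "flat J"] that by (auto simp: in_keys_iff lf)
    have trm: "(let v = act (E k) x (single (J k) 1)
           in \<Sum>K\<in>keys v. single (flat (J(k := K)))
                (mscl S (lookup v K) (lookup T J))) =
        slot_op (mscl S) n (a x k) k (single (flat J) (lookup T J))"
      if J: "J \<in> ?X" and k: "J k \<noteq> {}" for J k
    proof -
      have "k \<ge> 1" "J k \<subseteq> {..<n}" using key(2)[OF J] k by (auto simp: flat_def)
      then have "act (E k) x (single (J k) 1) = dgam (*) {..<n} (a x k) (single (J k) 1)"
        unfolding E_def a_def by (intro exterior_act_single[OF vsM b])
      then show ?thesis using slot_op_single[OF vs key(1)[OF J], of n "a x k" k] by simp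
    qed
    define F where "F = slots (?f T)"
    have F: "finite F" unfolding F_def by (rule finite_slots[OF fock_finkeys[OF fF[OF T]]])
    have JF: "{k. J k \<noteq> {}} \<subseteq> F" if "J \<in> ?X" for J
    proof
      fix k assume "k \<in> {k. J k \<noteq> {}}"
      then obtain i where "(k, i) \<in> flat J" by (auto simp: flat_def)
      moreover have "flat J \<in> keys (?f T)" using that by (simp add: in_keys_iff lf)
      ultimately show "k \<in> F" unfolding F_def slots_def by force
    qed
    have fT: "?f T = (\<Sum>J\<in>?X. single (flat J) (lookup T J))"
      using arg_cong[OF poly_mapping_sum_single[of T], of ?f] by (simp add: map_key_unflat_sum map_key_unflat_single)
    have x0: "act S x 0 = 0" by (rule om_act_0[OF S x])
    have mapx: "pmap (act S x) (?f T) = (\<Sum>J\<in>?X. single (flat J) (act S x (lookup T J)))"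
    proof (rule poly_mapping_eqI)
      fix K
      have "flat J = K \<longleftrightarrow> J = unflat K" for J by auto
      then show "lookup (pmap (act S x) (?f T)) K =
        lookup (\<Sum>J\<in>?X. single (flat J) (act S x (lookup T J))) K"
        by (auto simp: lookup_pmap x0 lf lookup_sum lookup_single when_def in_keys_iff)
    qed
    have "?f (act ?T x T) = (\<Sum>J\<in>?X. single (flat J) (act S x (lookup T J)) +
        (\<Sum>k\<in>{k. J k \<noteq> {}}. let v = act (E k) x (single (J k) 1)
           in \<Sum>K\<in>keys v. single (flat (J(k := K)))
                (mscl S (lookup v K) (lookup T J))))"
      by (simp add: infinite_tensor_def map_key_unflat_sum map_key_unflat_add map_key_unflat_single Let_def)
    also have "\<dots> = pmap (act S x) (?f T) +
        (\<Sum>J\<in>?X. \<Sum>k\<in>{k. J k \<noteq> {}}. slot_op (mscl S) n (a x k) k (single (flat J) (lookup T J)))"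
      unfolding sum.distrib mapx by (intro arg_cong2[of _ _ _ _ "(+)"] refl sum.cong trm) auto
    also have "(\<Sum>J\<in>?X. \<Sum>k\<in>{k. J k \<noteq> {}}. slot_op (mscl S) n (a x k) k (single (flat J) (lookup T J))) =
        (\<Sum>J\<in>?X. \<Sum>k\<in>F. slot_op (mscl S) n (a x k) k (single (flat J) (lookup T J)))"
    proof (rule sum.cong[OF refl])
      fix J assume J: "J \<in> ?X"
      show "(\<Sum>k\<in>{k. J k \<noteq> {}}. slot_op (mscl S) n (a x k) k (single (flat J) (lookup T J))) =
        (\<Sum>k\<in>F. slot_op (mscl S) n (a x k) k (single (flat J) (lookup T J)))"
      proof (rule sum.mono_neutral_left[OF F JF[OF J]])
        \<comment> \<open>On an empty slot the derivation vanishes, so the Leibniz sum may be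
          extended from the nonempty slots of \<open>J\<close> to all of \<open>F\<close>.\<close>
        show "\<forall>k\<in>F - {k. J k \<noteq> {}}. slot_op (mscl S) n (a x k) k (single (flat J) (lookup T J)) = 0"
          by (auto intro!: slot_op_0 simp: slots_def flat_def split: if_splits)
      qed
    qed
    also have "\<dots> = (\<Sum>k\<in>F. slot_op (mscl S) n (a x k) k (?f T))"
    proof -
      have z: "slot_op (mscl S) n A k 0 = 0" for A k by (rule slot_op_0) (simp add: slots_def)
      have "slot_op (mscl S) n A k (sum h X) = (\<Sum>i\<in>X. slot_op (mscl S) n A k (h i))" for A k X and h :: "(nat \<Rightarrow> nat set) \<Rightarrow> _"
        by (induction X rule: infinite_finite_induct) (auto simp: z slot_op_add[OF vs])
      then show ?thesis unfolding fT by (simp add: sum.swap[of _ ?X])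
    qed
    finally have r: "?f (act ?T x T) = pmap (act S x) (?f T) + (\<Sum>k\<in>F. slot_op (mscl S) n (a x k) k (?f T))" .
    have "slots (?f T) \<subseteq> F" by (simp add: F_def)
    then show ?thesis unfolding r fock_module_simps by (simp only: Sum_slot_op[OF F])
  qed
  have g: "mod_hom L ?F ?T ?g"
    unfolding mod_hom_def linear_on_def
  proof (intro conjI ballI allI)
    show "?g (u + v) = ?g u + ?g v" for u v by (rule poly_mapping_eqI) (simp add: lg lookup_add)
    show "?g (mscl ?F c u) = mscl ?T c (?g u)" for c u
      by (rule poly_mapping_eqI)
         (simp add: lg fock_module_simps infinite_tensor_def lookup_pmap vs_zero_right[OF vs])
    show "?g (act ?F x u) = act ?T x (?g u)" if x: "x \<in> lcar L" and u: "u \<in> mcar ?F" for x u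
      using arg_cong[OF eq[OF x gT[OF u]], of ?g] by (simp add: fg gf)
  qed (rule gT)
  have "bij_betw ?g (mcar ?F) (mcar ?T)"
    by (rule bij_betw_byWitness[where f' = ?f]) (use fg gf gT fF in auto)
  then show ?thesis using g by (auto simp: module_iso_iff)
qed

subsection \<open>Clifford modules with a vacuum\<close>

text \<open>The relations of the generators of \<open>spin_space I\<close>, in an arbitrary space
  \<open>T\<close>. Besides being killed by the annihilators, the vacuum has to be fixed by
  \<open>c 0\<close>: the relations only say that \<open>c 0\<close> squares to 1 and would allow
  the eigenvalue -1.\<close>

locale clifford_module =
  fixes I :: "int set" and s :: "complex \<Rightarrow> 't::ab_group_add \<Rightarrow> 't" and T :: "'t set"
    and c :: "int \<Rightarrow> 't \<Rightarrow> 't" and \<Omega> :: 't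
  assumes vs: "vector_space s" and sub: "module.subspace s T"
    and symI: "uminus ` I = I"
    and c_in: "i \<in> I \<Longrightarrow> t \<in> T \<Longrightarrow> c i t \<in> T"
    and c_lin: "i \<in> I \<Longrightarrow> linear_on s s T (c i)"
    and car: "i \<in> I \<Longrightarrow> j \<in> I \<Longrightarrow> t \<in> T \<Longrightarrow> c i (c j t) + c j (c i t) = (if i = - j then s 2 t else 0)"
    and vac: "\<Omega> \<in> T" and vac_ann: "i \<in> I \<Longrightarrow> i > 0 \<Longrightarrow> c (- i) \<Omega> = 0"
    and vac_0: "0 \<in> I \<Longrightarrow> c 0 \<Omega> = \<Omega>"
begin

lemma neg_I: "- i \<in> I \<longleftrightarrow> i \<in> I"
  using symI by (metis image_eqI image_iff minus_minus)

lemma c_neg: "i \<in> I \<Longrightarrow> t \<in> T \<Longrightarrow> c i (- t) = - c i t"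
  by (rule linear_on_neg[OF c_lin vs vs])

lemma c_zero: "i \<in> I \<Longrightarrow> c i 0 = 0"
  by (rule linear_on_0[OF c_lin vs vs sub])

lemma c_sg: "i \<in> I \<Longrightarrow> t \<in> T \<Longrightarrow> c i (sg m t) = sg m (c i t)"
  by (simp add: sg_def c_neg)

lemma anti: "i \<in> I \<Longrightarrow> j \<in> I \<Longrightarrow> t \<in> T \<Longrightarrow> i \<noteq> - j \<Longrightarrow> c i (c j t) = - c j (c i t)"
  using car[of i j t] by (simp add: eq_neg_iff_add_eq_0)

lemma square_0:
  assumes "i \<in> I" "t \<in> T" "i > 0"
  shows "c i (c i t) = 0"
proof -
  have "s 2 (c i (c i t)) = c i (c i t) + c i (c i t)"
    using vs_add_left[OF vs, of 1 1 "c i (c i t)"] by (simp add: vs_one[OF vs])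
  also have "\<dots> = 0" using car[OF assms(1,1,2)] assms(3) by simp
  finally have "s (1/2) (s 2 (c i (c i t))) = 0" by (simp add: vs_zero_right[OF vs])
  then show ?thesis by (simp add: vs_mult[OF vs] vs_one[OF vs])
qed

text \<open>The intended image of e_J: a descending product, matching the sign convention of the
  exterior algebra.\<close>

definition monomial :: "int set \<Rightarrow> 't" where
  "monomial J = foldr c (rev (sorted_list_of_set J)) \<Omega>"

lemma monomial_empty [simp]: "monomial {} = \<Omega>"
  by (simp add: monomial_def)

lemma monomial_insert:
  assumes "finite A" "\<forall>a\<in>A. a < m"
  shows "monomial (insert m A) = c m (monomial A)"
proof -
  have mA: "m \<notin> A" using assms by auto
  have "insort m (sorted_list_of_set A) = sorted_list_of_set A @ [m]"
    by (rule sorted_insort_is_snoc) (use assms in \<open>simp_all add: less_imp_le\<close>)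
  then have "sorted_list_of_set (insert m A) = sorted_list_of_set A @ [m]"
    using assms(1) mA by (simp add: sorted_list_of_set.sorted_key_list_of_set_insert)
  then show ?thesis by (simp add: monomial_def)
qed

abbreviation pos :: "int set" where "pos \<equiv> {i \<in> I. i > 0}"

lemma monomial_in: "finite J \<Longrightarrow> J \<subseteq> pos \<Longrightarrow> monomial J \<in> T"
proof (induction J rule: finite_linorder_max_induct)
  case (insert m A)
  then show ?case using monomial_insert[of A m] c_in by auto
qed (simp add: vac)

lemma above_max: "\<forall>a\<in>A. a < m \<Longrightarrow> i \<ge> m \<Longrightarrow> above i A = 0"
proof -
  assume "\<forall>a\<in>A. a < m" "i \<ge> m"
  then have "{j \<in> A. i < j} = {}" by fastforce
  then show ?thesis unfolding above_def by (metis card.empty)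
qed

text \<open>Induction on the largest element \<open>m\<close> of \<open>J\<close>. If
  \<open>i < m\<close>, the new generator first anticommutes past \<open>c m\<close>, which is the
  extra sign counted by \<open>above\<close>; if \<open>i > m\<close>, it is already in place; if
  \<open>i = m\<close>, it squares to zero.\<close>

lemma c_pos_monomial:
  assumes i: "i \<in> pos"
  shows "finite J \<Longrightarrow> J \<subseteq> pos \<Longrightarrow> c i (monomial J) = (if i \<in> J then 0 else sg (above i J) (monomial (insert i J)))"
proof (induction J rule: finite_linorder_max_induct)
  case empty
  then show ?case using monomial_insert[of "{}" i] by (simp add: sg_def above_def)
next
  case (insert m A)
  have A: "A \<subseteq> pos" "m \<in> pos" and mA: "m \<notin> A" using insert by auto
  have mon: "monomial (insert m A) = c m (monomial A)" using monomial_insert insert.hyps by blast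
  have inT: "monomial A \<in> T" by (rule monomial_in[OF insert.hyps(1) A(1)])
  consider "i = m" | "i > m" | "i < m" by linarith
  then show ?case
  proof cases
    case 1
    then show ?thesis unfolding mon using square_0[OF _ inT] A by auto
  next
    case 2
    then have "\<forall>a\<in>insert m A. a < i" using insert.hyps by auto
    moreover from this have "above i (insert m A) = 0" by (rule above_max) simp
    ultimately show ?thesis using monomial_insert[of "insert m A" i] insert.hyps(1) by (auto simp: sg_def)
  next
    case 3
    have "c i (c m (monomial A)) = - c m (c i (monomial A))" using anti[OF _ _ inT, of i m] i A by auto
    also have "c i (monomial A) = (if i \<in> A then 0 else sg (above i A) (monomial (insert i A)))"
      by (rule insert.IH[OF A(1)])
    finally have e: "c i (monomial (insert m A)) = - c m (if i \<in> A then 0 else sg (above i A) (monomial (insert i A)))"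
      unfolding mon .
    show ?thesis
    proof (cases "i \<in> A")
      case True
      then show ?thesis using e A c_zero[of m] by simp
    next
      case False
      have inT': "monomial (insert i A) \<in> T" using monomial_in[of "insert i A"] insert.hyps(1) A i by auto
      have "monomial (insert m (insert i A)) = c m (monomial (insert i A))"
        by (rule monomial_insert) (use insert.hyps 3 in auto)
      then have "c i (monomial (insert m A)) = - sg (above i A) (monomial (insert i (insert m A)))"
        using e False A by (simp add: c_sg[OF _ inT'] insert_commute)
      moreover have "above i (insert m A) = Suc (above i A)"
        using above_insert[OF insert.hyps(1) mA, of i] 3 by simp
      ultimately show ?thesis using False 3 by (simp add: sg_Suc)
    qed
  qed
qed

text \<open>The annihilator is moved to the right in the same manner; the factor 2 is the
  anticommutator with its partner.\<close>

lemma c_neg_monomial: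
  assumes i: "i \<in> pos"
  shows "finite J \<Longrightarrow> J \<subseteq> pos \<Longrightarrow> c (- i) (monomial J) = (if i \<in> J then s 2 (sg (above i J) (monomial (J - {i}))) else 0)"
proof (induction J rule: finite_linorder_max_induct)
  case empty
  then show ?case using vac_ann i by simp
next
  case (insert m A)
  have A: "A \<subseteq> pos" "m \<in> pos" and mA: "m \<notin> A" using insert by auto
  have mon: "monomial (insert m A) = c m (monomial A)" using monomial_insert insert.hyps by blast
  have inT: "monomial A \<in> T" by (rule monomial_in[OF insert.hyps(1) A(1)])
  have mi: "- i \<in> I" using i neg_I by simp
  have IH: "c (- i) (monomial A) = (if i \<in> A then s 2 (sg (above i A) (monomial (A - {i}))) else 0)"
    by (rule insert.IH[OF A(1)])
  have "c (- i) (c m (monomial A)) = (if i = m then s 2 (monomial A) else 0) - c m (c (- i) (monomial A))"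
    using car[OF mi _ inT, of m] A by (auto simp: eq_diff_eq)
  then have e: "c (- i) (monomial (insert m A)) = (if i = m then s 2 (monomial A) else 0) - c m (c (- i) (monomial A))"
    unfolding mon .
  show ?case
  proof (cases "i = m")
    case True
    have "above i (insert m A) = 0"
    proof -
      have "above i (insert i A) = above i A" by (rule above_self)
      then show ?thesis using True above_max[OF insert.hyps(2), of i] by simp
    qed
    moreover have "insert m A - {i} = A" using True mA by auto
    ultimately show ?thesis using e True IH mA A c_zero by (auto simp: sg_def)
  next
    case False
    show ?thesis
    proof (cases "i \<in> A")
      case True
      then have im: "i < m" using insert.hyps by auto
      have inT': "monomial (A - {i}) \<in> T" using monomial_in[of "A - {i}"] insert.hyps(1) A by auto
      have "monomial (insert m (A - {i})) = c m (monomial (A - {i}))"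
        by (rule monomial_insert) (use insert.hyps in auto)
      moreover have "insert m (A - {i}) = insert m A - {i}" using False by auto
      moreover have "c m (s 2 (sg (above i A) (monomial (A - {i})))) = s 2 (sg (above i A) (c m (monomial (A - {i}))))"
      proof -
        have "sg (above i A) (monomial (A - {i})) \<in> T" using inT' subspace_neg[OF vs sub] by (auto simp: sg_def)
        then show ?thesis using linear_on_scale[OF c_lin] A c_sg[OF _ inT'] by auto
      qed
      moreover have "above i (insert m A) = Suc (above i A)"
        using above_insert[OF insert.hyps(1) mA, of i] im by simp
      ultimately show ?thesis using e True False IH by (simp add: sg_Suc vs_neg_right[OF vs])
    next
      case False2: False
      then show ?thesis using e False IH A c_zero by auto
    qed
  qed
qed

lemma c_zero_monomial:
  assumes i: "0 \<in> I"
  shows "finite J \<Longrightarrow> J \<subseteq> pos \<Longrightarrow> c 0 (monomial J) = sg (card J) (monomial J)"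
proof (induction J rule: finite_linorder_max_induct)
  case empty
  then show ?case using vac_0 i by (simp add: sg_def)
next
  case (insert m A)
  have A: "A \<subseteq> pos" "m \<in> pos" and mA: "m \<notin> A" using insert by auto
  have mon: "monomial (insert m A) = c m (monomial A)" using monomial_insert insert.hyps by blast
  have inT: "monomial A \<in> T" by (rule monomial_in[OF insert.hyps(1) A(1)])
  have "c 0 (c m (monomial A)) = - c m (c 0 (monomial A))" using anti[OF i _ inT, of m] A by auto
  then show ?case using mon insert.IH[OF A(1)] c_sg[OF _ inT, of m] A insert.hyps(1) mA by (simp add: sg_Suc)
qed

definition fock_map :: "(int set \<Rightarrow>\<^sub>0 complex) \<Rightarrow> 't" where
  "fock_map u = (\<Sum>J\<in>keys u. s (lookup u J) (monomial J))"

lemma fock_map_sum: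
  assumes "finite X" "keys u \<subseteq> X"
  shows "fock_map u = (\<Sum>J\<in>X. s (lookup u J) (monomial J))"
  unfolding fock_map_def by (rule sum.mono_neutral_left[OF assms]) (auto simp: in_keys_iff vs_zero[OF vs])

lemma fock_map_add: "fock_map (u + v) = fock_map u + fock_map v"
proof -
  let ?X = "keys u \<union> keys v"
  have "finite ?X" by simp
  then show ?thesis
    using fock_map_sum[of ?X "u + v"] fock_map_sum[of ?X u] fock_map_sum[of ?X v] keys_add[of u v]
    by (simp add: lookup_add vs_add_left[OF vs] sum.distrib)
qed

lemma fock_map_cscale: "fock_map (cscale a u) = s a (fock_map u)"
  using fock_map_sum[of "keys u" "cscale a u"] keys_pmap_subset[of "(*) a" u]
  by (simp add: fock_map_def cscale_def lookup_pmap vs_sum[OF vs] vs_mult[OF vs])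

lemma fock_map_0 [simp]: "fock_map 0 = 0"
  by (simp add: fock_map_def)

lemma fock_map_finsum: "fock_map (sum f A) = (\<Sum>x\<in>A. fock_map (f x))"
  by (induction A rule: infinite_finite_induct) (auto simp: fock_map_add)

lemma fock_map_single: "fock_map (single J a) = s a (monomial J)"
  by (cases "a = 0") (simp_all add: fock_map_def vs_zero[OF vs])

lemma fock_map_vacuum: "fock_map (single {} 1) = \<Omega>"
  by (simp add: fock_map_single vs_one[OF vs])

lemma fock_map_in: "u \<in> spin_space I \<Longrightarrow> fock_map u \<in> T"
  unfolding fock_map_def
  by (rule subspace_sum[OF vs sub], rule subspace_scale[OF vs sub], rule monomial_in) (auto simp: spin_space_def)

lemma fock_map_linear: "linear_on cscale s A fock_map"
  by (simp add: linear_on_def fock_map_add fock_map_cscale)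

lemma s_sg: "s (sg m a) t = s a (sg m t)"
  by (simp add: sg_def vs_neg[OF vs] vs_neg_right[OF vs])

text \<open>By linearity only basis vectors matter, and there the monomials obey the sign rules of
  \<open>clifford\<close>.\<close>

lemma fock_map_clifford:
  assumes i: "i \<in> I" and u: "u \<in> spin_space I"
  shows "fock_map (clifford i u) = c i (fock_map u)"
proof -
  have single: "fock_map (clifford i (single J a)) = c i (s a (monomial J))"
    if J: "finite J" "J \<subseteq> pos" for J a
  proof (cases i "0::int" rule: linorder_cases)
    case greater
    then have ip: "i \<in> pos" using i by simp
    have "c i (s a (monomial J)) = s a (c i (monomial J))" by (rule linear_on_scale[OF c_lin[OF i] monomial_in[OF J]])
    then show ?thesis
      using greater c_pos_monomial[OF ip J]
      by (simp add: clifford_pos cre_single fock_map_single s_sg vs_zero_right[OF vs])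
  next
    case less
    then have ip: "- i \<in> pos" using i neg_I by simp
    have "c i (s a (monomial J)) = s a (c i (monomial J))" by (rule linear_on_scale[OF c_lin[OF i] monomial_in[OF J]])
    then show ?thesis
      using less c_neg_monomial[OF ip J]
      by (simp add: clifford_neg ann_single fock_map_cscale fock_map_single s_sg vs_zero_right[OF vs] vs_mult[OF vs] mult.commute)
  next
    case equal
    then have i0: "0 \<in> I" using i by simp
    have "c i (s a (monomial J)) = s a (c i (monomial J))" by (rule linear_on_scale[OF c_lin[OF i] monomial_in[OF J]])
    then show ?thesis
      using equal c_zero_monomial[OF i0 J] by (simp add: clifford_zero par_single fock_map_single s_sg)
  qed
  have key: "finite J" "J \<subseteq> pos" if "J \<in> keys u" for J
    using u that by (auto simp: spin_space_def)
  have "fock_map (clifford i u) = fock_map (clifford i (\<Sum>J\<in>keys u. single J (lookup u J)))"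
    by (simp add: poly_mapping_sum_single)
  also have "\<dots> = (\<Sum>J\<in>keys u. c i (s (lookup u J) (monomial J)))"
    unfolding clifford_sum fock_map_finsum by (rule sum.cong[OF refl], rule single, (rule key, assumption)+)
  also have "\<dots> = c i (fock_map u)"
    unfolding fock_map_def
    by (rule linear_on_sum[OF c_lin[OF i] vs vs sub, symmetric])
       (use key monomial_in subspace_scale[OF vs sub] in auto)
  finally show ?thesis .
qed

text \<open>The kernel is stable under all generators, so if it were nonzero it would contain the
  vacuum, whose image is \<open>\<Omega>\<close>.\<close>

lemma fock_map_inj:
  assumes "\<Omega> \<noteq> 0"
  shows "inj_on fock_map (spin_space I)"
proof (rule inj_onI)
  fix u v assume uv: "u \<in> spin_space I" "v \<in> spin_space I" "fock_map u = fock_map v"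
  let ?W = "{w \<in> spin_space I. fock_map w = 0}"
  note sp = spin_space_subspace[of I]
  have W: "module.subspace cscale ?W"
    by (rule subspaceI[OF cscale_vs])
       (auto simp: subspace_0[OF cscale_vs sp] subspace_add[OF cscale_vs sp] subspace_scale[OF cscale_vs sp]
          fock_map_add fock_map_cscale vs_zero_right[OF vs])
  have "fock_map (u - v) = 0"
    using fock_map_add[of "u - v" v] uv(3) by simp
  then have d: "u - v \<in> ?W" using subspace_diff[OF cscale_vs sp] uv by simp
  show "u = v"
  proof (rule ccontr)
    assume "u \<noteq> v"
    then have "single {} 1 \<in> ?W"
      using d by (intro spin_space_reach_vacuum[OF W _ symI d])
        (auto simp: clifford_spin_space fock_map_clifford c_zero)
    then show False using fock_map_vacuum assms by simp
  qed
qed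

end

section \<open>Creation and annihilation fields on the Fock space\<close>

type_synonym fock = "(nat \<times> nat) set \<Rightarrow>\<^sub>0 (int set \<Rightarrow>\<^sub>0 complex)"

definition fscale :: "complex \<Rightarrow> fock \<Rightarrow> fock" where
  "fscale c = pmap (cscale c)"

lemma fscale_vs: "vector_space fscale"
  unfolding fscale_def[abs_def] by (rule vector_space_pmap[OF cscale_vs])

lemmas fscale_add = vs_add[OF fscale_vs] and fscale_add_left = vs_add_left[OF fscale_vs]
  and fscale_mult = vs_mult[OF fscale_vs] and fscale_one = vs_one[OF fscale_vs]
  and fscale_zero = vs_zero[OF fscale_vs] and fscale_zero_right = vs_zero_right[OF fscale_vs]
  and fscale_neg = vs_neg[OF fscale_vs] and fscale_neg_right = vs_neg_right[OF fscale_vs]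
  and fscale_diff = vs_diff[OF fscale_vs] and fscale_sum = vs_sum[OF fscale_vs]

lemma fscale_sum_left: "fscale (sum f A) u = (\<Sum>x\<in>A. fscale (f x) u)"
  by (induction A rule: infinite_finite_induct) (auto simp: fscale_zero fscale_add_left)

lemma fscale_cre: "fscale c (cre p u) = cre p (fscale c u)"
  and fscale_ann: "fscale c (ann p u) = ann p (fscale c u)"
  and fscale_par: "fscale c (par u) = par (fscale c u)"
  by (simp_all add: fscale_def scale_cre[OF cscale_vs] scale_ann[OF cscale_vs] scale_par[OF cscale_vs])

lemma finkeys_fscale: "finkeys u \<Longrightarrow> finkeys (fscale c u)"
  unfolding fscale_def by (rule finkeys_pmap)

definition fld :: "(nat \<times> nat \<Rightarrow> complex) \<Rightarrow> (nat \<times> nat \<Rightarrow> complex) \<Rightarrow> nat \<times> nat \<Rightarrow> fock \<Rightarrow> fock" where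
  "fld \<alpha> \<beta> p u = fscale (\<alpha> p) (cre p u) + fscale (\<beta> p) (ann p u)"

text \<open>The operator of a general Clifford vector: \<open>g\<close> acts on the coefficients,
  the modes in \<open>R\<close> act by creation and annihilation. The factor \<open>par\<close> is
  the sign rule for tensor products of Clifford modules and makes the two parts anticommute.\<close>

definition gam :: "(nat \<times> nat) set \<Rightarrow> (nat \<times> nat \<Rightarrow> complex) \<Rightarrow> (nat \<times> nat \<Rightarrow> complex) \<Rightarrow>
    ((int set \<Rightarrow>\<^sub>0 complex) \<Rightarrow> (int set \<Rightarrow>\<^sub>0 complex)) \<Rightarrow> fock \<Rightarrow> fock" where
  "gam R \<alpha> \<beta> g u = par (pmap g u) + (\<Sum>p\<in>R. fld \<alpha> \<beta> p u)"

lemma fld_add: "fld \<alpha> \<beta> p (u + v) = fld \<alpha> \<beta> p u + fld \<alpha> \<beta> p v"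
  by (simp add: fld_def cre_add ann_add fscale_add)

lemma fld_0 [simp]: "fld \<alpha> \<beta> p 0 = 0"
  by (simp add: fld_def fscale_zero_right)

lemma fld_sum: "fld \<alpha> \<beta> p (sum f A) = (\<Sum>x\<in>A. fld \<alpha> \<beta> p (f x))"
  by (induction A rule: infinite_finite_induct) (auto simp: fld_add)

lemma fld_fscale: "fld \<alpha> \<beta> p (fscale c u) = fscale c (fld \<alpha> \<beta> p u)"
  by (simp add: fld_def fscale_add fscale_mult fscale_cre[symmetric] fscale_ann[symmetric] mult.commute)

lemma finkeys_fld: "finkeys u \<Longrightarrow> finkeys (fld \<alpha> \<beta> p u)"
  by (simp add: fld_def finkeys_add finkeys_fscale finkeys_cre finkeys_ann)

lemma fld_anticomm:
  assumes u: "finkeys u"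
  shows "fld \<alpha> \<beta> p (fld \<alpha>' \<beta>' q u) + fld \<alpha>' \<beta>' q (fld \<alpha> \<beta> p u) =
    (if p = q then fscale (\<alpha> p * \<beta>' p + \<beta> p * \<alpha>' p) u else 0)"
proof -
  have e: "fld a b r (fld a' b' t u) = fscale (a r * a' t) (cre r (cre t u)) + fscale (a r * b' t) (cre r (ann t u)) +
      (fscale (b r * a' t) (ann r (cre t u)) + fscale (b r * b' t) (ann r (ann t u)))" for a b a' b' r t
    by (simp add: fld_def cre_add ann_add fscale_add fscale_mult fscale_cre[symmetric] fscale_ann[symmetric])
  have c: "fscale (a * a') (cre p (cre q u)) + fscale (a' * a) (cre q (cre p u)) = 0" for a a'
    by (subst cre_cre[OF u, of q p]) (simp add: fscale_neg_right mult.commute)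
  have n: "fscale (a * a') (ann p (ann q u)) + fscale (a' * a) (ann q (ann p u)) = 0" for a a'
    by (subst ann_ann[OF u, of q p]) (simp add: fscale_neg_right mult.commute)
  have m1: "fscale (a * a') (cre p (ann q u)) + fscale (a' * a) (ann q (cre p u)) = (if p = q then fscale (a * a') u else 0)" for a a'
    by (subst ann_cre[OF u]) (auto simp: fscale_diff fscale_neg_right fscale_zero_right mult.commute)
  have m2: "fscale (a * a') (ann p (cre q u)) + fscale (a' * a) (cre q (ann p u)) = (if p = q then fscale (a * a') u else 0)" for a a'
    by (subst ann_cre[OF u]) (auto simp: fscale_diff fscale_neg_right fscale_zero_right mult.commute)
  have "fld \<alpha> \<beta> p (fld \<alpha>' \<beta>' q u) + fld \<alpha>' \<beta>' q (fld \<alpha> \<beta> p u) =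
    (fscale (\<alpha> p * \<alpha>' q) (cre p (cre q u)) + fscale (\<alpha>' q * \<alpha> p) (cre q (cre p u))) +
    (fscale (\<beta> p * \<beta>' q) (ann p (ann q u)) + fscale (\<beta>' q * \<beta> p) (ann q (ann p u))) +
    ((fscale (\<alpha> p * \<beta>' q) (cre p (ann q u)) + fscale (\<beta>' q * \<alpha> p) (ann q (cre p u))) +
    (fscale (\<beta> p * \<alpha>' q) (ann p (cre q u)) + fscale (\<alpha>' q * \<beta> p) (cre q (ann p u))))"
    unfolding e by (simp only: ac_simps)
  then show ?thesis unfolding c n m1 m2 by (simp add: fscale_add_left)
qed

text \<open>Linearity on the whole type, which the Clifford operators have. The Lie algebra acts
  linearly on carriers only, so \<open>gam_comm\<close> treats it separately.\<close>

definition linmap :: "((int set \<Rightarrow>\<^sub>0 complex) \<Rightarrow> (int set \<Rightarrow>\<^sub>0 complex)) \<Rightarrow> bool" where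
  "linmap g \<longleftrightarrow> (\<forall>u v. g (u + v) = g u + g v) \<and> (\<forall>c u. g (cscale c u) = cscale c (g u))"

lemma linmap:
  assumes "linmap g"
  shows linmap_add: "g (u + v) = g u + g v" and linmap_scale: "g (cscale c u) = cscale c (g u)"
    and linmap_0: "g 0 = 0" and linmap_neg: "g (- u) = - g u"
proof -
  show "g (u + v) = g u + g v" "g (cscale c u) = cscale c (g u)" using assms by (auto simp: linmap_def)
  have s: "g (cscale c u) = cscale c (g u)" for c u using assms by (auto simp: linmap_def)
  show "g 0 = 0" using s[of 0 0] by simp
  show "g (- u) = - g u" using s[of "- 1" u] by (simp add: cscale_minus_left)
qed

lemma
  assumes "linmap g"
  shows lmap_add: "pmap g (u + v) = pmap g u + pmap g (v :: fock)"
    and lmap_fscale: "pmap g (fscale c u) = fscale c (pmap g u)"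
    and lmap_cre: "pmap g (cre p u) = cre p (pmap g u)"
    and lmap_ann: "pmap g (ann p u) = ann p (pmap g u)"
    and lmap_par: "pmap g (par u) = par (pmap g u)"
proof -
  note l = linmap[OF assms]
  show "pmap g (u + v) = pmap g u + pmap g (v :: fock)"
    by (rule poly_mapping_eqI) (simp add: lookup_pmap lookup_add l)
  show "pmap g (fscale c u) = fscale c (pmap g u)"
    by (rule poly_mapping_eqI) (simp add: lookup_pmap fscale_def l)
  show "pmap g (cre p u) = cre p (pmap g u)" by (rule pmap_cre) (rule l)+
  show "pmap g (ann p u) = ann p (pmap g u)" by (rule pmap_ann) (rule l)+
  show "pmap g (par u) = par (pmap g u)" by (rule pmap_par) (rule l)+
qed

lemma lmap_sum: "linmap g \<Longrightarrow> pmap g (sum f A) = (\<Sum>x\<in>A. pmap g (f x :: fock))"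
  by (induction A rule: infinite_finite_induct) (auto simp: lmap_add)

lemma lmap_fld: "linmap g \<Longrightarrow> pmap g (fld \<alpha> \<beta> p u) = fld \<alpha> \<beta> p (pmap g u)"
  by (simp add: fld_def lmap_add lmap_fscale lmap_cre lmap_ann)

lemma fld_par: "finkeys u \<Longrightarrow> fld \<alpha> \<beta> p (par u) = - par (fld \<alpha> \<beta> p u)"
  by (simp add: fld_def cre_par ann_par par_add fscale_par fscale_neg_right)

lemma gam_add: "linmap g \<Longrightarrow> gam R \<alpha> \<beta> g (u + v) = gam R \<alpha> \<beta> g u + gam R \<alpha> \<beta> g v"
  by (simp add: gam_def lmap_add par_add fld_add sum.distrib algebra_simps)

lemma gam_fscale: "linmap g \<Longrightarrow> gam R \<alpha> \<beta> g (fscale c u) = fscale c (gam R \<alpha> \<beta> g u)"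
  by (simp add: gam_def lmap_fscale fscale_par[symmetric] fld_fscale fscale_add fscale_sum)

lemma finkeys_gam: "finkeys u \<Longrightarrow> finkeys (gam R \<alpha> \<beta> g u)"
  by (simp add: gam_def finkeys_add finkeys_par finkeys_pmap finkeys_sum finkeys_fld)

text \<open>The cross terms cancel, since \<open>par\<close> anticommutes with the modes while
  \<open>pmap g\<close> commutes with them; distinct modes anticommute, and equal ones give the sum
  over \<open>R\<close>.\<close>

lemma gam_anticomm:
  assumes R: "finite R" and u: "finkeys u" and g: "linmap g" and g': "linmap g'"
    and gg: "\<And>K. g (g' (lookup u K)) + g' (g (lookup u K)) = cscale d (lookup u K)"
  shows "gam R \<alpha> \<beta> g (gam R \<alpha>' \<beta>' g' u) + gam R \<alpha>' \<beta>' g' (gam R \<alpha> \<beta> g u) =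
    fscale (d + (\<Sum>p\<in>R. \<alpha> p * \<beta>' p + \<beta> p * \<alpha>' p)) u"
proof -
  note fm = finkeys_pmap[OF u]
  have e: "gam R \<alpha> \<beta> g (gam R \<alpha>' \<beta>' g' u) = pmap g (pmap g' u) +
      (\<Sum>q\<in>R. par (fld \<alpha>' \<beta>' q (pmap g u))) - (\<Sum>p\<in>R. par (fld \<alpha> \<beta> p (pmap g' u))) +
      (\<Sum>p\<in>R. \<Sum>q\<in>R. fld \<alpha> \<beta> p (fld \<alpha>' \<beta>' q u))"
    if "linmap g" "linmap g'" for g g' \<alpha> \<beta> \<alpha>' \<beta>'
    using that
    by (simp add: gam_def[of R] lmap_add lmap_par lmap_sum lmap_fld par_add par_sum fld_add fld_sum
        fld_par[OF fm] sum.distrib sum_negf sum_subtractf)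
  have "(\<Sum>p\<in>R. \<Sum>q\<in>R. fld \<alpha> \<beta> p (fld \<alpha>' \<beta>' q u)) + (\<Sum>p\<in>R. \<Sum>q\<in>R. fld \<alpha>' \<beta>' p (fld \<alpha> \<beta> q u)) =
     (\<Sum>p\<in>R. \<Sum>q\<in>R. fld \<alpha> \<beta> p (fld \<alpha>' \<beta>' q u) + fld \<alpha>' \<beta>' q (fld \<alpha> \<beta> p u))"
    by (subst (2) sum.swap) (simp add: sum.distrib)
  also have "\<dots> = (\<Sum>p\<in>R. \<Sum>q\<in>R. if p = q then fscale (\<alpha> p * \<beta>' p + \<beta> p * \<alpha>' p) u else 0)"
    unfolding fld_anticomm[OF u] ..
  also have "\<dots> = fscale (\<Sum>p\<in>R. \<alpha> p * \<beta>' p + \<beta> p * \<alpha>' p) u"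
    using R by (simp add: fscale_sum_left)
  finally have 1: "(\<Sum>p\<in>R. \<Sum>q\<in>R. fld \<alpha> \<beta> p (fld \<alpha>' \<beta>' q u)) + (\<Sum>p\<in>R. \<Sum>q\<in>R. fld \<alpha>' \<beta>' p (fld \<alpha> \<beta> q u)) =
    fscale (\<Sum>p\<in>R. \<alpha> p * \<beta>' p + \<beta> p * \<alpha>' p) u" .
  have 2: "pmap g (pmap g' u) + pmap g' (pmap g u) = fscale d u"
    by (rule poly_mapping_eqI)
       (use gg in \<open>simp add: lookup_add lookup_pmap linmap_0[OF g] linmap_0[OF g'] fscale_def\<close>)
  show ?thesis
    unfolding e[OF g g'] e[OF g' g] fscale_add_left 1[symmetric] 2[symmetric] by (simp add: algebra_simps)
qed

subsection \<open>Commutators with the action on the Fock module\<close>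

lemma slot_op_fscale_form:
  "slot_op cscale n A k u = (\<Sum>i<n. \<Sum>j<n. fscale (A j i) (cre (k, j) (ann (k, i) u)))"
proof -
  have "{k} \<times> {..<n} = Pair k ` {..<n}" by auto
  then show ?thesis unfolding slot_op_def dgam_def fscale_def by (simp add: sum.reindex inj_on_def)
qed

lemma slot_op_fld:
  assumes u: "finkeys u"
  shows "slot_op cscale n A k (fld \<alpha> \<beta> (l, m) u) = fld \<alpha> \<beta> (l, m) (slot_op cscale n A k u) +
    (if l = k \<and> m < n then (\<Sum>j<n. fscale (A j m * \<alpha> (l, m)) (cre (k, j) u)) - (\<Sum>i<n. fscale (A m i * \<beta> (l, m)) (ann (k, i) u)) else 0)"
proof -
  have P: "{k} \<times> {..<n} = Pair k ` {..<n}" by auto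
  have f: "finite ({k} \<times> {..<n})" by simp
  have c: "slot_op cscale n A k (cre (l, m) u) = cre (l, m) (slot_op cscale n A k u) +
      (if l = k \<and> m < n then \<Sum>j<n. fscale (A j m) (cre (k, j) u) else 0)"
    unfolding slot_op_def dgam_cre[OF cscale_vs f u]
    by (auto simp: P sum.reindex inj_on_def fscale_def)
  have a: "slot_op cscale n A k (ann (l, m) u) = ann (l, m) (slot_op cscale n A k u) -
      (if l = k \<and> m < n then \<Sum>i<n. fscale (A m i) (ann (k, i) u) else 0)"
    unfolding slot_op_def dgam_ann[OF cscale_vs f u]
    by (auto simp: P sum.reindex inj_on_def fscale_def)
  have s: "slot_op cscale n A k (fscale d v) = fscale d (slot_op cscale n A k v)" for d v
    unfolding fscale_def by (rule slot_op_scale[OF cscale_vs])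
  show ?thesis
    unfolding fld_def slot_op_add[OF cscale_vs] s c a fscale_add fscale_diff
    by (auto simp: fscale_sum fscale_mult fscale_zero_right mult.commute)
qed

lemma slot_op_lmap: "linmap g \<Longrightarrow> slot_op cscale n A k (pmap g u) = pmap g (slot_op cscale n A k u)"
  by (simp add: slot_op_fscale_form lmap_sum lmap_fscale lmap_cre lmap_ann)

lemma slot_op_par: "finkeys u \<Longrightarrow> slot_op cscale n A k (par u) = par (slot_op cscale n A k (u :: fock))"
  by (simp add: slot_op_fscale_form ann_par finkeys_ann cre_par cre_neg par_sum fscale_par par_neg)

lemma slot_op_sum: "slot_op cscale n A k (sum f X) = (\<Sum>x\<in>X. slot_op cscale n A k (f x))"
proof -
  have z: "slot_op cscale n A k 0 = 0" by (rule slot_op_0) (simp add: slots_def)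
  show ?thesis by (induction X rule: infinite_finite_induct) (auto simp: z slot_op_add[OF cscale_vs])
qed

text \<open>The operators \<open>gam\<close> are closed under commutators with the algebra: creation
  coefficients transform by the matrix, annihilation coefficients by its negative transpose, and the
  operator on the coefficients by its own commutator.\<close>

lemma gam_comm:
  assumes S: "op_module L S" "mscl S = cscale" and x: "x \<in> lcar L"
    and u: "u \<in> mcar (fock_module S n a)" and Ks: "finite Ks" "Ks \<subseteq> {1..}"
    and g: "linmap g" "\<And>w. w \<in> mcar S \<Longrightarrow> g w \<in> mcar S" and g': "linmap g'"
    and com: "\<And>w. w \<in> mcar S \<Longrightarrow> act S x (g w) = g (act S x w) + g' w"
    and \<alpha>': "\<And>k j. k \<in> Ks \<Longrightarrow> j < n \<Longrightarrow> \<alpha>' (k, j) = (\<Sum>i<n. a x k j i * \<alpha> (k, i))"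
    and \<beta>': "\<And>k i. k \<in> Ks \<Longrightarrow> i < n \<Longrightarrow> \<beta>' (k, i) = - (\<Sum>j<n. a x k j i * \<beta> (k, j))"
  defines "R \<equiv> Ks \<times> {..<n}"
  shows "act (fock_module S n a) x (gam R \<alpha> \<beta> g u) =
    gam R \<alpha> \<beta> g (act (fock_module S n a) x u) + gam R \<alpha>' \<beta>' g' u"
proof -
  let ?W = "mcar (fock_module S n a)" and ?x = "act S x"
  \<comment> \<open>All slots that matter for \<open>u\<close>, for its image or for the modes, so
    that every sum over slots becomes a sum over \<open>F\<close>.\<close>
  define F where "F = slots u \<union> slots (gam R \<alpha> \<beta> g u) \<union> Ks"
  note fu = fock_finkeys[OF u]
  have R: "finite R" unfolding R_def using Ks by simp
  have F: "finite F" "slots u \<subseteq> F" "slots (gam R \<alpha> \<beta> g u) \<subseteq> F" "Ks \<subseteq> F"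
    unfolding F_def using finite_slots[OF fu] finite_slots[OF finkeys_gam[OF fu]] Ks by auto
  have x0: "?x 0 = 0" by (rule om_act_0[OF S(1) x])
  have lu: "lookup v K \<in> mcar S" if "v \<in> ?W" for v K using that by (simp add: fock_module_simps)
  note sub = fscale_vs fock_module_subspace[OF S(1), of n a, unfolded S(2) fscale_def[symmetric, abs_def]]
  have crW: "cre p v \<in> ?W" if "p \<in> R" "v \<in> ?W" for p v
    using that fock_cre[OF S(1) that(2)] Ks(2) by (cases p) (auto simp: R_def)
  have anW: "ann p v \<in> ?W" if "v \<in> ?W" for p v by (rule fock_ann[OF S(1) that])
  have mapx_add: "pmap ?x (v + w) = pmap ?x v + pmap ?x w" if "v \<in> ?W" "w \<in> ?W" for v w
    by (rule poly_mapping_eqI) (use lu that in \<open>simp add: lookup_pmap x0 lookup_add om_act_add[OF S(1) x]\<close>)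
  have mapx_scale: "pmap ?x (fscale c v) = fscale c (pmap ?x v)" if "v \<in> ?W" for c v
    by (rule poly_mapping_eqI)
       (use lu[OF that] om_act_scale[OF S(1) x, unfolded S(2)] in \<open>simp add: lookup_pmap x0 fscale_def\<close>)
  have mapx_sum: "pmap ?x (sum f X) = (\<Sum>i\<in>X. pmap ?x (f i))"
    if "\<And>i. i \<in> X \<Longrightarrow> f i \<in> ?W" for f :: "nat \<times> nat \<Rightarrow> fock" and X
    using that
  proof (induction X rule: infinite_finite_induct)
    case (insert i X)
    then have "sum f X \<in> ?W" by (intro subspace_sum[OF sub]) auto
    then show ?case using insert mapx_add by simp
  qed auto
  have neg: "?x (- lookup v K) = - ?x (lookup v K)" if "v \<in> ?W" for v K
    by (rule om_act_neg[OF S(1) x lu[OF that]])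
  have mapx_cre: "pmap ?x (cre p v) = cre p (pmap ?x v)"
    and mapx_ann: "pmap ?x (ann p v) = ann p (pmap ?x v)"
    and mapx_par: "pmap ?x (par v) = par (pmap ?x v)" if "v \<in> ?W" for p v
    using pmap_cre[of ?x, OF x0 neg[OF that]] pmap_ann[of ?x, OF x0 neg[OF that]] pmap_par[of ?x, OF x0 neg[OF that]] by blast+
  have fldW: "fld \<alpha> \<beta> p u \<in> ?W" if "p \<in> R" for p
    unfolding fld_def using crW[OF that u] anW[OF u] subspace_add[OF sub] subspace_scale[OF sub] by blast
  have mapx_fld: "pmap ?x (fld \<alpha> \<beta> p u) = fld \<alpha> \<beta> p (pmap ?x u)" if "p \<in> R" for p
    unfolding fld_def using crW[OF that u] anW[OF u] subspace_scale[OF sub]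
    by (simp add: mapx_add mapx_scale mapx_cre mapx_ann u)
  have gW: "pmap g u \<in> ?W"
    by (rule fock_pmap[where f = g, OF u linmap_0[OF g(1)] g(2)])
  have pW: "par v \<in> ?W" if "v \<in> ?W" for v
    using that sg_mem[OF S(1)] by (simp add: fock_module_simps par.rep_eq)
  have mg: "pmap ?x (pmap g u) = pmap g (pmap ?x u) + pmap g' u"
    by (rule poly_mapping_eqI)
       (use com lu[OF u] in \<open>simp add: lookup_pmap x0 lookup_add linmap_0[OF g(1)] linmap_0[OF g']\<close>)
  have 1: "pmap ?x (gam R \<alpha> \<beta> g u) = gam R \<alpha> \<beta> g (pmap ?x u) + par (pmap g' u)"
  proof -
    have "(\<Sum>p\<in>R. fld \<alpha> \<beta> p u) \<in> ?W" by (rule subspace_sum[OF sub fldW])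
    moreover have "pmap ?x (\<Sum>p\<in>R. fld \<alpha> \<beta> p u) = (\<Sum>p\<in>R. fld \<alpha> \<beta> p (pmap ?x u))"
      using mapx_sum[of R "\<lambda>p. fld \<alpha> \<beta> p u"] fldW mapx_fld by simp
    ultimately show ?thesis
      unfolding gam_def mapx_add[OF pW[OF gW]] mapx_par[OF gW] mg by (simp add: par_add mapx_add[OF pW[OF gW]] mapx_par[OF gW] mg)
  qed
  \<comment> \<open>The commutator of the slot operator of \<open>k\<close> with the mode
    \<open>p\<close>; it is zero unless \<open>p\<close> belongs to slot \<open>k\<close>.\<close>
  define E where "E k p = (if fst p = k \<and> snd p < n then (\<Sum>j<n. fscale (a x k j (snd p) * \<alpha> p) (cre (k, j) u)) -
      (\<Sum>i<n. fscale (a x k (snd p) i * \<beta> p) (ann (k, i) u)) else 0)" for k p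
  have 2: "slot_op cscale n (a x k) k (gam R \<alpha> \<beta> g u) = gam R \<alpha> \<beta> g (slot_op cscale n (a x k) k u) + (\<Sum>p\<in>R. E k p)" for k
  proof -
    have "slot_op cscale n (a x k) k (fld \<alpha> \<beta> p u) = fld \<alpha> \<beta> p (slot_op cscale n (a x k) k u) + E k p" for p
      using slot_op_fld[OF fu, of n "a x k" k \<alpha> \<beta>] by (cases p) (simp only: E_def fst_conv snd_conv)
    then show ?thesis
      unfolding gam_def slot_op_add[OF cscale_vs] slot_op_sum slot_op_par[OF finkeys_pmap[OF fu]] slot_op_lmap[OF g(1)]
      by (simp add: sum.distrib add.assoc)
  qed
  have 3: "(\<Sum>k\<in>F. \<Sum>p\<in>R. E k p) = (\<Sum>p\<in>R. fld \<alpha>' \<beta>' p u)"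
  proof -
    have "(\<Sum>k\<in>F. \<Sum>p\<in>R. E k p) = (\<Sum>k\<in>Ks. \<Sum>p\<in>R. E k p)"
    proof (rule sum.mono_neutral_right[OF F(1,4)])
      have "E k p = 0" if "k \<notin> Ks" "p \<in> R" for k p using that by (auto simp: E_def R_def)
      then show "\<forall>k\<in>F - Ks. (\<Sum>p\<in>R. E k p) = 0" by simp
    qed
    also have "\<dots> = (\<Sum>k\<in>Ks. \<Sum>m<n. E k (k, m))"
    proof (rule sum.cong[OF refl])
      fix k assume k: "k \<in> Ks"
      have "(\<Sum>p\<in>R. E k p) = (\<Sum>p\<in>Pair k ` {..<n}. E k p)"
        by (rule sum.mono_neutral_right[OF R]) (use k in \<open>auto simp: R_def E_def\<close>)
      then show "(\<Sum>p\<in>R. E k p) = (\<Sum>m<n. E k (k, m))" by (simp add: sum.reindex inj_on_def)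
    qed
    also have "\<dots> = (\<Sum>k\<in>Ks. \<Sum>m<n. fld \<alpha>' \<beta>' (k, m) u)"
    proof (rule sum.cong[OF refl])
      fix k assume k: "k \<in> Ks"
      have "(\<Sum>m<n. E k (k, m)) = (\<Sum>m<n. \<Sum>j<n. fscale (a x k j m * \<alpha> (k, m)) (cre (k, j) u)) -
          (\<Sum>m<n. \<Sum>i<n. fscale (a x k m i * \<beta> (k, m)) (ann (k, i) u))"
        by (simp add: E_def sum_subtractf)
      also have "\<dots> = (\<Sum>j<n. \<Sum>m<n. fscale (a x k j m * \<alpha> (k, m)) (cre (k, j) u)) -
          (\<Sum>i<n. \<Sum>m<n. fscale (a x k m i * \<beta> (k, m)) (ann (k, i) u))"
        by (rule arg_cong2[of _ _ _ _ minus]; rule sum.swap)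
      also have "\<dots> = (\<Sum>j<n. fscale (\<alpha>' (k, j)) (cre (k, j) u)) + (\<Sum>i<n. fscale (\<beta>' (k, i)) (ann (k, i) u))"
        using \<alpha>'[OF k] \<beta>'[OF k] by (simp add: fscale_sum_left fscale_neg sum_negf)
      finally show "(\<Sum>m<n. E k (k, m)) = (\<Sum>m<n. fld \<alpha>' \<beta>' (k, m) u)"
        by (simp add: fld_def sum.distrib)
    qed
    also have "\<dots> = (\<Sum>p\<in>R. fld \<alpha>' \<beta>' p u)" unfolding R_def by (simp add: sum.cartesian_product)
    finally show ?thesis .
  qed
  have gs: "gam R \<alpha> \<beta> g (sum f X) = (\<Sum>k\<in>X. gam R \<alpha> \<beta> g (f k))" for f :: "nat \<Rightarrow> fock" and X
    by (induction X rule: infinite_finite_induct) (auto simp: gam_add[OF g(1)] gam_def[of _ _ _ _ 0])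
  show ?thesis
    unfolding fock_module_simps S(2) Sum_slot_op[OF F(1,3)] Sum_slot_op[OF F(1,2)]
    unfolding 1 2
    by (simp add: sum.distrib 3 gam_add[OF g(1)] gs gam_def[of R \<alpha>' \<beta>'])
qed

section \<open>Coordinates with respect to a basis\<close>

lemma
  assumes "vector_space s" "basis_of s W I b"
  shows basis_of_mem: "i \<in> I \<Longrightarrow> b i \<in> W"
    and basis_of_subspace: "module.subspace s W"
    and rep_basis: "i \<in> I \<Longrightarrow> j \<in> I \<Longrightarrow> module.representation s (b ` I) (b i) (b j) = (if i = j then 1 else 0)"
    and rep_add: "v \<in> W \<Longrightarrow> w \<in> W \<Longrightarrow>
      module.representation s (b ` I) (v + w) x = module.representation s (b ` I) v x + module.representation s (b ` I) w x"
    and rep_scale: "v \<in> W \<Longrightarrow> module.representation s (b ` I) (s c v) x = c * module.representation s (b ` I) v x"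
    and rep_finite: "finite {i \<in> I. module.representation s (b ` I) v (b i) \<noteq> 0}"
    and rep_eq: "v \<in> W \<Longrightarrow> finite F \<Longrightarrow> {i \<in> I. module.representation s (b ` I) v (b i) \<noteq> 0} \<subseteq> F \<Longrightarrow> F \<subseteq> I \<Longrightarrow>
      v = (\<Sum>i\<in>F. s (module.representation s (b ` I) v (b i)) (b i))"
    and rep_zero: "module.representation s (b ` I) 0 x = 0"
proof -
  interpret vector_space s by fact
  have inj: "inj_on b I" and ind: "independent (b ` I)" and W: "span (b ` I) = W"
    using assms(2) by (auto simp: basis_of_def)
  show "i \<in> I \<Longrightarrow> b i \<in> W" using W span_base by blast
  show "subspace W" using W subspace_span by metis
  show "representation (b ` I) (b i) (b j) = (if i = j then 1 else 0)" if "i \<in> I" "j \<in> I"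
    using representation_basis[OF ind, of "b i"] that inj by (auto simp: inj_on_def)
  show "v \<in> W \<Longrightarrow> w \<in> W \<Longrightarrow>
      representation (b ` I) (v + w) x = representation (b ` I) v x + representation (b ` I) w x"
    using representation_add[OF ind] W by simp
  show "v \<in> W \<Longrightarrow> representation (b ` I) (s c v) x = c * representation (b ` I) v x"
    using representation_scale[OF ind] W by simp
  show fin: "finite {i \<in> I. representation (b ` I) v (b i) \<noteq> 0}"
  proof (rule inj_on_finite[of b _ "{x. representation (b ` I) v x \<noteq> 0}"])
    show "inj_on b {i \<in> I. representation (b ` I) v (b i) \<noteq> 0}" using inj by (auto simp: inj_on_def)
    show "finite {x. representation (b ` I) v x \<noteq> 0}" by (rule finite_representation)
  qed auto
  show "v = (\<Sum>i\<in>F. s (representation (b ` I) v (b i)) (b i))"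
    if v: "v \<in> W" and F: "finite F" "{i \<in> I. representation (b ` I) v (b i) \<noteq> 0} \<subseteq> F" "F \<subseteq> I"
  proof -
    have vs: "v \<in> span (b ` I)" using v W by simp
    have "v = (\<Sum>x | representation (b ` I) v x \<noteq> 0. s (representation (b ` I) v x) x)"
      using sum_nonzero_representation_eq[OF ind vs] by simp
    also have "{x. representation (b ` I) v x \<noteq> 0} = b ` {i \<in> I. representation (b ` I) v (b i) \<noteq> 0}"
      using representation_ne_zero by blast
    also have "(\<Sum>x\<in>b ` {i \<in> I. representation (b ` I) v (b i) \<noteq> 0}. s (representation (b ` I) v x) x) =
        (\<Sum>i | i \<in> I \<and> representation (b ` I) v (b i) \<noteq> 0. s (representation (b ` I) v (b i)) (b i))"
      by (subst sum.reindex) (use inj in \<open>auto simp: inj_on_def\<close>)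
    also have "\<dots> = (\<Sum>i\<in>F. s (representation (b ` I) v (b i)) (b i))"
      by (rule sum.mono_neutral_left[OF F(1)]) (use F in auto)
    finally show ?thesis .
  qed
  show "representation (b ` I) 0 x = 0" by (simp add: representation_zero)
qed

subsection \<open>The affinization\<close>

locale loop_module =
  fixes G :: "'g::ab_group_add lie_alg" and B :: "'g \<Rightarrow> 'g \<Rightarrow> complex"
    and V :: "('g, 'v::ab_group_add) lie_mod" and Q :: "'v \<Rightarrow> 'v \<Rightarrow> complex"
  assumes lieG: "lie_algebra G" and carG: "lcar G = UNIV"
    and modV: "lie_module G V" and carV: "mcar V = UNIV" and formQ: "orthogonal_form G V Q"
begin

abbreviation "sU \<equiv> mscl (affinization V)"
abbreviation "av \<equiv> act (affinization V)"
abbreviation "Qh \<equiv> affine_form Q"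

text \<open>The elements x + aK + cd. The smaller algebra consists of such elements, and they
  preserve every \<open>t\<^sup>kV\<close>, so the degree-shifting part of the loop product does not
  enter the comparison.\<close>

definition deg0 :: "'g \<Rightarrow> complex \<Rightarrow> complex \<Rightarrow> 'g affine" where
  "deg0 x a c = (single 0 x, a, c)"

lemma vsG: "vector_space (lscl G)" using lieG by (simp add: lie_algebra_def)

lemma vsV: "vector_space (mscl V)" using modV by (simp add: lie_module_def)

lemma sU_eq: "sU c = pmap (mscl V c)"
  by (simp add: affinization_def)

lemma vsU: "vector_space sU"
proof -
  have "sU = (\<lambda>c. pmap (mscl V c))" by (simp add: affinization_def)
  then show ?thesis using vector_space_pmap[OF vsV] by metis
qed

lemma lookup_sU: "lookup (sU c u) k = mscl V c (lookup u k)"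
  by (simp add: sU_eq lookup_pmap vs_zero_right[OF vsV])

lemma actV_lin: "linear_on (mscl V) (mscl V) UNIV (act V x)" "linear_on (lscl G) (mscl V) UNIV (\<lambda>x. act V x u)"
  using modV carG carV by (simp_all add: lie_module_def)

lemma actV_add: "act V x (u + v) = act V x u + act V x v" and actV_scale: "act V x (mscl V c u) = mscl V c (act V x u)"
  and actV_add_left: "act V (x + y) u = act V x u + act V y u" and actV_scale_left: "act V (lscl G c x) u = mscl V c (act V x u)"
  using actV_lin by (auto simp: linear_on_def)

lemma actV_0: "act V x 0 = 0" and actV_0_left: "act V 0 u = 0"
  using actV_scale[of x 0 0] actV_scale_left[of 0 0 u]
  by (simp_all add: vs_zero[OF vsV] vs_zero[OF vsG])

lemma lookup_euler: "lookup (euler_derivation (mscl V) u) k = mscl V (of_int k) (lookup u k)"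
proof -
  have "lookup (euler_derivation (mscl V) u) k =
      (\<Sum>l\<in>keys u. if l = k then mscl V (of_int k) (lookup u k) else 0)"
    unfolding euler_derivation_def lookup_sum by (rule sum.cong) (auto simp: lookup_single when_def)
  then show ?thesis by (auto simp: in_keys_iff vs_zero_right[OF vsV])
qed

lemma lookup_av: "lookup (av (deg0 x a c) u) k =
    act V x (lookup u k) + mscl V (c * of_int k) (lookup u k)"
proof -
  have "lookup (loop_product (act V) (single 0 x) u) k = act V x (lookup u k)"
  proof (cases "x = 0")
    case True
    then show ?thesis by (simp add: loop_product_def actV_0_left)
  next
    case False
    then have "lookup (loop_product (act V) (single 0 x) u) k =
        (\<Sum>l\<in>keys u. if l = k then act V x (lookup u k) else 0)"
      unfolding loop_product_def by (auto simp: lookup_sum lookup_single when_def intro!: sum.cong)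
    then show ?thesis by (auto simp: in_keys_iff actV_0)
  qed
  then show ?thesis
    by (simp add: affinization_def deg0_def lookup_add lookup_pmap vs_zero_right[OF vsV] lookup_euler vs_mult[OF vsV])
qed

lemma keys_av: "keys (av (deg0 x a c) u) \<subseteq> keys u"
  by (auto simp: in_keys_iff lookup_av actV_0 vs_zero_right[OF vsV])

lemma av_add: "av (deg0 x a c) (u + v) = av (deg0 x a c) u + av (deg0 x a c) v"
  by (rule poly_mapping_eqI) (simp add: lookup_av lookup_add actV_add vs_add[OF vsV])

lemma av_scale: "av (deg0 x a c) (sU d u) = sU d (av (deg0 x a c) u)"
  by (rule poly_mapping_eqI) (simp add: lookup_av lookup_sU actV_scale vs_add[OF vsV] vs_mult[OF vsV] mult.commute)

lemma av_0: "av (deg0 x a c) 0 = 0"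
  by (rule poly_mapping_eqI) (simp add: lookup_av actV_0 vs_zero_right[OF vsV])

lemma av_sum: "av (deg0 x a c) (sum f A) = (\<Sum>i\<in>A. av (deg0 x a c) (f i))"
  by (induction A rule: infinite_finite_induct) (auto simp: av_0 av_add)

definition proj :: "int \<Rightarrow> (int \<Rightarrow>\<^sub>0 'v) \<Rightarrow> (int \<Rightarrow>\<^sub>0 'v)" where
  "proj l u = single l (lookup u l)"

lemma lookup_proj: "lookup (proj l u) k = (if k = l then lookup u l else 0)"
  by (auto simp: proj_def lookup_single when_def)

lemma proj_add: "proj l (u + v) = proj l u + proj l v"
  by (rule poly_mapping_eqI) (simp add: lookup_proj lookup_add)

lemma proj_scale: "proj l (sU c u) = sU c (proj l u)"
  by (rule poly_mapping_eqI) (simp add: lookup_proj lookup_sU vs_zero_right[OF vsV])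

lemma proj_av: "proj l (av (deg0 x a c) u) = av (deg0 x a c) (proj l u)"
  by (rule poly_mapping_eqI) (simp add: lookup_proj lookup_av actV_0 vs_zero_right[OF vsV])

lemma proj_keys: "keys (proj l u) \<subseteq> {l}"
  by (simp add: proj_def)

lemma proj_id: "keys u \<subseteq> {l} \<Longrightarrow> proj l u = u"
  by (rule poly_mapping_eqI) (auto simp: lookup_proj in_keys_iff)

lemma proj_other: "keys u \<subseteq> {l} \<Longrightarrow> k \<noteq> l \<Longrightarrow> proj k u = 0"
  by (rule poly_mapping_eqI) (auto simp: lookup_proj in_keys_iff)

lemma sum_proj:
  assumes "finite X" "keys u \<subseteq> X"
  shows "u = (\<Sum>l\<in>X. proj l u)"
proof (rule poly_mapping_eqI)
  fix k
  have "lookup u k = 0" if "k \<notin> X" using that assms(2) by (auto simp: in_keys_iff)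
  then show "lookup u k = lookup (\<Sum>l\<in>X. proj l u) k"
    using assms(1) by (simp add: lookup_sum lookup_proj)
qed

lemma Q_lin: "linear_on (mscl V) (*) UNIV (Q u)" and Q_sym: "Q u v = Q v u"
  using formQ by (simp_all add: orthogonal_form_def carV)

lemma Q_inv: "Q (act V x u) v + Q u (act V x v) = 0"
  using formQ unfolding orthogonal_form_def carV carG by blast

lemma Q_add: "Q u (v + w) = Q u v + Q u w" and Q_scale: "Q u (mscl V c v) = c * Q u v"
  using Q_lin by (auto simp: linear_on_def)

lemma Q_0: "Q u 0 = 0" "Q 0 u = 0"
  using Q_scale[of u 0 0] Q_sym[of u 0] by (simp_all add: vs_zero[OF vsV])

lemma Qh_superset: "finite X \<Longrightarrow> keys u \<subseteq> X \<Longrightarrow>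
    Qh u v = (\<Sum>k\<in>X. Q (lookup u k) (lookup v (- k)))"
  unfolding affine_form_def by (rule sum.mono_neutral_left) (auto simp: in_keys_iff Q_0)

lemma Qh_add_right: "Qh u (v + w) = Qh u v + Qh u w" and Qh_scale_right: "Qh u (sU c v) = c * Qh u v"
  by (simp_all add: affine_form_def lookup_add lookup_sU Q_add Q_scale sum.distrib sum_distrib_left)

lemma Qh_sym: "Qh u v = Qh v u"
proof -
  let ?X = "keys u \<union> uminus ` keys v"
  have "Qh u v = (\<Sum>k\<in>?X. Q (lookup u k) (lookup v (- k)))"
    by (rule Qh_superset) auto
  also have "\<dots> = (\<Sum>k\<in>uminus ` ?X. Q (lookup v k) (lookup u (- k)))"
    by (subst sum.reindex) (auto simp: inj_on_def Q_sym)
  also have "\<dots> = Qh v u"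
    by (rule Qh_superset[symmetric]) (force simp: image_iff)+
  finally show ?thesis .
qed

lemma Qh_add_left: "Qh (u + w) v = Qh u v + Qh w v" and Qh_scale_left: "Qh (sU c u) v = c * Qh u v"
  using Qh_add_right[of v u w] Qh_scale_right[of v c u] by (simp_all add: Qh_sym[of v])

lemma Qh_0: "Qh 0 v = 0" "Qh v 0 = 0"
  using Qh_sym[of v 0] by (simp_all add: affine_form_def)

lemma Qh_sum_left: "Qh (sum f A) v = (\<Sum>i\<in>A. Qh (f i) v)"
  and Qh_sum_right: "Qh v (sum f A) = (\<Sum>i\<in>A. Qh v (f i))"
  by (induction A rule: infinite_finite_induct) (auto simp: Qh_0 Qh_add_left Qh_add_right)

lemma Qh_proj: "Qh (proj l u) v = Q (lookup u l) (lookup v (- l))"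
  using Qh_superset[of "{l}" "proj l u" v] proj_keys[of l u] by (simp add: lookup_proj)

lemma Qh_proj_right: "Qh u (proj l v) = Qh (proj (- l) u) v"
  using Qh_proj[of l v u] Qh_proj[of "- l" u v] by (simp add: Qh_sym[of u] Q_sym)

text \<open>The form pairs degrees \<open>k\<close> and \<open>- k\<close> only, and on these the
  derivation acts by opposite scalars; the rest is invariance of \<open>Q\<close>.\<close>

lemma Qh_inv: "Qh (av (deg0 x a c) u) v + Qh u (av (deg0 x a c) v) = 0"
proof -
  let ?X = "keys u"
  have "keys (av (deg0 x a c) u) \<subseteq> ?X" by (rule keys_av)
  then have "Qh (av (deg0 x a c) u) v + Qh u (av (deg0 x a c) v) =
      (\<Sum>k\<in>?X. Q (lookup (av (deg0 x a c) u) k) (lookup v (- k)) +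
        Q (lookup u k) (lookup (av (deg0 x a c) v) (- k)))"
    using Qh_superset[of ?X "av (deg0 x a c) u" v] Qh_superset[of ?X u "av (deg0 x a c) v"] by (simp add: sum.distrib)
  also have "\<dots> = 0"
  proof (rule sum.neutral, rule ballI)
    fix k
    let ?p = "lookup u k" and ?q = "lookup v (- k)"
    have "Q (act V x ?p + mscl V (c * of_int k) ?p) ?q = Q (act V x ?p) ?q + c * of_int k * Q ?p ?q"
      using Q_add[of ?q] Q_scale[of ?q] by (simp add: Q_sym[of _ ?q])
    then show "Q (lookup (av (deg0 x a c) u) k) ?q +
        Q ?p (lookup (av (deg0 x a c) v) (- k)) = 0"
      using Q_inv[of x ?p ?q] by (simp add: lookup_av Q_add Q_scale algebra_simps)
  qed
  finally show ?thesis .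
qed

lemma bracket_deg0: "lbr (affine_algebra G B) (deg0 x a c) (deg0 y a' c') = deg0 (lbr G x y) 0 0"
proof -
  have l: "linear_on (lscl G) (lscl G) UNIV (lbr G x)" "linear_on (lscl G) (lscl G) UNIV (\<lambda>x. lbr G x y)"
    using lieG carG by (auto simp: lie_algebra_def)
  have z: "lbr G x 0 = 0" "lbr G 0 y = 0"
    using linear_on_0[OF l(1) vsG vsG] linear_on_0[OF l(2) vsG vsG] by (simp_all add: subspaceI[OF vsG])
  have "loop_product (lbr G) (single 0 x) (single 0 y) = (single 0 (lbr G x y) :: int \<Rightarrow>\<^sub>0 'g)"
    using z by (cases "x = 0"; cases "y = 0") (simp_all add: loop_product_def)
  moreover have "euler_derivation (lscl G) (single 0 w) = 0" for w
    unfolding euler_derivation_def by (rule sum.neutral) (auto simp: vs_zero[OF vsG] split: if_splits)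
  moreover have "(\<Sum>m\<in>keys (single (0::int) x).
           of_int m * B (lookup (single 0 x) m) (lookup (single 0 y) (- m))) = 0"
    by (rule sum.neutral) (auto split: if_splits)
  ultimately show ?thesis by (simp add: affine_algebra_def deg0_def)
qed

lemma lscl_deg0: "lscl (affine_algebra G B) c (deg0 x a d) = deg0 (lscl G c x) (c * a) (c * d)"
  by (simp add: affine_algebra_def deg0_def pmap_single[where f = "lscl G c", OF vs_zero_right[OF vsG]])

lemma deg0_add: "deg0 x a c + deg0 y b d = deg0 (x + y) (a + b) (c + d)"
  by (simp add: deg0_def single_add)

lemma vs_affine: "vector_space (lscl (affine_algebra G B))"
  unfolding affine_algebra_def
  by standard
     (auto simp: algebra_simps vs_add[OF vector_space_pmap[OF vsG]] vs_add_left[OF vector_space_pmap[OF vsG]]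
        vs_mult[OF vector_space_pmap[OF vsG]] vs_one[OF vector_space_pmap[OF vsG]])

lemma hat_d_deg0: "hat_d N d = deg0 d 0 (of_int N)"
  by (simp add: hat_d_def deg0_def)

text \<open>The derivation is recovered from \<open>hat_d N d\<close> by subtracting the element
  \<open>d\<close> of \<open>W\<close> and dividing by \<open>N\<close>.\<close>

lemma with_hat_d_eq:
  assumes W: "module.subspace (lscl G) W" "d \<in> W" and N: "N \<noteq> 0"
  shows "with_hat_d G B N d W = {deg0 x 0 c | x c. x \<in> W}"
proof (intro equalityI subsetI)
  fix y assume "y \<in> with_hat_d G B N d W"
  then obtain x c where xc: "x \<in> W" "y = deg0 x 0 0 + lscl (affine_algebra G B) c (hat_d N d)"
    unfolding with_hat_d_def deg0_def by blast
  have "y = deg0 (x + lscl G c d) 0 (c * of_int N)" unfolding xc(2) hat_d_deg0 lscl_deg0 deg0_add by simp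
  moreover have "x + lscl G c d \<in> W" using subspace_add[OF vsG W(1) xc(1)] subspace_scale[OF vsG W(1,2)] by blast
  ultimately show "y \<in> {deg0 x 0 c | x c. x \<in> W}" by blast
next
  fix y assume "y \<in> {deg0 x 0 c | x c. x \<in> W}"
  then obtain x c where xc: "y = deg0 x 0 c" "x \<in> W" by blast
  let ?r = "c / of_int N"
  have "y = deg0 (x - lscl G ?r d) 0 0 + lscl (affine_algebra G B) ?r (hat_d N d)"
    unfolding xc(1) hat_d_deg0 lscl_deg0 deg0_add using N by simp
  moreover have "x - lscl G ?r d \<in> W" using subspace_diff[OF vsG W(1) xc(2)] subspace_scale[OF vsG W(1,2)] by blast
  ultimately show "y \<in> with_hat_d G B N d W" unfolding with_hat_d_def deg0_def by blast
qed

lemma t_power_simps: "mscl (t_power V k) = sU" "act (t_power V k) = av" "mcar (t_power V k) = {u. keys u \<subseteq> {k}}"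
  by (simp_all add: t_power_def)

end

subsection \<open>The Clifford action of the affinization on the Fock space\<close>

text \<open>The small spin module is described by its commutators with the Clifford generators
  (\<open>st_comm\<close>), which are insensitive to the scalar in the lift. The space of degree
  \<open>\<epsilon> * k\<close> supplies the creation operators of slot \<open>k\<close>.\<close>

locale loop_fock = loop_module G B V Q
  for G :: "'g::ab_group_add lie_alg" and B and V :: "('g, 'v::ab_group_add) lie_mod" and Q +
  fixes L :: "'g affine lie_alg" and \<epsilon> :: int and n :: nat and b :: "nat \<Rightarrow> nat \<Rightarrow> (int \<Rightarrow>\<^sub>0 'v)"
    and I :: "int set" and e :: "int \<Rightarrow> (int \<Rightarrow>\<^sub>0 'v)"
    and st :: "'g affine \<Rightarrow> (int set \<Rightarrow>\<^sub>0 complex) \<Rightarrow> (int set \<Rightarrow>\<^sub>0 complex)"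
  assumes eps: "\<epsilon> \<in> {1, - 1}"
    and carL: "x \<in> lcar L \<Longrightarrow> \<exists>y a c. x = deg0 y a c"
    and bk: "k \<ge> 1 \<Longrightarrow> basis_of sU {u. keys u \<subseteq> {\<epsilon> * int k}} {..<n} (b k)"
    and be: "basis_of sU {u. keys u \<subseteq> {0}} I e"
    and finI: "finite I" and symI: "uminus ` I = I"
    and formI: "i \<in> I \<Longrightarrow> j \<in> I \<Longrightarrow> Qh (e i) (e j) = (if i = - j then 1 else 0)"
    and st_mod: "op_module L (spin_module I st)"
    and st_comm: "x \<in> lcar L \<Longrightarrow> w \<in> spin_space I \<Longrightarrow> l \<in> I \<Longrightarrow>
      st x (clifford l w) = clifford l (st x w) +
        (\<Sum>i\<in>I. cscale (module.representation sU (e ` I) (av x (e (\<epsilon> * l))) (e (\<epsilon> * i))) (clifford i w))"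
begin

lemma eps_cases: "\<epsilon> = 1 \<or> \<epsilon> = - 1" using eps by simp

lemma eps_sq [simp]: "\<epsilon> * \<epsilon> = 1" "\<epsilon> * (\<epsilon> * i) = i" using eps_cases by auto

lemma neg_I: "- i \<in> I \<longleftrightarrow> i \<in> I" using symI by (metis image_eqI image_iff minus_minus)

lemma eps_I: "\<epsilon> * i \<in> I \<longleftrightarrow> i \<in> I"
  by (rule disjE[OF eps_cases]) (simp_all add: neg_I)

definition repI :: "(int \<Rightarrow>\<^sub>0 'v) \<Rightarrow> int \<Rightarrow> complex" where
  "repI v i = module.representation sU (e ` I) (proj 0 v) (e i)"

definition al :: "(int \<Rightarrow>\<^sub>0 'v) \<Rightarrow> nat \<times> nat \<Rightarrow> complex" where
  "al v = (\<lambda>(k, i). module.representation sU (b k ` {..<n}) (proj (\<epsilon> * int k) v) (b k i))"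

text \<open>The component of degree \<open>- \<epsilon> * k\<close> is recorded by its pairings with
  \<open>b k\<close>, that is, by its coordinates in the dual basis, so no basis of that space has
  to be chosen. The factor 2 produces the anticommutators \<open>2 * Qh\<close>.\<close>

definition bt :: "(int \<Rightarrow>\<^sub>0 'v) \<Rightarrow> nat \<times> nat \<Rightarrow> complex" where
  "bt v = (\<lambda>(k, i). 2 * Qh v (b k i))"

text \<open>For \<open>\<epsilon> = - 1\<close> the vector e_i acts by the generator of index
  \<open>- i\<close>: creation and annihilation change places, as they do in that
  normalization.\<close>

definition gI :: "(int \<Rightarrow>\<^sub>0 'v) \<Rightarrow> (int set \<Rightarrow>\<^sub>0 complex) \<Rightarrow> (int set \<Rightarrow>\<^sub>0 complex)" where
  "gI v w = (\<Sum>i\<in>I. cscale (repI v i) (clifford (\<epsilon> * i) w))"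

definition Ks :: "(int \<Rightarrow>\<^sub>0 'v) \<Rightarrow> nat set" where
  "Ks v = {k. k \<ge> 1 \<and> (\<epsilon> * int k \<in> keys v \<or> - \<epsilon> * int k \<in> keys v)}"

text \<open>The Clifford action of \<open>v\<close>: creation on the components of degree \<open>\<epsilon> k\<close>, annihilation on
  those of degree \<open>- \<epsilon> k\<close>, and the Clifford action on the spin space in degree zero.\<close>

definition Gm :: "(int \<Rightarrow>\<^sub>0 'v) \<Rightarrow> fock \<Rightarrow> fock" where
  "Gm v = gam (Ks v \<times> {..<n}) (al v) (bt v) (gI v)"

definition amat :: "'g affine \<Rightarrow> nat \<Rightarrow> nat \<Rightarrow> nat \<Rightarrow> complex" where
  "amat x k j i = module.representation sU (b k ` {..<n}) (av x (b k i)) (b k j)"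

abbreviation "FT \<equiv> fock_module (spin_module I st) n amat"

lemma spin_module_simps: "mcar (spin_module I st) = spin_space I" "mscl (spin_module I st) = cscale"
  "act (spin_module I st) = st"
  by (simp_all add: spin_module_def)

lemma proj_in: "proj l v \<in> {u. keys u \<subseteq> {l}}"
  using proj_keys by simp

lemma b_keys: "k \<ge> 1 \<Longrightarrow> i < n \<Longrightarrow> keys (b k i) \<subseteq> {\<epsilon> * int k}"
  using basis_of_mem[OF vsU bk] by simp

lemma e_keys: "i \<in> I \<Longrightarrow> keys (e i) \<subseteq> {0}"
  using basis_of_mem[OF vsU be] by simp

lemma finite_Ks: "finite (Ks v)"
proof -
  have "Ks v \<subseteq> (\<lambda>l. nat \<bar>l\<bar>) ` keys v"
  proof
    fix k assume "k \<in> Ks v"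
    then have "\<epsilon> * int k \<in> keys v \<or> - \<epsilon> * int k \<in> keys v" by (simp add: Ks_def)
    moreover have "nat \<bar>\<epsilon> * int k\<bar> = k" "nat \<bar>- \<epsilon> * int k\<bar> = k" using eps_cases by auto
    ultimately show "k \<in> (\<lambda>l. nat \<bar>l\<bar>) ` keys v" by (metis imageI)
  qed
  then show ?thesis by (rule finite_subset) simp
qed

lemma Ks_pos: "Ks v \<subseteq> {1..}" by (auto simp: Ks_def)

lemma al_add: "k \<ge> 1 \<Longrightarrow> al (v + w) (k, i) = al v (k, i) + al w (k, i)"
  unfolding al_def using rep_add[OF vsU bk proj_in proj_in] by (simp add: proj_add)

lemma al_scale: "k \<ge> 1 \<Longrightarrow> al (sU c v) (k, i) = c * al v (k, i)"
  unfolding al_def using rep_scale[OF vsU bk proj_in] by (simp add: proj_scale)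

lemma repI_add: "repI (v + w) i = repI v i + repI w i"
  unfolding repI_def using rep_add[OF vsU be proj_in proj_in] by (simp add: proj_add)

lemma repI_scale: "repI (sU c v) i = c * repI v i"
  unfolding repI_def using rep_scale[OF vsU be proj_in] by (simp add: proj_scale)

lemma bt_add: "bt (v + w) p = bt v p + bt w p" and bt_scale: "bt (sU c v) p = c * bt v p"
  by (simp_all add: bt_def Qh_add_left Qh_scale_left algebra_simps split: prod.splits)

lemma gI_add: "gI (v + v') w = gI v w + gI v' w"
  by (simp add: gI_def repI_add cscale_add_left sum.distrib)

lemma gI_scale: "gI (sU c v) w = cscale c (gI v w)"
  by (simp add: gI_def repI_scale cscale_sum cscale_cscale)

lemma gI_linmap: "linmap (gI v)"
  unfolding linmap_def gI_def
  by (simp add: clifford_add clifford_cscale cscale_add sum.distrib cscale_sum cscale_cscale mult.commute)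

lemma gI_spin: "w \<in> spin_space I \<Longrightarrow> gI v w \<in> spin_space I"
  unfolding gI_def
  by (rule subspace_sum[OF cscale_vs spin_space_subspace], rule subspace_scale[OF cscale_vs spin_space_subspace])
     (rule clifford_spin_space, auto simp: eps_I)

lemma proj_repI: "proj 0 v = (\<Sum>i\<in>I. sU (repI v i) (e i))"
  unfolding repI_def by (rule rep_eq[OF vsU be proj_in finI]) auto

lemma proj_al: "k \<ge> 1 \<Longrightarrow> proj (\<epsilon> * int k) v = (\<Sum>i<n. sU (al v (k, i)) (b k i))"
  unfolding al_def prod.case by (rule rep_eq[OF vsU bk proj_in]) auto

text \<open>Outside \<open>Ks v\<close> both coefficients vanish. Enlarging the index set allows the
  operators of several vectors to be written over the same modes.\<close>

lemma Gm_eq: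
  assumes "finite K" "Ks v \<subseteq> K" "K \<subseteq> {1..}"
  shows "Gm v u = gam (K \<times> {..<n}) (al v) (bt v) (gI v) u"
proof -
  have "fld (al v) (bt v) p u = 0" if p: "p \<in> K \<times> {..<n} - Ks v \<times> {..<n}" for p
  proof -
    obtain k i where ki: "p = (k, i)" "k \<ge> 1" "k \<notin> Ks v" "i < n" using p assms(3) by auto
    then have nk: "lookup v (\<epsilon> * int k) = 0" "lookup v (- (\<epsilon> * int k)) = 0"
      by (auto simp: Ks_def in_keys_iff)
    then have "proj (\<epsilon> * int k) v = 0" by (simp add: proj_def)
    then have a: "al v p = 0" unfolding al_def ki(1) using rep_zero[OF vsU bk] ki(2) by simp
    have "Qh v (b k i) = Qh v (proj (\<epsilon> * int k) (b k i))" using proj_id[OF b_keys[OF ki(2,4)]] by simp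
    also have "\<dots> = 0" unfolding Qh_proj_right Qh_proj using nk by (simp add: Q_0)
    finally have "bt v p = 0" by (simp add: bt_def ki(1))
    then show ?thesis using a by (simp add: fld_def fscale_zero)
  qed
  then have "(\<Sum>p\<in>Ks v \<times> {..<n}. fld (al v) (bt v) p u) = (\<Sum>p\<in>K \<times> {..<n}. fld (al v) (bt v) p u)"
    using assms by (intro sum.mono_neutral_left) auto
  then show ?thesis unfolding Gm_def gam_def by simp
qed

lemma Gm_add_right: "Gm v (u + w) = Gm v u + Gm v w" and Gm_fscale_right: "Gm v (fscale c u) = fscale c (Gm v u)"
  unfolding Gm_def by (rule gam_add[OF gI_linmap], rule gam_fscale[OF gI_linmap])

lemma Gm_add: "Gm (v + w) u = Gm v u + Gm w u"
proof -
  let ?K = "Ks (v + w) \<union> Ks v \<union> Ks w"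
  have K: "finite ?K" "?K \<subseteq> {1..}" using finite_Ks Ks_pos by auto
  have e: "Gm x u = gam (?K \<times> {..<n}) (al x) (bt x) (gI x) u" if "x \<in> {v + w, v, w}" for x
    by (rule Gm_eq[OF K(1) _ K(2)]) (use that in auto)
  have "pmap (gI (v + w)) u = pmap (gI v) u + pmap (gI w) u"
    by (rule poly_mapping_eqI) (simp add: lookup_pmap linmap_0[OF gI_linmap] lookup_add gI_add)
  moreover have "fld (al (v + w)) (bt (v + w)) p u = fld (al v) (bt v) p u + fld (al w) (bt w) p u" if "p \<in> ?K \<times> {..<n}" for p
    using that K(2) al_add[of "fst p" v w "snd p"] by (cases p) (auto simp: fld_def bt_add fscale_add_left)
  ultimately show ?thesis
    using e[of v] e[of w] e[of "v + w"] by (simp add: gam_def par_add sum.distrib)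
qed

lemma Gm_scale: "Gm (sU c v) u = fscale c (Gm v u)"
proof -
  let ?K = "Ks (sU c v) \<union> Ks v"
  have K: "finite ?K" "?K \<subseteq> {1..}" using finite_Ks Ks_pos by auto
  have e: "Gm x u = gam (?K \<times> {..<n}) (al x) (bt x) (gI x) u" if "x \<in> {sU c v, v}" for x
    by (rule Gm_eq[OF K(1) _ K(2)]) (use that in auto)
  have "pmap (gI (sU c v)) u = fscale c (pmap (gI v) u)"
    by (rule poly_mapping_eqI) (simp add: lookup_pmap linmap_0[OF gI_linmap] fscale_def gI_scale)
  moreover have "fld (al (sU c v)) (bt (sU c v)) p u = fscale c (fld (al v) (bt v) p u)" if "p \<in> ?K \<times> {..<n}" for p
    using that K(2) al_scale[of "fst p" c v "snd p"] by (cases p) (auto simp: fld_def bt_scale fscale_add fscale_mult)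
  ultimately show ?thesis
    using e[of v] e[of "sU c v"] by (simp add: gam_def fscale_par fscale_add fscale_sum)
qed

lemma Gm_0: "Gm 0 u = 0"
  using Gm_scale[of 0 0 u] by (simp add: vs_zero[OF vsU] fscale_zero)

lemma Gm_sum: "Gm (sum f A) u = (\<Sum>i\<in>A. Gm (f i) u)"
  by (induction A rule: infinite_finite_induct) (auto simp: Gm_0 Gm_add)

lemma gI_anticomm:
  assumes w: "finkeys w"
  shows "gI v (gI v' w) + gI v' (gI v w) = cscale (2 * Qh (proj 0 v) (proj 0 v')) w"
proof -
  have "gI v (gI v' w) = (\<Sum>i\<in>I. \<Sum>j\<in>I. cscale (repI v i * repI v' j) (clifford (\<epsilon> * i) (clifford (\<epsilon> * j) w)))" for v v'
    by (simp add: gI_def clifford_sum clifford_cscale cscale_sum cscale_cscale)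
  then have "gI v (gI v' w) + gI v' (gI v w) =
      (\<Sum>i\<in>I. \<Sum>j\<in>I. cscale (repI v i * repI v' j) (clifford (\<epsilon> * i) (clifford (\<epsilon> * j) w))) +
      (\<Sum>j\<in>I. \<Sum>i\<in>I. cscale (repI v' j * repI v i) (clifford (\<epsilon> * j) (clifford (\<epsilon> * i) w)))"
    by simp
  also have "\<dots> = (\<Sum>i\<in>I. \<Sum>j\<in>I. cscale (repI v i * repI v' j)
      (clifford (\<epsilon> * i) (clifford (\<epsilon> * j) w) + clifford (\<epsilon> * j) (clifford (\<epsilon> * i) w)))"
    by (subst (2) sum.swap) (simp add: sum.distrib cscale_add mult.commute)
  also have "\<dots> = (\<Sum>i\<in>I. \<Sum>j\<in>I. cscale (repI v i * repI v' j * (2 * Qh (e i) (e j))) w)"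
  proof (intro sum.cong refl)
    fix i j assume ij: "i \<in> I" "j \<in> I"
    have "\<epsilon> * i = - (\<epsilon> * j) \<longleftrightarrow> i = - j" using eps_cases by auto
    then have "clifford (\<epsilon> * i) (clifford (\<epsilon> * j) w) + clifford (\<epsilon> * j) (clifford (\<epsilon> * i) w) = cscale (2 * Qh (e i) (e j)) w"
      using clifford_anticomm[OF w, of "\<epsilon> * i" "\<epsilon> * j"] formI[OF ij] by simp
    then show "cscale (repI v i * repI v' j) (clifford (\<epsilon> * i) (clifford (\<epsilon> * j) w) + clifford (\<epsilon> * j) (clifford (\<epsilon> * i) w)) =
      cscale (repI v i * repI v' j * (2 * Qh (e i) (e j))) w"
      by (simp add: cscale_cscale)
  qed
  also have "\<dots> = cscale (2 * Qh (proj 0 v) (proj 0 v')) w"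
  proof -
    have "cscale (sum f A) w = (\<Sum>i\<in>A. cscale (f i) w)" for f :: "int \<Rightarrow> complex" and A
      by (induction A rule: infinite_finite_induct) (auto simp: cscale_add_left)
    moreover have "2 * Qh (proj 0 v) (proj 0 v') = (\<Sum>i\<in>I. \<Sum>j\<in>I. repI v i * repI v' j * (2 * Qh (e i) (e j)))"
      unfolding proj_repI Qh_sum_left Qh_sum_right Qh_scale_left Qh_scale_right sum_distrib_left
      by (subst sum.swap) (simp add: algebra_simps)
    ultimately show ?thesis by simp
  qed
  finally show ?thesis .
qed

text \<open>The component of degree \<open>\<epsilon> * k\<close> of one vector pairs with that of
  degree \<open>- \<epsilon> * k\<close> of the other: coordinates \<open>al\<close> of the first
  times pairings \<open>bt\<close> of the second, in both orders.\<close>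

lemma Qh_split:
  assumes K: "finite K" "Ks v \<subseteq> K" "K \<subseteq> {1..}"
  shows "2 * Qh v w = 2 * Qh (proj 0 v) (proj 0 w) + (\<Sum>p\<in>K \<times> {..<n}. al v p * bt w p + bt v p * al w p)"
proof -
  let ?p = "(\<lambda>k. \<epsilon> * int k) ` K" and ?m = "(\<lambda>k. - (\<epsilon> * int k)) ` K"
  have inj: "inj_on (\<lambda>k. \<epsilon> * int k) K" "inj_on (\<lambda>k. - (\<epsilon> * int k)) K" using eps_cases by (auto simp: inj_on_def)
  have pos: "int k > 0" if "k \<in> K" for k using K(3) that by auto
  have "\<epsilon> * int k \<noteq> - (\<epsilon> * int k')" if "k \<in> K" "k' \<in> K" for k k'
    using pos[OF that(1)] pos[OF that(2)] eps_cases by auto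
  then have disj: "?p \<inter> ?m = {}" "0 \<notin> ?p \<union> ?m" using pos eps_cases by (blast, force)
  have keys: "keys v \<subseteq> insert 0 (?p \<union> ?m)"
  proof
    fix l assume l: "l \<in> keys v"
    show "l \<in> insert 0 (?p \<union> ?m)"
    proof (cases "l = 0")
      case False
      let ?k = "nat \<bar>l\<bar>"
      have lk: "l = \<epsilon> * int ?k \<or> l = - (\<epsilon> * int ?k)" using eps_cases by auto
      then have "?k \<in> K" using l False K(2) by (auto simp: Ks_def)
      then show ?thesis using lk by blast
    qed simp
  qed
  have "Qh v w = (\<Sum>l\<in>insert 0 (?p \<union> ?m). Qh (proj l v) w)"
    using sum_proj[OF _ keys] K(1) Qh_sum_left[of "\<lambda>l. proj l v" "insert 0 (?p \<union> ?m)" w] by simp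
  also have "\<dots> = Qh (proj 0 v) w + ((\<Sum>l\<in>?p. Qh (proj l v) w) + (\<Sum>l\<in>?m. Qh (proj l v) w))"
    using disj K(1) by (simp add: sum.union_disjoint)
  also have "(\<Sum>l\<in>?p. Qh (proj l v) w) = (\<Sum>k\<in>K. \<Sum>i<n. al v (k, i) * Qh w (b k i))"
    unfolding sum.reindex[OF inj(1)]
  proof (rule sum.cong[OF refl])
    fix k assume "k \<in> K"
    then have "k \<ge> 1" using K(3) by auto
    then show "((\<lambda>l. Qh (proj l v) w) \<circ> (\<lambda>k. \<epsilon> * int k)) k = (\<Sum>i<n. al v (k, i) * Qh w (b k i))"
      by (simp add: proj_al Qh_sum_left Qh_scale_left Qh_sym[of w])
  qed
  also have "(\<Sum>l\<in>?m. Qh (proj l v) w) = (\<Sum>k\<in>K. \<Sum>i<n. al w (k, i) * Qh v (b k i))"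
    unfolding sum.reindex[OF inj(2)]
  proof (rule sum.cong[OF refl])
    fix k assume "k \<in> K"
    then have k: "k \<ge> 1" using K(3) by auto
    have "Qh (proj (- (\<epsilon> * int k)) v) w = Qh v (proj (\<epsilon> * int k) w)" by (simp add: Qh_proj_right)
    then show "((\<lambda>l. Qh (proj l v) w) \<circ> (\<lambda>k. - (\<epsilon> * int k))) k = (\<Sum>i<n. al w (k, i) * Qh v (b k i))"
      by (simp add: proj_al[OF k] Qh_sum_right Qh_scale_right)
  qed
  also have "Qh (proj 0 v) w = Qh (proj 0 v) (proj 0 w)" by (simp add: Qh_proj lookup_proj)
  finally have "2 * Qh v w = 2 * Qh (proj 0 v) (proj 0 w) +
      (\<Sum>k\<in>K. \<Sum>i<n. al v (k, i) * bt w (k, i) + bt v (k, i) * al w (k, i))"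
    by (simp add: bt_def sum.distrib sum_distrib_left algebra_simps)
  then show ?thesis by (simp add: sum.cartesian_product)
qed

lemma FT_finkeys: "u \<in> mcar FT \<Longrightarrow> finkeys u" by (rule fock_finkeys)

lemma FT_lookup: "u \<in> mcar FT \<Longrightarrow> lookup u K \<in> spin_space I"
  by (simp add: fock_module_simps spin_module_simps)

lemma Gm_anticomm:
  assumes u: "u \<in> mcar FT"
  shows "Gm v (Gm w u) + Gm w (Gm v u) = fscale (2 * Qh v w) u"
proof -
  let ?K = "Ks v \<union> Ks w"
  have K: "finite ?K" "?K \<subseteq> {1..}" using finite_Ks Ks_pos by auto
  have ev: "Gm v = gam (?K \<times> {..<n}) (al v) (bt v) (gI v)" by (rule ext, rule Gm_eq[OF K(1) _ K(2)]) simp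
  have ew: "Gm w = gam (?K \<times> {..<n}) (al w) (bt w) (gI w)" by (rule ext, rule Gm_eq[OF K(1) _ K(2)]) simp
  have "gam (?K \<times> {..<n}) (al v) (bt v) (gI v) (gam (?K \<times> {..<n}) (al w) (bt w) (gI w) u) +
     gam (?K \<times> {..<n}) (al w) (bt w) (gI w) (gam (?K \<times> {..<n}) (al v) (bt v) (gI v) u) =
     fscale (2 * Qh (proj 0 v) (proj 0 w) + (\<Sum>p\<in>?K \<times> {..<n}. al v p * bt w p + bt v p * al w p)) u"
    by (rule gam_anticomm)
       (use K FT_finkeys[OF u] gI_linmap gI_anticomm[OF spin_space_finkeys[OF FT_lookup[OF u]]] in auto)
  then show ?thesis unfolding ev ew Qh_split[OF K(1) Un_upper1 K(2)] .
qed

lemma fscale_eq: "fscale = (\<lambda>c. pmap (mscl (spin_module I st) c))"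
  by (simp add: fscale_def[abs_def] spin_module_simps)

lemma FT_subspace: "module.subspace fscale (mcar FT)"
  unfolding fscale_eq by (rule fock_module_subspace[OF st_mod])

lemma FT_par: "u \<in> mcar FT \<Longrightarrow> par u \<in> mcar FT"
  using sg_mem[OF st_mod] by (simp add: fock_module_simps par.rep_eq)

lemma Gm_in: 
  assumes u: "u \<in> mcar FT"
  shows "Gm v u \<in> mcar FT"
proof -
  have "pmap (gI v) u \<in> mcar FT"
    by (rule fock_pmap[where f = "gI v", OF u linmap_0[OF gI_linmap]]) (simp add: spin_module_simps gI_spin)
  moreover have "fld (al v) (bt v) p u \<in> mcar FT" if "p \<in> Ks v \<times> {..<n}" for p
  proof -
    have "cre p u \<in> mcar FT" using that Ks_pos fock_cre[OF st_mod u] by (cases p) auto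
    then show ?thesis
      unfolding fld_def using fock_ann[OF st_mod u]
      by (intro subspace_add[OF fscale_vs FT_subspace] subspace_scale[OF fscale_vs FT_subspace])
  qed
  ultimately show ?thesis
    unfolding Gm_def gam_def
    by (intro subspace_add[OF fscale_vs FT_subspace] subspace_sum[OF fscale_vs FT_subspace] FT_par)
qed

lemma rep_act_sum:
  assumes "finite J" "basis_of sU {u. keys u \<subseteq> {l}} J c" "v \<in> {u. keys u \<subseteq> {l}}"
  shows "module.representation sU (c ` J) (av (deg0 y a d) v) x =
    (\<Sum>i\<in>J. module.representation sU (c ` J) v (c i) * module.representation sU (c ` J) (av (deg0 y a d) (c i)) x)"
proof -
  let ?W = "{u :: int \<Rightarrow>\<^sub>0 'v. keys u \<subseteq> {l}}" and ?rep = "module.representation sU (c ` J)"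
  have sub: "module.subspace sU ?W" by (rule basis_of_subspace[OF vsU assms(2)])
  have avW: "av (deg0 y a d) u \<in> ?W" if "u \<in> ?W" for u
    using that keys_av[of y a d u] by simp
  have "v = (\<Sum>i\<in>J. sU (?rep v (c i)) (c i))" by (rule rep_eq[OF vsU assms(2,3,1)]) auto
  then have "av (deg0 y a d) v = (\<Sum>i\<in>J. sU (?rep v (c i)) (av (deg0 y a d) (c i)))"
    by (metis (no_types, lifting) av_sum av_scale sum.cong)
  moreover have "?rep (\<Sum>i\<in>X. sU (f i) (av (deg0 y a d) (c i))) x = (\<Sum>i\<in>X. f i * ?rep (av (deg0 y a d) (c i)) x)"
    if "X \<subseteq> J" for f and X
    using finite_subset[OF that assms(1)] that
  proof (induction X rule: finite_induct)
    case empty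
    then show ?case using rep_zero[OF vsU assms(2)] by simp
  next
    case (insert i X)
    have m: "av (deg0 y a d) (c i) \<in> ?W" if "i \<in> J" for i using avW basis_of_mem[OF vsU assms(2) that] by simp
    have "sU (f i) (av (deg0 y a d) (c i)) \<in> ?W" "(\<Sum>i\<in>X. sU (f i) (av (deg0 y a d) (c i))) \<in> ?W"
      using insert m by (intro subspace_scale[OF vsU sub] subspace_sum[OF vsU sub]; blast)+
    then show ?case using insert m rep_add[OF vsU assms(2)] rep_scale[OF vsU assms(2)] by simp
  qed
  ultimately show ?thesis by simp
qed

lemma al_act: "k \<ge> 1 \<Longrightarrow> al (av (deg0 y a d) v) (k, j) = (\<Sum>i<n. amat (deg0 y a d) k j i * al v (k, i))"
  unfolding al_def amat_def prod.case proj_av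
  by (subst rep_act_sum[OF _ bk proj_in]) (auto simp: mult.commute)

text \<open>Invariance of the form moves the action to the basis vectors with a minus sign, so these
  coefficients transform as \<open>gam_comm\<close> demands.\<close>

lemma bt_act:
  assumes "k \<ge> 1" "i < n"
  shows "bt (av (deg0 y a d) v) (k, i) = - (\<Sum>j<n. amat (deg0 y a d) k j i * bt v (k, j))"
proof -
  have "av (deg0 y a d) (b k i) \<in> {u. keys u \<subseteq> {\<epsilon> * int k}}"
    using b_keys[OF assms] keys_av[of y a d "b k i"] by blast
  then have "av (deg0 y a d) (b k i) = (\<Sum>j<n. sU (amat (deg0 y a d) k j i) (b k j))"
    unfolding amat_def by (rule rep_eq[OF vsU bk[OF assms(1)]]) auto
  then have "Qh v (av (deg0 y a d) (b k i)) = (\<Sum>j<n. amat (deg0 y a d) k j i * Qh v (b k j))"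
    by (simp add: Qh_sum_right Qh_scale_right)
  moreover have "Qh (av (deg0 y a d) v) (b k i) = - Qh v (av (deg0 y a d) (b k i))"
    using Qh_inv[of y a d v "b k i"] by (simp add: eq_neg_iff_add_eq_0)
  ultimately show ?thesis by (simp add: bt_def sum_distrib_left mult.left_commute)
qed

lemma gI_act:
  assumes x: "x \<in> lcar L" and w: "w \<in> spin_space I"
  shows "st x (gI v w) = gI v (st x w) + gI (av x v) w"
proof -
  obtain y a d where xy: "x = deg0 y a d" using carL[OF x] by blast
  note om = st_mod[unfolded op_module_def spin_module_simps]
  have lin: "linear_on cscale cscale (spin_space I) (st x)" using om x by blast
  have cl: "clifford (\<epsilon> * i) w \<in> spin_space I" if "i \<in> I" for i
    by (rule clifford_spin_space[OF w]) (simp add: eps_I that)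
  have "st x (gI v w) = (\<Sum>i\<in>I. cscale (repI v i) (st x (clifford (\<epsilon> * i) w)))"
    unfolding gI_def
    by (subst linear_on_sum[OF lin cscale_vs cscale_vs spin_space_subspace finI])
       (auto intro!: subspace_scale[OF cscale_vs spin_space_subspace] cl sum.cong linear_on_scale[OF lin])
  also have "\<dots> = (\<Sum>i\<in>I. cscale (repI v i) (clifford (\<epsilon> * i) (st x w)) +
      (\<Sum>j\<in>I. cscale (repI v i * module.representation sU (e ` I) (av x (e i)) (e (\<epsilon> * j))) (clifford j w)))"
    by (rule sum.cong[OF refl]) (simp add: st_comm[OF x w] eps_I cscale_add cscale_sum cscale_cscale)
  also have "\<dots> = gI v (st x w) +
      (\<Sum>j\<in>I. \<Sum>i\<in>I. cscale (repI v i * module.representation sU (e ` I) (av x (e i)) (e (\<epsilon> * j))) (clifford j w))"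
    unfolding sum.distrib gI_def by (subst (2) sum.swap) simp
  also have "(\<Sum>j\<in>I. \<Sum>i\<in>I. cscale (repI v i * module.representation sU (e ` I) (av x (e i)) (e (\<epsilon> * j))) (clifford j w)) =
      (\<Sum>j\<in>I. cscale (repI (av x v) (\<epsilon> * j)) (clifford j w))"
  proof (rule sum.cong[OF refl])
    fix j assume "j \<in> I"
    have "cscale (sum f A) u = (\<Sum>i\<in>A. cscale (f i) u)" for f :: "int \<Rightarrow> complex" and A and u :: "int set \<Rightarrow>\<^sub>0 complex"
      by (induction A rule: infinite_finite_induct) (auto simp: cscale_add_left)
    moreover have "repI (av x v) (\<epsilon> * j) =
        (\<Sum>i\<in>I. repI v i * module.representation sU (e ` I) (av x (e i)) (e (\<epsilon> * j)))"
      unfolding repI_def xy proj_av by (rule rep_act_sum[OF finI be proj_in])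
    ultimately show "(\<Sum>i\<in>I. cscale (repI v i * module.representation sU (e ` I) (av x (e i)) (e (\<epsilon> * j))) (clifford j w)) =
      cscale (repI (av x v) (\<epsilon> * j)) (clifford j w)" by simp
  qed
  also have "\<dots> = gI (av x v) w"
    unfolding gI_def
    by (rule sum.reindex_bij_witness[of _ "\<lambda>i. \<epsilon> * i" "\<lambda>i. \<epsilon> * i"]) (auto simp: eps_I)
  finally show ?thesis .
qed

text \<open>Equivariance of the Clifford action. The corresponding relation on the spin space of the
  affinization, in coordinates, is \<open>st'_comm\<close>.\<close>

lemma Gm_comm:
  assumes x: "x \<in> lcar L" and u: "u \<in> mcar FT"
  shows "act FT x (Gm v u) = Gm v (act FT x u) + Gm (av x v) u"
proof -
  obtain y a d where xy: "x = deg0 y a d" using carL[OF x] by blast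
  let ?K = "Ks v \<union> Ks (av x v)"
  have K: "finite ?K" "?K \<subseteq> {1..}" using finite_Ks Ks_pos by auto
  have ev: "Gm v = gam (?K \<times> {..<n}) (al v) (bt v) (gI v)" by (rule ext, rule Gm_eq[OF K(1) _ K(2)]) simp
  have ew: "Gm (av x v) = gam (?K \<times> {..<n}) (al (av x v)) (bt (av x v)) (gI (av x v))"
    by (rule ext, rule Gm_eq[OF K(1) _ K(2)]) simp
  show ?thesis
    unfolding ev ew
  proof (rule gam_comm[OF st_mod spin_module_simps(2) x u K gI_linmap _ gI_linmap])
    show "gI v w \<in> mcar (spin_module I st)" if "w \<in> mcar (spin_module I st)" for w
      using that gI_spin by (simp add: spin_module_simps)
    show "act (spin_module I st) x (gI v w) = gI v (act (spin_module I st) x w) + gI (av x v) w"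
      if "w \<in> mcar (spin_module I st)" for w
      using that gI_act[OF x] by (simp add: spin_module_simps)
    show "al (av x v) (k, j) = (\<Sum>i<n. amat x k j i * al v (k, i))" if "k \<in> ?K" "j < n" for k j
      unfolding xy by (rule al_act) (use that K(2) in auto)
    show "bt (av x v) (k, i) = - (\<Sum>j<n. amat x k j i * bt v (k, j))" if "k \<in> ?K" "i < n" for k i
      unfolding xy by (rule bt_act) (use that K(2) in auto)
  qed
qed

end

subsection \<open>Spin modules\<close>

lemma spin_index_sym:
  assumes "spin_index_set I"
  shows "uminus ` I = I"
proof -
  have "- i \<in> I" if "i \<in> I" for i using assms that unfolding spin_index_set_def by auto
  then show ?thesis by (metis image_eqI image_subsetI minus_minus subsetI subset_antisym)
qed

text \<open>The lift is \<open>phi\<close> of the matrix up to a scalar, and the scalar cancels in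
  commutators.\<close>

lemma spin_lift_comm:
  assumes lift: "spin_lift \<epsilon> L H U I e H2 \<psi> st" and \<epsilon>: "\<epsilon> \<in> {1, - 1}" and I: "uminus ` I = I"
    and x: "x \<in> lcar L" and w: "w \<in> spin_space I" and l: "l \<in> I"
  defines "a \<equiv> action_matrix U I e x"
  shows "st x (clifford l w) = clifford l (st x w) +
    (\<Sum>i | a (\<epsilon> * i) (\<epsilon> * l) \<noteq> 0. cscale (a (\<epsilon> * i) (\<epsilon> * l)) (clifford i w))"
proof -
  obtain c where a: "a \<in> so_matrices I" and c: "\<And>u. u \<in> spin_space I \<Longrightarrow> st x u = phi \<epsilon> a u + cscale c u"
    using lift x unfolding spin_lift_def so_ext_projects_def a_def by blast
  show ?thesis
    unfolding c[OF w] c[OF clifford_spin_space[OF w l]] phi_comm[OF a I \<epsilon> spin_space_finkeys[OF w]]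
    by (simp add: clifford_add clifford_cscale)
qed

text \<open>\<open>phi\<close> of a diagonal matrix kills the vacuum, so on \<open>H2\<close> the
  weight of the vacuum is the prescribed functional.\<close>

lemma spin_lift_vacuum:
  assumes lift: "spin_lift \<epsilon> L H U I e H2 \<psi> st" and \<epsilon>: "\<epsilon> \<in> {1, - 1}"
    and vsL: "vector_space (lscl L)" and vsU: "vector_space (mscl U)" and basis: "basis_of (mscl U) W I e"
    and x: "x \<in> lcar L" "x \<in> H2" and diag: "\<And>j. j \<in> I \<Longrightarrow> act U x (e j) = mscl U (\<beta> j) (e j)"
  shows "st x (single {} 1) = cscale (\<psi> x) (single {} 1)"
proof -
  let ?a = "action_matrix U I e x"
  have a: "?a \<in> so_matrices I" using lift x(1) unfolding spin_lift_def so_ext_projects_def by blast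
  \<comment> \<open>The lift is prescribed on sums of an element of \<open>H2\<close> and one of the
    root span, so it is used at \<open>x + 0\<close>.\<close>
  have "0 \<in> root_span L H"
    unfolding root_span_def using module.span_zero[OF vector_space_module[OF vsL]] by blast
  then have "st (x + 0) (single {} 1) =
      phi \<epsilon> (action_matrix U I e (x + 0)) (single {} 1) + cscale (\<psi> (x + 0)) (single {} 1)"
    using lift x(2) spin_space_vacuum[of 1 I] unfolding spin_lift_def by blast
  moreover have "phi \<epsilon> ?a (single {} 1) = 0"
  proof (rule phi_vacuum[OF a \<epsilon>])
    fix i j assume nz: "?a i j \<noteq> 0"
    then have ij: "i \<in> I" "j \<in> I" by (auto simp: action_matrix_def split: if_splits)
    then have "?a i j = \<beta> j * (if j = i then 1 else 0)"
      using diag[of j] rep_scale[OF vsU basis basis_of_mem[OF vsU basis]] rep_basis[OF vsU basis]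
      by (simp add: action_matrix_def)
    then show "i = j" using nz by (auto split: if_splits)
  qed
  ultimately show ?thesis by simp
qed

text \<open>If e_K with \<open>i \<in> K\<close> occurs in \<open>w\<close>, contraction with
  \<open>i\<close> leaves a nonzero coefficient at \<open>K - {i}\<close>.\<close>

lemma annihilated_vacuum:
  assumes w: "w \<in> spin_space I" and ann: "\<And>i. i \<in> I \<Longrightarrow> i > 0 \<Longrightarrow> clifford (- i) w = 0"
  shows "w = cscale (lookup w {}) (single {} 1)"
proof (rule poly_mapping_eqI)
  fix K
  have "lookup w K = 0" if ne: "K \<noteq> {}"
  proof (rule ccontr)
    assume nz: "lookup w K \<noteq> 0"
    obtain i where i: "i \<in> K" using ne by blast
    have iI: "i \<in> I" "i > 0" using w nz i by (auto simp: spin_space_iff)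
    then have "lookup (cscale 2 (ann i w)) (K - {i}) = 0" using ann by (simp add: clifford_neg)
    then show False using nz i by (simp add: ann.rep_eq insert_absorb)
  qed
  then show "lookup w K = lookup (cscale (lookup w {}) (single {} 1)) K"
    by (auto simp: lookup_single when_def)
qed

text \<open>Schur's lemma without eigenvalues: \<open>T\<close> sends the vacuum to a vector killed
  by all annihilators, hence to a multiple of the vacuum, and the vacuum generates the
  space.\<close>

lemma spin_commutant:
  assumes I: "uminus ` I = I" and T: "linear_on cscale cscale (spin_space I) T"
    and TI: "\<And>w. w \<in> spin_space I \<Longrightarrow> T w \<in> spin_space I"
    and com: "\<And>i w. i \<in> I \<Longrightarrow> w \<in> spin_space I \<Longrightarrow> T (clifford i w) = clifford i (T w)"
  obtains c where "\<And>w. w \<in> spin_space I \<Longrightarrow> T w = cscale c w"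
proof -
  let ?v = "single {} 1 :: int set \<Rightarrow>\<^sub>0 complex"
  note sp = spin_space_subspace[of I]
  have v: "?v \<in> spin_space I" by (rule spin_space_vacuum)
  have T0: "T 0 = 0" by (rule linear_on_0[OF T cscale_vs cscale_vs sp])
  have "clifford (- i) (T ?v) = 0" if "i \<in> I" "i > 0" for i
  proof -
    have "- i \<in> I" using that I by blast
    then have "clifford (- i) (T ?v) = T (clifford (- i) ?v)" using com[OF _ v] by simp
    also have "clifford (- i) ?v = 0" using that by (simp add: clifford_neg ann_single)
    finally show ?thesis using T0 by simp
  qed
  then obtain c where c: "T ?v = cscale c ?v" using annihilated_vacuum[OF TI[OF v]] by blast
  have "spin_space I \<subseteq> {w \<in> spin_space I. T w = cscale c w}"
  proof (rule spin_space_from_vacuum)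
    show "module.subspace cscale {w \<in> spin_space I. T w = cscale c w}"
      by (rule subspaceI[OF cscale_vs])
         (auto simp: T0 subspace_0[OF cscale_vs sp] subspace_add[OF cscale_vs sp] subspace_scale[OF cscale_vs sp]
            linear_on_add[OF T] linear_on_scale[OF T] cscale_add cscale_cscale mult.commute)
  qed (use c v in \<open>auto simp: com clifford_spin_space clifford_cscale\<close>)
  then show ?thesis using that by blast
qed

text \<open>A simple ideal is its own derived algebra, because the latter is a nonzero ideal of it;
  so \<open>f\<close> vanishes on each of the ideals that span the algebra.\<close>

lemma semisimple_perfect:
  assumes ss: "semisimple_lie_algebra G" and lin: "linear_on (lscl G) (*) (lcar G) f"
    and br: "\<And>x y. x \<in> lcar G \<Longrightarrow> y \<in> lcar G \<Longrightarrow> f (lbr G x y) = 0" and x: "x \<in> lcar G"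
  shows "f x = 0"
proof -
  have lie: "lie_algebra G" using ss by (simp add: semisimple_lie_algebra_def)
  have vs: "vector_space (lscl G)" and sub: "module.subspace (lscl G) (lcar G)" using lie by (simp_all add: lie_algebra_def)
  obtain F where F: "\<And>S. S \<in> F \<Longrightarrow> lie_ideal G S \<and> simple_lie_algebra (G\<lparr>lcar := S\<rparr>)"
    "module.span (lscl G) (\<Union>F) = lcar G"
    using ss unfolding semisimple_lie_algebra_def by (elim conjE exE) (rule that; simp)
  interpret vector_space "lscl G" by (rule vs)
  note f0 = linear_on_0[OF lin vs vector_space_complex sub]
  have ker: "subspace {z \<in> lcar G. f z = 0}"
    by (rule subspaceI)
       (auto simp: f0 subspace_0[OF sub] subspace_add[OF sub] subspace_scale[OF sub]
          linear_on_add[OF lin] linear_on_scale[OF lin])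
  have "f y = 0" if S: "S \<in> F" and y: "y \<in> S" for S y
  proof -
    let ?D = "span {lbr G x y | x y. x \<in> S \<and> y \<in> S}"
    have ideal: "subspace S" "S \<subseteq> lcar G" "\<And>x y. x \<in> lcar G \<Longrightarrow> y \<in> S \<Longrightarrow> lbr G x y \<in> S"
      using F(1)[OF S] by (auto simp: lie_ideal_def)
    have DS: "?D \<subseteq> S" by (rule span_minimal) (use ideal in auto)
    have "lbr G x y \<in> ?D" if "x \<in> S" "y \<in> ?D" for x y
      by (rule span_base) (use that DS in blast)
    then have "lie_ideal (G\<lparr>lcar := S\<rparr>) ?D"
      unfolding lie_ideal_def using DS subspace_span by simp
    then have "?D = {0} \<or> ?D = S" using F(1)[OF S] unfolding simple_lie_algebra_def by simp
    moreover have "?D \<noteq> {0}"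
    proof -
      obtain p q where "p \<in> S" "q \<in> S" "lbr G p q \<noteq> 0"
        using F(1)[OF S] unfolding simple_lie_algebra_def by auto
      then show ?thesis using span_base[of "lbr G p q" "{lbr G x y | x y. x \<in> S \<and> y \<in> S}"] by blast
    qed
    ultimately have "y \<in> ?D" using y by blast
    moreover have "?D \<subseteq> {z \<in> lcar G. f z = 0}"
      by (rule span_minimal[OF _ ker]) (use ideal(2,3) br in blast)
    ultimately show ?thesis by blast
  qed
  then have "span (\<Union>F) \<subseteq> {z \<in> lcar G. f z = 0}"
    by (intro span_minimal[OF _ ker]) (use F(1) in \<open>unfold lie_ideal_def, blast\<close>)
  then show ?thesis using x F(2) by blast
qed

section \<open>The two spin constructions and their weights\<close>

locale loop_spin = loop_module G B V Q
  for G :: "'g::ab_group_add lie_alg" and B and V :: "('g, 'v::ab_group_add) lie_mod" and Q +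
  fixes h :: "'g set" and d1 :: 'g and N :: int and \<epsilon> :: int
    and e' :: "int \<Rightarrow> (int \<Rightarrow>\<^sub>0 'v)" and I' :: "int set"
    and H2' :: "'g affine set" and \<psi>' :: "'g affine \<Rightarrow> complex"
    and st' :: "'g affine \<Rightarrow> (int set \<Rightarrow>\<^sub>0 complex) \<Rightarrow> (int set \<Rightarrow>\<^sub>0 complex)"
    and e :: "int \<Rightarrow> (int \<Rightarrow>\<^sub>0 'v)" and I :: "int set"
    and H2 :: "'g affine set" and \<psi> :: "'g affine \<Rightarrow> complex"
    and st :: "'g affine \<Rightarrow> (int set \<Rightarrow>\<^sub>0 complex) \<Rightarrow> (int set \<Rightarrow>\<^sub>0 complex)"
    and n :: nat and b :: "nat \<Rightarrow> nat \<Rightarrow> (int \<Rightarrow>\<^sub>0 'v)"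
  assumes ss: "semisimple_lie_algebra G"
    and finV: "\<exists>A. finite A \<and> module.span (mscl V) A = UNIV"
    and subh: "module.subspace (lscl G) h" and d1h: "d1 \<in> h"
    and wt_int: "is_weight G V h \<beta> \<Longrightarrow> \<exists>x\<in>h. \<beta> x \<noteq> 0 \<Longrightarrow> \<beta> d1 \<in> \<int> - {0}"
    and Npos: "N > 0"
    and wt_bound: "is_weight G V h \<beta> \<Longrightarrow> - N < Re (\<beta> d1) \<and> Re (\<beta> d1) < N"
    and eps: "\<epsilon> \<in> {1, - 1}"
    and basis': "spin_basis (affine_algebra G B) (affine_cartan h) (hat_d N d1)
           (affinization V) (affine_form Q) I' e'"
    and lift': "spin_lift \<epsilon> (affine_algebra G B) (affine_cartan h) (affinization V) I' e' H2' \<psi>' st'"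
    and basis: "spin_basis (augmented_algebra G B N d1) (with_hat_d G B N d1 h) (hat_d N d1)
           (t_power V 0) (affine_form Q) I e"
    and compl: "complement_in (lscl (augmented_algebra G B N d1)) (with_hat_d G B N d1 h)
           (module.span (lscl (augmented_algebra G B N d1))
              (simple_coroots (augmented_algebra G B N d1) (with_hat_d G B N d1 h) (hat_d N d1))) H2"
    and lift: "spin_lift \<epsilon> (augmented_algebra G B N d1) (with_hat_d G B N d1 h) (t_power V 0) I e H2 \<psi> st"
    and H2_sub: "H2 \<subseteq> H2'" and psi_eq: "x \<in> H2 \<Longrightarrow> \<psi>' x = \<psi> x"
    and bs: "k \<ge> 1 \<Longrightarrow> basis_of (mscl (affinization V)) (mcar (t_power V (\<epsilon> * int k))) {..<n} (b k)"
begin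

abbreviation "AA \<equiv> augmented_algebra G B N d1"
abbreviation "HA \<equiv> with_hat_d G B N d1 h"

lemma AA_simps: "lcar AA = with_hat_d G B N d1 (lcar G)" "lscl AA = lscl (affine_algebra G B)"
  "lbr AA = lbr (affine_algebra G B)"
  by (simp_all add: augmented_algebra_def)

lemma lcar_AA: "lcar AA = {deg0 x 0 c | x c. True}"
proof -
  have "module.subspace (lscl G) (UNIV :: 'g set)" by (rule subspaceI[OF vsG]) auto
  then show ?thesis using with_hat_d_eq[of UNIV d1 N] Npos by (simp add: AA_simps carG)
qed

lemma deg0_AA: "deg0 x 0 c \<in> lcar AA" unfolding lcar_AA by blast

lemma HA_eq: "HA = {deg0 x 0 c | x c. x \<in> h}"
  using with_hat_d_eq[OF subh d1h] Npos by simp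

lemma HA_AA: "HA \<subseteq> lcar AA" unfolding HA_eq lcar_AA by blast

lemma HA_cartan: "HA \<subseteq> affine_cartan h" unfolding HA_eq affine_cartan_def deg0_def by blast

lemma hat_HA: "hat_d N d1 \<in> HA" unfolding HA_eq hat_d_deg0 using d1h by blast

lemma symI': "uminus ` I' = I'" and symI0: "uminus ` I = I"
  using basis' basis by (simp_all add: spin_basis_def spin_index_sym)

lemma be': "basis_of sU UNIV I' e'" and be0: "basis_of sU {u. keys u \<subseteq> {0}} I e"
  using basis' basis by (simp_all add: spin_basis_def t_power_simps) (simp add: affinization_def)

lemma form': "i \<in> I' \<Longrightarrow> j \<in> I' \<Longrightarrow> Qh (e' i) (e' j) = (if i = - j then 1 else 0)"
  using basis' unfolding spin_basis_def by blast

lemma form0: "i \<in> I \<Longrightarrow> j \<in> I \<Longrightarrow> Qh (e i) (e j) = (if i = - j then 1 else 0)"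
  using basis unfolding spin_basis_def by blast

lemma fin_dim_deg: "fin_dim sU {u :: int \<Rightarrow>\<^sub>0 'v. keys u \<subseteq> {0}}"
proof -
  have l: "linear_on (mscl V) sU UNIV (single 0)"
    by (auto simp: linear_on_def single_add sU_eq pmap_single[where f = "mscl V _", OF vs_zero_right[OF vsV]])
  have f: "fin_dim (mscl V) (UNIV :: 'v set)" using finV by (auto simp: fin_dim_def)
  have "module.subspace (mscl V) UNIV" by (rule subspaceI[OF vsV]) auto
  from fin_dim_image[OF vsV vsU this l f] show ?thesis
  proof (rule fin_dim_mono)
    show "{u :: int \<Rightarrow>\<^sub>0 'v. keys u \<subseteq> {0}} \<subseteq> range (single 0)"
    proof
      fix u :: "int \<Rightarrow>\<^sub>0 'v" assume "u \<in> {u. keys u \<subseteq> {0}}"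
      then have "u = single 0 (lookup u 0)" using proj_id[of u 0] by (simp add: proj_def)
      then show "u \<in> range (single 0)" by (rule range_eqI)
    qed
  qed
qed

text \<open>The degree-zero part of the affinization is a copy of \<open>V\<close>, which bounds
  independent families in it.\<close>

lemma finite_basis_deg0:
  assumes c: "basis_of sU W J c" and X: "X \<subseteq> J" "\<And>i. i \<in> X \<Longrightarrow> keys (c i) \<subseteq> {0}"
  shows "finite X"
proof -
  interpret vector_space sU by (rule vsU)
  obtain F where F: "finite F" "{u :: int \<Rightarrow>\<^sub>0 'v. keys u \<subseteq> {0}} \<subseteq> span F"
    using fin_dim_deg by (auto simp: fin_dim_def)
  have "independent (c ` J)" "inj_on c J" using c by (auto simp: basis_of_def)
  then have "independent (c ` X)" "inj_on c X" using X(1) independent_mono[of "c ` J" "c ` X"] inj_on_subset by blast+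
  moreover have "c ` X \<subseteq> span F" using X(2) F(2) by blast
  ultimately show ?thesis using independent_span_bound[OF F(1)] finite_imageD by blast
qed

lemma finI: "finite I"
  by (rule finite_basis_deg0[OF be0 order_refl]) (use basis_of_mem[OF vsU be0] in auto)

lemma st_lie: "lie_module AA (spin_module I st)" and st'_lie: "lie_module (affine_algebra G B) (spin_module I' st')"
  using lift lift' by (simp_all add: spin_lift_def)

lemma lcar_affine: "lcar (affine_algebra G B) = UNIV" by (simp add: affine_algebra_def)

lemma st'_op: "op_module (affine_algebra G B) (spin_module I' st')"
  by (rule lie_module_op_module[OF st'_lie])

lemma st'_in: "w \<in> spin_space I' \<Longrightarrow> st' x w \<in> spin_space I'"
  using op_moduleD(3)[OF st'_op, of x w] by (simp add: lcar_affine spin_module_def)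

lemma st'_lin: "linear_on cscale cscale (spin_space I') (st' x)"
  using op_moduleD(4)[OF st'_op, of x] by (simp add: lcar_affine spin_module_def)

sublocale loop_fock G B V Q AA \<epsilon> n b I e st
proof
  show "\<exists>y a c. x = deg0 y a c" if "x \<in> lcar AA" for x using that unfolding lcar_AA by blast
  show "basis_of sU {u. keys u \<subseteq> {\<epsilon> * int k}} {..<n} (b k)" if "k \<ge> 1" for k
    using bs[OF that] by (simp add: t_power_simps)
  show "op_module AA (spin_module I st)" by (rule lie_module_op_module[OF st_lie])
  fix x w l assume x: "x \<in> lcar AA" and w: "w \<in> spin_space I" and l: "l \<in> I"
  let ?a = "action_matrix (t_power V 0) I e x"
  have nI: "- i \<in> I \<longleftrightarrow> i \<in> I" for i using symI0 by (metis image_eqI image_iff minus_minus)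
  have eI: "\<epsilon> * i \<in> I \<longleftrightarrow> i \<in> I" for i
  proof -
    have "\<epsilon> = 1 \<or> \<epsilon> = - 1" using eps by simp
    then show ?thesis by (rule disjE) (simp_all add: nI)
  qed
  have "(\<Sum>i | ?a (\<epsilon> * i) (\<epsilon> * l) \<noteq> 0. cscale (?a (\<epsilon> * i) (\<epsilon> * l)) (clifford i w)) =
      (\<Sum>i\<in>I. cscale (?a (\<epsilon> * i) (\<epsilon> * l)) (clifford i w))"
    by (rule sum.mono_neutral_left[OF finI]) (auto simp: action_matrix_def eI split: if_splits)
  also have "\<dots> = (\<Sum>i\<in>I. cscale (module.representation sU (e ` I) (av x (e (\<epsilon> * l))) (e (\<epsilon> * i))) (clifford i w))"
    by (rule sum.cong) (auto simp: action_matrix_def eI l t_power_simps)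
  finally show "st x (clifford l w) = clifford l (st x w) +
      (\<Sum>i\<in>I. cscale (module.representation sU (e ` I) (av x (e (\<epsilon> * l))) (e (\<epsilon> * i))) (clifford i w))"
    using spin_lift_comm[OF lift eps symI0 x w l] by simp
qed (use eps be0 finI symI0 form0 in auto)

text \<open>Unlike \<open>I\<close>, the index set \<open>I'\<close> may be infinite, so the sum is
  restricted to the nonzero coefficients.\<close>

lemma st'_comm:
  assumes x: "x \<in> lcar AA" and w: "w \<in> spin_space I'" and l: "l \<in> I'"
  defines "r \<equiv> \<lambda>i. module.representation sU (e' ` I') (av x (e' (\<epsilon> * l))) (e' i)"
  shows "st' x (clifford l w) = clifford l (st' x w) + (\<Sum>i | i \<in> I' \<and> r (\<epsilon> * i) \<noteq> 0. cscale (r (\<epsilon> * i)) (clifford i w))"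
proof -
  have nI: "- i \<in> I' \<longleftrightarrow> i \<in> I'" for i using symI' by (metis image_eqI image_iff minus_minus)
  have eI: "\<epsilon> * i \<in> I' \<longleftrightarrow> i \<in> I'" for i by (rule disjE[OF eps_cases]) (simp_all add: nI)
  have a: "action_matrix (affinization V) I' e' x (\<epsilon> * i) (\<epsilon> * l) = (if i \<in> I' then r (\<epsilon> * i) else 0)" for i
    by (simp add: action_matrix_def eI l r_def)
  have s: "{i. (if i \<in> I' then r (\<epsilon> * i) else 0) \<noteq> 0} = {i \<in> I'. r (\<epsilon> * i) \<noteq> 0}" by auto
  have "x \<in> lcar (affine_algebra G B)" by (simp add: lcar_affine)
  from spin_lift_comm[OF lift' eps symI' this w l] show ?thesis
    unfolding a s by simp
qed

lemma neg_I': "- i \<in> I' \<longleftrightarrow> i \<in> I'" using symI' by (metis image_eqI image_iff minus_minus)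

lemma eps_I': "\<epsilon> * i \<in> I' \<longleftrightarrow> i \<in> I'" by (rule disjE[OF eps_cases]) (simp_all add: neg_I')

lemma e'_nonzero: "i \<in> I' \<Longrightarrow> e' i \<noteq> 0"
  using form'[of i "- i"] by (auto simp: neg_I' Qh_0)

lemma sU_cancel: "sU c u = sU d u \<Longrightarrow> u \<noteq> 0 \<Longrightarrow> c = d"
proof -
  assume "sU c u = sU d u" "u \<noteq> 0"
  then have z: "sU (c - d) u = 0" using vs_add_left[OF vsU, of "c - d" d u] by simp
  show "c = d"
  proof (rule ccontr)
    assume "c \<noteq> d"
    then have "u = sU (inverse (c - d)) (sU (c - d) u)" by (simp add: vs_mult[OF vsU] vs_one[OF vsU])
    then show False using z \<open>u \<noteq> 0\<close> by (simp add: vs_zero_right[OF vsU])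
  qed
qed

text \<open>The derivation belongs to the Cartan subalgebra and multiplies the component of degree
  \<open>l\<close> by \<open>l\<close>, so the weight vectors \<open>e' i\<close> are homogeneous,
  and their coefficients are weight vectors of \<open>V\<close>. The last clause is the positivity
  of the basis, written out at \<open>hat_d N d1\<close>.\<close>

lemma weights':
  obtains \<mu> dg where
    "\<And>i. i \<in> I' \<Longrightarrow> keys (e' i) \<subseteq> {dg i}"
    "\<And>i x c. i \<in> I' \<Longrightarrow> x \<in> h \<Longrightarrow> av (deg0 x 0 c) (e' i) = sU (\<mu> i x + c * of_int (dg i)) (e' i)"
    "\<And>i. i \<in> I' \<Longrightarrow> is_weight G V h (\<mu> i)"
    "\<And>i. i \<in> I' \<Longrightarrow> i > 0 \<Longrightarrow> 0 \<le> Re (\<mu> i d1 + of_int N * of_int (dg i))"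
proof -
  obtain \<beta> where \<beta>: "\<And>i. i \<in> I' \<Longrightarrow> linear_on (lscl (affine_algebra G B)) (*) (affine_cartan h) (\<beta> i)"
      "\<And>i. i \<in> I' \<Longrightarrow> e' i \<in> weight_space (affinization V) (affine_cartan h) (\<beta> i)"
      "\<And>i. i \<in> I' \<Longrightarrow> i > 0 \<Longrightarrow> Re (\<beta> i (hat_d N d1)) \<ge> 0"
    using basis' unfolding spin_basis_def by blast
  have cart: "deg0 x a c \<in> affine_cartan h" if "x \<in> h" for x a c
    using that unfolding affine_cartan_def deg0_def by blast
  have ev: "av (deg0 x a c) (e' i) = sU (\<beta> i (deg0 x a c)) (e' i)" if "i \<in> I'" "x \<in> h" for i x a c
    using \<beta>(2)[OF that(1)] cart[OF that(2)] by (auto simp: weight_space_def)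
  have h0: "0 \<in> h" by (rule subspace_0[OF vsG subh])
  have "\<exists>k. keys (e' i) = {k}" if i: "i \<in> I'" for i
  proof -
    have key: "of_int l = \<beta> i (deg0 0 0 1)" if l: "l \<in> keys (e' i)" for l
    proof (rule ccontr)
      assume ne: "of_int l \<noteq> \<beta> i (deg0 0 0 1)"
      let ?w = "lookup (e' i) l" and ?c = "of_int l - \<beta> i (deg0 0 0 1)"
      have "mscl V (of_int l) ?w = mscl V (\<beta> i (deg0 0 0 1)) ?w"
        using arg_cong[OF ev[OF i h0, of 0 1], of "\<lambda>u. lookup u l"] by (simp add: lookup_av lookup_sU actV_0_left)
      then have "mscl V ?c ?w = 0" using vs_add_left[OF vsV, of ?c "\<beta> i (deg0 0 0 1)" ?w] by simp
      then have "mscl V (inverse ?c) (mscl V ?c ?w) = 0" by (simp add: vs_zero_right[OF vsV])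
      then have "?w = 0" using ne by (simp add: vs_mult[OF vsV] vs_one[OF vsV])
      then show False using l by (simp add: in_keys_iff)
    qed
    have "keys (e' i) \<noteq> {}" using e'_nonzero[OF i] by simp
    then obtain k where k: "k \<in> keys (e' i)" by blast
    have "l = k" if "l \<in> keys (e' i)" for l
      using key[OF that] key[OF k] by (metis of_int_eq_iff)
    then show ?thesis using k by blast
  qed
  then obtain dg where dg: "\<And>i. i \<in> I' \<Longrightarrow> keys (e' i) = {dg i}" by metis
  define \<mu> where "\<mu> i x = \<beta> i (deg0 x 0 0)" for i x
  have act: "av (deg0 x 0 c) (e' i) = sU (\<mu> i x + c * of_int (dg i)) (e' i)" if i: "i \<in> I'" and x: "x \<in> h" for i x c
  proof (rule poly_mapping_eqI)
    fix k
    have "act V x (lookup (e' i) k) = mscl V (\<mu> i x) (lookup (e' i) k)"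
      using arg_cong[OF ev[OF i x, of 0 0], of "\<lambda>u. lookup u k"]
      by (simp add: lookup_av lookup_sU \<mu>_def vs_zero[OF vsV])
    note w = this
    show "lookup (av (deg0 x 0 c) (e' i)) k = lookup (sU (\<mu> i x + c * of_int (dg i)) (e' i)) k"
    proof (cases "k = dg i")
      case True
      then show ?thesis unfolding lookup_av lookup_sU w vs_add_left[OF vsV] by simp
    next
      case False
      then have "lookup (e' i) k = 0" using dg[OF i] by (simp flip: not_in_keys_iff_lookup_eq_zero)
      then show ?thesis by (simp add: lookup_av lookup_sU actV_0 vs_zero_right[OF vsV])
    qed
  qed
  have "is_weight G V h (\<mu> i)" if i: "i \<in> I'" for i
    unfolding is_weight_def
  proof
    have add: "deg0 x 0 0 + deg0 y 0 0 = deg0 (x + y) 0 0" for x y by (simp add: deg0_add)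
    have sc: "lscl (affine_algebra G B) c (deg0 x 0 0) = deg0 (lscl G c x) 0 0" for c x by (simp add: lscl_deg0)
    show "linear_on (lscl G) (*) h (\<mu> i)"
      unfolding linear_on_def
    proof (intro conjI ballI allI)
      show "\<mu> i (x + y) = \<mu> i x + \<mu> i y" if "x \<in> h" "y \<in> h" for x y
        using linear_on_add[OF \<beta>(1)[OF i] cart[OF that(1), of 0 0] cart[OF that(2), of 0 0]] by (simp add: \<mu>_def add)
      show "\<mu> i (lscl G c x) = c * \<mu> i x" if "x \<in> h" for c x
        using linear_on_scale[OF \<beta>(1)[OF i] cart[OF that, of 0 0], of c] by (simp add: \<mu>_def sc)
    qed
    let ?w = "lookup (e' i) (dg i)"
    have "act V x ?w = mscl V (\<mu> i x) ?w" if "x \<in> h" for x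
      using arg_cong[OF act[OF i that, of 0], of "\<lambda>u. lookup u (dg i)"]
      by (simp add: lookup_av lookup_sU vs_zero[OF vsV])
    then have "?w \<in> weight_space V h (\<mu> i)" by (simp add: weight_space_def carV)
    moreover have "?w \<noteq> 0" using dg[OF i] by (auto simp flip: in_keys_iff)
    ultimately show "weight_space V h (\<mu> i) \<noteq> {0}" by blast
  qed
  moreover have "0 \<le> Re (\<mu> i d1 + of_int N * of_int (dg i))" if i: "i \<in> I'" "i > 0" for i
  proof -
    have "sU (\<beta> i (hat_d N d1)) (e' i) = sU (\<mu> i d1 + of_int N * of_int (dg i)) (e' i)"
      using ev[OF i(1) d1h, of 0 "of_int N"] act[OF i(1) d1h, of "of_int N"] by (simp add: hat_d_deg0)
    then have "\<beta> i (hat_d N d1) = \<mu> i d1 + of_int N * of_int (dg i)" by (rule sU_cancel[OF _ e'_nonzero[OF i(1)]])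
    then show ?thesis using \<beta>(3)[OF i] by simp
  qed
  ultimately show ?thesis using that[of dg \<mu>] act dg by auto
qed

text \<open>Opposite indices have opposite weights, because the form is invariant and pairs e_i with
  e_(-i) to 1.\<close>

lemma weights:
  obtains \<beta> where "\<And>i x. i \<in> I \<Longrightarrow> x \<in> HA \<Longrightarrow> av x (e i) = sU (\<beta> i x) (e i)"
    "\<And>i. i \<in> I \<Longrightarrow> i > 0 \<Longrightarrow> 0 \<le> Re (\<beta> i (hat_d N d1))"
    "\<And>i x. i \<in> I \<Longrightarrow> x \<in> HA \<Longrightarrow> \<beta> (- i) x = - \<beta> i x"
proof -
  obtain \<beta> where \<beta>: "\<And>i. i \<in> I \<Longrightarrow> e i \<in> weight_space (t_power V 0) HA (\<beta> i)"
      "\<And>i. i \<in> I \<Longrightarrow> i > 0 \<Longrightarrow> Re (\<beta> i (hat_d N d1)) \<ge> 0"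
    using basis unfolding spin_basis_def by blast
  have ev: "av x (e i) = sU (\<beta> i x) (e i)" if "i \<in> I" "x \<in> HA" for i x
    using \<beta>(1)[OF that(1)] that(2) by (auto simp: weight_space_def t_power_simps)
  have "\<beta> (- i) x = - \<beta> i x" if i: "i \<in> I" and x: "x \<in> HA" for i x
  proof -
    obtain y c where xy: "x = deg0 y 0 c" using x unfolding HA_eq by blast
    have "Qh (av x (e i)) (e (- i)) + Qh (e i) (av x (e (- i))) = 0" unfolding xy by (rule Qh_inv)
    then have "\<beta> i x + \<beta> (- i) x = 0"
      using i x neg_I[of i] formI[of i "- i"] by (simp add: ev Qh_scale_left Qh_scale_right)
    then show ?thesis by (simp add: eq_neg_iff_add_eq_0 add.commute)
  qed
  then show ?thesis using that[of \<beta>] ev \<beta>(2) by blast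
qed

section \<open>Vacua for the polarization of the affinization\<close>

lemma H2_HA: "H2 \<subseteq> HA"
  using compl by (simp add: complement_in_def)

text \<open>There is nothing to create, the empty key admits no contraction, and it has even parity;
  what remains is the action of degree zero.\<close>

lemma Gm_vacuum:
  assumes "\<And>k. k \<ge> 1 \<Longrightarrow> proj (\<epsilon> * int k) v = 0"
  shows "Gm v (single {} s) = single {} (gI v s)"
proof -
  have "fld (al v) (bt v) p (single {} s) = 0" if p: "p \<in> Ks v \<times> {..<n}" for p
  proof -
    have "fst p \<in> Ks v" using p by auto
    then have k: "fst p \<ge> 1" using Ks_pos[of v] by auto
    have "al v p = 0"
      using assms[OF k] rep_zero[OF vsU bk[OF k]] by (cases p) (simp add: al_def)
    then show ?thesis by (simp add: fld_def ann_single fscale_zero fscale_zero_right)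
  qed
  then show ?thesis
    unfolding Gm_def gam_def
    by (simp add: pmap_single[where f = "gI v", OF linmap_0[OF gI_linmap]] par_single sg_def)
qed

lemma gI_zero_deg: "proj 0 v = 0 \<Longrightarrow> gI v s = 0"
  unfolding gI_def repI_def using rep_zero[OF vsU be] by simp

text \<open>Being killed by the annihilators of nonzero weight, stated without the basis
  \<open>e\<close>: these are the degree-zero vectors on which \<open>hat_d N d1\<close> has an
  eigenvalue of sign opposite to \<open>\<epsilon>\<close>. In this form it can be applied to the
  vectors \<open>e' i\<close>.\<close>

definition neg_killed :: "(int set \<Rightarrow>\<^sub>0 complex) \<Rightarrow> bool" where
  "neg_killed s \<longleftrightarrow> (\<forall>v m. keys v \<subseteq> {0} \<longrightarrow> av (hat_d N d1) v = sU (complex_of_real m) v \<longrightarrow>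
     of_int \<epsilon> * m < 0 \<longrightarrow> gI v s = 0)"

text \<open>The conditions on a vacuum that concern nonzero weights and \<open>H2\<close>. They
  survive the action of zero weight vectors, so the zero weight part can be adjusted
  afterwards.\<close>

definition vacuum_like :: "(int set \<Rightarrow>\<^sub>0 complex) \<Rightarrow> bool" where
  "vacuum_like s \<longleftrightarrow> s \<in> spin_space I \<and> neg_killed s \<and> (\<forall>x\<in>H2. st x s = cscale (\<psi> x) s)"

definition zero_vector :: "(int \<Rightarrow>\<^sub>0 'v) \<Rightarrow> bool" where
  "zero_vector w \<longleftrightarrow> keys w \<subseteq> {0} \<and> (\<forall>x\<in>HA. av x w = 0)"

lemma st_lin: "x \<in> lcar AA \<Longrightarrow> linear_on cscale cscale (spin_space I) (st x)"
  using op_moduleD(4)[OF st_mod] by (simp add: spin_module_simps)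

text \<open>An eigenvector for \<open>m\<close> involves only those e_i that have eigenvalue
  \<open>m\<close>; by the positivity of the basis and the sign condition, these all act as
  annihilators.\<close>

lemma vacuum_like_vacuum: "vacuum_like (single {} 1)"
proof -
  obtain \<beta> where \<beta>: "\<And>i x. i \<in> I \<Longrightarrow> x \<in> HA \<Longrightarrow> av x (e i) = sU (\<beta> i x) (e i)"
    "\<And>i. i \<in> I \<Longrightarrow> i > 0 \<Longrightarrow> 0 \<le> Re (\<beta> i (hat_d N d1))"
    "\<And>i x. i \<in> I \<Longrightarrow> x \<in> HA \<Longrightarrow> \<beta> (- i) x = - \<beta> i x"
    using weights by metis
  have "neg_killed (single {} 1)"
    unfolding neg_killed_def
  proof (intro allI impI)
    fix v :: "int \<Rightarrow>\<^sub>0 'v" and m :: real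
    assume v: "keys v \<subseteq> {0}" and ev: "av (hat_d N d1) v = sU (complex_of_real m) v" and m: "of_int \<epsilon> * m < 0"
    have v0: "proj 0 v = v" by (rule proj_id[OF v])
    have rep: "repI v i * \<beta> i (hat_d N d1) = complex_of_real m * repI v i" if i: "i \<in> I" for i
    proof -
      have "repI (av (hat_d N d1) v) i = complex_of_real m * repI v i" unfolding ev by (rule repI_scale)
      moreover have "repI (av (hat_d N d1) v) i =
          (\<Sum>j\<in>I. repI v j * module.representation sU (e ` I) (av (hat_d N d1) (e j)) (e i))"
        unfolding repI_def hat_d_deg0 proj_av by (rule rep_act_sum[OF finI be]) (use proj_keys in simp)
      moreover have "\<dots> = (\<Sum>j\<in>I. if j = i then repI v i * \<beta> i (hat_d N d1) else 0)"
        by (rule sum.cong[OF refl])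
           (use i in \<open>simp add: \<beta>(1)[OF _ hat_HA] rep_scale[OF vsU be basis_of_mem[OF vsU be]] rep_basis[OF vsU be]\<close>)
      ultimately show ?thesis using i finI by simp
    qed
    have "cscale (repI v i) (clifford (\<epsilon> * i) (single {} 1)) = 0" if i: "i \<in> I" for i
    proof (cases "repI v i = 0")
      case False
      then have bm: "\<beta> i (hat_d N d1) = complex_of_real m" using rep[OF i] by simp
      have b0: "\<beta> 0 (hat_d N d1) = 0" if "0 \<in> I" using \<beta>(3)[OF that hat_HA] by simp
      have mi: "- i \<in> I" using i neg_I by simp
      have "\<epsilon> * i < 0"
      proof (rule ccontr)
        assume c: "\<not> \<epsilon> * i < 0"
        have "i \<noteq> 0" using bm b0 m i by auto
        then consider "\<epsilon> = 1" "i > 0" | "\<epsilon> = - 1" "- i > 0" using c eps_cases by fastforce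
        then show False
        proof cases
          case 1
          then show False using \<beta>(2)[OF i] bm m by simp
        next
          case 2
          then show False using \<beta>(2)[OF mi] \<beta>(3)[OF i hat_HA] bm m by simp
        qed
      qed
      then show ?thesis by (simp add: clifford_neg ann_single)
    qed simp
    then show "gI v (single {} 1) = 0" unfolding gI_def by simp
  qed
  moreover have "st x (single {} 1) = cscale (\<psi> x) (single {} 1)" if x: "x \<in> H2" for x
  proof (rule spin_lift_vacuum[OF lift eps])
    show "vector_space (lscl AA)" by (simp add: AA_simps vs_affine)
    show "vector_space (mscl (t_power V 0))" by (simp add: t_power_simps vsU)
    show "basis_of (mscl (t_power V 0)) {u. keys u \<subseteq> {0}} I e" by (simp add: t_power_simps be)
    show "x \<in> lcar AA" using x H2_HA HA_AA by blast
    show "act (t_power V 0) x (e j) = mscl (t_power V 0) (\<beta> j x) (e j)" if "j \<in> I" for j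
      using \<beta>(1)[OF that subsetD[OF H2_HA x]] by (simp add: t_power_simps)
  qed (rule x)
  ultimately show ?thesis by (simp add: vacuum_like_def spin_space_vacuum)
qed

text \<open>A zero weight vector is orthogonal to eigenvectors of nonzero eigenvalue, so the two
  operators anticommute. Being killed by the Cartan subalgebra, it does not change the weight on
  \<open>H2\<close>.\<close>

lemma vacuum_like_gI:
  assumes s: "vacuum_like s" and w: "zero_vector w"
  shows "vacuum_like (gI w s)"
proof -
  have sp: "s \<in> spin_space I" using s by (simp add: vacuum_like_def)
  have w0: "proj 0 w = w" using w proj_id by (simp add: zero_vector_def)
  have "neg_killed (gI w s)"
    unfolding neg_killed_def
  proof (intro allI impI)
    fix v :: "int \<Rightarrow>\<^sub>0 'v" and m :: real
    assume v: "keys v \<subseteq> {0}" and ev: "av (hat_d N d1) v = sU (complex_of_real m) v" and m: "of_int \<epsilon> * m < 0"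
    have gv: "gI v s = 0" using s v ev m unfolding vacuum_like_def neg_killed_def by blast
    have v0: "proj 0 v = v" by (rule proj_id[OF v])
    have "Qh (av (hat_d N d1) v) w + Qh v (av (hat_d N d1) w) = 0" unfolding hat_d_deg0 by (rule Qh_inv)
    moreover have "av (hat_d N d1) w = 0" using w hat_HA by (simp add: zero_vector_def)
    ultimately have "complex_of_real m * Qh v w = 0" by (simp add: ev Qh_scale_left Qh_0)
    then have "Qh v w = 0" using m by auto
    then show "gI v (gI w s) = 0"
      using gI_anticomm[OF spin_space_finkeys[OF sp], of v w] by (simp add: gv v0 w0 linmap_0[OF gI_linmap])
  qed
  moreover have "st x (gI w s) = cscale (\<psi> x) (gI w s)" if x: "x \<in> H2" for x
  proof -
    have xA: "x \<in> lcar AA" "x \<in> HA" using x H2_HA HA_AA by blast+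
    have "av x w = 0" using w xA(2) by (simp add: zero_vector_def)
    moreover have "gI 0 s = 0" by (rule gI_zero_deg) (simp add: proj_def)
    ultimately show ?thesis
      using gI_act[OF xA(1) sp, of w] s x by (simp add: vacuum_like_def linmap_scale[OF gI_linmap])
  qed
  ultimately show ?thesis using gI_spin[OF sp] by (simp add: vacuum_like_def)
qed

lemma vacuum_like_add:
  assumes s: "vacuum_like s" and t: "vacuum_like t"
  shows "vacuum_like (s + t)"
proof -
  have "st x (s + t) = cscale (\<psi> x) (s + t)" if x: "x \<in> H2" for x
  proof -
    have "x \<in> lcar AA" using x H2_HA HA_AA by blast
    then have "st x (s + t) = st x s + st x t" using linear_on_add[OF st_lin] s t by (simp add: vacuum_like_def)
    then show ?thesis using s t x by (simp add: vacuum_like_def cscale_add)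
  qed
  moreover have "neg_killed (s + t)"
    using s t unfolding vacuum_like_def neg_killed_def by (simp add: linmap_add[OF gI_linmap])
  ultimately show ?thesis
    using s t subspace_add[OF cscale_vs spin_space_subspace] by (simp add: vacuum_like_def)
qed

lemma double_0: "u + u = (0 :: int set \<Rightarrow>\<^sub>0 complex) \<Longrightarrow> u = 0"
proof -
  assume "u + u = 0"
  then have "cscale 2 u = 0" using cscale_add_left[of 1 1 u] by simp
  then show ?thesis by (simp add: cscale_eq_0_iff)
qed

text \<open>The polarizations given by \<open>e\<close> and \<open>e'\<close> differ only on the zero weight space, where applying
  those annihilators of \<open>e'\<close> that do not vanish produces a vacuum for \<open>e'\<close>.\<close>

lemma vacuum_exists:
  obtains s \<sigma> where "s \<in> spin_space I" "s \<noteq> 0" "\<sigma> \<in> {1, - 1 :: complex}"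
    "\<And>x. x \<in> H2 \<Longrightarrow> st x s = cscale (\<psi> x) s"
    "\<And>i. i \<in> I' \<Longrightarrow> i > 0 \<Longrightarrow> Gm (e' (- (\<epsilon> * i))) (single {} s) = 0"
    "0 \<in> I' \<Longrightarrow> Gm (e' 0) (single {} s) = fscale \<sigma> (single {} s)"
proof -
  obtain \<mu> dg where dg: "\<And>i. i \<in> I' \<Longrightarrow> keys (e' i) \<subseteq> {dg i}"
    and ev: "\<And>i x c. i \<in> I' \<Longrightarrow> x \<in> h \<Longrightarrow> av (deg0 x 0 c) (e' i) = sU (\<mu> i x + c * of_int (dg i)) (e' i)"
    and wt: "\<And>i. i \<in> I' \<Longrightarrow> is_weight G V h (\<mu> i)"
    and pos: "\<And>i. i \<in> I' \<Longrightarrow> i > 0 \<Longrightarrow> 0 \<le> Re (\<mu> i d1 + of_int N * of_int (dg i))"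
    using weights' by metis
  have opp: "\<mu> i x + c * of_int (dg i) + (\<mu> (- i) x + c * of_int (dg (- i))) = 0" if i: "i \<in> I'" and x: "x \<in> h" for i x c
  proof -
    have "Qh (av (deg0 x 0 c) (e' i)) (e' (- i)) + Qh (e' i) (av (deg0 x 0 c) (e' (- i))) = 0" by (rule Qh_inv)
    then show ?thesis
      using i x neg_I'[of i] form'[of i "- i"] by (simp add: ev Qh_scale_left Qh_scale_right)
  qed
  have h0: "0 \<in> h" by (rule subspace_0[OF vsG subh])
  have mu_neg: "\<mu> (- i) x = - \<mu> i x" if "i \<in> I'" "x \<in> h" for i x
    using opp[OF that, of 0] by (simp add: eq_neg_iff_add_eq_0 add.commute)
  have dg_neg: "dg (- i) = - dg i" if i: "i \<in> I'" for i
  proof -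
    have "complex_of_int (dg i + dg (- i)) = 0" using opp[OF i h0, of 1] mu_neg[OF i h0] by simp
    then have "dg i + dg (- i) = 0" by (simp only: of_int_eq_0_iff)
    then show ?thesis by simp
  qed
  have dg_eps: "dg (\<epsilon> * i) = \<epsilon> * dg i" if "i \<in> I'" for i
    by (rule disjE[OF eps_cases]) (simp_all add: dg_neg[OF that])
  \<comment> \<open>A negative degree contributes at most \<open>- N\<close> to the eigenvalue, and
    a weight of \<open>V\<close> at \<open>d1\<close>, being less than \<open>N\<close>, cannot
    compensate for it.\<close>
  have dg_pos: "dg i \<ge> 0" if i: "i \<in> I'" "i > 0" for i
  proof (rule ccontr)
    assume "\<not> dg i \<ge> 0"
    then have "N * dg i \<le> N * (- 1)" using Npos by (intro mult_left_mono) auto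
    then have "real_of_int (N * dg i) \<le> real_of_int (N * (- 1))" by (simp only: of_int_le_iff)
    moreover have "Re (\<mu> i d1) < N" using wt_bound[OF wt[OF i(1)]] by simp
    ultimately show False using pos[OF i] by simp
  qed
  \<comment> \<open>The positive indices of zero weight, the only ones whose annihilators need not
    kill a vacuum-like vector.\<close>
  define J0 where "J0 = {i \<in> I'. i > 0 \<and> dg i = 0 \<and> (\<forall>x\<in>h. \<mu> i x = 0)}"
  have finJ: "finite J0"
    by (rule finite_basis_deg0[OF be']) (use dg in \<open>auto simp: J0_def\<close>)
  have zv: "zero_vector (e' i)" if i: "i \<in> I'" "dg i = 0" "\<forall>x\<in>h. \<mu> i x = 0" for i
    unfolding zero_vector_def
  proof (intro conjI ballI)
    show "keys (e' i) \<subseteq> {0}" using dg[OF i(1)] i(2) by simp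
    fix x assume "x \<in> HA"
    then obtain y c where "x = deg0 y 0 c" "y \<in> h" unfolding HA_eq by blast
    then show "av x (e' i) = 0" using ev[OF i(1)] i by (simp add: vs_zero[OF vsU])
  qed
  \<comment> \<open>The vector playing the annihilator of index \<open>i\<close>: in
    \<open>spin_intertwiner\<close> the generator of index \<open>i\<close> comes from
    \<open>e' (\<epsilon> * i)\<close>.\<close>
  define z where "z i = e' (- (\<epsilon> * i))" for i
  have zI: "- (\<epsilon> * i) \<in> I'" if "i \<in> I'" for i using that neg_I' eps_I' by simp
  have z0: "zero_vector (z i)" if i: "i \<in> J0" for i
  proof -
    have I: "i \<in> I'" "dg i = 0" "\<forall>x\<in>h. \<mu> i x = 0" using i by (auto simp: J0_def)
    have "- (\<epsilon> * i) = i \<or> - (\<epsilon> * i) = - i" using eps_cases by auto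
    then show ?thesis
      unfolding z_def using zv[OF I] zv[of "- i"] I neg_I' dg_neg[OF I(1)] mu_neg[OF I(1)] by auto
  qed
  have Qz: "Qh (z i) (z j) = 0" if "i \<in> I'" "j \<in> I'" "i > 0" "j > 0" for i j
  proof -
    have "- (\<epsilon> * i) \<noteq> - (- (\<epsilon> * j))" using that eps_cases by auto
    then show ?thesis unfolding z_def using form'[OF zI[OF that(1)] zI[OF that(2)]] by simp
  qed
  have pz: "proj 0 w = w" if "zero_vector w" for w using that proj_id by (simp add: zero_vector_def)
  have anti: "gI v (gI w s) + gI w (gI v s) = cscale (2 * Qh v w) s"
    if "vacuum_like s" "zero_vector v" "zero_vector w" for v w s
    using gI_anticomm[OF spin_space_finkeys, of s I v w] that pz by (simp add: vacuum_like_def)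
  \<comment> \<open>If the operator of \<open>z i\<close> does not kill \<open>s\<close>, the image
    of \<open>s\<close> replaces it: \<open>z i\<close> is isotropic, so its operator squares to
    zero, and it anticommutes with the earlier ones, so nothing achieved is lost.\<close>
  have "\<exists>s. s \<noteq> 0 \<and> vacuum_like s \<and> (\<forall>i\<in>J. gI (z i) s = 0)" if "J \<subseteq> J0" for J
    using finite_subset[OF that finJ] that
  proof (induction J rule: finite_induct)
    case empty
    have "single {} 1 \<noteq> (0 :: int set \<Rightarrow>\<^sub>0 complex)" by (metis lookup_single_eq lookup_zero zero_neq_one)
    then show ?case using vacuum_like_vacuum by blast
  next
    case (insert i J)
    then obtain s where s: "s \<noteq> 0" "vacuum_like s" "\<forall>j\<in>J. gI (z j) s = 0" by auto
    show ?case
    proof (cases "gI (z i) s = 0")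
      case True
      then show ?thesis using s by blast
    next
      case False
      have i: "i \<in> J0" using insert by blast
      have "gI (z j) (gI (z i) s) = 0" if j: "j \<in> insert i J" for j
      proof -
        have jJ: "j \<in> J0" using j insert by blast
        have a: "gI (z j) (gI (z i) s) + gI (z i) (gI (z j) s) = 0"
          using anti[OF s(2) z0[OF jJ] z0[OF i]] Qz i jJ by (simp add: J0_def)
        show ?thesis
        proof (cases "j = i")
          case True
          show ?thesis using a unfolding True by (rule double_0)
        next
          case False
          then have "gI (z j) s = 0" using j s(3) by blast
          then show ?thesis using a by (simp add: linmap_0[OF gI_linmap])
        qed
      qed
      then show ?thesis using False vacuum_like_gI[OF s(2) z0[OF i]] by blast
    qed
  qed
  from this[OF order_refl] obtain s0 where s0: "s0 \<noteq> 0" "vacuum_like s0" "\<forall>i\<in>J0. gI (z i) s0 = 0" by blast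
  \<comment> \<open>The operator of \<open>e' 0\<close> is an involution preserving all conditions.
    Either \<open>s0\<close> plus its image is a nonzero eigenvector for 1, or \<open>s0\<close> is
    an eigenvector for -1; the sign is recorded as \<open>\<sigma>\<close>.\<close>
  have "\<exists>s \<sigma>. s \<noteq> 0 \<and> vacuum_like s \<and> (\<forall>i\<in>J0. gI (z i) s = 0) \<and> \<sigma> \<in> {1, - 1 :: complex} \<and> (0 \<in> I' \<longrightarrow> gI (e' 0) s = cscale \<sigma> s)"
  proof (cases "0 \<in> I'")
    case False
    then show ?thesis using s0 by blast
  next
    case True
    have "\<forall>x\<in>h. \<mu> 0 x = 0" using mu_neg[OF True] by simp
    then have zv0: "zero_vector (e' 0)" using zv[OF True] dg_neg[OF True] by simp
    have "gI (e' 0) (gI (e' 0) s0) + gI (e' 0) (gI (e' 0) s0) = cscale 2 s0"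
      using anti[OF s0(2) zv0 zv0] form'[OF True True] by simp
    then have "gI (e' 0) (gI (e' 0) s0) - s0 + (gI (e' 0) (gI (e' 0) s0) - s0) = 0"
      using cscale_add_left[of 1 1 s0] by (simp add: algebra_simps)
    then have "gI (e' 0) (gI (e' 0) s0) - s0 = 0" by (rule double_0)
    then have sq: "gI (e' 0) (gI (e' 0) s0) = s0" by simp
    let ?t = "s0 + gI (e' 0) s0"
    show ?thesis
    proof (cases "?t = 0")
      case False
      have "gI (z i) ?t = 0" if i: "i \<in> J0" for i
      proof -
        have iI: "i \<in> I'" "i > 0" using i by (auto simp: J0_def)
        have "Qh (z i) (e' 0) = 0" unfolding z_def using form'[OF zI[OF iI(1)] True] iI eps_cases by auto
        then have "gI (z i) (gI (e' 0) s0) = 0"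
          using anti[OF s0(2) z0[OF i] zv0] s0(3) i by (simp add: linmap_0[OF gI_linmap])
        then show ?thesis using s0(3) i by (simp add: linmap_add[OF gI_linmap])
      qed
      moreover have "gI (e' 0) ?t = cscale 1 ?t" by (simp add: linmap_add[OF gI_linmap] sq add.commute)
      moreover have "vacuum_like ?t" by (rule vacuum_like_add[OF s0(2) vacuum_like_gI[OF s0(2) zv0]])
      ultimately show ?thesis using False by blast
    next
      case True
      then have "gI (e' 0) s0 = cscale (- 1) s0" by (simp add: cscale_minus_left eq_neg_iff_add_eq_0 add.commute)
      then show ?thesis using s0 by blast
    qed
  qed
  then obtain s \<sigma> where s: "s \<noteq> 0" "vacuum_like s" "\<forall>i\<in>J0. gI (z i) s = 0"
    and \<sigma>: "\<sigma> \<in> {1, - 1 :: complex}" "0 \<in> I' \<Longrightarrow> gI (e' 0) s = cscale \<sigma> s" by blast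
  show ?thesis
  proof (rule that[of s \<sigma>])
    show "s \<in> spin_space I" "\<And>x. x \<in> H2 \<Longrightarrow> st x s = cscale (\<psi> x) s" using s(2) by (auto simp: vacuum_like_def)
    show "s \<noteq> 0" "\<sigma> \<in> {1, - 1}" by fact+
    show "Gm (e' 0) (single {} s) = fscale \<sigma> (single {} s)" if "0 \<in> I'"
    proof -
      have "dg 0 = 0" using dg_neg[OF that] by simp
      then have "proj (\<epsilon> * int k) (e' 0) = 0" if "k \<ge> 1" for k
        using proj_other[OF dg[OF \<open>0 \<in> I'\<close>]] that eps_cases by auto
      then have "Gm (e' 0) (single {} s) = single {} (gI (e' 0) s)" by (rule Gm_vacuum)
      then show ?thesis using \<sigma>(2)[OF that] by (simp add: fscale_def pmap_single[where f = "cscale \<sigma>"])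
    qed
    fix i assume i: "i \<in> I'" "i > 0"
    let ?v = "e' (- (\<epsilon> * i))"
    have deg: "keys ?v \<subseteq> {- (\<epsilon> * dg i)}"
      using dg[OF zI[OF i(1)]] dg_neg[of "\<epsilon> * i"] dg_eps[OF i(1)] eps_I' i(1) by simp
    have "proj (\<epsilon> * int k) ?v = 0" if "k \<ge> 1" for k
      by (rule proj_other[OF deg]) (use that dg_pos[OF i] eps_cases in auto)
    then have G: "Gm ?v (single {} s) = single {} (gI ?v s)" by (rule Gm_vacuum)
    have "gI ?v s = 0"
    proof (cases "dg i = 0")
      case False
      then have "proj 0 ?v = 0" by (intro proj_other[OF deg]) (use eps_cases in auto)
      then show ?thesis by (rule gI_zero_deg)
    next
      case d0: True
      show ?thesis
      proof (cases "\<forall>x\<in>h. \<mu> i x = 0")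
        case True
        then have "i \<in> J0" using i d0 by (simp add: J0_def)
        then show ?thesis using s(3) by (simp add: z_def)
      next
        case False
        \<comment> \<open>A nonzero weight of \<open>V\<close> has a nonzero integer value at
          \<open>d1\<close>, so the positivity of the basis becomes strict and
          \<open>neg_killed\<close> applies.\<close>
        then have "\<mu> i d1 \<in> \<int> - {0}" using wt_int[OF wt[OF i(1)]] by blast
        then obtain m0 :: int where m0: "\<mu> i d1 = of_int m0" "m0 \<noteq> 0" by (auto elim!: Ints_cases)
        have "m0 \<ge> 0" using pos[OF i] d0 m0 by simp
        then have m0p: "m0 > 0" using m0 by simp
        have "\<mu> (\<epsilon> * i) d1 = of_int \<epsilon> * of_int m0"
          by (rule disjE[OF eps_cases]) (simp_all add: mu_neg[OF i(1) d1h] m0)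
        then have "\<mu> (- (\<epsilon> * i)) d1 = - (of_int \<epsilon> * of_int m0)"
          using mu_neg[of "\<epsilon> * i" d1] eps_I' i(1) d1h by simp
        moreover have "dg (- (\<epsilon> * i)) = 0" using dg_neg[of "\<epsilon> * i"] dg_eps[OF i(1)] eps_I' i(1) d0 by simp
        ultimately have "av (hat_d N d1) ?v = sU (complex_of_real (- (of_int \<epsilon> * of_int m0))) ?v"
          unfolding hat_d_deg0 using ev[OF zI[OF i(1)] d1h] by simp
        moreover have "keys ?v \<subseteq> {0}" using deg d0 by simp
        moreover have "of_int \<epsilon> * (- (of_int \<epsilon> * of_int m0)) < (0 :: real)"
          using m0p eps_cases by auto
        ultimately show ?thesis using s(2) unfolding vacuum_like_def neg_killed_def by blast
      qed
    qed
    then show "Gm ?v (single {} s) = 0" using G by simp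
  qed
qed

lemma FT_op: "op_module AA FT" by (rule op_module_fock[OF st_mod])

lemma FT_mscl: "mscl FT = fscale" by (simp add: fock_module_simps fscale_eq)

lemma FT_single_vacuum: "w \<in> spin_space I \<Longrightarrow> single {} w \<in> mcar FT"
  using subspace_0[OF cscale_vs spin_space_subspace, of I]
  by (auto simp: fock_module_simps spin_module_simps lookup_single when_def)

lemma act_single_vacuum:
  assumes x: "x \<in> lcar AA"
  shows "act FT x (single {} w) = single {} (st x w)"
proof -
  have "slots (single {} w) = {}" by (auto simp: slots_def)
  then have "Sum_any (\<lambda>k. slot_op cscale n (amat x k) k (single {} w)) = 0"
    using Sum_slot_op[of "{}" "single {} w"] by simp
  moreover have "st x 0 = 0" using om_act_0[OF st_mod x] by (simp add: spin_module_simps)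
  ultimately show ?thesis
    by (simp add: fock_module_simps spin_module_simps pmap_single[where f = "st x"])
qed

lemma Gm_e: "l \<in> I \<Longrightarrow> Gm (e l) (single {} w) = single {} (clifford (\<epsilon> * l) w)"
proof -
  assume l: "l \<in> I"
  have "proj (\<epsilon> * int k) (e l) = 0" if "k \<ge> 1" for k
    by (rule proj_other[OF e_keys[OF l]]) (use that eps_cases in auto)
  then have "Gm (e l) (single {} w) = single {} (gI (e l) w)" by (rule Gm_vacuum)
  also have "gI (e l) w = (\<Sum>i\<in>I. if i = l then clifford (\<epsilon> * l) w else 0)"
    unfolding gI_def repI_def using rep_basis[OF vsU be l] proj_id[OF e_keys[OF l]]
    by (intro sum.cong refl) auto
  finally show ?thesis using l finI by simp
qed

text \<open>The vectors of degree \<open>\<epsilon> * k\<close> pair trivially with one another and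
  have no degree-zero part, so they act by pure creation. In this way the slots are filled in
  \<open>spin_intertwiner\<close>.\<close>

lemma Gm_b:
  assumes k: "k \<ge> 1" and i: "i < n"
  shows "Gm (b k i) u = cre (k, i) u"
proof -
  have kb: "keys (b k i) \<subseteq> {\<epsilon> * int k}" by (rule b_keys[OF k i])
  have "Ks (b k i) \<subseteq> {k}"
  proof
    fix l assume l: "l \<in> Ks (b k i)"
    then have "\<epsilon> * int l = \<epsilon> * int k \<or> - \<epsilon> * int l = \<epsilon> * int k" "l \<ge> 1" using kb by (auto simp: Ks_def)
    then show "l \<in> {k}" using eps_cases k by auto
  qed
  then have G: "Gm (b k i) u = gam ({k} \<times> {..<n}) (al (b k i)) (bt (b k i)) (gI (b k i)) u"
    by (rule Gm_eq[rotated]) (use k in auto)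
  have "proj 0 (b k i) = 0" by (rule proj_other[OF kb]) (use k eps_cases in auto)
  then have "pmap (gI (b k i)) u = 0"
    by (intro poly_mapping_eqI) (simp add: lookup_pmap linmap_0[OF gI_linmap] gI_zero_deg)
  moreover have "fld (al (b k i)) (bt (b k i)) (k, j) u = (if j = i then cre (k, i) u else 0)" if j: "j < n" for j
  proof -
    have "al (b k i) (k, j) = (if j = i then 1 else 0)"
      using rep_basis[OF vsU bk[OF k], of i j] i j by (auto simp: al_def proj_id[OF kb])
    moreover have "bt (b k i) (k, j) = 0"
    proof -
      have "Qh (b k i) (b k j) = Qh (b k i) (proj (\<epsilon> * int k) (b k j))" using proj_id[OF b_keys[OF k j]] by simp
      also have "\<dots> = Qh (proj (- (\<epsilon> * int k)) (b k i)) (b k j)" by (rule Qh_proj_right)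
      also have "proj (- (\<epsilon> * int k)) (b k i) = 0" by (rule proj_other[OF kb]) (use k eps_cases in auto)
      finally show ?thesis by (simp add: bt_def Qh_0)
    qed
    ultimately show ?thesis by (simp add: fld_def fscale_zero fscale_one)
  qed
  moreover have "{k} \<times> {..<n} = Pair k ` {..<n}" by auto
  ultimately show ?thesis unfolding G gam_def using i by (simp add: sum.reindex inj_on_def)
qed

text \<open>The map is \<open>fock_map\<close> for the vacuum of \<open>vacuum_exists\<close>. It is
  onto because its image is stable under all \<open>Gm v\<close>: these reach all of
  \<open>Spin(V)\<close> from \<open>s\<close> and then fill the slots.\<close>

lemma spin_intertwiner:
  obtains \<Phi> \<Lambda> s where
    "bij_betw \<Phi> (spin_space I') (mcar FT)" "linear_on cscale fscale (spin_space I') \<Phi>"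
    "\<And>x w. x \<in> lcar AA \<Longrightarrow> w \<in> spin_space I' \<Longrightarrow> act FT x (\<Phi> w) = \<Phi> (st' x w) + fscale (\<Lambda> x) (\<Phi> w)"
    "\<Phi> (single {} 1) = single {} s" "s \<in> spin_space I" "s \<noteq> 0"
    "\<And>x. x \<in> H2 \<Longrightarrow> st x s = cscale (\<psi> x) s"
proof -
  obtain s \<sigma> where s: "s \<in> spin_space I" "s \<noteq> 0" and \<sigma>: "\<sigma> \<in> {1, - 1 :: complex}"
    and s_wt: "\<And>x. x \<in> H2 \<Longrightarrow> st x s = cscale (\<psi> x) s"
    and s_ann: "\<And>i. i \<in> I' \<Longrightarrow> i > 0 \<Longrightarrow> Gm (e' (- (\<epsilon> * i))) (single {} s) = 0"
    and s_0: "0 \<in> I' \<Longrightarrow> Gm (e' 0) (single {} s) = fscale \<sigma> (single {} s)"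
    using vacuum_exists by metis
  have \<sigma>2: "\<sigma> * \<sigma> = 1" "\<sigma> * (\<sigma> * c) = c" for c using \<sigma> by auto
  \<comment> \<open>Rescaling by \<open>\<sigma>\<close> makes \<open>c 0\<close> fix the vacuum
    and, as \<open>\<sigma> * \<sigma> = 1\<close>, preserves the relations. The index
    \<open>\<epsilon> * i\<close> matches the commutators of \<open>phi\<close>.\<close>
  define c where "c i u = fscale \<sigma> (Gm (e' (\<epsilon> * i)) u)" for i u
  define \<Omega> where "\<Omega> = (single {} s :: fock)"
  note sub = fscale_vs FT_subspace
  interpret C: clifford_module I' fscale "mcar FT" c \<Omega>
  proof (rule clifford_module.intro)
    show "c i t \<in> mcar FT" if "t \<in> mcar FT" for i t
      unfolding c_def by (rule subspace_scale[OF sub Gm_in[OF that]])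
    show "linear_on fscale fscale (mcar FT) (c i)" for i
      by (simp add: linear_on_def c_def Gm_add_right Gm_fscale_right fscale_add fscale_mult mult.commute)
    show "c i (c j t) + c j (c i t) = (if i = - j then fscale 2 t else 0)" if "i \<in> I'" "j \<in> I'" "t \<in> mcar FT" for i j t
    proof -
      have "\<epsilon> * i = - (\<epsilon> * j) \<longleftrightarrow> i = - j" using eps_cases by auto
      moreover have "c i (c j t) + c j (c i t) = Gm (e' (\<epsilon> * i)) (Gm (e' (\<epsilon> * j)) t) + Gm (e' (\<epsilon> * j)) (Gm (e' (\<epsilon> * i)) t)"
        by (simp add: c_def Gm_fscale_right fscale_mult \<sigma>2 fscale_one)
      ultimately show ?thesis
        using Gm_anticomm[OF that(3)] form' that eps_I' by (simp add: fscale_zero)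
    qed
    show "\<Omega> \<in> mcar FT" unfolding \<Omega>_def by (rule FT_single_vacuum[OF s(1)])
    show "c (- i) \<Omega> = 0" if "i \<in> I'" "i > 0" for i
      unfolding c_def \<Omega>_def using s_ann[OF that] by (simp add: fscale_zero_right)
    show "c 0 \<Omega> = \<Omega>" if "0 \<in> I'"
      unfolding c_def \<Omega>_def using s_0[OF that] by (simp add: fscale_mult \<sigma>2 fscale_one)
  qed (rule fscale_vs, rule FT_subspace, rule symI')
  let ?\<Phi> = C.fock_map
  have \<Omega>0: "\<Omega> \<noteq> 0" unfolding \<Omega>_def using s(2) by (metis lookup_single_eq lookup_zero)
  have Gc: "Gm (e' i) t = fscale \<sigma> (c (\<epsilon> * i) t)" for i t
    by (simp add: c_def fscale_mult \<sigma>2 fscale_one)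
  \<comment> \<open>The \<open>e' i\<close> span the affinization, so every Clifford operator is a
    finite combination of the generators \<open>c i\<close>.\<close>
  have cG: "fscale \<sigma> (Gm v t) = (\<Sum>i | i \<in> I' \<and> module.representation sU (e' ` I') v (e' (\<epsilon> * i)) \<noteq> 0.
      fscale (module.representation sU (e' ` I') v (e' (\<epsilon> * i))) (c i t))" for v t
  proof -
    let ?r = "\<lambda>i. module.representation sU (e' ` I') v (e' i)"
    have "v = (\<Sum>i | i \<in> I' \<and> ?r i \<noteq> 0. sU (?r i) (e' i))"
      by (rule rep_eq[OF vsU be' UNIV_I rep_finite[OF vsU be'] order_refl]) blast
    then have "Gm v t = (\<Sum>i | i \<in> I' \<and> ?r i \<noteq> 0. fscale (?r i) (Gm (e' i) t))"
      by (metis (no_types, lifting) Gm_sum Gm_scale sum.cong)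
    then have "fscale \<sigma> (Gm v t) = (\<Sum>i | i \<in> I' \<and> ?r i \<noteq> 0. fscale (?r i) (c (\<epsilon> * i) t))"
      by (simp add: fscale_sum Gc fscale_mult \<sigma>2 mult.commute mult.left_commute)
    also have "\<dots> = (\<Sum>i | i \<in> I' \<and> ?r (\<epsilon> * i) \<noteq> 0. fscale (?r (\<epsilon> * i)) (c i t))"
      by (rule sum.reindex_bij_witness[of _ "\<lambda>i. \<epsilon> * i" "\<lambda>i. \<epsilon> * i"]) (auto simp: eps_I')
    finally show ?thesis .
  qed
  note sp = spin_space_subspace[of I'] and spI = spin_space_subspace[of I]
  let ?W = "?\<Phi> ` spin_space I'"
  have W: "module.subspace fscale ?W"
  proof (rule subspaceI[OF fscale_vs])
    show "0 \<in> ?W" using subspace_0[OF cscale_vs sp] C.fock_map_0 by (metis imageI)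
    show "u + v \<in> ?W" if "u \<in> ?W" "v \<in> ?W" for u v
      using that subspace_add[OF cscale_vs sp] by (auto simp flip: C.fock_map_add)
    show "fscale a u \<in> ?W" if "u \<in> ?W" for a u
      using that subspace_scale[OF cscale_vs sp] by (auto simp flip: C.fock_map_cscale)
  qed
  have WG: "Gm v t \<in> ?W" if t: "t \<in> ?W" for v t
  proof -
    obtain u where u: "u \<in> spin_space I'" "t = ?\<Phi> u" using t by blast
    have "c i t \<in> ?W" if "i \<in> I'" for i
      unfolding u(2) using C.fock_map_clifford[OF that u(1)] clifford_spin_space[OF u(1) that] by (metis imageI)
    then have "fscale \<sigma> (Gm v t) \<in> ?W"
      unfolding cG by (intro subspace_sum[OF fscale_vs W] subspace_scale[OF fscale_vs W]) auto
    then have "fscale \<sigma> (fscale \<sigma> (Gm v t)) \<in> ?W" by (rule subspace_scale[OF fscale_vs W])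
    then show ?thesis by (simp add: fscale_mult \<sigma>2 fscale_one)
  qed
  have \<Omega>W: "\<Omega> \<in> ?W" using C.fock_map_vacuum spin_space_vacuum by (metis imageI)
  \<comment> \<open>\<open>s\<close> need not be the vacuum of \<open>Spin(V)\<close>. Annihilators
    lead from it to that vacuum, and creators then produce all of \<open>Spin(V)\<close>.\<close>
  have vacW: "single {} w \<in> ?W" if w: "w \<in> spin_space I" for w
  proof -
    let ?Y = "{w \<in> spin_space I. single {} w \<in> ?W}"
    have fs: "fscale a (single {} w) = single {} (cscale a w)" for a w
      by (simp add: fscale_def pmap_single[where f = "cscale a"])
    have Y: "module.subspace cscale ?Y"
    proof (rule subspaceI[OF cscale_vs])
      show "0 \<in> ?Y" using subspace_0[OF fscale_vs W] subspace_0[OF cscale_vs spI] by simp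
      show "x + y \<in> ?Y" if "x \<in> ?Y" "y \<in> ?Y" for x y
        using that subspace_add[OF fscale_vs W] subspace_add[OF cscale_vs spI] by (simp add: single_add)
      show "cscale a x \<in> ?Y" if "x \<in> ?Y" for a x
        using that subspace_scale[OF fscale_vs W, of "single {} x" a] subspace_scale[OF cscale_vs spI]
        by (simp add: fs)
    qed
    have cl: "clifford i u \<in> ?Y" if "i \<in> I" "u \<in> ?Y" for i u
    proof -
      have "Gm (e (\<epsilon> * i)) (single {} u) \<in> ?W" using WG that by simp
      then show ?thesis using that Gm_e[of "\<epsilon> * i" u] eps_I clifford_spin_space by simp
    qed
    have sY: "s \<in> ?Y" using \<Omega>W s(1) by (simp add: \<Omega>_def)
    have "single {} 1 \<in> ?Y"
      by (rule spin_space_reach_vacuum[OF Y _ symI sY s]) (rule cl)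
    then have "spin_space I \<subseteq> ?Y"
      by (intro spin_space_from_vacuum[OF Y]) (rule cl)
    then show ?thesis using w by blast
  qed
  have singleW: "single K w \<in> ?W" if "finite K" "K \<subseteq> {1..} \<times> {..<n}" "w \<in> spin_space I" for K w
    using that
  proof (induction K arbitrary: w rule: finite_induct)
    case empty
    then show ?case using vacW by simp
  next
    case (insert p K)
    let ?w = "sg (above p K) w"
    have "?w \<in> spin_space I" using insert.prems subspace_neg[OF cscale_vs spI] by (simp add: sg_def)
    then have m: "single K ?w \<in> ?W" using insert by simp
    obtain k i where p: "p = (k, i)" "k \<ge> 1" "i < n" using insert.prems by (cases p) auto
    have "cre p (single K ?w) \<in> ?W" using WG[OF m, of "b k i"] Gm_b[OF p(2,3)] p(1) by simp
    then show ?case using insert.hyps by (simp add: cre_single)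
  qed
  have surj: "mcar FT \<subseteq> ?W"
  proof
    fix t assume t: "t \<in> mcar FT"
    have "(\<Sum>K\<in>keys t. single K (lookup t K)) \<in> ?W"
    proof (rule subspace_sum[OF fscale_vs W])
      fix K assume "K \<in> keys t"
      then have "lookup t K \<noteq> 0" by (simp add: in_keys_iff)
      then show "single K (lookup t K) \<in> ?W"
        by (intro singleW fock_key[OF t] FT_lookup[OF t])
    qed
    then show "t \<in> ?W" by (simp add: poly_mapping_sum_single)
  qed
  have im: "?W = mcar FT" using surj C.fock_map_in by blast
  have inj: "inj_on ?\<Phi> (spin_space I')" by (rule C.fock_map_inj[OF \<Omega>0])
  have "\<exists>a. \<forall>w\<in>spin_space I'. act FT x (?\<Phi> w) = ?\<Phi> (st' x w) + fscale a (?\<Phi> w)" if x: "x \<in> lcar AA" for x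
  proof -
    have actW: "act FT x t \<in> ?W" if "t \<in> mcar FT" for t using op_moduleD(3)[OF FT_op x that] im by simp
    \<comment> \<open>The difference between the transported action of \<open>x\<close> and
      \<open>st' x\<close>. Both have the same commutators with the generators, so \<open>T\<close>
      commutes with them.\<close>
    define T where "T w = inv_into (spin_space I') ?\<Phi> (act FT x (?\<Phi> w)) - st' x w" for w
    have T_in: "T w \<in> spin_space I'" if "w \<in> spin_space I'" for w
      unfolding T_def
      by (rule subspace_diff[OF cscale_vs sp inv_into_into[OF actW[OF C.fock_map_in[OF that]]] st'_in[OF that]])
    have \<Phi>T: "?\<Phi> (T w) = act FT x (?\<Phi> w) - ?\<Phi> (st' x w)" if "w \<in> spin_space I'" for w
    proof -
      have "?\<Phi> (T w + st' x w) = act FT x (?\<Phi> w)"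
        unfolding T_def using f_inv_into_f[OF actW[OF C.fock_map_in[OF that]]] by simp
      then show ?thesis by (simp add: C.fock_map_add algebra_simps)
    qed
    have FTin: "?\<Phi> w \<in> mcar FT" if "w \<in> spin_space I'" for w by (rule C.fock_map_in[OF that])
    have eqI: "u = v" if "?\<Phi> u = ?\<Phi> v" "u \<in> spin_space I'" "v \<in> spin_space I'" for u v
      using inj that by (auto simp: inj_on_def)
    have lin: "linear_on cscale cscale (spin_space I') T"
      unfolding linear_on_def
    proof (intro conjI ballI allI)
      fix u v assume u: "u \<in> spin_space I'" and v: "v \<in> spin_space I'"
      have uv: "u + v \<in> spin_space I'" by (rule subspace_add[OF cscale_vs sp u v])
      show "T (u + v) = T u + T v"
      proof (rule eqI[OF _ T_in[OF uv] subspace_add[OF cscale_vs sp T_in[OF u] T_in[OF v]]])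
        show "?\<Phi> (T (u + v)) = ?\<Phi> (T u + T v)"
          using \<Phi>T[OF uv] \<Phi>T[OF u] \<Phi>T[OF v] om_act_add[OF FT_op x FTin[OF u] FTin[OF v]]
            linear_on_add[OF st'_lin u v]
          by (simp add: C.fock_map_add)
      qed
    next
      fix a u assume u: "u \<in> spin_space I'"
      have au: "cscale a u \<in> spin_space I'" by (rule subspace_scale[OF cscale_vs sp u])
      show "T (cscale a u) = cscale a (T u)"
      proof (rule eqI[OF _ T_in[OF au] subspace_scale[OF cscale_vs sp T_in[OF u]]])
        show "?\<Phi> (T (cscale a u)) = ?\<Phi> (cscale a (T u))"
          using \<Phi>T[OF au] \<Phi>T[OF u] om_act_scale[OF FT_op x FTin[OF u], unfolded FT_mscl]
            linear_on_scale[OF st'_lin u]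
          by (simp add: C.fock_map_cscale fscale_diff)
      qed
    qed
    have com: "T (clifford i w) = clifford i (T w)" if i: "i \<in> I'" and w: "w \<in> spin_space I'" for i w
    proof (rule eqI[OF _ T_in[OF clifford_spin_space[OF w i]] clifford_spin_space[OF T_in[OF w] i]])
      let ?r = "\<lambda>j. module.representation sU (e' ` I') (av x (e' (\<epsilon> * i))) (e' (\<epsilon> * j))"
      let ?S = "\<Sum>j | j \<in> I' \<and> ?r j \<noteq> 0. fscale (?r j) (c j (?\<Phi> w))"
      have "act FT x (c i t) = c i (act FT x t) + (\<Sum>j | j \<in> I' \<and> ?r j \<noteq> 0. fscale (?r j) (c j t))"
        if t: "t \<in> mcar FT" for t
      proof -
        have "act FT x (c i t) = fscale \<sigma> (act FT x (Gm (e' (\<epsilon> * i)) t))"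
          unfolding c_def by (rule om_act_scale[OF FT_op x Gm_in[OF t], unfolded FT_mscl])
        also have "\<dots> = fscale \<sigma> (Gm (e' (\<epsilon> * i)) (act FT x t)) + fscale \<sigma> (Gm (av x (e' (\<epsilon> * i))) t)"
          by (simp add: Gm_comm[OF x t] fscale_add)
        finally show ?thesis unfolding cG[of "av x (e' (\<epsilon> * i))"] by (simp add: c_def)
      qed
      from this[OF FTin[OF w]] have 1: "act FT x (c i (?\<Phi> w)) = c i (act FT x (?\<Phi> w)) + ?S" .
      have "?\<Phi> (st' x (clifford i w)) = ?\<Phi> (clifford i (st' x w)) +
          (\<Sum>j | j \<in> I' \<and> ?r j \<noteq> 0. ?\<Phi> (cscale (?r j) (clifford j w)))"
        unfolding st'_comm[OF x w i] C.fock_map_add C.fock_map_finsum ..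
      also have "(\<Sum>j | j \<in> I' \<and> ?r j \<noteq> 0. ?\<Phi> (cscale (?r j) (clifford j w))) = ?S"
        by (rule sum.cong[OF refl]) (simp add: C.fock_map_cscale C.fock_map_clifford[OF _ w])
      finally have 2: "?\<Phi> (st' x (clifford i w)) = c i (?\<Phi> (st' x w)) + ?S"
        using C.fock_map_clifford[OF i st'_in[OF w]] by simp
      have "?\<Phi> (T (clifford i w)) = c i (act FT x (?\<Phi> w)) - c i (?\<Phi> (st' x w))"
        using \<Phi>T[OF clifford_spin_space[OF w i]] 1 2 C.fock_map_clifford[OF i w] by simp
      also have "\<dots> = c i (act FT x (?\<Phi> w) - ?\<Phi> (st' x w))"
        by (rule linear_on_diff[OF C.c_lin[OF i] fscale_vs fscale_vs FT_subspace, symmetric])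
           (use op_moduleD(3)[OF FT_op x FTin[OF w]] FTin[OF st'_in[OF w]] in auto)
      also have "\<dots> = ?\<Phi> (clifford i (T w))" using C.fock_map_clifford[OF i T_in[OF w]] \<Phi>T[OF w] by simp
      finally show "?\<Phi> (T (clifford i w)) = ?\<Phi> (clifford i (T w))" .
    qed
    obtain a where a: "\<And>w. w \<in> spin_space I' \<Longrightarrow> T w = cscale a w"
      using spin_commutant[OF symI' lin T_in com] by blast
    have "act FT x (?\<Phi> w) = ?\<Phi> (st' x w) + fscale a (?\<Phi> w)" if "w \<in> spin_space I'" for w
      using \<Phi>T[OF that] a[OF that] by (simp add: C.fock_map_cscale algebra_simps)
    then show ?thesis by blast
  qed
  then obtain \<Lambda> where \<Lambda>: "\<And>x w. x \<in> lcar AA \<Longrightarrow> w \<in> spin_space I' \<Longrightarrow>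
      act FT x (?\<Phi> w) = ?\<Phi> (st' x w) + fscale (\<Lambda> x) (?\<Phi> w)"
    by metis
  show ?thesis
  proof (rule that[OF _ C.fock_map_linear \<Lambda> _ s s_wt])
    show "bij_betw ?\<Phi> (spin_space I') (mcar FT)" using inj im by (simp add: bij_betw_def)
    show "?\<Phi> (single {} 1) = single {} s" using C.fock_map_vacuum by (simp add: \<Omega>_def)
  qed
qed

section \<open>Vanishing of the scalar discrepancy\<close>

lemma AA_add: "x \<in> lcar AA \<Longrightarrow> y \<in> lcar AA \<Longrightarrow> x + y \<in> lcar AA"
  and AA_scale: "x \<in> lcar AA \<Longrightarrow> lscl (affine_algebra G B) c x \<in> lcar AA"
  and AA_br: "x \<in> lcar AA \<Longrightarrow> y \<in> lcar AA \<Longrightarrow> lbr (affine_algebra G B) x y \<in> lcar AA"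
proof -
  show "x + y \<in> lcar AA" if xy: "x \<in> lcar AA" "y \<in> lcar AA"
  proof -
    obtain a b c d where "x = deg0 a 0 b" "y = deg0 c 0 d" using xy unfolding lcar_AA by blast
    then show ?thesis by (simp add: deg0_add deg0_AA)
  qed
  show "lscl (affine_algebra G B) c x \<in> lcar AA" if x: "x \<in> lcar AA"
  proof -
    obtain a b where "x = deg0 a 0 b" using x unfolding lcar_AA by blast
    then show ?thesis by (simp add: lscl_deg0 deg0_AA)
  qed
  show "lbr (affine_algebra G B) x y \<in> lcar AA" if xy: "x \<in> lcar AA" "y \<in> lcar AA"
  proof -
    obtain a b c d where "x = deg0 a 0 b" "y = deg0 c 0 d" using xy unfolding lcar_AA by blast
    then show ?thesis by (simp add: bracket_deg0 deg0_AA)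
  qed
qed

lemma st_bracket: "x \<in> lcar AA \<Longrightarrow> y \<in> lcar AA \<Longrightarrow> w \<in> spin_space I \<Longrightarrow>
    st (lbr (affine_algebra G B) x y) w = st x (st y w) - st y (st x w)"
  using st_lie unfolding lie_module_def spin_module_def AA_simps(3) by (elim conjE) simp

lemma st'_bracket: "w \<in> spin_space I' \<Longrightarrow>
    st' (lbr (affine_algebra G B) x y) w = st' x (st' y w) - st' y (st' x w)"
  using st'_lie unfolding lie_module_def spin_module_def lcar_affine by (elim conjE) (simp del: split_paired_All)

lemma st_linear: "w \<in> spin_space I \<Longrightarrow> linear_on (lscl (affine_algebra G B)) cscale (lcar AA) (\<lambda>x. st x w)"
  using st_lie unfolding lie_module_def spin_module_def AA_simps(2) by (elim conjE) simp

lemma st'_linear: "w \<in> spin_space I' \<Longrightarrow> linear_on (lscl (affine_algebra G B)) cscale UNIV (\<lambda>x. st' x w)"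
  using st'_lie unfolding lie_module_def spin_module_def lcar_affine by (elim conjE) (simp del: split_paired_All)

lemma lscl_AA_vs: "vector_space (lscl AA)" unfolding AA_simps(2) by (rule vs_affine)

text \<open>Coroots lie in spans of brackets, and the bracket of two elements of the smaller algebra
  has no component along the derivation.\<close>

lemma simple_coroots_deg0:
  assumes "z \<in> module.span (lscl AA) (simple_coroots AA HA d)"
  shows "\<exists>x. z = deg0 x 0 0"
proof -
  interpret A: vector_space "lscl AA" by (rule lscl_AA_vs)
  have z0: "deg0 0 0 0 = 0" by (simp add: deg0_def zero_prod_def)
  have sub: "A.subspace {deg0 x 0 0 | x. True}"
  proof (rule A.subspaceI)
    show "0 \<in> {deg0 x 0 0 | x. True}" using z0 by (metis (mono_tags) mem_Collect_eq)
    show "x + y \<in> {deg0 x 0 0 | x. True}" if "x \<in> {deg0 x 0 0 | x. True}" "y \<in> {deg0 x 0 0 | x. True}" for x y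
    proof -
      obtain p q where "x = deg0 p 0 0" "y = deg0 q 0 0" using \<open>x \<in> _\<close> \<open>y \<in> _\<close> by blast
      then have "x + y = deg0 (p + q) 0 0" by (simp add: deg0_add)
      then show ?thesis by blast
    qed
    show "lscl AA c x \<in> {deg0 x 0 0 | x. True}" if x: "x \<in> {deg0 x 0 0 | x. True}" for c x
    proof -
      obtain p where "x = deg0 p 0 0" using x by blast
      then have "lscl AA c x = deg0 (lscl G c p) 0 0" by (simp add: lscl_deg0 AA_simps(2))
      then show ?thesis by blast
    qed
  qed
  have "simple_coroots AA HA d \<subseteq> {deg0 x 0 0 | x. True}"
  proof
    fix k assume "k \<in> simple_coroots AA HA d"
    then obtain \<alpha> where k: "k \<in> A.span {lbr AA x y | x y. x \<in> weight_space (adjoint AA) HA \<alpha> \<and>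
        y \<in> weight_space (adjoint AA) HA (\<lambda>h. - \<alpha> h)}"
      unfolding simple_coroots_def by blast
    have wA: "weight_space (adjoint AA) HA \<beta> \<subseteq> lcar AA" for \<beta>
      unfolding weight_space_def adjoint_def by auto
    have br: "lbr AA x y \<in> {deg0 x 0 0 | x. True}" if xy: "x \<in> lcar AA" "y \<in> lcar AA" for x y
    proof -
      obtain a b c d where "x = deg0 a 0 b" "y = deg0 c 0 d" using xy unfolding lcar_AA by blast
      then have "lbr AA x y = deg0 (lbr G a c) 0 0" by (simp add: bracket_deg0 AA_simps(3))
      then show ?thesis by blast
    qed
    have "{lbr AA x y | x y. x \<in> weight_space (adjoint AA) HA \<alpha> \<and>
        y \<in> weight_space (adjoint AA) HA (\<lambda>h. - \<alpha> h)} \<subseteq> {deg0 x 0 0 | x. True}"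
      using wA br by blast
    then show "k \<in> {deg0 x 0 0 | x. True}" using A.span_minimal[OF _ sub] k by blast
  qed
  then show ?thesis using A.span_minimal[OF _ sub] assms by blast
qed

lemma spin_iso: "module_iso AA (spin_module I' st') FT"
proof -
  obtain \<Phi> \<Lambda> s where bij: "bij_betw \<Phi> (spin_space I') (mcar FT)"
    and lin: "linear_on cscale fscale (spin_space I') \<Phi>"
    and \<Lambda>: "\<And>x w. x \<in> lcar AA \<Longrightarrow> w \<in> spin_space I' \<Longrightarrow> act FT x (\<Phi> w) = \<Phi> (st' x w) + fscale (\<Lambda> x) (\<Phi> w)"
    and vac: "\<Phi> (single {} 1) = single {} s" and s: "s \<in> spin_space I" "s \<noteq> 0"
    and wt: "\<And>x. x \<in> H2 \<Longrightarrow> st x s = cscale (\<psi> x) s"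
    using spin_intertwiner by metis
  let ?v = "single {} 1 :: int set \<Rightarrow>\<^sub>0 complex"
  let ?\<Omega> = "single {} s :: fock"
  let ?sc = "lscl (affine_algebra G B)"
  note sp = spin_space_subspace[of I']
  have v: "?v \<in> spin_space I'" by (rule spin_space_vacuum)
  have can: "a = b" if "fscale a ?\<Omega> = fscale b ?\<Omega>" for a b
  proof -
    have "fscale (a - b) ?\<Omega> = 0" using that fscale_add_left[of "a - b" b ?\<Omega>] by simp
    moreover have "fscale (a - b) ?\<Omega> = single {} (cscale (a - b) s)"
      by (simp add: fscale_def pmap_single[where f = "cscale (a - b)"])
    ultimately have "cscale (a - b) s = 0" by (metis lookup_single_eq lookup_zero)
    then show ?thesis using s(2) by (simp add: cscale_eq_0_iff)
  qed
  \<comment> \<open>Everything about \<open>\<Lambda>\<close> is read off at the vacuum, where the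
    Fock action reduces to \<open>st\<close>.\<close>
  have E: "single {} (st x s) = \<Phi> (st' x ?v) + fscale (\<Lambda> x) ?\<Omega>" if "x \<in> lcar AA" for x
    using \<Lambda>[OF that v] act_single_vacuum[OF that] by (simp add: vac)
  have \<Phi>add: "\<Phi> (x + y) = \<Phi> x + \<Phi> y" if "x \<in> spin_space I'" "y \<in> spin_space I'" for x y
    by (rule linear_on_add[OF lin that])
  have \<Phi>sc: "\<Phi> (cscale c x) = fscale c (\<Phi> x)" if "x \<in> spin_space I'" for c x
    by (rule linear_on_scale[OF lin that])
  have \<Phi>diff: "\<Phi> (x - y) = \<Phi> x - \<Phi> y" if "x \<in> spin_space I'" "y \<in> spin_space I'" for x y
    by (rule linear_on_diff[OF lin cscale_vs fscale_vs sp that])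
  have \<Lambda>lin: "linear_on ?sc (*) (lcar AA) \<Lambda>"
    unfolding linear_on_def
  proof (intro conjI ballI allI)
    fix x y assume x: "x \<in> lcar AA" and y: "y \<in> lcar AA"
    show "\<Lambda> (x + y) = \<Lambda> x + \<Lambda> y"
    proof (rule can)
      have "st (x + y) s = st x s + st y s" by (rule linear_on_add[OF st_linear[OF s(1)] x y])
      moreover have "st' (x + y) ?v = st' x ?v + st' y ?v" by (rule linear_on_add[OF st'_linear[OF v]]) simp_all
      ultimately show "fscale (\<Lambda> (x + y)) ?\<Omega> = fscale (\<Lambda> x + \<Lambda> y) ?\<Omega>"
        using E[OF AA_add[OF x y]] E[OF x] E[OF y] \<Phi>add[OF st'_in[OF v] st'_in[OF v]]
        by (simp add: single_add fscale_add_left)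
    qed
  next
    fix c x assume x: "x \<in> lcar AA"
    show "\<Lambda> (?sc c x) = c * \<Lambda> x"
    proof (rule can)
      have "st (?sc c x) s = cscale c (st x s)" by (rule linear_on_scale[OF st_linear[OF s(1)] x])
      moreover have "st' (?sc c x) ?v = cscale c (st' x ?v)" by (rule linear_on_scale[OF st'_linear[OF v]]) simp
      moreover have "single {} (cscale c (st x s)) = fscale c (single {} (st x s))"
        by (simp add: fscale_def pmap_single[where f = "cscale c"])
      ultimately show "fscale (\<Lambda> (?sc c x)) ?\<Omega> = fscale (c * \<Lambda> x) ?\<Omega>"
        using E[OF AA_scale[OF x, of c]] E[OF x] \<Phi>sc[OF st'_in[OF v, of x], of c]
        by (simp add: fscale_add fscale_mult)
    qed
  qed
  define T where "T x w = st' x w + cscale (\<Lambda> x) w" for x w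
  have T_in: "T x w \<in> spin_space I'" if "w \<in> spin_space I'" for x w
    unfolding T_def by (intro subspace_add[OF cscale_vs sp] subspace_scale[OF cscale_vs sp] st'_in that)
  have \<Phi>T: "act FT x (\<Phi> w) = \<Phi> (T x w)" if "x \<in> lcar AA" "w \<in> spin_space I'" for x w
    unfolding T_def \<Phi>add[OF st'_in[OF that(2)] subspace_scale[OF cscale_vs sp that(2)]] \<Phi>sc[OF that(2)]
    by (rule \<Lambda>[OF that])
  \<comment> \<open>The scalars drop out of commutators, so those of \<open>T\<close> are given by
    \<open>st'\<close> on the bracket.\<close>
  have TT: "T x (T y w) - T y (T x w) = st' (lbr (affine_algebra G B) x y) w" if w: "w \<in> spin_space I'" for x y w
  proof -
    have 1: "st' x (T y w) = st' x (st' y w) + cscale (\<Lambda> y) (st' x w)" for x y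
      unfolding T_def linear_on_add[OF st'_lin st'_in[OF w] subspace_scale[OF cscale_vs sp w]]
        linear_on_scale[OF st'_lin w] ..
    have "T x (T y w) = st' x (st' y w) + cscale (\<Lambda> y) (st' x w) + cscale (\<Lambda> x) (st' y w) + cscale (\<Lambda> x * \<Lambda> y) w" for x y
      unfolding T_def[of x "T y w"] 1[of x y] by (simp add: T_def cscale_add cscale_cscale)
    then show ?thesis by (simp add: st'_bracket[OF w] mult.commute)
  qed
  \<comment> \<open>On vectors \<open>single {} w\<close> the Fock action is that of
    \<open>st\<close>, which respects brackets; comparison with \<open>TT\<close> leaves no scalar
    for a bracket.\<close>
  have \<Lambda>br: "\<Lambda> (lbr (affine_algebra G B) x y) = 0" if x: "x \<in> lcar AA" and y: "y \<in> lcar AA" for x y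
  proof (rule can)
    let ?z = "lbr (affine_algebra G B) x y"
    have two: "single {} (st x (st y s)) = \<Phi> (T x (T y ?v))" if "x \<in> lcar AA" "y \<in> lcar AA" for x y
      using act_single_vacuum[OF that(1), of "st y s"] act_single_vacuum[OF that(2), of s]
        \<Phi>T[OF that(2) v] \<Phi>T[OF that(1) T_in[OF v]] by (simp add: vac)
    have "single {} (st ?z s) = \<Phi> (T x (T y ?v)) - \<Phi> (T y (T x ?v))"
      unfolding st_bracket[OF x y s(1)] single_diff two[OF x y] two[OF y x] ..
    also have "\<dots> = \<Phi> (st' ?z ?v)"
      unfolding TT[OF v, symmetric] by (rule \<Phi>diff[symmetric]) (intro T_in v)+
    finally show "fscale (\<Lambda> ?z) ?\<Omega> = fscale 0 ?\<Omega>" using E[OF AA_br[OF x y]] by (simp add: fscale_zero)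
  qed
  have \<Lambda>G: "\<Lambda> (deg0 x 0 0) = 0" for x
  proof (rule semisimple_perfect[OF ss])
    show "linear_on (lscl G) (*) (lcar G) (\<lambda>x. \<Lambda> (deg0 x 0 0))"
      unfolding linear_on_def
    proof (intro conjI ballI allI)
      show "\<Lambda> (deg0 (x + y) 0 0) = \<Lambda> (deg0 x 0 0) + \<Lambda> (deg0 y 0 0)" for x y
        using linear_on_add[OF \<Lambda>lin deg0_AA deg0_AA, of x 0 y 0] by (simp add: deg0_add)
      show "\<Lambda> (deg0 (lscl G c x) 0 0) = c * \<Lambda> (deg0 x 0 0)" for c x
        using linear_on_scale[OF \<Lambda>lin deg0_AA, of c x 0] by (simp add: lscl_deg0)
    qed
    show "\<Lambda> (deg0 (lbr G x y) 0 0) = 0" for x y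
      using \<Lambda>br[OF deg0_AA deg0_AA, of x 0 y 0] by (simp add: bracket_deg0)
    show "x \<in> lcar G" by (simp add: carG)
  qed
  have H2HA: "H2 \<subseteq> HA" using compl by (simp add: complement_in_def)
  have \<Lambda>H2: "\<Lambda> x = 0" if x: "x \<in> H2" for x
  proof (rule can)
    obtain y c where xy: "x = deg0 y 0 c" "y \<in> h" using x H2HA unfolding HA_eq by blast
    obtain \<mu> dg where \<mu>: "\<And>i. i \<in> I' \<Longrightarrow> av (deg0 y 0 c) (e' i) = sU (\<mu> i y + c * of_int (dg i)) (e' i)"
      using weights' xy(2) by metis
    have "st' x ?v = cscale (\<psi>' x) ?v"
    proof (rule spin_lift_vacuum[OF lift' eps vs_affine vsU be'])
      show "x \<in> lcar (affine_algebra G B)" by (simp add: lcar_affine)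
      show "x \<in> H2'" using x H2_sub by blast
      show "av x (e' j) = sU (\<mu> j y + c * of_int (dg j)) (e' j)" if "j \<in> I'" for j unfolding xy(1) by (rule \<mu>[OF that])
    qed
    then have "\<Phi> (st' x ?v) = fscale (\<psi> x) ?\<Omega>" using \<Phi>sc[OF v] by (simp add: psi_eq[OF x] vac)
    moreover have "single {} (st x s) = fscale (\<psi> x) ?\<Omega>"
      by (simp add: wt[OF x] fscale_def pmap_single[where f = "cscale (\<psi> x)"])
    moreover have "x \<in> lcar AA" using x H2HA HA_AA by blast
    ultimately show "fscale (\<Lambda> x) ?\<Omega> = fscale 0 ?\<Omega>" using E[of x] by (simp add: fscale_zero)
  qed
  \<comment> \<open>By the choice of the complement, \<open>hat_d N d1\<close> is an element of
    \<open>H2\<close> plus a combination of coroots, and the latter lies in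
    \<open>G\<close>.\<close>
  have \<Lambda>d: "\<Lambda> (hat_d N d1) = 0"
  proof -
    obtain y z where yz: "y \<in> H2" "z \<in> module.span (lscl AA) (simple_coroots AA HA (hat_d N d1))" "hat_d N d1 = y + z"
      using compl hat_HA unfolding complement_in_def by blast
    obtain p where p: "z = deg0 p 0 0" using simple_coroots_deg0[OF yz(2)] by blast
    have "y \<in> lcar AA" using yz(1) H2HA HA_AA by blast
    then have "\<Lambda> (y + z) = \<Lambda> y + \<Lambda> z" unfolding p by (rule linear_on_add[OF \<Lambda>lin _ deg0_AA])
    then show ?thesis unfolding yz(3) using \<Lambda>H2[OF yz(1)] \<Lambda>G[of p] by (simp add: p)
  qed
  \<comment> \<open>\<open>G\<close> and \<open>hat_d N d1\<close> span the smaller algebra; the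
    coefficient of \<open>hat_d N d1\<close> is found by dividing by \<open>N\<close>.\<close>
  have \<Lambda>0: "\<Lambda> x = 0" if x0: "x \<in> lcar AA" for x
  proof -
    obtain p c where x: "x = deg0 p 0 c" using x0 unfolding lcar_AA by blast
    let ?r = "c / of_int N"
    have "x = deg0 (p - lscl G ?r d1) 0 0 + ?sc ?r (hat_d N d1)"
      unfolding x hat_d_deg0 lscl_deg0 deg0_add using Npos by simp
    moreover have d: "hat_d N d1 \<in> lcar AA" unfolding hat_d_deg0 by (rule deg0_AA)
    ultimately show ?thesis
      using linear_on_add[OF \<Lambda>lin deg0_AA AA_scale[OF d]] linear_on_scale[OF \<Lambda>lin d] \<Lambda>d \<Lambda>G by simp
  qed
  show ?thesis
    unfolding module_iso_def
  proof (intro exI conjI ballI)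
    show "bij_betw \<Phi> (mcar (spin_module I' st')) (mcar FT)" using bij by (simp add: spin_module_def)
    show "linear_on (mscl (spin_module I' st')) (mscl FT) (mcar (spin_module I' st')) \<Phi>"
      using lin unfolding FT_mscl by (simp add: spin_module_def)
    show "\<Phi> (act (spin_module I' st') x w) = act FT x (\<Phi> w)" if "x \<in> lcar AA" "w \<in> mcar (spin_module I' st')" for x w
      using \<Lambda>[OF that(1), of w] that(2) \<Lambda>0[OF that(1)] by (simp add: spin_module_def fscale_zero)
  qed
qed

subsection \<open>The degree operator\<close>

abbreviation "DD \<equiv> deg0 0 0 1 :: 'g affine"

lemma av_degree: "keys u \<subseteq> {l} \<Longrightarrow> av DD u = sU (of_int l) u"
proof (rule poly_mapping_eqI)
  fix k assume u: "keys u \<subseteq> {l}"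
  show "lookup (av DD u) k = lookup (sU (of_int l) u) k"
  proof (cases "k = l")
    case True
    then show ?thesis by (simp add: lookup_av lookup_sU actV_0_left)
  next
    case False
    then have "lookup u k = 0" using u by (auto simp flip: not_in_keys_iff_lookup_eq_zero)
    then show ?thesis by (simp add: lookup_av lookup_sU actV_0 vs_zero_right[OF vsV])
  qed
qed

text \<open>The derivation acts by 0 on \<open>t\<^sup>0V\<close>, so its lift commutes with all
  Clifford generators and \<open>spin_commutant\<close> applies.\<close>

lemma degree_scalar: obtains c where "\<And>w. w \<in> spin_space I \<Longrightarrow> st DD w = cscale c w"
proof (rule spin_commutant[OF symI])
  have D: "DD \<in> lcar AA" by (rule deg0_AA)
  show "linear_on cscale cscale (spin_space I) (st DD)"
    using op_moduleD(4)[OF st_mod D] by (simp add: spin_module_simps)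
  show "st DD w \<in> spin_space I" if "w \<in> spin_space I" for w
    using op_moduleD(3)[OF st_mod D] that by (simp add: spin_module_simps)
  show "st DD (clifford i w) = clifford i (st DD w)" if i: "i \<in> I" and w: "w \<in> spin_space I" for i w
  proof -
    have "av DD (e (\<epsilon> * i)) = sU 0 (e (\<epsilon> * i))" using av_degree[OF e_keys] eps_I i by simp
    then have "module.representation sU (e ` I) (av DD (e (\<epsilon> * i))) x = 0" for x
      using rep_scale[OF vsU be basis_of_mem[OF vsU be], of "\<epsilon> * i" 0] eps_I i by simp
    then show ?thesis unfolding st_comm[OF D w i] by simp
  qed
qed (use that in blast)

lemma amat_degree: "k \<ge> 1 \<Longrightarrow> i < n \<Longrightarrow> j < n \<Longrightarrow> amat DD k j i = (if i = j then of_int \<epsilon> * of_nat k else 0)"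
  using rep_scale[OF vsU bk basis_of_mem[OF vsU bk], of k i] rep_basis[OF vsU bk, of k i j]
  by (simp add: amat_def av_degree[OF b_keys])

lemma lookup_cre_ann: "lookup (cre p (ann p u)) K = (if p \<in> K then lookup u K else 0)"
  by (auto simp: cre.rep_eq ann.rep_eq insert_absorb above_self)

lemma slot_op_degree:
  fixes u :: fock
  assumes k: "k \<ge> 1"
  shows "lookup (slot_op cscale n (amat DD k) k u) K =
    (\<Sum>i<n. if (k, i) \<in> K then cscale (of_int \<epsilon> * of_nat k) (lookup u K) else 0)"
proof -
  have "slot_op cscale n (amat DD k) k u = (\<Sum>i<n. \<Sum>j<n. fscale (amat DD k j i) (cre (k, j) (ann (k, i) u)))"
  proof -
    have "{k} \<times> {..<n} = Pair k ` {..<n}" by auto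
    then show ?thesis by (simp add: slot_op_def dgam_def sum.reindex inj_on_def fscale_def)
  qed
  also have "\<dots> = (\<Sum>i<n. fscale (of_int \<epsilon> * of_nat k) (cre (k, i) (ann (k, i) u)))"
  proof (rule sum.cong[OF refl])
    fix i assume i: "i \<in> {..<n}"
    have "(\<Sum>j<n. fscale (amat DD k j i) (cre (k, j) (ann (k, i) u))) =
        (\<Sum>j<n. if j = i then fscale (of_int \<epsilon> * of_nat k) (cre (k, i) (ann (k, i) u)) else 0)"
      by (rule sum.cong[OF refl]) (use k i in \<open>auto simp: amat_degree fscale_zero\<close>)
    then show "(\<Sum>j<n. fscale (amat DD k j i) (cre (k, j) (ann (k, i) u))) =
        fscale (of_int \<epsilon> * of_nat k) (cre (k, i) (ann (k, i) u))" using i by simp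
  qed
  finally show ?thesis
    by (simp add: lookup_sum fscale_def lookup_pmap[where f = "cscale _"] lookup_cre_ann if_distrib[where f = "cscale _"] cong: if_cong)
qed

lemma cscale_sum_left: "cscale (sum f A) w = (\<Sum>x\<in>A. cscale (f x) w)"
  by (induction A rule: infinite_finite_induct) (simp_all add: vs_zero[OF cscale_vs] vs_add_left[OF cscale_vs])

text \<open>The power of \<open>t\<close> carried by the wedge with key \<open>K\<close>, up to the
  sign \<open>\<epsilon>\<close>.\<close>

definition key_degree :: "(nat \<times> nat) set \<Rightarrow> nat" where
  "key_degree K = sum fst K"

lemma lookup_act_degree:
  assumes u: "u \<in> mcar FT" and c: "\<And>w. w \<in> spin_space I \<Longrightarrow> st DD w = cscale c w"
  shows "lookup (act FT DD u) K = cscale (c + of_int \<epsilon> * of_nat (key_degree K)) (lookup u K)"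
proof -
  let ?w = "lookup u K"
  have st0: "st DD 0 = 0" using om_act_0[OF st_mod deg0_AA] by (simp add: spin_module_simps)
  have fin: "finite (slots u)" by (rule finite_slots[OF fock_finkeys[OF u]])
  have pos: "k \<ge> 1" if "k \<in> slots u" for k
  proof -
    obtain K i where K: "K \<in> keys u" "(k, i) \<in> K" using \<open>k \<in> slots u\<close> by (auto simp: slots_def)
    then show ?thesis using fock_key(2)[OF u, of K] by (auto simp: in_keys_iff)
  qed
  have "(\<Sum>k\<in>slots u. \<Sum>i<n. if (k, i) \<in> K then cscale (of_int \<epsilon> * of_nat k) ?w else 0) =
      cscale (of_int \<epsilon> * of_nat (key_degree K)) ?w"
  proof (cases "?w = 0")
    case True
    then show ?thesis by (simp cong: if_cong)
  next
    case False
    then have K: "finite K" "K \<subseteq> {1..} \<times> {..<n}" using fock_key[OF u] by blast+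
    have "fst ` K \<subseteq> slots u" using False by (force simp: slots_def in_keys_iff)
    then have sub: "K \<subseteq> slots u \<times> {..<n}" using K(2) by force
    have "(\<Sum>k\<in>slots u. \<Sum>i<n. if (k, i) \<in> K then cscale (of_int \<epsilon> * of_nat k) ?w else 0) =
        (\<Sum>p\<in>slots u \<times> {..<n}. if p \<in> K then cscale (of_int \<epsilon> * of_nat (fst p)) ?w else 0)"
      by (simp add: sum.cartesian_product case_prod_unfold)
    also have "\<dots> = (\<Sum>p\<in>K. cscale (of_int \<epsilon> * of_nat (fst p)) ?w)"
      using sum.inter_restrict[of "slots u \<times> {..<n}" "\<lambda>p. cscale (of_int \<epsilon> * of_nat (fst p)) ?w" K] fin sub
      by (simp add: inf_absorb2)
    also have "\<dots> = cscale (\<Sum>p\<in>K. of_int \<epsilon> * of_nat (fst p)) ?w"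
      by (rule cscale_sum_left[symmetric])
    finally show ?thesis by (simp add: key_degree_def sum_distrib_left)
  qed
  then show ?thesis
    using Sum_slot_op[OF fin order_refl, of cscale n "amat DD"] slot_op_degree[OF pos]
    by (simp add: fock_module_simps spin_module_simps lookup_add lookup_pmap[where f = "st DD", OF st0] lookup_sum
        c[OF FT_lookup[OF u]] vs_add_left[OF cscale_vs])
qed

text \<open>The bracket of \<open>x\<close> with the derivation is zero, but for the Fock module
  compatibility with brackets has to be obtained from \<open>st'\<close>, along
  \<open>spin_iso\<close>.\<close>

lemma act_degree_commute:
  assumes x: "x \<in> lcar AA" and u: "u \<in> mcar FT"
  shows "act FT x (act FT DD u) = act FT DD (act FT x u)"
proof -
  obtain f where f: "bij_betw f (spin_space I') (mcar FT)"
    and hom: "\<And>x w. x \<in> lcar AA \<Longrightarrow> w \<in> spin_space I' \<Longrightarrow> f (st' x w) = act FT x (f w)"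
    using spin_iso unfolding module_iso_def spin_module_def by auto
  obtain w where w: "w \<in> spin_space I'" "u = f w" using f u by (auto simp: bij_betw_def)
  obtain y c where y: "x = deg0 y 0 c" using x unfolding lcar_AA by blast
  have l: "linear_on (lscl G) (lscl G) UNIV (lbr G y)"
    using lieG carG by (auto simp: lie_algebra_def)
  have "lbr G y 0 = 0" using linear_on_0[OF l vsG vsG] by (simp add: subspaceI[OF vsG])
  then have "lbr (affine_algebra G B) x DD = 0" unfolding y bracket_deg0 by (simp add: deg0_def zero_prod_def)
  moreover have "module.subspace (lscl (affine_algebra G B)) UNIV" by (rule subspaceI[OF vs_affine]) auto
  then have "st' 0 w = 0" by (rule linear_on_0[OF st'_linear[OF w(1)] vs_affine cscale_vs])
  ultimately have "st' x (st' DD w) = st' DD (st' x w)" using st'_bracket[OF w(1), of x DD] by simp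
  then show ?thesis
    using hom[OF x st'_in[OF w(1)]] hom[OF deg0_AA st'_in[OF w(1)]] hom[OF x w(1)] hom[OF deg0_AA w(1)] w(2)
    by metis
qed

text \<open>An eigenvalue fixes the total degree of the keys. As each slot \<open>k \<ge> 1\<close>
  counts with weight \<open>k\<close>, only finitely many keys have a given total degree, and the
  coefficients lie in the finite-dimensional \<open>Spin(V)\<close>.\<close>

lemma graded_FT: "graded_by AA DD FT"
  unfolding graded_by_def
proof (intro conjI ballI allI)
  obtain a where a: "\<And>w. w \<in> spin_space I \<Longrightarrow> st DD w = cscale a w" using degree_scalar by blast
  define wt where "wt K = a + of_int \<epsilon> * of_nat (key_degree K)" for K
  have eig: "u \<in> eigenspace DD FT c \<longleftrightarrow> u \<in> mcar FT \<and> (\<forall>K. lookup u K \<noteq> 0 \<longrightarrow> wt K = c)" for u c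
  proof -
    have "act FT DD u = fscale c u \<longleftrightarrow> (\<forall>K. lookup u K \<noteq> 0 \<longrightarrow> wt K = c)" if u: "u \<in> mcar FT"
    proof -
      have "act FT DD u = fscale c u \<longleftrightarrow>
          (\<forall>K. cscale (wt K) (lookup u K) = cscale c (lookup u K))"
        by (auto simp: poly_mapping_eq_iff fun_eq_iff lookup_act_degree[OF u a] wt_def fscale_def lookup_pmap[where f = "cscale c"])
      moreover have "cscale p w = cscale q w \<longleftrightarrow> (w \<noteq> 0 \<longrightarrow> p = q)" for p q and w :: "int set \<Rightarrow>\<^sub>0 complex"
        using cscale_eq_0_iff[of "p - q" w] vs_add_left[OF cscale_vs, of "p - q" q w] by auto
      ultimately show ?thesis by simp
    qed
    then show ?thesis by (auto simp: eigenspace_def FT_mscl)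
  qed
  show "DD \<in> lcar AA" by (rule deg0_AA)
  show "act FT x (act FT DD u) = act FT DD (act FT x u)" if "x \<in> lcar AA" "u \<in> mcar FT" for x u
    by (rule act_degree_commute[OF that])
  show "\<exists>S g. finite S \<and> (\<forall>c\<in>S. g c \<in> eigenspace DD FT c) \<and> u = (\<Sum>c\<in>S. g c)" if u: "u \<in> mcar FT" for u
  proof -
    define g where "g c = (\<Sum>K\<in>{K \<in> keys u. wt K = c}. single K (lookup u K))" for c
    have lk: "lookup (g c) K = (if wt K = c then lookup u K else 0)" for c K
      unfolding g_def by (auto simp: lookup_sum lookup_single when_def sum.delta in_keys_iff)
    have "g c \<in> eigenspace DD FT c" for c
      using u unfolding eig fock_module_simps lk
      by (auto simp: spin_module_simps subspace_0[OF cscale_vs spin_space_subspace])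
    moreover have "(\<Sum>c\<in>wt ` keys u. g c) = u"
    proof -
      have "(\<Sum>c\<in>wt ` keys u. g c) = (\<Sum>K\<in>keys u. single K (lookup u K))"
        unfolding g_def by (rule sum.group) simp_all
      then show ?thesis by (simp add: poly_mapping_sum_single)
    qed
    ultimately show ?thesis by (metis finite_imageI finite_keys)
  qed
  show "fin_dim (mscl FT) (eigenspace DD FT c)" for c
  proof -
    interpret vector_space fscale by (rule fscale_vs)
    \<comment> \<open>The total degree belonging to \<open>c\<close>, solved from the formula for
      \<open>wt\<close> by means of \<open>\<epsilon> * \<epsilon> = 1\<close>. If
      \<open>\<epsilon> * (c - a)\<close> is not a natural number, the eigenspace is zero and any
      value does.\<close>
    define m where "m = nat \<lfloor>Re (of_int \<epsilon> * (c - a))\<rfloor>"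
    let ?F = "(\<lambda>(K, J). single K (single J 1)) ` (Pow ({..m} \<times> {..<n}) \<times> Pow I) :: fock set"
    have "u \<in> span ?F" if u: "u \<in> eigenspace DD FT c" for u
    proof -
      have uF: "u \<in> mcar FT" using u by (simp add: eig)
      have single_sum: "(\<Sum>x\<in>X. single K (f x)) = single K (sum f X)"
        for K X and f :: "int set \<Rightarrow> int set \<Rightarrow>\<^sub>0 complex"
        by (rule poly_mapping_eqI) (simp add: lookup_sum lookup_single when_def)
      have s1: "single K (single J (x :: complex)) \<in> span ?F"
        if "K \<subseteq> {..m} \<times> {..<n}" "J \<subseteq> I" for K J x
      proof -
        have "single K (single J 1) \<in> span ?F" using that by (intro span_base) auto
        then have "fscale x (single K (single J 1)) \<in> span ?F" by (rule span_scale)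
        then show ?thesis by (simp add: fscale_def pmap_single[where f = "cscale x"] cscale_single)
      qed
      have "single K (lookup u K) \<in> span ?F" if K: "K \<in> keys u" for K
      proof -
        have nz: "lookup u K \<noteq> 0" using K by (simp add: in_keys_iff)
        then have "wt K = c" using u by (simp add: eig)
        then have "of_int \<epsilon> * (c - a) = of_nat (key_degree K)"
          using eps_cases by (auto simp: wt_def)
        then have m: "m = key_degree K" by (simp add: m_def)
        have Kn: "finite K" "K \<subseteq> {1..} \<times> {..<n}" using fock_key[OF uF nz] .
        have "K \<subseteq> {..m} \<times> {..<n}"
        proof
          fix p assume p: "p \<in> K"
          have "fst p \<le> m" unfolding m key_degree_def by (rule member_le_sum[OF p _ Kn(1)]) simp
          then show "p \<in> {..m} \<times> {..<n}" using p Kn(2) by auto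
        qed
        moreover have "J \<subseteq> I" if "J \<in> keys (lookup u K)" for J
          using FT_lookup[OF uF, of K] that by (auto simp: spin_space_def)
        ultimately have "(\<Sum>J\<in>keys (lookup u K).
            single K (single J (lookup (lookup u K) J))) \<in> span ?F"
          by (intro span_sum s1)
        moreover have "(\<Sum>J\<in>keys w. single K (single J (lookup w J))) =
            single K w" for w :: "int set \<Rightarrow>\<^sub>0 complex"
          by (simp add: single_sum poly_mapping_sum_single)
        ultimately show ?thesis by simp
      qed
      then have "(\<Sum>K\<in>keys u. single K (lookup u K)) \<in> span ?F" by (rule span_sum)
      then show ?thesis by (simp add: poly_mapping_sum_single)
    qed
    moreover have "finite ?F" using finI by simp
    ultimately show ?thesis unfolding fin_dim_def FT_mscl by blast
  qed
qed

text \<open>Weight zero for the affine Cartan subalgebra includes weight zero for the derivation,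
  hence degree zero, while \<open>K\<close> acts by zero. So both spin modules consist of the same
  number of copies.\<close>

lemma zero_weight_dim_eq: "zero_weight_dim (affinization V) (affine_cartan h) = zero_weight_dim (t_power V 0) HA"
proof -
  have "u \<in> weight_space (affinization V) (affine_cartan h) (\<lambda>h. 0) \<longleftrightarrow> u \<in> weight_space (t_power V 0) HA (\<lambda>h. 0)" for u
  proof
    assume u: "u \<in> weight_space (affinization V) (affine_cartan h) (\<lambda>h. 0)"
    then have ev: "av x u = sU 0 u" if "x \<in> affine_cartan h" for x using that by (auto simp: weight_space_def)
    have "DD \<in> affine_cartan h" unfolding affine_cartan_def deg0_def using subspace_0[OF vsG subh] by blast
    then have D: "av DD u = sU 0 u" by (rule ev)
    have "k = 0" if k: "k \<in> keys u" for k
    proof (rule ccontr)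
      assume "k \<noteq> 0"
      have "mscl V (of_int k) (lookup u k) = 0"
        using arg_cong[OF D, of "\<lambda>v. lookup v k"] by (simp add: lookup_av lookup_sU actV_0_left vs_zero[OF vsV])
      then have "mscl V (inverse (of_int k)) (mscl V (of_int k) (lookup u k)) = 0"
        by (simp add: vs_zero_right[OF vsV])
      then show False using k \<open>k \<noteq> 0\<close> by (simp add: vs_mult[OF vsV] vs_one[OF vsV] in_keys_iff)
    qed
    then show "u \<in> weight_space (t_power V 0) HA (\<lambda>h. 0)"
      unfolding weight_space_def t_power_simps using ev HA_cartan by blast
  next
    assume u: "u \<in> weight_space (t_power V 0) HA (\<lambda>h. 0)"
    have "av x u = sU 0 u" if x: "x \<in> affine_cartan h" for x
    proof -
      obtain y a c where xy: "x = deg0 y a c" "y \<in> h" using x unfolding affine_cartan_def deg0_def by blast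
      have "av (deg0 y a c) u = av (deg0 y 0 c) u" by (rule poly_mapping_eqI) (simp add: lookup_av)
      moreover have "deg0 y 0 c \<in> HA" unfolding HA_eq using xy(2) by blast
      ultimately show ?thesis using u unfolding weight_space_def t_power_simps xy(1) by simp
    qed
    then show "u \<in> weight_space (affinization V) (affine_cartan h) (\<lambda>h. 0)"
      unfolding weight_space_def by (simp add: affinization_def)
  qed
  then have "weight_space (affinization V) (affine_cartan h) (\<lambda>h. 0) = weight_space (t_power V 0) HA (\<lambda>h. 0)" by blast
  then show ?thesis by (simp add: zero_weight_dim_def t_power_simps)
qed

text \<open>\<open>FT\<close> consists of \<open>m\<close> copies of \<open>S'\<close> and also of
  \<open>m\<close> copies of the Fock space over \<open>S\<close>; both inherit the grading by the
  derivation from it, and \<open>m\<close> is positive.\<close>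

lemma spin0_tensor:
  assumes spin0': "is_spin0 (affine_algebra G B) (affine_cartan h) (affinization V) I' st' S'"
    and spin0: "is_spin0 AA HA (t_power V 0) I st S"
  shows "module_iso AA S' (infinite_tensor S (\<lambda>k. exterior_algebra (t_power V (\<epsilon> * int k)) n (b k)))"
proof -
  define m where "m = (2::nat) ^ (zero_weight_dim (t_power V 0) HA div 2)"
  have m: "m > 0" by (simp add: m_def)
  have res: "op_module AA M" if "op_module (affine_algebra G B) M" for M :: "('g affine, 'z::ab_group_add) lie_mod"
    using that unfolding op_module_def lcar_affine by blast
  have iso: "module_iso AA (spin_module I' st') (copies m S')"
    using spin0' unfolding is_spin0_def zero_weight_dim_eq m_def[symmetric] module_iso_def lcar_affine by blast
  have iso0: "module_iso AA (spin_module I st) (copies m S)" and S: "op_module AA S"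
    using spin0 lie_module_op_module unfolding is_spin0_def m_def by blast+
  have S': "op_module AA S'"
    by (rule res, rule lie_module_op_module) (use spin0' in \<open>simp add: is_spin0_def\<close>)
  let ?F = "fock_module S n amat"
  have F: "op_module AA ?F" by (rule op_module_fock[OF S])
  have FT_F: "module_iso AA FT (copies m ?F)" by (rule fock_copies[OF S st_mod iso0])
  have FT_S': "module_iso AA FT (copies m S')"
    by (rule module_iso_trans[OF module_iso_sym[OF spin_iso res[OF st'_op]] iso])
  have "module_iso AA S' ?F"
    by (rule graded_power_cancel[OF S' F graded_copies_summand[OF S' FT_op graded_FT FT_S' m]
        graded_copies_summand[OF F FT_op graded_FT FT_F m] m module_iso_trans[OF module_iso_sym[OF FT_S' FT_op] FT_F]])
  moreover have "module_iso AA ?F (infinite_tensor S (\<lambda>k. exterior_algebra (t_power V (\<epsilon> * int k)) n (b k)))"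
  proof -
    have "module_iso AA (fock_module S n (\<lambda>x k j i. module.representation (mscl (t_power V (\<epsilon> * int k))) (b k ` {..<n})
        (act (t_power V (\<epsilon> * int k)) x (b k i)) (b k j)))
        (infinite_tensor S (\<lambda>k. exterior_algebra (t_power V (\<epsilon> * int k)) n (b k)))"
      by (rule infinite_tensor_iso[OF S]) (use bs vsU in \<open>simp_all add: t_power_simps\<close>)
    moreover have "(\<lambda>x k j i. module.representation (mscl (t_power V (\<epsilon> * int k))) (b k ` {..<n})
        (act (t_power V (\<epsilon> * int k)) x (b k i)) (b k j)) = amat"
      by (intro ext) (simp add: amat_def t_power_simps)
    ultimately show ?thesis by simp
  qed
  ultimately show ?thesis by (rule module_iso_trans)
qed

end

theorem proposition6:
  fixes G :: "'g::ab_group_add lie_alg" and h :: "'g set" and \<Delta> :: "('g \<Rightarrow> complex) set"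
    and B :: "'g \<Rightarrow> 'g \<Rightarrow> complex"
    and V :: "('g, 'v::ab_group_add) lie_mod" and Q :: "'v \<Rightarrow> 'v \<Rightarrow> complex"
    and d1 :: 'g and N :: int and \<epsilon> :: int
    and e' :: "int \<Rightarrow> (int \<Rightarrow>\<^sub>0 'v)" and I' :: "int set"
    and H2' :: "'g affine set" and \<psi>' :: "'g affine \<Rightarrow> complex"
    and st' :: "'g affine \<Rightarrow> (int set \<Rightarrow>\<^sub>0 complex) \<Rightarrow> (int set \<Rightarrow>\<^sub>0 complex)"
    and S' :: "('g affine, 's1::ab_group_add) lie_mod"
    and e :: "int \<Rightarrow> (int \<Rightarrow>\<^sub>0 'v)" and I :: "int set"
    and H2 :: "'g affine set" and \<psi> :: "'g affine \<Rightarrow> complex"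
    and st :: "'g affine \<Rightarrow> (int set \<Rightarrow>\<^sub>0 complex) \<Rightarrow> (int set \<Rightarrow>\<^sub>0 complex)"
    and S :: "('g affine, 's2::ab_group_add) lie_mod"
    and n :: nat and b :: "nat \<Rightarrow> nat \<Rightarrow> (int \<Rightarrow>\<^sub>0 'v)"
  \<comment> \<open>the semisimple Lie algebra, its Cartan subalgebra, simple roots and invariant form\<close>
  assumes "semisimple_lie_algebra G" and "lcar G = UNIV"
    and "\<exists>A. finite A \<and> module.span (lscl G) A = UNIV"
    and "cartan_subalgebra G h" and "root_base G h \<Delta>"
    and "orthogonal_form G (adjoint G) B"
  \<comment> \<open>the orthogonal representation\<close>
    and "lie_module G V" and "mcar V = UNIV"
    and "\<exists>A. finite A \<and> module.span (mscl V) A = UNIV"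
    and "orthogonal_form G V Q"
  \<comment> \<open>the data defining \<open>hat_d N d1\<close>\<close>
    and "strictly_dominant_coweight h \<Delta> d1"
    and "\<And>\<beta>. is_weight G V h \<beta> \<Longrightarrow> \<exists>x\<in>h. \<beta> x \<noteq> 0 \<Longrightarrow> \<beta> d1 \<in> \<int> - {0}"
    and "N > 0"
    and "\<And>\<beta>. is_weight G V h \<beta> \<Longrightarrow> - N < Re (\<beta> d1) \<and> Re (\<beta> d1) < N"
    and "\<And>\<theta>. highest_root G h \<Delta> \<theta> \<Longrightarrow> - N < Re (\<theta> d1) \<and> Re (\<theta> d1) < N"
  \<comment> \<open>the normalization of the spin representation, see \<open>phi_Z\<close>\<close>
    and "\<epsilon> \<in> {1, - 1}"
  \<comment> \<open>the spin construction for the affine algebra and the affinization\<close>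
    and "spin_basis (affine_algebra G B) (affine_cartan h) (hat_d N d1)
           (affinization V) (affine_form Q) I' e'"
    and "complement_in (lscl (affine_algebra G B)) (affine_cartan h)
           (module.span (lscl (affine_algebra G B))
              (simple_coroots (affine_algebra G B) (affine_cartan h) (hat_d N d1))) H2'"
    and "spin_functional (affine_algebra G B) (affine_cartan h) H2' \<psi>'"
    and "spin_lift \<epsilon> (affine_algebra G B) (affine_cartan h) (affinization V) I' e' H2' \<psi>' st'"
    and "is_spin0 (affine_algebra G B) (affine_cartan h) (affinization V) I' st' S'"
  \<comment> \<open>the spin construction for the augmented algebra and \<open>V = t\<^sup>0V\<close>\<close>
    and "spin_basis (augmented_algebra G B N d1) (with_hat_d G B N d1 h) (hat_d N d1)
           (t_power V 0) (affine_form Q) I e"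
    and "complement_in (lscl (augmented_algebra G B N d1)) (with_hat_d G B N d1 h)
           (module.span (lscl (augmented_algebra G B N d1))
              (simple_coroots (augmented_algebra G B N d1) (with_hat_d G B N d1 h) (hat_d N d1))) H2"
    and "spin_functional (augmented_algebra G B N d1) (with_hat_d G B N d1 h) H2 \<psi>"
    and "spin_lift \<epsilon> (augmented_algebra G B N d1) (with_hat_d G B N d1 h) (t_power V 0) I e H2 \<psi> st"
    and "is_spin0 (augmented_algebra G B N d1) (with_hat_d G B N d1 h) (t_power V 0) I st S"
  \<comment> \<open>the two normalizations agree on the smaller algebra\<close>
    and "H2 \<subseteq> H2'" and "\<And>x. x \<in> H2 \<Longrightarrow> \<psi>' x = \<psi> x"
  \<comment> \<open>bases in which the exterior algebras are written\<close>
    and "\<And>k. k \<ge> 1 \<Longrightarrow>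
           basis_of (mscl (affinization V)) (mcar (t_power V (\<epsilon> * int k))) {..<n} (b k)"
  shows "module_iso (augmented_algebra G B N d1) S'
           (infinite_tensor S (\<lambda>k. exterior_algebra (t_power V (\<epsilon> * int k)) n (b k)))"
proof -
  have lie: "lie_algebra G" using assms(1) by (simp add: semisimple_lie_algebra_def)
  have h: "module.subspace (lscl G) h" using assms(4) by (simp add: cartan_subalgebra_def)
  have d1: "d1 \<in> h" using assms(11) by (simp add: strictly_dominant_coweight_def)
  interpret loop_spin G B V Q h d1 N \<epsilon> e' I' H2' \<psi>' st' e I H2 \<psi> st n b
    by (intro loop_spin.intro loop_module.intro loop_spin_axioms.intro lie h d1; rule assms)
  show ?thesis by (rule spin0_tensor[OF assms(21,26)])
qed

end
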